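(* Let $\Sigma$ be a graphical strip over $K$. Then $\Sigma$ is area-minimizing in $U$ if and only if there is a function $\sigma\colon\mathbb{R}\to\mathbb{R}$ such that $-2\le \frac{\sigma(t)-\sigma(s)}{t-s}<2$ for all $s<t$ and $$\Sigma=\bigcup_{z\in\mathbb{R}}\big[(-1,-\sigma(z),z),\,(1,\sigma(z),z)\big].$$
   Context: The Heisenberg group $\mathbb{H}$ is $\mathbb{R}^3$ with product $(x,y,z)\cdot(x',y',z')=(x+x',y+y',z+z'+\frac{xy'-yx'}{2})$. Write $X=(1,0,0)$, $Y=(0,1,0)$, $Z=(0,0,1)$ and $v^t=tv$ for $v\in\mathbb{H}$, $t\in\mathbb{R}$. A horizontal line is a set $p\langle v\rangle=\{p\cdot tv:t\in\mathbb{R}\}$ with $p\in\mathbb{H}$, $v=(a,b,0)\neq 0$. A ruled surface is a union of horizontal line segments (its rulings) with endpoints in its boundary. Let $V_0=\{(x,0,z)\}$. For $D\subset V_0$ and $f\colon D\to\mathbb{R}$, the intrinsic graph is $\Gamma_f=\{u\cdot Y^{f(u)}:u\in D\}$ and its epigraph is $\Gamma_f^+=\{u\cdot Y^{t}:u\in D,\ t>f(u)\}$. A graphical strip over $D$ is an intrinsic graph $\Gamma_f$ of a continuous $f\colon D\to\mathbb{R}$ which is a ruled surface every ruling of which intersects the $z$-axis. Let $K=\{(x,0,z):-1\le x\le 1\}$ and $U=\{(x,y,z)\in\mathbb{H}:-1<x<1\}$. $[p_1,p_2]$ denotes the line segment from $p_1$ to $p_2$. Perimeter: for measurable $E\subset\mathbb{H}$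 and open $\Omega$, $\mathrm{Per}_E(\Omega)=\sup\{\int_E (Xa+Yb)\,d\mathcal{L}^3: a,b\in C^\infty_c(\Omega),\ a^2+b^2\le 1\}$, where here $X=\partial_x-\frac{y}{2}\partial_z$, $Y=\partial_y+\frac{x}{2}\partial_z$ are the left-invariant vector fields. With the Korányi norm $\|(x,y,z)\|=((x^2+y^2)^2+z^2)^{1/4}$ and balls $B(p,r)=\{q:\|p^{-1}q\|<r\}$, $E$ is a perimeter minimizer in an open set $\Omega$ if for every $r>0$ and every measurable $F$ with $E\triangle F\Subset B(\mathbf{0},r)\cap\Omega$, $\mathrm{Per}_E(B(\mathbf{0},r)\cap\Omega)\le\mathrm{Per}_F(B(\mathbf{0},r)\cap\Omega)$. A graphical strip $\Sigma=\Gamma_f$ over $K$ is called area-minimizing in $U$ if its epigraph $\Sigma^+=\Gamma_f^+$ is a perimeter minimizer in $U$. *)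

theory Defs
  imports "HOL-Analysis.Analysis"
begin

type_synonym hpt = "real \<times> real \<times> real"

definition hmul :: "hpt \<Rightarrow> hpt \<Rightarrow> hpt" where
  "hmul p q = (case p of (x,y,z) \<Rightarrow> case q of (x',y',z') \<Rightarrow>
      (x + x', y + y', z + z' + (x * y' - y * x') / 2))"

definition hinv :: "hpt \<Rightarrow> hpt" where
  "hinv p = (case p of (x,y,z) \<Rightarrow> (-x, -y, -z))"

definition hscale :: "real \<Rightarrow> hpt \<Rightarrow> hpt" where
  "hscale t v = (case v of (a,b,c) \<Rightarrow> (t*a, t*b, t*c))"

definition horizontal_vec :: "hpt \<Rightarrow> bool" where
  "horizontal_vec v \<longleftrightarrow> snd (snd v) = 0 \<and> v \<noteq> (0,0,0)"

definition hsegment :: "hpt \<Rightarrow> hpt \<Rightarrow> hpt set" where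
  "hsegment p q = {hmul p (hscale t (hmul (hinv p) q)) | t. 0 \<le> t \<and> t \<le> 1}"

definition horizontal_segment :: "hpt set \<Rightarrow> bool" where
  "horizontal_segment S \<longleftrightarrow>
     (\<exists>p q. horizontal_vec (hmul (hinv p) q) \<and> S = hsegment p q)"

definition V0 :: "hpt set" where
  "V0 = {(x, y, z). y = 0}"

definition zaxis :: "hpt set" where
  "zaxis = {(x, y, z). x = 0 \<and> y = 0}"

definition igraph :: "hpt set \<Rightarrow> (hpt \<Rightarrow> real) \<Rightarrow> hpt set" where
  "igraph D f = {hmul u (0, f u, 0) | u. u \<in> D}"

definition iepigraph :: "hpt set \<Rightarrow> (hpt \<Rightarrow> real) \<Rightarrow> hpt set" where
  "iepigraph D f = {hmul u (0, t, 0) | u t. u \<in> D \<and> t > f u}"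

definition V0_boundary :: "hpt set \<Rightarrow> hpt set" where
  "V0_boundary D = closure D \<inter> closure (V0 - D)"

definition igraph_boundary :: "hpt set \<Rightarrow> (hpt \<Rightarrow> real) \<Rightarrow> hpt set" where
  "igraph_boundary D f = igraph (D \<inter> V0_boundary D) f"

definition graphical_strip :: "hpt set \<Rightarrow> (hpt \<Rightarrow> real) \<Rightarrow> bool" where
  "graphical_strip D f \<longleftrightarrow> D \<subseteq> V0 \<and> continuous_on D f \<and>
     (\<exists>R. igraph D f = \<Union>R \<and>
        (\<forall>S\<in>R. (\<exists>p q. horizontal_vec (hmul (hinv p) q) \<and> S = hsegment p q \<and>
                      p \<in> igraph_boundary D f \<and> q \<in> igraph_boundary D f) \<and>
                 S \<inter> zaxis \<noteq> {}))"

definition Kstrip :: "hpt set" where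
  "Kstrip = {(x, y, z). y = 0 \<and> -1 \<le> x \<and> x \<le> 1}"

definition Uslab :: "hpt set" where
  "Uslab = {(x, y, z). -1 < x \<and> x < 1}"

text \<open>Partial derivative along a coordinate direction, and C^\<infinity> functions
  (all iterated partial derivatives exist everywhere and are continuous).\<close>
definition pderiv3 :: "hpt \<Rightarrow> (hpt \<Rightarrow> real) \<Rightarrow> hpt \<Rightarrow> real" where
  "pderiv3 e a p = deriv (\<lambda>t. a (p + t *\<^sub>R e)) 0"

coinductive smooth3 :: "(hpt \<Rightarrow> real) \<Rightarrow> bool" where
  "\<lbrakk>continuous_on UNIV a;
    \<forall>e\<in>Basis. (\<forall>p. (\<lambda>t. a (p + t *\<^sub>R e)) differentiable (at 0)) \<and> smooth3 (pderiv3 e a)\<rbrakk>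
   \<Longrightarrow> smooth3 a"

definition Cinf_c :: "hpt set \<Rightarrow> (hpt \<Rightarrow> real) set" where
  "Cinf_c \<Omega> = {a. smooth3 a \<and> compact (closure {p. a p \<noteq> 0})
                     \<and> closure {p. a p \<noteq> 0} \<subseteq> \<Omega>}"

text \<open>Left-invariant vector fields X = d_x - y/2 d_z, Y = d_y + x/2 d_z.\<close>
definition Xfield :: "(hpt \<Rightarrow> real) \<Rightarrow> hpt \<Rightarrow> real" where
  "Xfield a p = pderiv3 (1,0,0) a p - fst (snd p) / 2 * pderiv3 (0,0,1) a p"

definition Yfield :: "(hpt \<Rightarrow> real) \<Rightarrow> hpt \<Rightarrow> real" where
  "Yfield a p = pderiv3 (0,1,0) a p + fst p / 2 * pderiv3 (0,0,1) a p"

definition Per :: "hpt set \<Rightarrow> hpt set \<Rightarrow> ereal" where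
  "Per E \<Omega> = (SUP ab \<in> {(a, b). a \<in> Cinf_c \<Omega> \<and> b \<in> Cinf_c \<Omega> \<and>
                          (\<forall>p. (a p)\<^sup>2 + (b p)\<^sup>2 \<le> 1)}.
       ereal (set_lebesgue_integral lebesgue E
                (\<lambda>p. Xfield (fst ab) p + Yfield (snd ab) p)))"

definition koranyi :: "hpt \<Rightarrow> real" where
  "koranyi p = (case p of (x,y,z) \<Rightarrow> root 4 ((x\<^sup>2 + y\<^sup>2)\<^sup>2 + z\<^sup>2))"

definition hball :: "hpt \<Rightarrow> real \<Rightarrow> hpt set" where
  "hball p r = {q. koranyi (hmul (hinv p) q) < r}"

definition perimeter_minimizer :: "hpt set \<Rightarrow> hpt set \<Rightarrow> bool" where
  "perimeter_minimizer E \<Omega> \<longleftrightarrow>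
     (\<forall>r>0. \<forall>F \<in> sets lebesgue.
        (compact (closure ((E - F) \<union> (F - E))) \<and>
         closure ((E - F) \<union> (F - E)) \<subseteq> hball (0,0,0) r \<inter> \<Omega>)
        \<longrightarrow> Per E (hball (0,0,0) r \<inter> \<Omega>) \<le> Per F (hball (0,0,0) r \<inter> \<Omega>))"

definition area_minimizing_strip :: "hpt set \<Rightarrow> (hpt \<Rightarrow> real) \<Rightarrow> hpt set \<Rightarrow> bool" where
  "area_minimizing_strip D f \<Omega> \<longleftrightarrow> perimeter_minimizer (iepigraph D f) \<Omega>"

end

theory Submission
  imports Defs "HOL-Computational_Algebra.Polynomial"
begin

text \<open>A graphical strip over \<open>K\<close> is the union over \<open>v\<close> of the segments of points
  \<open>(x, 2 x (Z v - v), Z v)\<close>, \<open>|x| \<le> 1\<close>, for a nondecreasing continuous surjection \<open>Z\<close>; the slope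
  condition on \<open>\<sigma>(Z v) = 2 (Z v - v)\<close> says that \<open>Z w - Z v \<ge> (w - v) / 2\<close> for \<open>v \<le> w\<close>.

  If this holds, the horizontal lines that meet the boundary curve \<open>x = 1\<close> of the strip foliate the
  slab. Their unit normals form a divergence-free horizontal field that calibrates the epigraph. As
  \<open>Z\<close> need not be differentiable, the field is approximated by the fields of mollified curves.

  Conversely, let \<open>0 < l < 1\<close>, and take a triangle in \<open>{x = 0}\<close> that has a side on the \<open>z\<close>-axis.
  Join its points by horizontal segments to the curves \<open>x = l\<close> and \<open>x = -l\<close> of the strip, and remove
  the wedge swept out by these segments from the epigraph. The unit normals of the foliations on the
  two sides of \<open>{x = 0}\<close> compare the perimeters, and minimality forces the jump of their flux
  through the triangle to be nonpositive. Small triangles then show that the slope of \<open>\<sigma>\<close> is at least \<open>-2 / l\<^sup>2\<close>, and \<open>l \<rightarrow> 1\<close>.\<close>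

section \<open>Left-invariant derivatives of continuously differentiable functions\<close>

text \<open>The parameter \<open>v\<close> of a ruling is the height \<open>z - xy/2\<close> over
  \<open>V0\<close> of its end at \<open>x = 1\<close>; at abscissa \<open>x\<close> its height is
  \<open>(1 - x\<^sup>2) * Z v + x\<^sup>2 * v\<close>. For the lines through the curve
  \<open>x = 1\<close> the weight \<open>x\<^sup>2\<close> becomes \<open>x\<close>. If
  \<open>Z\<close> grows at rate 1/2, the rate of the weighted sum is at least
  \<open>(1 + x) / 2\<close>, positive exactly inside the slab; this is the origin of the bound -2.
  In the converse no perimeter is computed. Any test field \<open>(a, b)\<close>, interpolated with
  the calibrating fields of the two sides, stays admissible by convexity. So the perimeter of the
  epigraph is at least the integral of the divergence of \<open>(a, b)\<close> over the competitor
  plus the flux jump; the supremum over \<open>(a, b)\<close> concludes, once that perimeter is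
  known to be finite. Two sides of the triangle are traces of all foliation lines through one point
  of the curve \<open>x = l\<close>, respectively \<open>x = -l\<close>. Hence both wedges end in
  the same triangle. They are compactly contained in the slab because \<open>l < 1\<close>. A
  further obstacle is that \<open>Z\<close> may be constant on intervals, where the slope jumps
  downwards; this is excluded before the flux is linearised.\<close>

definition C1on :: "hpt set \<Rightarrow> (hpt \<Rightarrow> real) \<Rightarrow> (hpt \<Rightarrow> hpt \<Rightarrow> real) \<Rightarrow> bool" where
  "C1on S a d \<longleftrightarrow> continuous_on S a \<and>
     (\<forall>e\<in>Basis. continuous_on S (d e) \<and>
        (\<forall>p\<in>S. ((\<lambda>t. a (p + t *\<^sub>R e)) has_real_derivative d e p) (at 0)))"

text \<open>The partial derivatives are an explicit argument \<open>d\<close>, so that the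
  left-invariant derivatives of sums, products and compositions become algebraic identities instead
  of evaluations of \<open>deriv\<close>.\<close>

definition Xd :: "(hpt \<Rightarrow> hpt \<Rightarrow> real) \<Rightarrow> hpt \<Rightarrow> real" where
  "Xd d p = d (1,0,0) p - fst (snd p) / 2 * d (0,0,1) p"

definition Yd :: "(hpt \<Rightarrow> hpt \<Rightarrow> real) \<Rightarrow> hpt \<Rightarrow> real" where
  "Yd d p = d (0,1,0) p + fst p / 2 * d (0,0,1) p"

lemma Basis_hpt: "(Basis :: hpt set) = {(1,0,0),(0,1,0),(0,0,1)}"
  by (auto simp: Basis_prod_def zero_prod_def)

lemma C1on_continuous: "C1on S a d \<Longrightarrow> continuous_on S a"
  by (simp add: C1on_def)

lemma C1on_continuous_deriv: "C1on S a d \<Longrightarrow> e \<in> Basis \<Longrightarrow> continuous_on S (d e)"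
  by (simp add: C1on_def)

lemma C1on_continuous_Xd: "C1on S a d \<Longrightarrow> continuous_on S (Xd d)"
  unfolding Xd_def
  by (intro continuous_intros) (auto simp: C1on_def Basis_hpt)

lemma C1on_continuous_Yd: "C1on S a d \<Longrightarrow> continuous_on S (Yd d)"
  unfolding Yd_def
  by (intro continuous_intros) (auto simp: C1on_def Basis_hpt)

lemma C1on_deriv:
  "C1on S a d \<Longrightarrow> e \<in> Basis \<Longrightarrow> p \<in> S \<Longrightarrow> ((\<lambda>t. a (p + t *\<^sub>R e)) has_real_derivative d e p) (at 0)"
  by (simp add: C1on_def)

lemma C1on_pderiv3: "C1on UNIV a d \<Longrightarrow> e \<in> Basis \<Longrightarrow> pderiv3 e a p = d e p"
  unfolding pderiv3_def using C1on_deriv[of UNIV a d e p] by (intro DERIV_imp_deriv) simp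

lemma Xfield_eq_Xd: "C1on UNIV a d \<Longrightarrow> Xfield a p = Xd d p"
  by (simp add: Xfield_def Xd_def C1on_pderiv3 Basis_hpt)

lemma Yfield_eq_Yd: "C1on UNIV a d \<Longrightarrow> Yfield a p = Yd d p"
  by (simp add: Yfield_def Yd_def C1on_pderiv3 Basis_hpt)

lemma C1on_subset: "C1on S a d \<Longrightarrow> T \<subseteq> S \<Longrightarrow> C1on T a d"
  by (auto simp: C1on_def intro: continuous_on_subset)

lemma C1on_const: "C1on S (\<lambda>p. c) (\<lambda>e p. 0)"
  by (simp add: C1on_def)

lemma C1on_linear:
  assumes "bounded_linear f" shows "C1on S f (\<lambda>e p. f e)"
proof -
  interpret bounded_linear f by fact
  show ?thesis unfolding C1on_def
    by (auto simp: add scaleR intro!: linear_continuous_on assms derivative_eq_intros)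
qed

lemma C1on_x: "C1on S (\<lambda>p. fst p) (\<lambda>e p. fst e)"
  by (rule C1on_linear) (rule bounded_linear_fst)

lemma C1on_y: "C1on S (\<lambda>p. fst (snd p)) (\<lambda>e p. fst (snd e))"
  by (rule C1on_linear)
     (rule bounded_linear_compose[OF bounded_linear_fst bounded_linear_snd])

lemma C1on_z: "C1on S (\<lambda>p. snd (snd p)) (\<lambda>e p. snd (snd e))"
  by (rule C1on_linear)
     (rule bounded_linear_compose[OF bounded_linear_snd bounded_linear_snd])

lemma C1on_add:
  "C1on S a da \<Longrightarrow> C1on S b db \<Longrightarrow> C1on S (\<lambda>p. a p + b p) (\<lambda>e p. da e p + db e p)"
  by (auto simp: C1on_def intro!: continuous_intros derivative_intros)

lemma C1on_diff:
  "C1on S a da \<Longrightarrow> C1on S b db \<Longrightarrow> C1on S (\<lambda>p. a p - b p) (\<lambda>e p. da e p - db e p)"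
  by (auto simp: C1on_def intro!: continuous_intros derivative_intros)

lemma C1on_mult:
  assumes "C1on S a da" "C1on S b db"
  shows "C1on S (\<lambda>p. a p * b p) (\<lambda>e p. da e p * b p + a p * db e p)"
proof -
  have "((\<lambda>t. a (p + t *\<^sub>R e) * b (p + t *\<^sub>R e)) has_real_derivative da e p * b p + a p * db e p) (at 0)"
    if "e \<in> Basis" "p \<in> S" for e p
    using DERIV_mult[OF C1on_deriv[OF assms(1) that] C1on_deriv[OF assms(2) that]]
    by (simp add: algebra_simps)
  then show ?thesis using assms unfolding C1on_def
    by (auto intro!: continuous_intros)
qed

lemma C1on_chain:
  assumes "C1on S a da" "continuous_on S (\<lambda>p. f (a p))" "continuous_on S (\<lambda>p. f' (a p))"
    and "\<And>p. p \<in> S \<Longrightarrow> (f has_real_derivative f' (a p)) (at (a p))"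
  shows "C1on S (\<lambda>p. f (a p)) (\<lambda>e p. f' (a p) * da e p)"
proof -
  have "((\<lambda>t. f (a (p + t *\<^sub>R e))) has_real_derivative f' (a p) * da e p) (at 0)"
    if "e \<in> Basis" "p \<in> S" for e p
    using DERIV_chain2[where f=f and g="\<lambda>t. a (p + t *\<^sub>R e)" and x=0 and s=UNIV, OF _ C1on_deriv[OF assms(1) that]]
      assms(4)[OF that(2)] by simp
  then show ?thesis using assms unfolding C1on_def
    by (auto intro!: continuous_intros)
qed

lemma C1on_chain_UNIV:
  assumes "C1on S a da" "\<And>t. (f has_real_derivative f' t) (at t)" "continuous_on UNIV f'"
  shows "C1on S (\<lambda>p. f (a p)) (\<lambda>e p. f' (a p) * da e p)"
proof (rule C1on_chain[OF assms(1)])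
  have "continuous_on UNIV f"
    using assms(2) by (meson DERIV_continuous_on has_field_derivative_at_within)
  then show "continuous_on S (\<lambda>p. f (a p))"
    by (rule continuous_on_compose2[OF _ C1on_continuous[OF assms(1)]]) auto
  show "continuous_on S (\<lambda>p. f' (a p))"
    by (rule continuous_on_compose2[OF assms(3) C1on_continuous[OF assms(1)]]) auto
qed (rule assms(2))

lemma C1on_divide:
  assumes "C1on S a da" "C1on S b db" "\<And>p. p \<in> S \<Longrightarrow> b p \<noteq> 0"
  shows "C1on S (\<lambda>p. a p / b p) (\<lambda>e p. (da e p * b p - a p * db e p) / (b p * b p))"
proof -
  have "((\<lambda>t. a (p + t *\<^sub>R e) / b (p + t *\<^sub>R e)) has_real_derivative (da e p * b p - a p * db e p) / (b p * b p)) (at 0)"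
    if "e \<in> Basis" "p \<in> S" for e p
    using DERIV_divide[OF C1on_deriv[OF assms(1) that] C1on_deriv[OF assms(2) that]] assms(3)[OF that(2)]
    by simp
  then show ?thesis using assms unfolding C1on_def
    by (auto intro!: continuous_intros)
qed

lemma eventually_line_in_open:
  fixes p e :: "'a::real_normed_vector"
  assumes "open S" "p \<in> S"
  shows "\<forall>\<^sub>F t in nhds (0::real). p + t *\<^sub>R e \<in> S"
proof -
  have "open ((\<lambda>t::real. p + t *\<^sub>R e) -` S)"
    by (intro open_vimage assms continuous_intros)
  then show ?thesis using assms(2)
    by (intro eventually_nhds_in_open[where s="(\<lambda>t::real. p + t *\<^sub>R e) -` S", simplified]) auto
qed

lemma C1on_cong:
  assumes "C1on S a d" "open S" "\<And>p. p \<in> S \<Longrightarrow> b p = a p"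
    and "\<And>p e. p \<in> S \<Longrightarrow> e \<in> Basis \<Longrightarrow> d' e p = d e p"
  shows "C1on S b d'"
  unfolding C1on_def
proof (intro conjI ballI)
  show "continuous_on S b"
    using C1on_continuous[OF assms(1)] assms(3) by (simp cong: continuous_on_cong)
  fix e :: hpt assume e: "e \<in> Basis"
  show "continuous_on S (d' e)"
    using C1on_continuous_deriv[OF assms(1) e] assms(4) e by (simp cong: continuous_on_cong)
  fix p assume p: "p \<in> S"
  have "\<forall>\<^sub>F t in nhds 0. a (p + t *\<^sub>R e) = b (p + t *\<^sub>R e)"
    using eventually_line_in_open[OF assms(2) p, of e] by (rule eventually_mono) (simp add: assms(3))
  then have "((\<lambda>t. b (p + t *\<^sub>R e)) has_real_derivative d e p) (at 0)"
    using DERIV_cong_ev[OF refl _ refl] C1on_deriv[OF assms(1) e p] by fastforce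
  then show "((\<lambda>t. b (p + t *\<^sub>R e)) has_real_derivative d' e p) (at 0)"
    using assms(4)[OF p e] by simp
qed

lemma C1on_Un:
  assumes "C1on S a d" "C1on T a d" "open S" "open T"
  shows "C1on (S \<union> T) a d"
  using assms by (auto simp: C1on_def intro!: continuous_on_open_Un)

lemma C1on_unique:
  assumes "C1on S a d" "C1on S a d'" "p \<in> S" "e \<in> Basis" shows "d e p = d' e p"
  using DERIV_unique[OF C1on_deriv[OF assms(1)] C1on_deriv[OF assms(2)]] assms by blast

text \<open>The open sets \<open>S\<close> and \<open>- K\<close> cover the space. On their overlap
  the function is locally zero, so uniqueness of derivatives makes \<open>d\<close> vanish there and
  the two descriptions agree.\<close>

lemma C1on_extend_zero:
  assumes "C1on S a d" "open S" "closed K" "K \<subseteq> S" "\<And>p. p \<notin> K \<Longrightarrow> a p = 0"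
  shows "C1on UNIV a (\<lambda>e p. if p \<in> K then d e p else 0)" (is "C1on _ _ ?d")
proof -
  have o: "open (S \<inter> - K)" using assms by auto
  have z: "C1on (- K) a (\<lambda>e p. 0)"
    by (rule C1on_cong[OF C1on_const[where c=0]]) (use assms in auto)
  have eq: "d e p = 0" if "p \<in> S" "p \<notin> K" "e \<in> Basis" for e p
    using C1on_unique[OF C1on_subset[OF assms(1), of "S \<inter> - K"] C1on_subset[OF z, of "S \<inter> - K"], of p e] that
    by auto
  have "C1on S a ?d" by (rule C1on_cong[OF assms(1,2)]) (use eq in auto)
  moreover have "C1on (- K) a ?d" by (rule C1on_cong[OF z]) (use assms in auto)
  ultimately have "C1on (S \<union> - K) a ?d" by (rule C1on_Un) (use assms in auto)
  moreover have "S \<union> - K = UNIV" using assms by auto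
  ultimately show ?thesis by simp
qed

lemma C1on_deriv_zero:
  assumes "C1on UNIV a d" "closed K" "\<And>p. p \<notin> K \<Longrightarrow> a p = 0" "p \<notin> K" "e \<in> Basis"
  shows "d e p = 0"
proof -
  have z: "C1on (- K) a (\<lambda>e p. 0)"
    by (rule C1on_cong[OF C1on_const[where c=0]]) (use assms in auto)
  show ?thesis
    using C1on_unique[OF C1on_subset[OF assms(1), of "- K"] z, of p e] assms by auto
qed

section \<open>Compactly supported functions and integration by parts\<close>

lemma compact_support_bounded:
  fixes g :: "'a::metric_space \<Rightarrow> real"
  assumes "continuous_on UNIV g" "compact K" "\<And>p. p \<notin> K \<Longrightarrow> g p = 0"
  obtains C where "0 \<le> C" "\<And>p. \<bar>g p\<bar> \<le> C"
proof -
  have "compact (g ` K)" using assms by (meson compact_continuous_image continuous_on_subset top_greatest)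
  then obtain C where "\<forall>y\<in>g ` K. \<bar>y\<bar> \<le> C"
    by (metis bounded_real compact_imp_bounded)
  then have "\<bar>g p\<bar> \<le> max C 0" for p using assms(3)[of p] by (cases "p \<in> K") force+
  then show thesis by (intro that[of "max C 0"]) auto
qed

lemma integrable_compact_support:
  fixes g :: "'a::euclidean_space \<Rightarrow> real"
  assumes "continuous_on UNIV g" "compact K" "\<And>p. p \<notin> K \<Longrightarrow> g p = 0"
  shows "integrable lborel g"
proof -
  have "set_integrable lborel K g"
    by (rule borel_integrable_compact[unfolded set_integrable_def[symmetric]])
       (use assms(2) continuous_on_subset[OF assms(1), of K] in auto)
  moreover have "(\<lambda>x. indicator K x *\<^sub>R g x) = g" 
  proof
    fix x show "indicator K x *\<^sub>R g x = g x" using assms(3)[of x] by (cases "x \<in> K") auto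
  qed
  ultimately show ?thesis by (simp add: set_integrable_def)
qed

text \<open>Difference quotients have integral zero because Lebesgue measure is translation
  invariant. They are bounded by the mean value theorem and converge to the derivative, so dominated
  convergence applies; Fubini is avoided.\<close>

lemma integral_C1_deriv_zero:
  assumes d: "C1on UNIV a d" and K: "compact K" "\<And>p. p \<notin> K \<Longrightarrow> a p = 0" and e: "e \<in> Basis"
  shows "integral\<^sup>L lborel (d e) = 0"
proof -
  have dz: "d e p = 0" if "p \<notin> K" for p
    using C1on_deriv_zero[OF d compact_imp_closed[OF K(1)] K(2) that e] .
  have dc: "continuous_on UNIV (d e)" using C1on_continuous_deriv[OF d e] .
  have ac: "continuous_on UNIV a" using C1on_continuous[OF d] .
  obtain C where C: "0 \<le> C" "\<And>p. \<bar>d e p\<bar> \<le> C"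
    using compact_support_bounded[OF dc K(1) dz] by metis
  have der: "((\<lambda>t. a (p + t *\<^sub>R e)) has_real_derivative d e (p + t *\<^sub>R e)) (at t)" for p t
  proof -
    have "((\<lambda>s. a ((p + t *\<^sub>R e) + s *\<^sub>R e)) has_real_derivative d e (p + t *\<^sub>R e)) (at 0)"
      using C1on_deriv[OF d e, of "p + t *\<^sub>R e"] by simp
    then have "((\<lambda>s. a (p + (s + t) *\<^sub>R e)) has_real_derivative d e (p + t *\<^sub>R e)) (at 0)"
      by (simp add: algebra_simps)
    then show ?thesis using DERIV_shift[of "\<lambda>s. a (p + s *\<^sub>R e)" _ 0 t] by simp
  qed
  define q where "q n p = real (Suc n) * (a (p + (1 / real (Suc n)) *\<^sub>R e) - a p)" for n p
  have qb: "\<bar>q n p\<bar> \<le> C" for n p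
  proof -
    have "\<bar>a (p + (1 / real (Suc n)) *\<^sub>R e) - a (p + 0 *\<^sub>R e)\<bar> \<le> C * \<bar>1 / real (Suc n) - 0\<bar>"
      using field_differentiable_bound[where S=UNIV and f="\<lambda>t. a (p + t *\<^sub>R e)" and f'="\<lambda>t. d e (p + t *\<^sub>R e)" and B=C
          and x=0 and y="1 / real (Suc n)"]
      using der C by (simp add: norm_minus_commute)
    then have "\<bar>a (p + (1 / real (Suc n)) *\<^sub>R e) - a p\<bar> \<le> C / real (Suc n)" by simp
    then have "real (Suc n) * \<bar>a (p + (1 / real (Suc n)) *\<^sub>R e) - a p\<bar> \<le> C"
      by (simp add: field_simps)
    then show ?thesis by (simp add: q_def abs_mult)
  qed
  obtain r where r: "\<And>p. p \<in> K \<Longrightarrow> norm p \<le> r" using compact_imp_bounded[OF K(1)] unfolding bounded_iff by auto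
  \<comment> \<open>The shifts have length at most 1, so all quotients vanish outside one ball,
    which supplies the integrable majorant.\<close>
  have qz: "q n p = 0" if "p \<notin> cball 0 (r + 1)" for n p
  proof -
    have n: "norm p > r + 1" using that by simp
    have "norm ((1 / real (Suc n)) *\<^sub>R e) \<le> 1" using e by simp
    then have "norm (p + (1 / real (Suc n)) *\<^sub>R e) > r"
      using n norm_triangle_ineq4[of "p + (1 / real (Suc n)) *\<^sub>R e" "(1 / real (Suc n)) *\<^sub>R e"] by (simp del: norm_scaleR)
    then have "p + (1 / real (Suc n)) *\<^sub>R e \<notin> K" "p \<notin> K" using r[of p] r[of "p + (1 / real (Suc n)) *\<^sub>R e"] n by linarith+
    then show ?thesis using K(2) by (simp add: q_def)
  qed
  have ai: "integrable lborel a" by (rule integrable_compact_support[OF ac K])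
  have tr: "integral\<^sup>L lborel (\<lambda>p. a (p + v)) = integral\<^sup>L lborel a" "integrable lborel (\<lambda>p. a (p + v))" for v
  proof -
    have am: "a \<in> borel_measurable borel" using ac by (rule borel_measurable_continuous_onI)
    have "integral\<^sup>L (distr lborel borel ((+) v)) a = integral\<^sup>L lborel (\<lambda>p. a (v + p))"
      by (rule integral_distr) (use am in auto)
    then show "integral\<^sup>L lborel (\<lambda>p. a (p + v)) = integral\<^sup>L lborel a"
      by (simp add: lborel_distr_plus add.commute)
    have "integrable (distr lborel borel ((+) v)) a = integrable lborel (\<lambda>p. a (v + p))"
      by (rule integrable_distr_eq) (use am in auto)
    then show "integrable lborel (\<lambda>p. a (p + v))"
      using ai by (simp add: lborel_distr_plus add.commute)
  qed
  have q0: "integral\<^sup>L lborel (q n) = 0" for n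
    unfolding q_def using tr ai by simp
  have "(\<lambda>n. integral\<^sup>L lborel (q n)) \<longlonglongrightarrow> integral\<^sup>L lborel (d e)"
  proof (rule integral_dominated_convergence[where w="\<lambda>p. C * indicator (cball 0 (r+1)) p"])
    show "d e \<in> borel_measurable lborel" using dc by (simp add: borel_measurable_continuous_onI)
    show "q n \<in> borel_measurable lborel" for n unfolding q_def
      by (intro borel_measurable_integrable) (use tr ai in auto)
    show "integrable lborel (\<lambda>p. C * indicator (cball 0 (r + 1)) p)"
      by (intro integrable_mult_right integrable_real_indicator) (use emeasure_bounded_finite[of "cball 0 (r + 1)"] in auto)
    show "AE p in lborel. (\<lambda>n. q n p) \<longlonglongrightarrow> d e p"
    proof (intro AE_I2)
      fix p
      have "((\<lambda>t. (a (p + t *\<^sub>R e) - a p) / t) \<longlongrightarrow> d e p) (at 0)"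
        using C1on_deriv[OF d e, of p] by (simp add: has_field_derivative_iff)
      moreover have "filterlim (\<lambda>n. 1 / real (Suc n)) (at 0) sequentially"
        unfolding filterlim_at using LIMSEQ_Suc[OF lim_1_over_n] by (simp add: eventually_sequentially)
      ultimately have "(\<lambda>n. (a (p + (1 / real (Suc n)) *\<^sub>R e) - a p) / (1 / real (Suc n))) \<longlonglongrightarrow> d e p"
        by (rule filterlim_compose)
      then show "(\<lambda>n. q n p) \<longlonglongrightarrow> d e p" by (simp add: q_def mult.commute)
    qed
    show "AE p in lborel. norm (q n p) \<le> C * indicator (cball 0 (r + 1)) p" for n
      using qb[of n] qz[of _ n] by (intro AE_I2) (auto simp: indicator_def)
  qed
  then show ?thesis using q0 by (simp add: LIMSEQ_const_iff)
qed

text \<open>The coefficient \<open>y\<close> does not depend on \<open>z\<close>, so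
  \<open>y\<close> times the \<open>z\<close>-derivative of \<open>a\<close> is the
  \<open>z\<close>-derivative of \<open>y * a\<close>: the field X is divergence-free. The same
  holds for Y with the coefficient \<open>x\<close>.\<close>

lemma integral_Xd_zero:
  assumes d: "C1on UNIV a d" and K: "compact K" "\<And>p. p \<notin> K \<Longrightarrow> a p = 0"
  shows "integral\<^sup>L lborel (Xd d) = 0"
proof -
  have c: "C1on UNIV (\<lambda>p. fst (snd p) * a p) (\<lambda>e p. fst (snd e) * a p + fst (snd p) * d e p)"
    by (rule C1on_mult[OF C1on_y d])
  have 1: "integral\<^sup>L lborel (d (1,0,0)) = 0" "integral\<^sup>L lborel (\<lambda>p. fst (snd p) * d (0,0,1) p) = 0"
    using integral_C1_deriv_zero[OF d K, of "(1,0,0)"] integral_C1_deriv_zero[OF c K(1), of "(0,0,1)"] K(2)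
    by (auto simp: Basis_hpt)
  have z: "d e p = 0" if "p \<notin> K" "e \<in> Basis" for e p
    using C1on_deriv_zero[OF d compact_imp_closed[OF K(1)] K(2) that] .
  have i: "integrable lborel (d (1,0,0))" "integrable lborel (\<lambda>p. fst (snd p) * d (0,0,1) p)"
    using d by (auto intro!: integrable_compact_support[OF _ K(1)] continuous_intros z
        simp: C1on_def Basis_hpt)
  have "integral\<^sup>L lborel (\<lambda>p. d (1,0,0) p - (1/2) * (fst (snd p) * d (0,0,1) p)) = 0"
    using i 1 by simp
  then show ?thesis by (simp add: Xd_def[abs_def])
qed

lemma integral_Yd_zero:
  assumes d: "C1on UNIV a d" and K: "compact K" "\<And>p. p \<notin> K \<Longrightarrow> a p = 0"
  shows "integral\<^sup>L lborel (Yd d) = 0"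
proof -
  have c: "C1on UNIV (\<lambda>p. fst p * a p) (\<lambda>e p. fst e * a p + fst p * d e p)"
    by (rule C1on_mult[OF C1on_x d])
  have 1: "integral\<^sup>L lborel (d (0,1,0)) = 0" "integral\<^sup>L lborel (\<lambda>p. fst p * d (0,0,1) p) = 0"
    using integral_C1_deriv_zero[OF d K, of "(0,1,0)"] integral_C1_deriv_zero[OF c K(1), of "(0,0,1)"] K(2)
    by (auto simp: Basis_hpt)
  have z: "d e p = 0" if "p \<notin> K" "e \<in> Basis" for e p
    using C1on_deriv_zero[OF d compact_imp_closed[OF K(1)] K(2) that] .
  have i: "integrable lborel (d (0,1,0))" "integrable lborel (\<lambda>p. fst p * d (0,0,1) p)"
    using d by (auto intro!: integrable_compact_support[OF _ K(1)] continuous_intros z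
        simp: C1on_def Basis_hpt)
  have "integral\<^sup>L lborel (\<lambda>p. d (0,1,0) p + (1/2) * (fst p * d (0,0,1) p)) = 0"
    using i 1 by simp
  then show ?thesis by (simp add: Yd_def[abs_def])
qed

section \<open>Smooth approximation and lower bounds for the perimeter\<close>

text \<open>The derivatives of \<open>phi p\<close> are of the form \<open>phi q\<close>, so products of such functions are smooth.\<close>

definition phi :: "real poly \<Rightarrow> real \<Rightarrow> real" where
  "phi p x = (if 0 < x then poly p (1 / x) * exp (- (1 / x)) else 0)"

lemma poly_times_exp_minus_tendsto_0: "((\<lambda>t::real. poly p t * exp (- t)) \<longlongrightarrow> 0) at_top"
proof -
  have "((\<lambda>t::real. \<Sum>i\<le>degree p. coeff p i * (t ^ i / exp t)) \<longlongrightarrow> (\<Sum>i\<le>degree p. coeff p i * 0)) at_top"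
    by (intro tendsto_sum tendsto_mult tendsto_const tendsto_power_div_exp_0)
  then show ?thesis
    by (simp add: poly_altdef sum_distrib_right sum_divide_distrib exp_minus field_simps)
qed

text \<open>In the variable \<open>t = 1 / x\<close> the chain rule contributes the factor
  \<open>- t\<^sup>2\<close>, which turns the polynomial \<open>p\<close> into
  \<open>t\<^sup>2 * (p - p')\<close>. At 0 the difference quotient is
  \<open>t * p(t) * exp (- t)\<close> with \<open>t\<close> tending to infinity.\<close>

lemma phi_has_derivative:
  "(phi p has_real_derivative phi ([:0,0,1:] * (p - pderiv p)) x) (at x)"
proof -
  consider "x > 0" | "x < 0" | "x = 0" by linarith
  then show ?thesis
  proof cases
    case 1
    have "((\<lambda>x. poly p (1 / x) * exp (- (1 / x))) has_real_derivative phi ([:0,0,1:] * (p - pderiv p)) x) (at x)"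
      using 1 by (auto intro!: derivative_eq_intros DERIV_chain2[OF poly_DERIV] simp: phi_def field_simps power2_eq_square)
    moreover have e: "\<forall>\<^sub>F y in nhds x. phi p y = poly p (1 / y) * exp (- (1 / y))"
      using eventually_nhds_in_open[of "{0<..}" x] 1 by (auto simp: phi_def elim!: eventually_mono)
    ultimately show ?thesis by (simp only: DERIV_cong_ev[OF refl e refl])
  next
    case 2
    have "\<forall>\<^sub>F y in nhds x. phi p y = 0"
      using eventually_nhds_in_open[of "{..<0}" x] 2 by (auto simp: phi_def elim!: eventually_mono)
    then have "(phi p has_real_derivative 0) (at x) = ((\<lambda>x. 0) has_real_derivative 0) (at x)"
      by (intro DERIV_cong_ev) auto
    then show ?thesis using 2 by (simp add: phi_def)
  next
    case 3
    have "((\<lambda>h. poly (pCons 0 p) (1 / h) * exp (- (1 / h))) \<longlongrightarrow> 0) (at_right 0)"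
      using filterlim_compose[OF poly_times_exp_minus_tendsto_0[of "pCons 0 p"] filterlim_inverse_at_top_right]
      by (simp add: inverse_eq_divide)
    then have r: "((\<lambda>h. phi p h / h) \<longlongrightarrow> 0) (at_right 0)"
      by (rule Lim_transform_eventually)
         (auto simp: eventually_at_right_field phi_def intro!: exI[of _ 1])
    have l: "((\<lambda>h. phi p h / h) \<longlongrightarrow> 0) (at_left 0)"
      by (rule Lim_transform_eventually[OF tendsto_const])
         (auto simp: eventually_at_left_field phi_def intro!: exI[of _ "-1"])
    show ?thesis using filterlim_split_at[OF l r] 3
      by (simp add: has_field_derivative_iff phi_def)
  qed
qed

lemma phi_linear: "phi (- p) x = - phi p x" "phi (smult c p) x = c * phi p x"
  by (auto simp: phi_def)

text \<open>The product rule leaves the class of single products, so sums are included. Every member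
  vanishes outside \<open>(-\<epsilon>, \<epsilon>)\<close>, and derivatives stay in the
  class.\<close>

inductive bump :: "real \<Rightarrow> (real \<Rightarrow> real) \<Rightarrow> bool" for \<epsilon> where
  base: "bump \<epsilon> (\<lambda>x. phi p (\<epsilon> + x) * phi q (\<epsilon> - x))"
| add: "bump \<epsilon> g \<Longrightarrow> bump \<epsilon> h \<Longrightarrow> bump \<epsilon> (\<lambda>x. g x + h x)"

lemma bump_derivative:
  "bump \<epsilon> g \<Longrightarrow> \<exists>g'. bump \<epsilon> g' \<and> (\<forall>x. (g has_real_derivative g' x) (at x))"
proof (induction rule: bump.induct)
  case (base p q)
  let ?D = "\<lambda>p. [:0,0,1:] * (p - pderiv p)"
  have "bump \<epsilon> (\<lambda>x. phi (?D p) (\<epsilon> + x) * phi q (\<epsilon> - x) + phi p (\<epsilon> + x) * phi (- ?D q) (\<epsilon> - x))"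
    by (intro bump.intros)
  moreover have "((\<lambda>x. phi p (\<epsilon> + x) * phi q (\<epsilon> - x)) has_real_derivative
      phi (?D p) (\<epsilon> + x) * phi q (\<epsilon> - x) + phi p (\<epsilon> + x) * phi (- ?D q) (\<epsilon> - x)) (at x)" for x
    unfolding phi_linear
    by (auto intro!: derivative_eq_intros DERIV_chain2[OF phi_has_derivative] simp: algebra_simps)
  ultimately show ?case by blast
next
  case (add g h)
  from add.IH obtain g' h' where d: "bump \<epsilon> g'" "bump \<epsilon> h'"
    "\<And>x. (g has_real_derivative g' x) (at x)" "\<And>x. (h has_real_derivative h' x) (at x)" by metis
  have "bump \<epsilon> (\<lambda>x. g' x + h' x)" by (rule bump.add[OF d(1,2)])
  moreover have "\<forall>x. ((\<lambda>x. g x + h x) has_real_derivative g' x + h' x) (at x)"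
    using DERIV_add[OF d(3,4)] by blast
  ultimately show ?case by (intro exI[of _ "\<lambda>x. g' x + h' x"] conjI)
qed

lemma bump_outside: "bump \<epsilon> g \<Longrightarrow> \<epsilon> \<le> \<bar>x\<bar> \<Longrightarrow> g x = 0"
  by (induction rule: bump.induct) (auto simp: phi_def)

lemma bump_continuous: "bump \<epsilon> g \<Longrightarrow> continuous_on UNIV g"
  using bump_derivative by (meson DERIV_continuous_on has_field_derivative_at_within)

section \<open>Product bumps in three variables\<close>

definition bump3 :: "real \<Rightarrow> (hpt \<Rightarrow> real) \<Rightarrow> bool" where
  "bump3 \<epsilon> \<rho> \<longleftrightarrow> (\<exists>f g h. bump \<epsilon> f \<and> bump \<epsilon> g \<and> bump \<epsilon> h \<and>
     \<rho> = (\<lambda>p. f (fst p) * g (fst (snd p)) * h (snd (snd p))))"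

lemma bump3_continuous: "bump3 \<epsilon> \<rho> \<Longrightarrow> continuous_on UNIV \<rho>"
proof -
  assume "bump3 \<epsilon> \<rho>"
  then obtain f g h where b: "bump \<epsilon> f" "bump \<epsilon> g" "bump \<epsilon> h"
    and r: "\<rho> = (\<lambda>p. f (fst p) * g (fst (snd p)) * h (snd (snd p)))"
    unfolding bump3_def by blast
  show "continuous_on UNIV \<rho>" unfolding r
    by (intro continuous_on_mult continuous_on_compose2[OF bump_continuous[OF b(1)]]
      continuous_on_compose2[OF bump_continuous[OF b(2)]]
      continuous_on_compose2[OF bump_continuous[OF b(3)]] continuous_intros subset_UNIV)
qed

lemma bump3_outside:
  assumes "bump3 \<epsilon> \<rho>" "3 * \<epsilon> \<le> norm v" shows "\<rho> v = 0"
proof -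
  obtain x y z where v: "v = (x,y,z)" by (cases v)
  have "norm v \<le> \<bar>x\<bar> + \<bar>y\<bar> + \<bar>z\<bar>"
    using norm_Pair_le[of x "(y,z)"] norm_Pair_le[of y z] by (simp add: v)
  then have "\<epsilon> \<le> \<bar>x\<bar> \<or> \<epsilon> \<le> \<bar>y\<bar> \<or> \<epsilon> \<le> \<bar>z\<bar>" using assms(2) by linarith
  then show ?thesis using assms(1) bump_outside unfolding bump3_def v by fastforce
qed

text \<open>A coordinate derivative changes only one of the three factors, so it is again a single
  product. This closure is the invariant for the coinductive notion of smoothness.\<close>

lemma bump3_C1:
  assumes "bump3 \<epsilon> \<rho>"
  shows "\<exists>d. C1on UNIV \<rho> d \<and> (\<forall>e\<in>Basis. bump3 \<epsilon> (d e))"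
proof -
  obtain f g h where b: "bump \<epsilon> f" "bump \<epsilon> g" "bump \<epsilon> h"
    and r: "\<rho> = (\<lambda>p. f (fst p) * g (fst (snd p)) * h (snd (snd p)))"
    using assms unfolding bump3_def by blast
  obtain f' g' h' where b': "bump \<epsilon> f'" "bump \<epsilon> g'" "bump \<epsilon> h'"
    and D: "\<And>x. (f has_real_derivative f' x) (at x)" "\<And>x. (g has_real_derivative g' x) (at x)"
      "\<And>x. (h has_real_derivative h' x) (at x)"
    using bump_derivative b by metis
  define d where "d e p = fst e * (f' (fst p) * g (fst (snd p)) * h (snd (snd p)))
    + fst (snd e) * (f (fst p) * g' (fst (snd p)) * h (snd (snd p)))
    + snd (snd e) * (f (fst p) * g (fst (snd p)) * h' (snd (snd p)))" for e p :: hpt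
  have "C1on UNIV \<rho> d"
    unfolding r
  proof (rule C1on_cong[OF C1on_mult[OF C1on_mult[OF
        C1on_chain_UNIV[OF C1on_x D(1) bump_continuous[OF b'(1)]]
        C1on_chain_UNIV[OF C1on_y D(2) bump_continuous[OF b'(2)]]]
        C1on_chain_UNIV[OF C1on_z D(3) bump_continuous[OF b'(3)]]]])
  qed (auto simp: d_def algebra_simps)
  moreover have "bump3 \<epsilon> (d e)" if "e \<in> Basis" for e
  proof -
    have "d (1,0,0) = (\<lambda>p. f' (fst p) * g (fst (snd p)) * h (snd (snd p)))"
      "d (0,1,0) = (\<lambda>p. f (fst p) * g' (fst (snd p)) * h (snd (snd p)))"
      "d (0,0,1) = (\<lambda>p. f (fst p) * g (fst (snd p)) * h' (snd (snd p)))"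
      unfolding d_def by auto
    then show ?thesis using that b b' unfolding Basis_hpt bump3_def by blast
  qed
  ultimately show ?thesis by blast
qed

section \<open>Convolution and mollification\<close>

definition conv :: "(hpt \<Rightarrow> real) \<Rightarrow> (hpt \<Rightarrow> real) \<Rightarrow> hpt \<Rightarrow> real" where
  "conv a \<rho> p = integral\<^sup>L lborel (\<lambda>q. a q * \<rho> (p - q))"

lemma conv_integrable:
  fixes a \<rho> :: "hpt \<Rightarrow> real"
  assumes "continuous_on UNIV a" "compact K" "\<And>p. p \<notin> K \<Longrightarrow> a p = 0" "continuous_on UNIV \<rho>"
  shows "integrable lborel (\<lambda>q. a q * \<rho> (p - q))"
proof (rule integrable_compact_support[OF _ assms(2)])
  show "continuous_on UNIV (\<lambda>q. a q * \<rho> (p - q))"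
    by (intro continuous_intros assms(1) continuous_on_compose2[OF assms(4)]) auto
qed (use assms in auto)

text \<open>On a fixed box the theorems on continuity and differentiation of parameter integrals are
  available.\<close>

lemma conv_eq_integral_cbox:
  assumes "continuous_on UNIV a" "compact K" "\<And>p. p \<notin> K \<Longrightarrow> a p = 0" "continuous_on UNIV \<rho>"
    and "K \<subseteq> cbox l u"
  shows "conv a \<rho> p = integral (cbox l u) (\<lambda>q. a q * \<rho> (p - q))"
proof -
  have "((\<lambda>q. a q * \<rho> (p - q)) has_integral conv a \<rho> p) UNIV"
    unfolding conv_def by (rule has_integral_integral_lborel[OF conv_integrable[OF assms(1-4)]])
  then have "((\<lambda>q. if q \<in> cbox l u then a q * \<rho> (p - q) else 0) has_integral conv a \<rho> p) UNIV"
    by (rule has_integral_eq[rotated]) (use assms in auto)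
  then show ?thesis by (simp add: has_integral_restrict_UNIV integral_unique)
qed

lemma conv_C1:
  assumes a: "continuous_on UNIV a" "compact K" "\<And>p. p \<notin> K \<Longrightarrow> a p = 0" and r: "C1on UNIV \<rho> d"
  shows "C1on UNIV (conv a \<rho>) (\<lambda>e. conv a (d e))"
proof -
  obtain l u where K: "K \<subseteq> cbox l u"
    using bounded_subset_cbox_symmetric[OF compact_imp_bounded[OF a(2)]] by metis
  have cc: "continuous_on S (\<lambda>x. a (f x) * r (g x))"
    if "continuous_on UNIV r" "continuous_on S f" "continuous_on S g" for S and f g :: "'b::topological_space \<Rightarrow> hpt" and r
    by (rule continuous_on_mult[OF continuous_on_compose2[OF a(1) that(2) subset_UNIV]
          continuous_on_compose2[OF that(1,3) subset_UNIV]])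
  have cont: "continuous_on UNIV (conv a r)" if "continuous_on UNIV r" for r
    unfolding conv_eq_integral_cbox[OF a that K, THEN ext, of "\<lambda>p. p", simplified]
    by (rule integral_continuous_on_param, unfold split_beta, rule cc[OF that])
       (intro continuous_intros)+
  have rc: "continuous_on UNIV \<rho>" "\<And>e. e \<in> Basis \<Longrightarrow> continuous_on UNIV (d e)"
    using r by (auto simp: C1on_def)
  have "((\<lambda>t. conv a \<rho> (p + t *\<^sub>R e)) has_real_derivative conv a (d e) p) (at 0)"
    if e: "e \<in> Basis" for e p
  proof -
    have der: "((\<lambda>t. \<rho> (v + t *\<^sub>R e)) has_real_derivative d e (v + t *\<^sub>R e)) (at t)" for v t
    proof -
      have "((\<lambda>s. \<rho> ((v + t *\<^sub>R e) + s *\<^sub>R e)) has_real_derivative d e (v + t *\<^sub>R e)) (at 0)"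
        using C1on_deriv[OF r e, of "v + t *\<^sub>R e"] by simp
      then have "((\<lambda>s. \<rho> (v + (s + t) *\<^sub>R e)) has_real_derivative d e (v + t *\<^sub>R e)) (at 0)"
        by (simp add: algebra_simps)
      then show ?thesis using DERIV_shift[of "\<lambda>s. \<rho> (v + s *\<^sub>R e)" _ 0 t] by simp
    qed
    have eq: "p + t *\<^sub>R e - q = (p - q) + t *\<^sub>R e" for t q by (simp add: algebra_simps)
    have "((\<lambda>t. integral (cbox l u) (\<lambda>q. a q * \<rho> (p + t *\<^sub>R e - q))) has_real_derivative
        integral (cbox l u) (\<lambda>q. a q * d e (p + 0 *\<^sub>R e - q))) (at 0 within UNIV)"
    proof (rule leibniz_rule_field_derivative)
      show "((\<lambda>t. a q * \<rho> (p + t *\<^sub>R e - q)) has_real_derivative a q * d e (p + t *\<^sub>R e - q)) (at t within UNIV)" for t q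
        unfolding eq by (intro DERIV_cmult der)
      show "(\<lambda>q. a q * \<rho> (p + t *\<^sub>R e - q)) integrable_on cbox l u" for t
        by (rule integrable_continuous, rule cc[OF rc(1)]) (intro continuous_intros)+
      show "continuous_on (UNIV \<times> cbox l u) (\<lambda>(t, q). a q * d e (p + t *\<^sub>R e - q))"
        unfolding split_beta by (rule cc[OF rc(2)[OF e]]) (intro continuous_intros)+
    qed auto
    then show ?thesis
      using conv_eq_integral_cbox[OF a rc(1) K] conv_eq_integral_cbox[OF a rc(2)[OF e] K] by simp
  qed
  then show ?thesis using cont rc by (auto simp: C1on_def)
qed

text \<open>Coinduction on the set of all \<open>conv a \<rho>\<close> with \<open>\<rho>\<close> a
  product bump: all derivatives fall on \<open>\<rho>\<close>, whose partial derivatives are again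
  product bumps, so \<open>a\<close> only needs to be continuous.\<close>

lemma smooth3_conv:
  assumes "continuous_on UNIV a" "compact K" "\<And>p. p \<notin> K \<Longrightarrow> a p = 0" "bump3 \<epsilon> \<rho>"
  shows "smooth3 (conv a \<rho>)"
proof -
  have "\<exists>\<rho>. bump3 \<epsilon> \<rho> \<and> conv a \<rho> = conv a \<rho>0" if "bump3 \<epsilon> \<rho>0" for \<rho>0 using that by blast
  have "smooth3 g" if "\<exists>\<rho>. bump3 \<epsilon> \<rho> \<and> g = conv a \<rho>" for g
    using that
  proof (coinduction arbitrary: g)
    case smooth3
    then obtain \<rho> where r: "bump3 \<epsilon> \<rho>" and g: "g = conv a \<rho>" by blast
    obtain d where d: "C1on UNIV \<rho> d" "\<forall>e\<in>Basis. bump3 \<epsilon> (d e)" using bump3_C1[OF r] by blast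
    have c: "C1on UNIV g (\<lambda>e. conv a (d e))" unfolding g by (rule conv_C1[OF assms(1-3) d(1)])
    have "(\<lambda>t. g (p + t *\<^sub>R e)) differentiable (at 0)" if "e \<in> Basis" for e p
      using C1on_deriv[OF c that] real_differentiable_def by blast
    moreover have "pderiv3 e g = conv a (d e)" if "e \<in> Basis" for e
      using C1on_pderiv3[OF c that] by auto
    ultimately show ?case using C1on_continuous[OF c] d(2) by fastforce
  qed
  then show ?thesis using assms(4) by blast
qed

lemma smooth3_imp_C1on: "smooth3 a \<Longrightarrow> C1on UNIV a (\<lambda>e. pderiv3 e a)"
proof -
  assume s: "smooth3 a"
  have "((\<lambda>t. a (p + t *\<^sub>R e)) has_real_derivative pderiv3 e a p) (at 0)" if "e \<in> Basis" for e p
    using s that unfolding pderiv3_def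
    by (metis DERIV_deriv_iff_real_differentiable smooth3.cases)
  moreover have "continuous_on UNIV (pderiv3 e a)" if "e \<in> Basis" for e
    using s that by (metis smooth3.cases)
  ultimately show ?thesis using s unfolding C1on_def by (metis smooth3.cases)
qed

lemma integral_reflect_translate:
  fixes g :: "'a::euclidean_space \<Rightarrow> real"
  assumes "g \<in> borel_measurable borel"
  shows "integral\<^sup>L lborel (\<lambda>q. g (p - q)) = integral\<^sup>L lborel g"
proof -
  have "integral\<^sup>L (distr lborel borel (\<lambda>q. p - q)) g = integral\<^sup>L lborel (\<lambda>q. g (p - q))"
    by (rule integral_distr) (use assms in auto)
  moreover have "distr lborel borel (\<lambda>q. p - q) = lborel"
    using lborel_affine[of "-1" p] by (simp add: density_1)
  ultimately show ?thesis by simp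
qed

text \<open>Integration by parts in the integration variable; the minus sign from
  \<open>p - q\<close> cancels the one from the parts formula. Thus mollification commutes with
  coordinate derivatives of a continuously differentiable function.\<close>

lemma conv_deriv_swap:
  assumes a: "C1on UNIV a da" "compact K" "\<And>p. p \<notin> K \<Longrightarrow> a p = 0" and r: "C1on UNIV \<rho> d" and e: "e \<in> Basis"
  shows "conv a (d e) p = conv (da e) \<rho> p"
proof -
  have r': "C1on UNIV (\<lambda>q. \<rho> (p - q)) (\<lambda>e q. - d e (p - q))"
    unfolding C1on_def
  proof (intro conjI ballI)
    show "continuous_on UNIV (\<lambda>q. \<rho> (p - q))"
      by (rule continuous_on_compose2[OF C1on_continuous[OF r]]) (auto intro: continuous_intros)
    fix e :: hpt assume e: "e \<in> Basis"
    show "continuous_on UNIV (\<lambda>q. - d e (p - q))"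
      by (intro continuous_intros continuous_on_compose2[OF C1on_continuous_deriv[OF r e]]) auto
    fix q :: hpt
    have "((\<lambda>t. \<rho> ((p - q) + t *\<^sub>R e)) has_real_derivative d e (p - q)) (at (- 0))"
      using C1on_deriv[OF r e] by simp
    from DERIV_chain2[where f="\<lambda>t. \<rho> ((p - q) + t *\<^sub>R e)" and g=uminus and Db="- 1" and s=UNIV, OF this]
    show "((\<lambda>t. \<rho> (p - (q + t *\<^sub>R e))) has_real_derivative - d e (p - q)) (at 0)"
      by (simp add: algebra_simps DERIV_minus[OF DERIV_ident, simplified])
  qed
  have m: "C1on UNIV (\<lambda>q. a q * \<rho> (p - q)) (\<lambda>e q. da e q * \<rho> (p - q) + a q * - d e (p - q))"
    by (rule C1on_mult[OF a(1) r'])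
  have z: "integral\<^sup>L lborel (\<lambda>q. da e q * \<rho> (p - q) + a q * - d e (p - q)) = 0"
    by (rule integral_C1_deriv_zero[OF m a(2) _ e]) (use a in auto)
  have "da e q = 0" if "q \<notin> K" for q
    using C1on_deriv_zero[OF a(1) compact_imp_closed[OF a(2)] a(3) that e] .
  then have i: "integrable lborel (\<lambda>q. da e q * \<rho> (p - q))"
    by (intro conv_integrable[OF C1on_continuous_deriv[OF a(1) e] a(2) _ C1on_continuous[OF r]]) auto
  have j: "integrable lborel (\<lambda>q. a q * d e (p - q))"
    by (intro conv_integrable[OF C1on_continuous[OF a(1)] a(2,3) C1on_continuous_deriv[OF r e]])
  show ?thesis using z i j by (simp add: conv_def)
qed

lemma mollifier_exists:
  assumes "0 < \<epsilon>"
  obtains \<rho> where "bump3 \<epsilon> \<rho>" "\<And>v. 0 \<le> \<rho> v" "integral\<^sup>L lborel \<rho> = 1"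
proof -
  \<comment> \<open>The constant polynomial \<open>[:c:]\<close> in one factor allows normalisation
    of the integral without leaving the class \<open>bump3\<close>.\<close>
  define g where "g c = (\<lambda>x. phi [:c:] (\<epsilon> + x) * phi 1 (\<epsilon> - x))" for c
  define r where "r c = (\<lambda>p::hpt. g c (fst p) * g 1 (fst (snd p)) * g 1 (snd (snd p)))" for c
  have b: "bump3 \<epsilon> (r c)" for c unfolding bump3_def r_def g_def by (blast intro: bump.base)
  have n: "0 \<le> r 1 v" for v by (simp add: r_def g_def phi_def)
  have p: "r 1 0 > 0" using assms by (simp add: r_def g_def phi_def)
  have sm: "r c v = c * r 1 v" for c v by (simp add: r_def g_def phi_def)
  have i: "integrable lborel (r 1)"
    by (rule integrable_compact_support[OF bump3_continuous[OF b], of "cball 0 (3 * \<epsilon>)"])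
       (auto intro!: bump3_outside[OF b])
  \<comment> \<open>A nonnegative continuous function whose integral over a box is zero vanishes on
    the box, but the bump is positive at the origin.\<close>
  have pos: "integral\<^sup>L lborel (r 1) > 0"
  proof (rule ccontr)
    assume "\<not> ?thesis"
    moreover have "integral\<^sup>L lborel (r 1) \<ge> 0" using n by simp
    ultimately have z: "integral\<^sup>L lborel (r 1) = 0" by linarith
    obtain u where u: "cball (0::hpt) (3 * \<epsilon>) \<subseteq> cbox (-u) u"
      using bounded_subset_cbox_symmetric[OF bounded_cball] by metis
    have "(r 1 has_integral 0) UNIV" using has_integral_integral_lborel[OF i] z by simp
    then have "((\<lambda>q. if q \<in> cbox (-u) u then r 1 q else 0) has_integral 0) UNIV"
    proof (rule has_integral_eq[rotated])
      fix q show "r 1 q = (if q \<in> cbox (-u) u then r 1 q else 0)"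
      proof (cases "q \<in> cbox (-u) u")
        case False
        then have "q \<notin> cball 0 (3 * \<epsilon>)" using u by blast
        then show ?thesis using False bump3_outside[OF b, of q 1] by auto
      qed simp
    qed
    then have h: "(r 1 has_integral 0) (cbox (-u) u)" by (simp add: has_integral_restrict_UNIV)
    have "0 \<in> ball (0::hpt) (3 * \<epsilon>)" using assms by simp
    moreover have "ball 0 (3 * \<epsilon>) \<subseteq> box (-u) u"
      using interior_maximal[OF order_trans[OF ball_subset_cball u] open_ball] by (simp only: interior_cbox)
    ultimately have "0 \<in> box (-u) u" by blast
    then have "box (-u) u \<noteq> {}" "0 \<in> cbox (-u) u" using box_subset_cbox by blast+
    then have "r 1 0 = 0"
      by (intro has_integral_0_cbox_imp_0[OF continuous_on_subset[OF bump3_continuous[OF b] subset_UNIV] n h])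
    then show False using p by simp
  qed
  have "integral\<^sup>L lborel (r (1 / integral\<^sup>L lborel (r 1))) = 1"
    using pos unfolding sm[of "1 / integral\<^sup>L lborel (r 1)", abs_def] by simp
  moreover have "0 \<le> r (1 / integral\<^sup>L lborel (r 1)) v" for v
    using pos n unfolding sm[of "1 / integral\<^sup>L lborel (r 1)"] by simp
  ultimately show thesis using that[OF b] by blast
qed

lemma compact_support_uniformly_continuous:
  fixes g :: "'a::euclidean_space \<Rightarrow> real"
  assumes "continuous_on UNIV g" "compact K" "\<And>p. p \<notin> K \<Longrightarrow> g p = 0" "0 < \<delta>"
  obtains \<eta> where "0 < \<eta>" "\<And>p q. norm (p - q) < \<eta> \<Longrightarrow> \<bar>g p - g q\<bar> < \<delta>"
proof -
  define L where "L = {p + v | p v. p \<in> K \<and> v \<in> cball 0 1}"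
  have "compact L" unfolding L_def by (intro compact_sums assms) auto
  then have "uniformly_continuous_on L g"
    using assms(1) compact_uniformly_continuous continuous_on_subset by blast
  then obtain \<eta> where \<eta>: "0 < \<eta>" "\<And>p q. p \<in> L \<Longrightarrow> q \<in> L \<Longrightarrow> dist p q < \<eta> \<Longrightarrow> dist (g p) (g q) < \<delta>"
    using assms(4) unfolding uniformly_continuous_on_def by metis
  have KL: "q \<in> L" if "p \<in> K" "norm (p - q) < 1" for p q
    proof -
    have "q = p + (q - p)" "q - p \<in> cball 0 1" using that by (auto simp: norm_minus_commute)
    then show ?thesis unfolding L_def using that(1) by blast
  qed
  have "\<bar>g p - g q\<bar> < \<delta>" if n: "norm (p - q) < min \<eta> 1" for p q
  proof (cases "p \<in> K \<or> q \<in> K")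
    case True
    then have "p \<in> L" "q \<in> L" using KL[of p q] KL[of q p] KL[of p p] KL[of q q] n by (auto simp: norm_minus_commute)
    then show ?thesis using \<eta>(2)[of p q] n by (simp add: dist_norm)
  next
    case False then show ?thesis using assms by auto
  qed
  then show thesis using that[of "min \<eta> 1"] \<eta>(1) by auto
qed

lemma conv_close:
  assumes g: "continuous_on UNIV g" "compact K" "\<And>p. p \<notin> K \<Longrightarrow> g p = 0"
    and r: "bump3 \<epsilon> \<rho>" "\<And>v. 0 \<le> \<rho> v" "integral\<^sup>L lborel \<rho> = 1"
    and close: "\<And>p q. norm (p - q) < 3 * \<epsilon> \<Longrightarrow> \<bar>g p - g q\<bar> \<le> \<delta>"
  shows "\<bar>conv g \<rho> p - g p\<bar> \<le> \<delta>"
proof -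
  have rc: "continuous_on UNIV \<rho>" using bump3_continuous[OF r(1)] .
  have rm: "\<rho> \<in> borel_measurable borel" using rc by (rule borel_measurable_continuous_onI)
  have ri: "integrable lborel (\<lambda>q. \<rho> (p - q))"
    by (rule integrable_compact_support[of _ "cball p (3 * \<epsilon>)"])
       (auto intro!: continuous_on_compose2[OF rc] continuous_intros bump3_outside[OF r(1)] simp: dist_norm)
  have r1: "integral\<^sup>L lborel (\<lambda>q. \<rho> (p - q)) = 1"
    using integral_reflect_translate[OF rm] r(3) by simp
  have gi: "integrable lborel (\<lambda>q. g q * \<rho> (p - q))" by (rule conv_integrable[OF g rc])
  have "conv g \<rho> p - g p = integral\<^sup>L lborel (\<lambda>q. g q * \<rho> (p - q) - g p * \<rho> (p - q))"
    using gi ri r1 by (simp add: conv_def)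
  also have "\<bar>\<dots>\<bar> \<le> integral\<^sup>L lborel (\<lambda>q. \<bar>g q * \<rho> (p - q) - g p * \<rho> (p - q)\<bar>)"
    using integral_norm_bound[of lborel "\<lambda>q. g q * \<rho> (p - q) - g p * \<rho> (p - q)"] by simp
  also have "\<dots> \<le> integral\<^sup>L lborel (\<lambda>q. \<delta> * \<rho> (p - q))"
  proof (rule integral_mono)
    fix q
    show "\<bar>g q * \<rho> (p - q) - g p * \<rho> (p - q)\<bar> \<le> \<delta> * \<rho> (p - q)"
    proof (cases "norm (p - q) < 3 * \<epsilon>")
      case True
      have "\<bar>g q * \<rho> (p - q) - g p * \<rho> (p - q)\<bar> = \<bar>g p - g q\<bar> * \<rho> (p - q)"
        using r(2)[of "p - q"] by (simp add: left_diff_distrib[symmetric] abs_mult abs_minus_commute)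
      then show ?thesis using close[OF True] r(2)[of "p - q"] by (simp add: mult_right_mono)
    next
      case False
      then show ?thesis using bump3_outside[OF r(1), of "p - q"] by simp
    qed
  qed (use gi ri in auto)
  also have "\<dots> = \<delta>" using r1 by simp
  finally show ?thesis .
qed

lemma set_integrable_compact_support:
  fixes g :: "'a::euclidean_space \<Rightarrow> real"
  assumes "continuous_on UNIV g" "compact K" "\<And>p. p \<notin> K \<Longrightarrow> g p = 0" "F \<in> sets lebesgue"
  shows "set_integrable lebesgue F g"
proof -
  have "integrable lebesgue g"
    using integrable_compact_support[OF assms(1-3)] integrable_completion by blast
  then show ?thesis unfolding set_integrable_def
    using assms(4) integrable_mult_indicator by blast
qed

lemma measurable_compact_support_bound:
  fixes g :: "'a::euclidean_space \<Rightarrow> real"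
  assumes "continuous_on UNIV g" "compact K" "\<And>p. p \<notin> K \<Longrightarrow> g p = 0" "F \<in> sets lebesgue" "\<And>p. \<bar>g p\<bar> \<le> \<delta>" "0 \<le> \<delta>"
  shows "\<bar>set_lebesgue_integral lebesgue F g\<bar> \<le> \<delta> * measure lebesgue K"
proof -
  have K: "K \<in> lmeasurable" using assms(2) by (rule lmeasurable_compact)
  have "norm (integral\<^sup>L lebesgue (\<lambda>x. indicator F x *\<^sub>R g x)) \<le> integral\<^sup>L lebesgue (\<lambda>x. norm (indicator F x *\<^sub>R g x))"
    by (rule integral_norm_bound)
  also have "\<dots> \<le> integral\<^sup>L lebesgue (\<lambda>x. \<delta> * indicator K x)"
  proof (rule integral_mono)
    show "integrable lebesgue (\<lambda>x. norm (indicator F x *\<^sub>R g x))"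
      using set_integrable_compact_support[OF assms(1-4)] unfolding set_integrable_def by (rule integrable_norm)
    show "integrable lebesgue (\<lambda>x. \<delta> * indicator K x)"
      using K by (intro integrable_mult_right integrable_real_indicator) (auto simp: fmeasurable_def)
    show "norm (indicator F x *\<^sub>R g x) \<le> \<delta> * indicator K x" for x
      using assms(3)[of x] assms(5)[of x] assms(6) by (cases "x \<in> K"; cases "x \<in> F") auto
  qed
  also have "\<dots> = \<delta> * measure lebesgue K" using K by (simp add: fmeasurableD)
  finally show ?thesis by (simp add: set_lebesgue_integral_def)
qed

text \<open>Let \<open>N\<close> be the squared length of the averaged vector \<open>(A, B)\<close>.
  Then \<open>N\<close> is the average of \<open>A * a + B * b\<close>, which is at most
  \<open>sqrt N\<close> by Cauchy-Schwarz; so \<open>N \<le> sqrt N\<close>.\<close>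

lemma conv_sum_squares_le_1:
  assumes a: "continuous_on UNIV a" "compact K" "\<And>p. p \<notin> K \<Longrightarrow> a p = 0"
    and b: "continuous_on UNIV b" "\<And>p. p \<notin> K \<Longrightarrow> b p = 0"
    and ab: "\<And>p. (a p)\<^sup>2 + (b p)\<^sup>2 \<le> 1"
    and r: "bump3 \<epsilon> \<rho>" "\<And>v. 0 \<le> \<rho> v" "integral\<^sup>L lborel \<rho> = 1"
  shows "(conv a \<rho> p)\<^sup>2 + (conv b \<rho> p)\<^sup>2 \<le> 1"
proof -
  have rc: "continuous_on UNIV \<rho>" using bump3_continuous[OF r(1)] .
  have rm: "\<rho> \<in> borel_measurable borel" using rc by (rule borel_measurable_continuous_onI)
  have ri: "integrable lborel (\<lambda>q. \<rho> (p - q))"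
    by (rule integrable_compact_support[of _ "cball p (3 * \<epsilon>)"])
       (auto intro!: continuous_on_compose2[OF rc] continuous_intros bump3_outside[OF r(1)] simp: dist_norm)
  have r1: "integral\<^sup>L lborel (\<lambda>q. \<rho> (p - q)) = 1"
    using integral_reflect_translate[OF rm] r(3) by simp
  define A B N where "A = conv a \<rho> p" and "B = conv b \<rho> p" and "N = A\<^sup>2 + B\<^sup>2"
  have ai: "integrable lborel (\<lambda>q. a q * \<rho> (p - q))" "integrable lborel (\<lambda>q. b q * \<rho> (p - q))"
    using conv_integrable[OF a rc] conv_integrable[OF b(1) a(2) b(2) rc] by auto
  have "N = integral\<^sup>L lborel (\<lambda>q. A * (a q * \<rho> (p - q)) + B * (b q * \<rho> (p - q)))"
    using ai by (simp add: N_def A_def B_def conv_def power2_eq_square)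
  also have "\<dots> \<le> integral\<^sup>L lborel (\<lambda>q. sqrt N * \<rho> (p - q))"
  proof (rule integral_mono)
    fix q
    have "(A * a q + B * b q)\<^sup>2 \<le> N * ((a q)\<^sup>2 + (b q)\<^sup>2)"
      using sum_power2_ge_zero[of "A * b q - B * a q" 0] unfolding N_def by (simp add: power2_eq_square algebra_simps)
    also have "\<dots> \<le> N * 1" using ab by (intro mult_left_mono) (auto simp: N_def)
    finally have "A * a q + B * b q \<le> sqrt N" by (simp add: real_le_rsqrt)
    then have "(A * a q + B * b q) * \<rho> (p - q) \<le> sqrt N * \<rho> (p - q)" using r(2) by (intro mult_right_mono)
    then show "A * (a q * \<rho> (p - q)) + B * (b q * \<rho> (p - q)) \<le> sqrt N * \<rho> (p - q)" by (simp add: algebra_simps)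
  qed (use ai ri in auto)
  also have "\<dots> = sqrt N" using r1 by simp
  finally have "N \<le> sqrt N" .
  then have "N \<le> 1"
  proof (rule contrapos_pp)
    assume "\<not> N \<le> 1"
    then have "sqrt N * 1 < sqrt N * sqrt N" by (intro mult_strict_left_mono) auto
    then show "\<not> N \<le> sqrt N" using \<open>\<not> N \<le> 1\<close> by simp
  qed
  then show ?thesis by (simp add: N_def A_def B_def)
qed

text \<open>The fields used later are built from cutoffs and foliations that are only continuously
  differentiable, whereas the perimeter is tested with smooth ones. Mollification in coordinates
  does not commute with X and Y. However, their coefficients are evaluated outside the convolution,
  so uniform convergence of the partial derivatives on one compact set is enough.\<close>

lemma Per_ge_integral_C1:
  assumes F: "F \<in> sets lebesgue" and O: "open \<Omega>"
    and a: "C1on UNIV a da" and b: "C1on UNIV b db"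
    and K: "compact K" "K \<subseteq> \<Omega>" "\<And>p. p \<notin> K \<Longrightarrow> a p = 0" "\<And>p. p \<notin> K \<Longrightarrow> b p = 0"
    and ab: "\<And>p. (a p)\<^sup>2 + (b p)\<^sup>2 \<le> 1"
  shows "ereal (set_lebesgue_integral lebesgue F (\<lambda>p. Xd da p + Yd db p)) \<le> Per F \<Omega>"
proof -
  obtain r where r: "0 < r" "(\<Union>x\<in>K. ball x r) \<subseteq> \<Omega>"
    using compact_subset_open_imp_ball_epsilon_subset[OF K(1) O K(2)] by blast
  define L where "L = {p + v | p v. p \<in> K \<and> v \<in> cball 0 (r/2)}"
  have L: "compact L" unfolding L_def by (intro compact_sums K) auto
  have LO: "L \<subseteq> \<Omega>"
  proof
    fix q assume "q \<in> L"
    then obtain p v where "p \<in> K" "q = p + v" "norm v \<le> r/2" unfolding L_def by auto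
    then have "q \<in> ball p r" using r(1) by (simp add: dist_norm)
    then show "q \<in> \<Omega>" using r(2) \<open>p \<in> K\<close> by blast
  qed
  have KL: "p \<in> L" if "q \<in> K" "norm (p - q) \<le> r/2" for p q
  proof -
    have "p = q + (p - q)" "p - q \<in> cball 0 (r/2)" using that by auto
    then show ?thesis unfolding L_def using that(1) by blast
  qed
  obtain R where R: "0 \<le> R" "\<And>p. p \<in> L \<Longrightarrow> norm p \<le> R"
    using compact_imp_bounded[OF L] unfolding bounded_iff by (meson norm_ge_zero order_trans)
  have daz: "da e p = 0" "db e p = 0" if "p \<notin> K" "e \<in> Basis" for e p
    using C1on_deriv_zero[OF a compact_imp_closed[OF K(1)] K(3) that]
      C1on_deriv_zero[OF b compact_imp_closed[OF K(1)] K(4) that] by auto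
  \<comment> \<open>The divergence contains two partial derivatives with coefficient 1 and two with
    coefficient at most \<open>R / 2\<close>. An error \<open>\<delta>\<close> in each costs at most
    \<open>2 * (1 + R) * \<delta>\<close> pointwise.\<close>
  define c where "c = 2 * (1 + R) * measure lebesgue L"
  have c: "0 \<le> c" using R(1) by (simp add: c_def)
  have main: "ereal (set_lebesgue_integral lebesgue F (\<lambda>p. Xd da p + Yd db p)) \<le> Per F \<Omega> + ereal (c * \<delta>)"
    if d: "0 < \<delta>" for \<delta>
  proof -
    have "\<exists>\<eta>>0. \<forall>p q. norm (p - q) < \<eta> \<longrightarrow> \<bar>g p - g q\<bar> < \<delta>"
      if "continuous_on UNIV g" "\<And>p. p \<notin> K \<Longrightarrow> g p = 0" for g :: "hpt \<Rightarrow> real"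
      using compact_support_uniformly_continuous[OF that(1) K(1) that(2) d] by metis
    then have "\<exists>\<eta>>0. \<forall>p q. norm (p - q) < \<eta> \<longrightarrow> \<bar>da e p - da e q\<bar> < \<delta>"
      "\<exists>\<eta>>0. \<forall>p q. norm (p - q) < \<eta> \<longrightarrow> \<bar>db e p - db e q\<bar> < \<delta>" if "e \<in> Basis" for e
      using C1on_continuous_deriv[OF a that] C1on_continuous_deriv[OF b that] daz that by blast+
    then obtain \<eta>1 \<eta>2 where e: "\<And>e. e \<in> Basis \<Longrightarrow> 0 < \<eta>1 e" "\<And>e. e \<in> Basis \<Longrightarrow> 0 < \<eta>2 e"
      "\<And>e p q. e \<in> Basis \<Longrightarrow> norm (p - q) < \<eta>1 e \<Longrightarrow> \<bar>da e p - da e q\<bar> < \<delta>"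
      "\<And>e p q. e \<in> Basis \<Longrightarrow> norm (p - q) < \<eta>2 e \<Longrightarrow> \<bar>db e p - db e q\<bar> < \<delta>" by metis
    \<comment> \<open>The bump with parameter \<open>\<eta> / 3\<close> has support of radius at
      most \<open>\<eta>\<close>. At this distance all partial derivatives oscillate by less than
      \<open>\<delta>\<close>, and the support stays in \<open>L\<close>.\<close>
    define \<eta> where "\<eta> = Min ({r/2} \<union> \<eta>1 ` Basis \<union> \<eta>2 ` Basis)"
    have \<eta>: "0 < \<eta>" unfolding \<eta>_def using e(1,2) r(1) by (subst Min_gr_iff) auto
    have \<eta>le: "\<eta> \<le> r/2" "\<And>e. e \<in> Basis \<Longrightarrow> \<eta> \<le> \<eta>1 e" "\<And>e. e \<in> Basis \<Longrightarrow> \<eta> \<le> \<eta>2 e"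
      unfolding \<eta>_def by (intro Min_le; simp)+
    define \<epsilon> where "\<epsilon> = \<eta> / 3"
    have "0 < \<epsilon>" using \<eta> by (simp add: \<epsilon>_def)
    then obtain \<rho> where rho: "bump3 \<epsilon> \<rho>" "\<And>v. 0 \<le> \<rho> v" "integral\<^sup>L lborel \<rho> = 1"
      using mollifier_exists[of \<epsilon>] by metis
    obtain d' where d': "C1on UNIV \<rho> d'" using bump3_C1[OF rho(1)] by blast
    note ac = C1on_continuous[OF a] and bc = C1on_continuous[OF b]
    have sm: "smooth3 (conv a \<rho>)" "smooth3 (conv b \<rho>)"
      using smooth3_conv[OF ac K(1,3) rho(1)] smooth3_conv[OF bc K(1,4) rho(1)] by auto
    have supp: "conv g \<rho> p = 0" if "\<And>p. p \<notin> K \<Longrightarrow> g p = 0" "p \<notin> L" for g p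
    proof -
      have "g q * \<rho> (p - q) = 0" for q
      proof (cases "q \<in> K")
        case True
        then have "\<not> norm (p - q) \<le> r / 2" using KL[of q p] that(2) by blast
        then have "3 * \<epsilon> \<le> norm (p - q)" using \<eta>le(1) by (simp add: \<epsilon>_def)
        then show ?thesis using bump3_outside[OF rho(1)] by simp
      qed (simp add: that(1))
      then have "(\<lambda>q. g q * \<rho> (p - q)) = (\<lambda>q. 0)" by blast
      then show ?thesis by (simp only: conv_def integral_zero)
    qed
    have cl: "closure {p. conv g \<rho> p \<noteq> 0} \<subseteq> L" if "\<And>p. p \<notin> K \<Longrightarrow> g p = 0" for g
      using supp[of g, OF that] by (intro closure_minimal compact_imp_closed[OF L]) blast
    have cpt: "compact (closure {p. conv g \<rho> p \<noteq> 0})" if "\<And>p. p \<notin> K \<Longrightarrow> g p = 0" for g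
    proof -
      have "closure {p. conv g \<rho> p \<noteq> 0} \<subseteq> L" using that by (rule cl)
      then show ?thesis
        using compact_Int_closed[OF L closed_closure, of "{p. conv g \<rho> p \<noteq> 0}"] by (simp add: Int_absorb1)
    qed
    have Cinf: "conv a \<rho> \<in> Cinf_c \<Omega>" "conv b \<rho> \<in> Cinf_c \<Omega>"
    proof -
      have "closure {p. conv a \<rho> p \<noteq> 0} \<subseteq> L" "closure {p. conv b \<rho> p \<noteq> 0} \<subseteq> L"
        "compact (closure {p. conv a \<rho> p \<noteq> 0})" "compact (closure {p. conv b \<rho> p \<noteq> 0})"
        by (rule cl cpt, erule K(3,4))+
      then show "conv a \<rho> \<in> Cinf_c \<Omega>" "conv b \<rho> \<in> Cinf_c \<Omega>"
        unfolding Cinf_c_def using sm LO by blast+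
    qed
    have ca: "C1on UNIV (conv a \<rho>) (\<lambda>e. conv a (d' e))" "C1on UNIV (conv b \<rho>) (\<lambda>e. conv b (d' e))"
      using conv_C1[OF ac K(1,3) d'] conv_C1[OF bc K(1,4) d'] by auto
    have Xe: "Xfield (conv a \<rho>) p = conv (da (1,0,0)) \<rho> p - fst (snd p) / 2 * conv (da (0,0,1)) \<rho> p" for p
      unfolding Xfield_eq_Xd[OF ca(1)] Xd_def
      using conv_deriv_swap[OF a K(1,3) d', of "(1,0,0)"] conv_deriv_swap[OF a K(1,3) d', of "(0,0,1)"]
      by (simp add: Basis_hpt)
    have Ye: "Yfield (conv b \<rho>) p = conv (db (0,1,0)) \<rho> p + fst p / 2 * conv (db (0,0,1)) \<rho> p" for p
      unfolding Yfield_eq_Yd[OF ca(2)] Yd_def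
      using conv_deriv_swap[OF b K(1,4) d', of "(0,1,0)"] conv_deriv_swap[OF b K(1,4) d', of "(0,0,1)"]
      by (simp add: Basis_hpt)
    have close: "\<bar>conv (da e) \<rho> p - da e p\<bar> \<le> \<delta>" "\<bar>conv (db e) \<rho> p - db e p\<bar> \<le> \<delta>" if "e \<in> Basis" for e p
    proof -
      show "\<bar>conv (da e) \<rho> p - da e p\<bar> \<le> \<delta>"
        by (rule conv_close[OF C1on_continuous_deriv[OF a that] K(1) daz(1)[OF _ that] rho])
           (use e(3)[OF that] \<eta>le(2)[OF that] in \<open>fastforce simp: \<epsilon>_def intro: less_imp_le\<close>)+
      show "\<bar>conv (db e) \<rho> p - db e p\<bar> \<le> \<delta>"
        by (rule conv_close[OF C1on_continuous_deriv[OF b that] K(1) daz(2)[OF _ that] rho])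
           (use e(4)[OF that] \<eta>le(3)[OF that] in \<open>fastforce simp: \<epsilon>_def intro: less_imp_le\<close>)+
    qed
    define g where "g p = (Xd da p + Yd db p) - (Xfield (conv a \<rho>) p + Yfield (conv b \<rho>) p)" for p
    have gz: "g p = 0" if "p \<notin> L" for p
    proof -
      have "p \<notin> K" using that KL[of p p] r(1) by auto
      moreover have "conv (da e) \<rho> p = 0" "conv (db e) \<rho> p = 0" if "e \<in> Basis" for e
        using supp daz that \<open>p \<notin> L\<close> by auto
      ultimately show ?thesis using daz by (simp add: g_def Xe Ye Xd_def Yd_def Basis_hpt)
    qed
    have gb: "\<bar>g p\<bar> \<le> 2 * (1 + R) * \<delta>" for p
    proof (cases "p \<in> L")
      case True
      obtain x y z where p: "p = (x,y,z)" by (cases p)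
      have "\<bar>x\<bar> \<le> R" "\<bar>y\<bar> \<le> R" using R(2)[OF True] norm_fst_le[of x "(y,z)"] norm_snd_le[of "(y,z)" x] norm_fst_le[of y z]
        unfolding p by auto
      define u1 u2 u3 u4 where "u1 = conv (da (1,0,0)) \<rho> p - da (1,0,0) p"
        and "u2 = conv (da (0,0,1)) \<rho> p - da (0,0,1) p"
        and "u3 = conv (db (0,1,0)) \<rho> p - db (0,1,0) p"
        and "u4 = conv (db (0,0,1)) \<rho> p - db (0,0,1) p"
      have u: "\<bar>u1\<bar> \<le> \<delta>" "\<bar>u2\<bar> \<le> \<delta>" "\<bar>u3\<bar> \<le> \<delta>" "\<bar>u4\<bar> \<le> \<delta>"
        unfolding u1_def u2_def u3_def u4_def using close by (auto simp: Basis_hpt)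
      have "g p = - u1 + y / 2 * u2 - u3 - x / 2 * u4"
        unfolding g_def Xe Ye Xd_def Yd_def u1_def u2_def u3_def u4_def p by (simp add: algebra_simps)
      moreover have "\<bar>y / 2 * u2\<bar> \<le> R / 2 * \<delta>" "\<bar>x / 2 * u4\<bar> \<le> R / 2 * \<delta>"
        unfolding abs_mult using u \<open>\<bar>x\<bar> \<le> R\<close> \<open>\<bar>y\<bar> \<le> R\<close> by (intro mult_mono; simp)+
      ultimately have "\<bar>g p\<bar> \<le> \<delta> + R / 2 * \<delta> + \<delta> + R / 2 * \<delta>" using u by linarith
      also have "\<dots> \<le> 2 * (1 + R) * \<delta>" using R(1) d by (simp add: algebra_simps)
      finally show ?thesis .
    next
      case False
      then show ?thesis using gz d R(1) by simp
    qed
    have c1: "continuous_on UNIV (\<lambda>p. Xd da p + Yd db p)"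
      by (intro continuous_intros C1on_continuous_Xd[OF a] C1on_continuous_Yd[OF b])
    have c2: "continuous_on UNIV (\<lambda>p. Xfield (conv a \<rho>) p + Yfield (conv b \<rho>) p)"
      unfolding Xfield_eq_Xd[OF ca(1)] Yfield_eq_Yd[OF ca(2)]
      by (intro continuous_intros C1on_continuous_Xd[OF ca(1)] C1on_continuous_Yd[OF ca(2)])
    have z1: "Xd da p + Yd db p = 0" if "p \<notin> L" for p
    proof -
      have "p \<notin> K" using that KL[of p p] r(1) by auto
      then show ?thesis using daz by (simp add: Xd_def Yd_def Basis_hpt)
    qed
    have z2: "Xfield (conv a \<rho>) p + Yfield (conv b \<rho>) p = 0" if "p \<notin> L" for p
      using gz[OF that] z1[OF that] by (simp add: g_def)
    have "set_lebesgue_integral lebesgue F (\<lambda>p. Xd da p + Yd db p)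
        - set_lebesgue_integral lebesgue F (\<lambda>p. Xfield (conv a \<rho>) p + Yfield (conv b \<rho>) p)
      = set_lebesgue_integral lebesgue F g"
      unfolding g_def
    proof (rule set_integral_diff(2)[symmetric])
      show "set_integrable lebesgue F (\<lambda>p. Xd da p + Yd db p)"
        by (rule set_integrable_compact_support[OF c1 L _ F]) (rule z1)
      show "set_integrable lebesgue F (\<lambda>p. Xfield (conv a \<rho>) p + Yfield (conv b \<rho>) p)"
        by (rule set_integrable_compact_support[OF c2 L _ F]) (rule z2)
    qed
    also have "\<dots> \<le> 2 * (1 + R) * \<delta> * measure lebesgue L"
    proof -
      have "continuous_on UNIV g" unfolding g_def by (rule continuous_on_diff[OF c1 c2])
      then have "\<bar>set_lebesgue_integral lebesgue F g\<bar> \<le> 2 * (1 + R) * \<delta> * measure lebesgue L"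
        by (rule measurable_compact_support_bound[OF _ L _ F]) (use gz gb R(1) d in auto)
      then show ?thesis by linarith
    qed
    also have "\<dots> = c * \<delta>" by (simp add: c_def)
    finally have "set_lebesgue_integral lebesgue F (\<lambda>p. Xd da p + Yd db p)
      \<le> set_lebesgue_integral lebesgue F (\<lambda>p. Xfield (conv a \<rho>) p + Yfield (conv b \<rho>) p) + c * \<delta>" by simp
    moreover have "ereal (set_lebesgue_integral lebesgue F (\<lambda>p. Xfield (conv a \<rho>) p + Yfield (conv b \<rho>) p)) \<le> Per F \<Omega>"
      unfolding Per_def
      using conv_sum_squares_le_1[OF ac K(1,3) bc K(4) ab rho] Cinf
      by (intro SUP_upper2[of "(conv a \<rho>, conv b \<rho>)"]) auto
    ultimately have "ereal (set_lebesgue_integral lebesgue F (\<lambda>p. Xd da p + Yd db p))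
        \<le> ereal (set_lebesgue_integral lebesgue F (\<lambda>p. Xfield (conv a \<rho>) p + Yfield (conv b \<rho>) p)) + ereal (c * \<delta>)"
      and "ereal (set_lebesgue_integral lebesgue F (\<lambda>p. Xfield (conv a \<rho>) p + Yfield (conv b \<rho>) p)) + ereal (c * \<delta>)
        \<le> Per F \<Omega> + ereal (c * \<delta>)" by (simp, intro add_right_mono)
    then show ?thesis by (rule order_trans)
  qed
  show ?thesis
  proof (rule ereal_le_epsilon2)
    fix e :: real assume e: "0 < e"
    have "c * (e / (c + 1)) \<le> e" using c e by (simp add: field_simps)
    then show "ereal (set_lebesgue_integral lebesgue F (\<lambda>p. Xd da p + Yd db p)) \<le> Per F \<Omega> + ereal e"
      using order_trans[OF main[of "e / (c + 1)"] add_left_mono] c e by simp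
  qed
qed

section \<open>Calibrations\<close>

lemma Xd_simps:
  "Xd (\<lambda>e p. da e p + db e p) p = Xd da p + Xd db p"
  "Xd (\<lambda>e p. da e p - db e p) p = Xd da p - Xd db p"
  "Xd (\<lambda>e p. da e p * b p + a p * db e p) p = Xd da p * b p + a p * Xd db p"
  "Xd (\<lambda>e p. f p * da e p) p = f p * Xd da p"
  by (simp_all add: Xd_def algebra_simps)

lemma Yd_simps:
  "Yd (\<lambda>e p. da e p + db e p) p = Yd da p + Yd db p"
  "Yd (\<lambda>e p. da e p - db e p) p = Yd da p - Yd db p"
  "Yd (\<lambda>e p. da e p * b p + a p * db e p) p = Yd da p * b p + a p * Yd db p"
  "Yd (\<lambda>e p. f p * da e p) p = f p * Yd da p"
  by (simp_all add: Yd_def algebra_simps)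

section \<open>A continuously differentiable step function\<close>

definition pos_sq :: "real \<Rightarrow> real" where "pos_sq t = (max 0 t)\<^sup>2"

lemma pos_sq_derivative: "(pos_sq has_real_derivative 2 * max 0 t) (at t)"
proof -
  consider "t > 0" | "t < 0" | "t = 0" by linarith
  then show ?thesis
  proof cases
    case 1
    have "\<forall>\<^sub>F s in nhds t. pos_sq s = s\<^sup>2"
      using eventually_nhds_in_open[of "{0<..}" t] 1 by (auto simp: pos_sq_def elim!: eventually_mono)
    then have "(pos_sq has_real_derivative 2 * t) (at t) = ((\<lambda>s. s\<^sup>2) has_real_derivative 2 * t) (at t)"
      by (intro DERIV_cong_ev) auto
    then show ?thesis using 1 by (auto intro!: derivative_eq_intros)
  next
    case 2
    have "\<forall>\<^sub>F s in nhds t. pos_sq s = 0"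
      using eventually_nhds_in_open[of "{..<0}" t] 2 by (auto simp: pos_sq_def elim!: eventually_mono)
    then have "(pos_sq has_real_derivative 0) (at t) = ((\<lambda>s. 0) has_real_derivative 0) (at t)"
      by (intro DERIV_cong_ev) auto
    then show ?thesis using 2 by auto
  next
    case 3
    have "((\<lambda>h::real. max 0 h) \<longlongrightarrow> max 0 0) (at 0)" by (intro tendsto_intros)
    then have "((\<lambda>h::real. max 0 h) \<longlongrightarrow> 0) (at 0)" by simp
    then have "((\<lambda>h. pos_sq h / h) \<longlongrightarrow> 0) (at 0)"
      by (rule Lim_transform_eventually)
         (auto simp: pos_sq_def eventually_at_filter max_def power2_eq_square intro!: always_eventually)
    then show ?thesis using 3 by (simp add: has_field_derivative_iff pos_sq_def)
  qed
qed

text \<open>On \<open>[0, 1]\<close> this is \<open>2 * t\<^sup>2\<close> up to 1/2 and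
  \<open>1 - 2 * (1 - t)\<^sup>2\<close> afterwards.\<close>

definition hstep :: "real \<Rightarrow> real" where
  "hstep t = 2 * pos_sq t - 4 * pos_sq (t - 1/2) + 2 * pos_sq (t - 1)"

definition hstep' :: "real \<Rightarrow> real" where
  "hstep' t = 4 * max 0 t - 8 * max 0 (t - 1/2) + 4 * max 0 (t - 1)"

lemma hstep_derivative: "(hstep has_real_derivative hstep' t) (at t)"
  unfolding hstep_def[abs_def] hstep'_def
  by (auto intro!: derivative_eq_intros DERIV_chain2[OF pos_sq_derivative])

lemma hstep'_continuous: "continuous_on UNIV hstep'"
  unfolding hstep'_def[abs_def] by (intro continuous_intros)

lemma hstep'_nonneg: "0 \<le> hstep' t" and hstep'_le: "hstep' t \<le> 2"
  by (auto simp: hstep'_def max_def)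

lemma hstep_0: "t \<le> 0 \<Longrightarrow> hstep t = 0" and hstep_1: "1 \<le> t \<Longrightarrow> hstep t = 1"
  by (auto simp: hstep_def pos_sq_def max_def power2_eq_square algebra_simps)

lemma hstep'_0: "t \<le> 0 \<or> 1 \<le> t \<Longrightarrow> hstep' t = 0"
  by (auto simp: hstep'_def max_def)

lemma hstep_mono: "s \<le> t \<Longrightarrow> hstep s \<le> hstep t"
  by (rule DERIV_nonneg_imp_nondecreasing) (use hstep_derivative hstep'_nonneg in blast)+

lemma hstep_bounds: "0 \<le> hstep t" "hstep t \<le> 1"
  using hstep_mono[of t "max t 1"] hstep_mono[of "min t 0" t] hstep_0[of "min t 0"] hstep_1[of "max t 1"] by auto

lemma C1on_hstep: "C1on S a da \<Longrightarrow> C1on S (\<lambda>p. hstep (a p)) (\<lambda>e p. hstep' (a p) * da e p)"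
  by (rule C1on_chain_UNIV[OF _ hstep_derivative hstep'_continuous])

text \<open>Steepening the step while its argument converges yields the indicator of the positive
  side. The limit level 0 is ambiguous, which is why level sets are later shown to be
  negligible.\<close>

lemma hstep_sequence:
  assumes "(v \<longlonglongrightarrow> w)" "w \<noteq> 0"
  shows "(\<lambda>n. hstep (real n * v n)) \<longlonglongrightarrow> (if 0 < w then 1 else 0)"
proof (cases "0 < w")
  case True
  have "filterlim (\<lambda>n. v n * real n) at_top sequentially"
    by (rule filterlim_tendsto_pos_mult_at_top[OF assms(1) True filterlim_real_sequentially])
  then have "\<forall>\<^sub>F n in sequentially. 1 \<le> v n * real n" by (simp add: filterlim_at_top)
  then have "\<forall>\<^sub>F n in sequentially. 1 = hstep (real n * v n)"
    by eventually_elim (simp add: hstep_1 mult.commute)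
  then show ?thesis using True tendsto_eventually[of "\<lambda>n. hstep (real n * v n)" 1]
    by (auto elim: eventually_mono)
next
  case False
  then have "\<forall>\<^sub>F n in sequentially. v n < 0" using order_tendstoD(2)[OF assms(1), of 0] assms(2) by auto
  then have "\<forall>\<^sub>F n in sequentially. hstep (real n * v n) = 0"
    by eventually_elim (simp add: hstep_0 mult_nonneg_nonpos)
  then show ?thesis using False by (auto intro: tendsto_eventually)
qed

text \<open>The calibrating field is the unit horizontal vector orthogonal to the direction of slope
  \<open>M\<close>; its components are \<open>fx M\<close> and \<open>fy M\<close>.\<close>

definition fx :: "real \<Rightarrow> real" where "fx m = m / sqrt (1 + m\<^sup>2)"
definition fy :: "real \<Rightarrow> real" where "fy m = - 1 / sqrt (1 + m\<^sup>2)"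
definition fx' :: "real \<Rightarrow> real" where "fx' m = 1 / ((1 + m\<^sup>2) * sqrt (1 + m\<^sup>2))"

lemma one_plus_sq_pos: "0 < 1 + (m::real)\<^sup>2"
  by (simp add: add_pos_nonneg)

lemma fx_derivative: "(fx has_real_derivative fx' m) (at m)"
proof -
  define s where "s = sqrt (1 + m\<^sup>2)"
  have s: "s > 0" "s * s = 1 + m * m" "1 + m\<^sup>2 = s * s" using one_plus_sq_pos[of m]
    by (auto simp: s_def power2_eq_square)
  have "((\<lambda>m. m / sqrt (1 + m\<^sup>2)) has_real_derivative (1 * s - m * (m / s)) / (s * s)) (at m)"
    unfolding s_def using one_plus_sq_pos[of m]
    by (auto intro!: derivative_eq_intros simp: divide_simps)
  moreover have "(1 * s - m * (m / s)) / (s * s) = fx' m"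
  proof -
    have "fx' m = 1 / ((1 + m\<^sup>2) * s)" by (simp add: fx'_def s_def)
    also have "\<dots> = 1 / (s * s * s)" by (simp only: s(3))
    also have "1 = s * s - m * m" using s(2) by simp
    finally show ?thesis using s(1) by (simp add: field_simps)
  qed
  ultimately show ?thesis by (simp add: fx_def[abs_def])
qed

text \<open>The factor \<open>m\<close> in front of \<open>fx' m\<close> makes the divergence of
  \<open>(fx M, fy M)\<close> equal to \<open>fx' M\<close> times \<open>X M + M * Y M\<close>.
  Hence it vanishes as soon as \<open>M\<close> is constant along horizontal lines of slope
  \<open>M\<close>.\<close>

lemma fy_derivative: "(fy has_real_derivative m * fx' m) (at m)"
proof -
  define s where "s = sqrt (1 + m\<^sup>2)"
  have s: "s > 0" "s * s = 1 + m * m" "1 + m\<^sup>2 = s * s" using one_plus_sq_pos[of m]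
    by (auto simp: s_def power2_eq_square)
  have "((\<lambda>m. - 1 / sqrt (1 + m\<^sup>2)) has_real_derivative (m / s) / (s * s)) (at m)"
    unfolding s_def using one_plus_sq_pos[of m]
    by (auto intro!: derivative_eq_intros simp: divide_simps)
  moreover have "(m / s) / (s * s) = m * fx' m"
  proof -
    have "fx' m = 1 / ((1 + m\<^sup>2) * s)" by (simp add: fx'_def s_def)
    also have "\<dots> = 1 / (s * s * s)" by (simp only: s(3))
    finally show ?thesis by simp
  qed
  ultimately show ?thesis by (simp add: fy_def[abs_def])
qed

lemma fx'_pos: "0 < fx' m"
  using one_plus_sq_pos[of m] by (simp add: fx'_def)

lemma fx'_continuous: "continuous_on UNIV fx'"
  unfolding fx'_def[abs_def] using one_plus_sq_pos
  by (intro continuous_intros) (auto simp: less_imp_neq[symmetric])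

lemma fx_fy_norm: "(fx m)\<^sup>2 + (fy m)\<^sup>2 = 1"
  using one_plus_sq_pos[of m] by (simp add: fx_def fy_def power_divide add_divide_distrib[symmetric] add.commute)

lemma abs_le_1_of_sum_squares: "a\<^sup>2 + b\<^sup>2 \<le> (1::real) \<Longrightarrow> \<bar>a\<bar> \<le> 1 \<and> \<bar>b\<bar> \<le> 1"
proof -
  assume "a\<^sup>2 + b\<^sup>2 \<le> 1"
  then have "a\<^sup>2 \<le> 1" "b\<^sup>2 \<le> 1" using zero_le_power2[of a] zero_le_power2[of b] by linarith+
  then show ?thesis by (simp add: abs_square_le_1)
qed

lemma fx_abs_le: "\<bar>fx m\<bar> \<le> 1" and fy_abs_le: "\<bar>fy m\<bar> \<le> 1"
  using abs_le_1_of_sum_squares[of "fx m" "fy m"] fx_fy_norm[of m] by simp_all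

lemma fx_continuous: "continuous_on UNIV fx" and fy_continuous: "continuous_on UNIV fy"
  by (rule DERIV_continuous_on, rule has_field_derivative_at_within, rule fx_derivative fy_derivative)+

lemma calibration_flux: "m * fx m - fy m = sqrt (1 + m\<^sup>2)"
proof -
  have "sqrt (1 + m\<^sup>2) > 0" "sqrt (1 + m\<^sup>2) * sqrt (1 + m\<^sup>2) = 1 + m * m"
    using one_plus_sq_pos[of m] by (auto simp: power2_eq_square)
  then show ?thesis by (simp add: fx_def fy_def field_simps)
qed

text \<open>Cauchy-Schwarz for \<open>(m, -1)\<close> and \<open>(a, b)\<close>; the calibrating
  vector attains the bound \<open>sqrt (1 + m\<^sup>2)\<close>.\<close>

lemma flux_le:
  assumes "a\<^sup>2 + b\<^sup>2 \<le> (1::real)" shows "m * a - b \<le> m * fx m - fy m"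
proof -
  have "(m * a - b)\<^sup>2 \<le> (1 + m\<^sup>2) * (a\<^sup>2 + b\<^sup>2)"
    using zero_le_power2[of "m * b + a"] by (simp add: power2_eq_square algebra_simps)
  also have "\<dots> \<le> (1 + m\<^sup>2) * 1" using assms one_plus_sq_pos[of m] by (intro mult_left_mono) auto
  finally show ?thesis unfolding calibration_flux by (simp add: real_le_rsqrt)
qed

text \<open>For divergence-free \<open>(fx M, fy M)\<close> this is the divergence of
  \<open>\<kappa> ((fx M, fy M) - (a, b))\<close>.\<close>

definition calib where
  "calib \<kappa> d\<kappa> M a da b db p = Xd d\<kappa> p * (fx (M p) - a p) + Yd d\<kappa> p * (fy (M p) - b p)
     - \<kappa> p * (Xd da p + Yd db p)"

lemma continuous_on_extend_zero:
  fixes g :: "'a::t2_space \<Rightarrow> real"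
  assumes "continuous_on S g" "open S" "compact K" "K \<subseteq> S" "\<And>p. p \<notin> K \<Longrightarrow> g p = 0"
  shows "continuous_on UNIV g"
proof -
  have "continuous_on (- K) g"
    by (rule continuous_on_eq[OF continuous_on_const[where c=0]]) (simp add: assms(5))
  then have "continuous_on (S \<union> - K) g"
    using assms by (intro continuous_on_open_Un) (auto intro: compact_imp_closed)
  moreover have "S \<union> - K = UNIV" using assms by auto
  ultimately show ?thesis by simp
qed

lemma C1on_cutoff_deriv_zero:
  assumes "C1on UNIV \<kappa> d\<kappa>" "compact K" "\<And>p. p \<notin> K \<Longrightarrow> \<kappa> p = 0" "p \<notin> K"
  shows "Xd d\<kappa> p = 0" "Yd d\<kappa> p = 0"
  using C1on_deriv_zero[OF assms(1) compact_imp_closed[OF assms(2)] assms(3,4)]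
  by (auto simp: Xd_def Yd_def Basis_hpt)

lemma calib_zero:
  assumes "C1on UNIV \<kappa> d\<kappa>" "compact K" "\<And>p. p \<notin> K \<Longrightarrow> \<kappa> p = 0" "p \<notin> K"
  shows "calib \<kappa> d\<kappa> M a da b db p = 0"
  using C1on_cutoff_deriv_zero[OF assms] assms(3,4) by (simp add: calib_def)

lemma calib_continuous:
  assumes "open S" "compact K" "K \<subseteq> S" "C1on UNIV \<kappa> d\<kappa>" "\<And>p. p \<notin> K \<Longrightarrow> \<kappa> p = 0"
    and M: "continuous_on S M" and a: "C1on UNIV a da" and b: "C1on UNIV b db"
  shows "continuous_on UNIV (calib \<kappa> d\<kappa> M a da b db)"
proof (rule continuous_on_extend_zero[OF _ assms(1-3)])
  note sub = continuous_on_subset[OF _ subset_UNIV]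
  have "continuous_on S (\<lambda>p. fx (M p))" "continuous_on S (\<lambda>p. fy (M p))"
    by (rule continuous_on_compose2[OF fx_continuous M], simp)
       (rule continuous_on_compose2[OF fy_continuous M], simp)
  then show "continuous_on S (calib \<kappa> d\<kappa> M a da b db)"
    unfolding calib_def[abs_def]
    by (intro continuous_intros sub[OF C1on_continuous[OF a]] sub[OF C1on_continuous[OF b]]
        sub[OF C1on_continuous[OF assms(4)]] sub[OF C1on_continuous_Xd[OF a]] sub[OF C1on_continuous_Yd[OF b]]
        sub[OF C1on_continuous_Xd[OF assms(4)]] sub[OF C1on_continuous_Yd[OF assms(4)]])
qed (rule calib_zero[OF assms(4,2,5)])

text \<open>Since \<open>\<theta>\<close> is constant along the lines, its horizontal gradient is
  \<open>Yd d\<theta>\<close> times \<open>(- M, 1)\<close>. Paired with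
  \<open>(fx M - a, fy M - b)\<close> it gives a nonpositive number, by \<open>flux_le\<close>. The
  divergence of \<open>\<theta> * \<kappa>\<close> times that field integrates to zero, and
  subtracting it leaves the claim. With \<open>\<theta>\<close> a smoothed indicator, this says that
  no admissible field has a larger flux through the boundary of the set than the calibrating
  one.\<close>

lemma calibration_inequality:
  assumes S: "open S" "compact K" "K \<subseteq> S"
    and th: "C1on S \<theta> d\<theta>" and M: "C1on S M dM"
    and chi: "C1on UNIV \<kappa> d\<kappa>" "\<And>p. p \<notin> K \<Longrightarrow> \<kappa> p = 0" "\<And>p. 0 \<le> \<kappa> p"
    and a: "C1on UNIV a da" and b: "C1on UNIV b db" and ab: "\<And>p. (a p)\<^sup>2 + (b p)\<^sup>2 \<le> 1"
    and VM: "\<And>p. p \<in> S \<Longrightarrow> Xd dM p + M p * Yd dM p = 0"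
    and Vth: "\<And>p. p \<in> S \<Longrightarrow> Xd d\<theta> p + M p * Yd d\<theta> p = 0"
    and Yth: "\<And>p. p \<in> S \<Longrightarrow> 0 \<le> Yd d\<theta> p"
  shows "0 \<le> integral\<^sup>L lborel (\<lambda>p. \<theta> p * calib \<kappa> d\<kappa> M a da b db p)"
proof -
  have z: "calib \<kappa> d\<kappa> M a da b db p = 0" if "p \<notin> K" for M a da b db p
    by (rule calib_zero[OF chi(1) S(2) _ that]) (rule chi(2))
  note sub = C1on_subset[OF _ subset_UNIV]
  have f: "C1on S (\<lambda>p. fx (M p)) (\<lambda>e p. fx' (M p) * dM e p)"
    by (rule C1on_chain_UNIV[OF M fx_derivative fx'_continuous])
  have g: "C1on S (\<lambda>p. fy (M p)) (\<lambda>e p. M p * fx' (M p) * dM e p)"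
    by (rule C1on_chain_UNIV[OF M fy_derivative]) (intro continuous_intros fx'_continuous)
  note P0 = C1on_mult[OF C1on_mult[OF th sub[OF chi(1)]] C1on_diff[OF f sub[OF a]]]
  note Q0 = C1on_mult[OF C1on_mult[OF th sub[OF chi(1)]] C1on_diff[OF g sub[OF b]]]
  define dP where "dP = (\<lambda>e p. (d\<theta> e p * \<kappa> p + \<theta> p * d\<kappa> e p) * (fx (M p) - a p) + \<theta> p * \<kappa> p * (fx' (M p) * dM e p - da e p))"
  define dQ where "dQ = (\<lambda>e p. (d\<theta> e p * \<kappa> p + \<theta> p * d\<kappa> e p) * (fy (M p) - b p) + \<theta> p * \<kappa> p * (M p * fx' (M p) * dM e p - db e p))"
  have P: "C1on UNIV (\<lambda>p. \<theta> p * \<kappa> p * (fx (M p) - a p)) (\<lambda>e p. if p \<in> K then dP e p else 0)"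
    unfolding dP_def by (rule C1on_extend_zero[OF P0 S(1) compact_imp_closed[OF S(2)] S(3)]) (simp add: chi(2))
  have Q: "C1on UNIV (\<lambda>p. \<theta> p * \<kappa> p * (fy (M p) - b p)) (\<lambda>e p. if p \<in> K then dQ e p else 0)"
    unfolding dQ_def by (rule C1on_extend_zero[OF Q0 S(1) compact_imp_closed[OF S(2)] S(3)]) (simp add: chi(2))
  define dvg where "dvg p = Xd (\<lambda>e p. if p \<in> K then dP e p else 0) p + Yd (\<lambda>e p. if p \<in> K then dQ e p else 0) p" for p
  have Xz: "Xd (\<lambda>e p. if p \<in> K then dP e p else 0) p = (if p \<in> K then Xd dP p else 0)" for p by (simp add: Xd_def)
  have Yz: "Yd (\<lambda>e p. if p \<in> K then dQ e p else 0) p = (if p \<in> K then Yd dQ p else 0)" for p by (simp add: Yd_def)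
  have Xi: "integrable lborel (Xd (\<lambda>e p. if p \<in> K then dP e p else 0))"
    by (rule integrable_compact_support[OF C1on_continuous_Xd[OF P] S(2)]) (simp add: Xz)
  have Yi: "integrable lborel (Yd (\<lambda>e p. if p \<in> K then dQ e p else 0))"
    by (rule integrable_compact_support[OF C1on_continuous_Yd[OF Q] S(2)]) (simp add: Yz)
  have div0: "integral\<^sup>L lborel dvg = 0"
    unfolding dvg_def using Xi Yi integral_Xd_zero[OF P S(2)] integral_Yd_zero[OF Q S(2)] chi(2) by simp
  have divi: "integrable lborel dvg" unfolding dvg_def using Xi Yi by simp
  let ?calib = "calib \<kappa> d\<kappa> M a da b db"
  have eq: "\<theta> p * ?calib p - dvg p = (if p \<in> K then Yd d\<theta> p * \<kappa> p * ((M p * fx (M p) - fy (M p)) - (M p * a p - b p)) else 0)" for p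
  proof (cases "p \<in> K")
    case True
    then have pS: "p \<in> S" using S by auto
    have "Xd dP p = (Xd d\<theta> p * \<kappa> p + \<theta> p * Xd d\<kappa> p) * (fx (M p) - a p) + \<theta> p * \<kappa> p * (fx' (M p) * Xd dM p - Xd da p)"
      unfolding dP_def by (simp add: Xd_def field_simps)
    moreover have "Yd dQ p = (Yd d\<theta> p * \<kappa> p + \<theta> p * Yd d\<kappa> p) * (fy (M p) - b p) + \<theta> p * \<kappa> p * (M p * fx' (M p) * Yd dM p - Yd db p)"
      unfolding dQ_def by (simp add: Yd_def field_simps)
    moreover have "Xd dM p = - (M p * Yd dM p)" "Xd d\<theta> p = - (M p * Yd d\<theta> p)"
      using VM[OF pS] Vth[OF pS] by auto
    ultimately show ?thesis using True unfolding dvg_def Xz Yz calib_def by (simp add: algebra_simps)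
  next
    case False
    then show ?thesis using calib_zero[OF chi(1) S(2) chi(2)] by (simp add: dvg_def Xz Yz)
  qed
  have pc: "continuous_on UNIV ?calib"
    by (rule calib_continuous[OF S chi(1,2) C1on_continuous[OF M] a b])
  have "continuous_on UNIV (\<lambda>p. \<theta> p * ?calib p)"
    by (rule continuous_on_extend_zero[OF _ S])
       (use z in \<open>auto intro!: continuous_intros C1on_continuous[OF th] continuous_on_subset[OF pc]\<close>)
  then have i: "integrable lborel (\<lambda>p. \<theta> p * ?calib p)"
    by (rule integrable_compact_support[OF _ S(2)]) (use z in auto)
  have "0 \<le> integral\<^sup>L lborel (\<lambda>p. \<theta> p * ?calib p - dvg p)"
    unfolding eq using Yth chi(3) flux_le[OF ab] S(3)
    by (intro Bochner_Integration.integral_nonneg) (auto intro!: mult_nonneg_nonneg)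
  also have "\<dots> = integral\<^sup>L lborel (\<lambda>p. \<theta> p * ?calib p)" using i divi div0 by simp
  finally show ?thesis .
qed

lemma calib_bound:
  assumes "\<bar>a p\<bar> \<le> 1" "\<bar>b p\<bar> \<le> 1"
  shows "\<bar>calib \<kappa> d\<kappa> M a da b db p\<bar> \<le> 2 * \<bar>Xd d\<kappa> p\<bar> + 2 * \<bar>Yd d\<kappa> p\<bar> + \<bar>\<kappa> p * (Xd da p + Yd db p)\<bar>"
proof -
  have "\<bar>fx (M p) - a p\<bar> \<le> 2" "\<bar>fy (M p) - b p\<bar> \<le> 2"
    using assms fx_abs_le[of "M p"] fy_abs_le[of "M p"] by auto
  then have "\<bar>Xd d\<kappa> p * (fx (M p) - a p)\<bar> \<le> \<bar>Xd d\<kappa> p\<bar> * 2" "\<bar>Yd d\<kappa> p * (fy (M p) - b p)\<bar> \<le> \<bar>Yd d\<kappa> p\<bar> * 2"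
    unfolding abs_mult by (intro mult_left_mono; simp)+
  then show ?thesis unfolding calib_def by linarith
qed

lemma calib_dominated:
  assumes chi: "C1on UNIV \<kappa> d\<kappa>" "compact K" "\<And>p. p \<notin> K \<Longrightarrow> \<kappa> p = 0"
    and a: "C1on UNIV a da" and b: "C1on UNIV b db" and ab: "\<And>p. (a p)\<^sup>2 + (b p)\<^sup>2 \<le> 1"
  obtains C where "0 \<le> C" "\<And>M p. \<bar>calib \<kappa> d\<kappa> M a da b db p\<bar> \<le> C * indicator K p"
proof -
  define g where "g p = 2 * \<bar>Xd d\<kappa> p\<bar> + 2 * \<bar>Yd d\<kappa> p\<bar> + \<bar>\<kappa> p * (Xd da p + Yd db p)\<bar>" for p
  have "continuous_on UNIV g" unfolding g_def
    by (intro continuous_intros C1on_continuous_Xd[OF a] C1on_continuous_Yd[OF b] C1on_continuous[OF chi(1)]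
        C1on_continuous_Xd[OF chi(1)] C1on_continuous_Yd[OF chi(1)])
  moreover have "g p = 0" if "p \<notin> K" for p
    using C1on_cutoff_deriv_zero[OF chi that] chi(3) that by (simp add: g_def)
  ultimately obtain C where C: "0 \<le> C" "\<And>p. \<bar>g p\<bar> \<le> C"
    using compact_support_bounded[OF _ chi(2)] by metis
  have "\<bar>calib \<kappa> d\<kappa> M a da b db p\<bar> \<le> C * indicator K p" for M p
  proof (cases "p \<in> K")
    case True
    have "\<bar>calib \<kappa> d\<kappa> M a da b db p\<bar> \<le> g p"
      unfolding g_def by (rule calib_bound) (use abs_le_1_of_sum_squares[OF ab[of p]] in auto)
    then show ?thesis using C(2)[of p] True by simp
  next
    case False
    then show ?thesis using calib_zero[OF chi] by simp
  qed
  then show thesis using that C(1) by blast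
qed

lemma calib_tendsto:
  assumes chi: "C1on UNIV \<kappa> d\<kappa>" "compact K" "\<And>p. p \<notin> K \<Longrightarrow> \<kappa> p = 0" and "K \<subseteq> S"
    and "\<And>p. p \<in> S \<Longrightarrow> (\<lambda>n. Ms n p) \<longlonglongrightarrow> M p"
  shows "(\<lambda>n. calib \<kappa> d\<kappa> (Ms n) a da b db p) \<longlonglongrightarrow> calib \<kappa> d\<kappa> M a da b db p"
proof (cases "p \<in> K")
  case True
  then have "(\<lambda>n. Ms n p) \<longlonglongrightarrow> M p" using assms(4,5) by (meson subsetD)
  then have "(\<lambda>n. fx (Ms n p)) \<longlonglongrightarrow> fx (M p)" "(\<lambda>n. fy (Ms n p)) \<longlonglongrightarrow> fy (M p)"
    using fx_continuous fy_continuous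
    by (auto intro!: isCont_tendsto_compose[of _ fx] isCont_tendsto_compose[of _ fy] simp: continuous_on_eq_continuous_at)
  then show ?thesis unfolding calib_def by (intro tendsto_intros)
qed (simp add: calib_zero[OF chi])

text \<open>The expression \<open>calib\<close> contains no derivative of \<open>M\<close>, and its
  bound does not depend on \<open>M\<close>. So pointwise convergence of the slopes and dominated
  convergence suffice, even if the limit slope is not differentiable.\<close>

lemma calibrated_limit:
  assumes S: "open S" "compact K" "K \<subseteq> S"
    and chi: "C1on UNIV \<kappa> d\<kappa>" "\<And>p. p \<notin> K \<Longrightarrow> \<kappa> p = 0" "\<And>p. 0 \<le> \<kappa> p"
    and a: "C1on UNIV a da" and b: "C1on UNIV b db" and ab: "\<And>p. (a p)\<^sup>2 + (b p)\<^sup>2 \<le> 1"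
    and th: "\<And>n. C1on S (\<theta> n) (d\<theta> n)" and Ms: "\<And>n. C1on S (Ms n) (dM n)"
    and VM: "\<And>n p. p \<in> S \<Longrightarrow> Xd (dM n) p + Ms n p * Yd (dM n) p = 0"
    and Vth: "\<And>n p. p \<in> S \<Longrightarrow> Xd (d\<theta> n) p + Ms n p * Yd (d\<theta> n) p = 0"
    and Yth: "\<And>n p. p \<in> S \<Longrightarrow> 0 \<le> Yd (d\<theta> n) p"
    and th01: "\<And>n p. p \<in> S \<Longrightarrow> \<bar>\<theta> n p\<bar> \<le> 1"
    and Mlim: "\<And>p. p \<in> S \<Longrightarrow> (\<lambda>n. Ms n p) \<longlonglongrightarrow> M p"
    and F: "F \<in> sets lebesgue" and N: "negligible N"
    and thlim: "\<And>p. p \<in> S \<Longrightarrow> p \<notin> N \<Longrightarrow> (\<lambda>n. \<theta> n p) \<longlonglongrightarrow> indicator F p"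
  shows "0 \<le> set_lebesgue_integral lebesgue F (calib \<kappa> d\<kappa> M a da b db)"
proof -
  obtain C where C: "0 \<le> C" "\<And>M p. \<bar>calib \<kappa> d\<kappa> M a da b db p\<bar> \<le> C * indicator K p"
    using calib_dominated[OF chi(1) S(2) chi(2) a b ab] by metis
  have z: "calib \<kappa> d\<kappa> M a da b db p = 0" if "p \<notin> K" for M a da b db p
    by (rule calib_zero[OF chi(1) S(2) _ that]) (rule chi(2))
  have pc: "continuous_on UNIV (calib \<kappa> d\<kappa> (Ms n) a da b db)" for n
    by (rule calib_continuous[OF S chi(1,2) C1on_continuous[OF Ms] a b])
  have tpc: "continuous_on UNIV (\<lambda>p. \<theta> n p * calib \<kappa> d\<kappa> (Ms n) a da b db p)" for n
    by (rule continuous_on_extend_zero[OF _ S])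
       (use z in \<open>auto intro!: continuous_intros C1on_continuous[OF th] continuous_on_subset[OF pc]\<close>)
  have plim: "(\<lambda>n. calib \<kappa> d\<kappa> (Ms n) a da b db p) \<longlonglongrightarrow> calib \<kappa> d\<kappa> M a da b db p" for p
    by (rule calib_tendsto[OF chi(1) S(2) chi(2) S(3) Mlim])
  have pm: "calib \<kappa> d\<kappa> M a da b db \<in> borel_measurable lebesgue"
    by (rule borel_measurable_LIMSEQ_real[OF plim])
       (intro measurable_completion borel_measurable_continuous_onI[OF pc, unfolded measurable_lborel2[symmetric]])
  have tpm: "(\<lambda>p. \<theta> n p * calib \<kappa> d\<kappa> (Ms n) a da b db p) \<in> borel_measurable lborel" for n
    using borel_measurable_continuous_onI[OF tpc] by simp
  have "(\<lambda>n. integral\<^sup>L lebesgue (\<lambda>p. \<theta> n p * calib \<kappa> d\<kappa> (Ms n) a da b db p)) \<longlonglongrightarrow>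
      integral\<^sup>L lebesgue (\<lambda>p. indicator F p * calib \<kappa> d\<kappa> M a da b db p)"
  proof (rule integral_dominated_convergence[where w="\<lambda>p. C * indicator K p"])
    show "(\<lambda>p. indicator F p * calib \<kappa> d\<kappa> M a da b db p) \<in> borel_measurable lebesgue"
      using F pm by measurable
    show "(\<lambda>p. \<theta> n p * calib \<kappa> d\<kappa> (Ms n) a da b db p) \<in> borel_measurable lebesgue" for n
      by (rule measurable_completion[OF tpm])
    show "integrable lebesgue (\<lambda>p. C * indicator K p)"
      using lmeasurable_compact[OF S(2)]
      by (intro integrable_mult_right integrable_real_indicator) (auto simp: fmeasurable_def)
    show "AE p in lebesgue. (\<lambda>n. \<theta> n p * calib \<kappa> d\<kappa> (Ms n) a da b db p) \<longlonglongrightarrow> indicator F p * calib \<kappa> d\<kappa> M a da b db p"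
    proof (rule AE_I'[of N])
      show "N \<in> null_sets lebesgue" using N by (simp add: negligible_iff_null_sets)
      show "{p \<in> space lebesgue. \<not> (\<lambda>n. \<theta> n p * calib \<kappa> d\<kappa> (Ms n) a da b db p) \<longlonglongrightarrow> indicator F p * calib \<kappa> d\<kappa> M a da b db p} \<subseteq> N"
      proof clarify
        fix x y w assume h: "\<not> (\<lambda>n. \<theta> n (x,y,w) * calib \<kappa> d\<kappa> (Ms n) a da b db (x,y,w)) \<longlonglongrightarrow> indicator F (x,y,w) * calib \<kappa> d\<kappa> M a da b db (x,y,w)"
        show "(x,y,w) \<in> N"
        proof (rule ccontr)
          assume "(x,y,w) \<notin> N"
          then have "(\<lambda>n. \<theta> n (x,y,w) * calib \<kappa> d\<kappa> (Ms n) a da b db (x,y,w)) \<longlonglongrightarrow> indicator F (x,y,w) * calib \<kappa> d\<kappa> M a da b db (x,y,w)"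
          proof (cases "(x,y,w) \<in> S")
            case True
            show ?thesis by (rule tendsto_mult[OF thlim plim]) fact+
          next
            case False
            then have "(x,y,w) \<notin> K" using S(3) by blast
            then show ?thesis by (simp add: z)
          qed
          then show False using h by blast
        qed
      qed
    qed
    show "AE p in lebesgue. norm (\<theta> n p * calib \<kappa> d\<kappa> (Ms n) a da b db p) \<le> C * indicator K p" for n
    proof (intro AE_I2)
      fix p
      show "norm (\<theta> n p * calib \<kappa> d\<kappa> (Ms n) a da b db p) \<le> C * indicator K p"
      proof (cases "p \<in> K")
        case True
        then have "\<bar>\<theta> n p\<bar> * \<bar>calib \<kappa> d\<kappa> (Ms n) a da b db p\<bar> \<le> 1 * \<bar>calib \<kappa> d\<kappa> (Ms n) a da b db p\<bar>"
          using th01[of p] S(3) by (intro mult_right_mono abs_ge_zero) blast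
        then show ?thesis using C(2)[of "Ms n" p] by (simp add: abs_mult)
      qed (simp add: z)
    qed
  qed
  moreover have "0 \<le> integral\<^sup>L lebesgue (\<lambda>p. \<theta> n p * calib \<kappa> d\<kappa> (Ms n) a da b db p)" for n
    unfolding integral_completion[OF tpm]
    by (rule calibration_inequality[OF S th Ms chi a b ab VM Vth Yth])
  ultimately have "0 \<le> integral\<^sup>L lebesgue (\<lambda>p. indicator F p * calib \<kappa> d\<kappa> M a da b db p)"
    by (intro LIMSEQ_le_const) auto
  then show ?thesis by (simp add: set_lebesgue_integral_def)
qed

text \<open>The test field is \<open>(a, b) + \<kappa> * ((fx M, fy M) - (a, b))\<close>, a convex
  combination of admissible fields, with a smooth approximation in place of \<open>M\<close>. Its
  divergence is that of \<open>(a, b)\<close> plus \<open>calib\<close>, and dominated convergence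
  passes to the limit.\<close>

lemma Per_ge_limit:
  assumes S: "open S" "compact K" "K \<subseteq> S" and O: "open \<Omega>" "K \<subseteq> \<Omega>"
    and chi: "C1on UNIV \<kappa> d\<kappa>" "\<And>p. p \<notin> K \<Longrightarrow> \<kappa> p = 0" "\<And>p. 0 \<le> \<kappa> p" "\<And>p. \<kappa> p \<le> 1"
    and a: "C1on UNIV a da" and b: "C1on UNIV b db" and ab: "\<And>p. (a p)\<^sup>2 + (b p)\<^sup>2 \<le> 1"
    and L: "compact L" "L \<subseteq> \<Omega>" "\<And>p. p \<notin> L \<Longrightarrow> a p = 0" "\<And>p. p \<notin> L \<Longrightarrow> b p = 0"
    and Ms: "\<And>n. C1on S (Ms n) (dM n)"
    and VM: "\<And>n p. p \<in> S \<Longrightarrow> Xd (dM n) p + Ms n p * Yd (dM n) p = 0"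
    and Mlim: "\<And>p. p \<in> S \<Longrightarrow> (\<lambda>n. Ms n p) \<longlonglongrightarrow> M p"
    and F: "F \<in> sets lebesgue"
  shows "ereal (set_lebesgue_integral lebesgue F (\<lambda>p. Xd da p + Yd db p + calib \<kappa> d\<kappa> M a da b db p)) \<le> Per F \<Omega>"
proof -
  obtain C where C: "0 \<le> C" "\<And>M p. \<bar>calib \<kappa> d\<kappa> M a da b db p\<bar> \<le> C * indicator K p"
    using calib_dominated[OF chi(1) S(2) chi(2) a b ab] by metis
  have z: "calib \<kappa> d\<kappa> M a da b db p = 0" if "p \<notin> K" for M a da b db p
    by (rule calib_zero[OF chi(1) S(2) _ that]) (rule chi(2))
  note sub = C1on_subset[OF _ subset_UNIV]
  have abz: "Xd da p = 0" "Yd db p = 0" if "p \<notin> L" for p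
    using C1on_cutoff_deriv_zero[OF a L(1,3) that] C1on_cutoff_deriv_zero[OF b L(1,4) that] by auto
  have pc: "continuous_on UNIV (calib \<kappa> d\<kappa> (Ms n) a da b db)" for n
    by (rule calib_continuous[OF S chi(1,2) C1on_continuous[OF Ms] a b])
  have plim: "(\<lambda>n. calib \<kappa> d\<kappa> (Ms n) a da b db p) \<longlonglongrightarrow> calib \<kappa> d\<kappa> M a da b db p" for p
    by (rule calib_tendsto[OF chi(1) S(2) chi(2) S(3) Mlim])
  have pm: "calib \<kappa> d\<kappa> M a da b db \<in> borel_measurable lebesgue"
    by (rule borel_measurable_LIMSEQ_real[OF plim])
       (intro measurable_completion borel_measurable_continuous_onI[OF pc, unfolded measurable_lborel2[symmetric]])
  have dc: "continuous_on UNIV (\<lambda>p. Xd da p + Yd db p)"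
    by (intro continuous_intros C1on_continuous_Xd[OF a] C1on_continuous_Yd[OF b])
  obtain B where B: "0 \<le> B" "\<And>p. \<bar>Xd da p + Yd db p\<bar> \<le> B"
    using compact_support_bounded[OF dc L(1)] abz by (metis add_0)
  have step: "ereal (set_lebesgue_integral lebesgue F (\<lambda>p. Xd da p + Yd db p + calib \<kappa> d\<kappa> (Ms n) a da b db p)) \<le> Per F \<Omega>" for n
  proof -
    have f: "C1on S (\<lambda>p. fx (Ms n p)) (\<lambda>e p. fx' (Ms n p) * dM n e p)"
      by (rule C1on_chain_UNIV[OF Ms fx_derivative fx'_continuous])
    have g: "C1on S (\<lambda>p. fy (Ms n p)) (\<lambda>e p. Ms n p * fx' (Ms n p) * dM n e p)"
      by (rule C1on_chain_UNIV[OF Ms fy_derivative]) (intro continuous_intros fx'_continuous)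
    note P0 = C1on_mult[OF sub[OF chi(1)] C1on_diff[OF f sub[OF a]]]
    note Q0 = C1on_mult[OF sub[OF chi(1)] C1on_diff[OF g sub[OF b]]]
    define dP where "dP = (\<lambda>e p. d\<kappa> e p * (fx (Ms n p) - a p) + \<kappa> p * (fx' (Ms n p) * dM n e p - da e p))"
    define dQ where "dQ = (\<lambda>e p. d\<kappa> e p * (fy (Ms n p) - b p) + \<kappa> p * (Ms n p * fx' (Ms n p) * dM n e p - db e p))"
    have P: "C1on UNIV (\<lambda>p. \<kappa> p * (fx (Ms n p) - a p)) (\<lambda>e p. if p \<in> K then dP e p else 0)"
      unfolding dP_def by (rule C1on_extend_zero[OF P0 S(1) compact_imp_closed[OF S(2)] S(3)]) (simp add: chi(2))
    have Q: "C1on UNIV (\<lambda>p. \<kappa> p * (fy (Ms n p) - b p)) (\<lambda>e p. if p \<in> K then dQ e p else 0)"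
      unfolding dQ_def by (rule C1on_extend_zero[OF Q0 S(1) compact_imp_closed[OF S(2)] S(3)]) (simp add: chi(2))
    have dvg: "Xd (\<lambda>e p. da e p + (if p \<in> K then dP e p else 0)) p + Yd (\<lambda>e p. db e p + (if p \<in> K then dQ e p else 0)) p
        = Xd da p + Yd db p + calib \<kappa> d\<kappa> (Ms n) a da b db p" for p
    proof (cases "p \<in> K")
      case True
      then have pS: "p \<in> S" using S by auto
      have 1: "Xd (\<lambda>e p. da e p + (if p \<in> K then dP e p else 0)) p = Xd da p + Xd d\<kappa> p * (fx (Ms n p) - a p)
          + \<kappa> p * (fx' (Ms n p) * Xd (dM n) p - Xd da p)"
        using True unfolding dP_def by (simp add: Xd_def field_simps)
      have 2: "Yd (\<lambda>e p. db e p + (if p \<in> K then dQ e p else 0)) p = Yd db p + Yd d\<kappa> p * (fy (Ms n p) - b p)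
          + \<kappa> p * (Ms n p * fx' (Ms n p) * Yd (dM n) p - Yd db p)"
        using True unfolding dQ_def by (simp add: Yd_def field_simps)
      have 3: "Xd (dM n) p = - (Ms n p * Yd (dM n) p)" using VM[OF pS, of n] by auto
      show ?thesis unfolding 1 2 3 calib_def by (simp add: algebra_simps)
    next
      case False
      then show ?thesis using z[OF False] by (simp add: Xd_def Yd_def)
    qed
    have sq: "(a p + \<kappa> p * (fx (Ms n p) - a p))\<^sup>2 + (b p + \<kappa> p * (fy (Ms n p) - b p))\<^sup>2 \<le> 1" for p
    proof -
      define t u v w s where "t = \<kappa> p" and "u = fx (Ms n p)" and "v = fy (Ms n p)" and "w = a p" and "s = b p"
      have t: "0 \<le> t" "t \<le> 1" and uv: "u\<^sup>2 + v\<^sup>2 = 1" and ws: "w\<^sup>2 + s\<^sup>2 \<le> 1"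
        using chi ab[of p] fx_fy_norm by (auto simp: t_def u_def v_def w_def s_def)
      \<comment> \<open>Convexity of the squared norm, with its exact defect as the last
        term.\<close>
      have "(w + t * (u - w))\<^sup>2 + (s + t * (v - s))\<^sup>2
          = (1 - t) * (w\<^sup>2 + s\<^sup>2) + t * (u\<^sup>2 + v\<^sup>2) - t * (1 - t) * ((u - w)\<^sup>2 + (v - s)\<^sup>2)"
        by (simp add: power2_eq_square algebra_simps)
      also have "\<dots> \<le> (1 - t) * 1 + t * 1 - 0"
        using t uv ws by (intro diff_mono add_mono mult_left_mono mult_nonneg_nonneg) auto
      finally show ?thesis by (simp add: t_def u_def v_def w_def s_def)
    qed
    have "ereal (set_lebesgue_integral lebesgue F (\<lambda>p. Xd (\<lambda>e p. da e p + (if p \<in> K then dP e p else 0)) p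
        + Yd (\<lambda>e p. db e p + (if p \<in> K then dQ e p else 0)) p)) \<le> Per F \<Omega>"
      by (rule Per_ge_integral_C1[OF F O(1) C1on_add[OF a P] C1on_add[OF b Q], of "K \<union> L"])
         (use S(2) L O(2) chi(2) sq in auto)
    then show ?thesis unfolding dvg .
  qed
  have "(\<lambda>n. integral\<^sup>L lebesgue (\<lambda>p. indicator F p *\<^sub>R (Xd da p + Yd db p + calib \<kappa> d\<kappa> (Ms n) a da b db p))) \<longlonglongrightarrow>
      integral\<^sup>L lebesgue (\<lambda>p. indicator F p *\<^sub>R (Xd da p + Yd db p + calib \<kappa> d\<kappa> M a da b db p))"
  proof (rule integral_dominated_convergence[where w="\<lambda>p. B * indicator L p + C * indicator K p"])
    have dm: "(\<lambda>p. Xd da p + Yd db p) \<in> borel_measurable lebesgue"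
      by (intro measurable_completion borel_measurable_continuous_onI[OF dc, unfolded measurable_lborel2[symmetric]])
    show "(\<lambda>p. indicator F p *\<^sub>R (Xd da p + Yd db p + calib \<kappa> d\<kappa> M a da b db p)) \<in> borel_measurable lebesgue"
      using F pm dm by measurable
    have "calib \<kappa> d\<kappa> (Ms n) a da b db \<in> borel_measurable lebesgue" for n
      by (intro measurable_completion borel_measurable_continuous_onI[OF pc, unfolded measurable_lborel2[symmetric]])
    then show "(\<lambda>p. indicator F p *\<^sub>R (Xd da p + Yd db p + calib \<kappa> d\<kappa> (Ms n) a da b db p)) \<in> borel_measurable lebesgue" for n
      using F dm by measurable
    show "integrable lebesgue (\<lambda>p. B * indicator L p + C * indicator K p)"
      using lmeasurable_compact[OF S(2)] lmeasurable_compact[OF L(1)]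
      by (intro Bochner_Integration.integrable_add integrable_mult_right integrable_real_indicator) (auto simp: fmeasurable_def)
    show "AE p in lebesgue. (\<lambda>n. indicator F p *\<^sub>R (Xd da p + Yd db p + calib \<kappa> d\<kappa> (Ms n) a da b db p)) \<longlonglongrightarrow>
        indicator F p *\<^sub>R (Xd da p + Yd db p + calib \<kappa> d\<kappa> M a da b db p)"
      by (intro AE_I2 tendsto_intros plim)
    show "AE p in lebesgue. norm (indicator F p *\<^sub>R (Xd da p + Yd db p + calib \<kappa> d\<kappa> (Ms n) a da b db p))
        \<le> B * indicator L p + C * indicator K p" for n
    proof (intro AE_I2)
      fix p
      have "\<bar>Xd da p + Yd db p\<bar> \<le> B * indicator L p" using B(2)[of p] abz[of p] by (cases "p \<in> L") auto
      then have "\<bar>Xd da p + Yd db p + calib \<kappa> d\<kappa> (Ms n) a da b db p\<bar> \<le> B * indicator L p + C * indicator K p"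
        using C(2)[of "Ms n" p] by linarith
      moreover have "0 \<le> B * indicator L p + C * indicator K p" using B(1) C(1) by simp
      ultimately show "norm (indicator F p *\<^sub>R (Xd da p + Yd db p + calib \<kappa> d\<kappa> (Ms n) a da b db p))
        \<le> B * indicator L p + C * indicator K p" by (cases "p \<in> F") auto
    qed
  qed
  then have "(\<lambda>n. ereal (set_lebesgue_integral lebesgue F (\<lambda>p. Xd da p + Yd db p + calib \<kappa> d\<kappa> (Ms n) a da b db p))) \<longlonglongrightarrow>
      ereal (set_lebesgue_integral lebesgue F (\<lambda>p. Xd da p + Yd db p + calib \<kappa> d\<kappa> M a da b db p))"
    unfolding set_lebesgue_integral_def by simp
  from LIMSEQ_le_const2[OF this] show ?thesis using step by blast
qed

lemma C1_cutoff:
  assumes K: "compact K" and O: "open \<Omega>" "K \<subseteq> \<Omega>"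
  obtains \<eta> d\<eta> K' V where "C1on UNIV \<eta> d\<eta>" "\<And>p. 0 \<le> \<eta> p" "\<And>p. \<eta> p \<le> (1::real)" "compact K'" "K' \<subseteq> \<Omega>"
    "\<And>p. p \<notin> K' \<Longrightarrow> \<eta> p = 0" "open V" "K \<subseteq> V" "\<And>p. p \<in> V \<Longrightarrow> \<eta> p = 1"
proof (cases "K = {}")
  case True
  show thesis by (rule that[OF C1on_const[where c=0], of "{}" "{}"]) (use True in auto)
next
  case False
  obtain r where r: "0 < r" "(\<Union>x\<in>K. ball x r) \<subseteq> \<Omega>"
    using compact_subset_open_imp_ball_epsilon_subset[OF K O] by blast
  \<comment> \<open>Four layers of width \<open>\<delta>\<close> must fit into the distance
    \<open>r\<close>: the profile is 1 up to \<open>2 * \<delta>\<close> and 0 beyond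
    \<open>3 * \<delta>\<close>. Mollification at scale \<open>\<delta>\<close> loses one layer on
    either side.\<close>
  define \<delta> where "\<delta> = r / 5"
  have d: "0 < \<delta>" using r by (simp add: \<delta>_def)
  define K' where "K' = {p. infdist p K \<le> 4 * \<delta>}"
  have cl: "closed {p. infdist p K \<le> c}" for c by (intro closed_Collect_le continuous_intros)
  have near: "\<exists>x\<in>K. dist p x \<le> c" if "infdist p K \<le> c" for p c
    using infdist_attains_inf[OF compact_imp_closed[OF K] False, of p] that by metis
  have bd: "bounded {p. infdist p K \<le> c}" for c
  proof -
    obtain R where R: "\<forall>x\<in>K. norm x \<le> R" using compact_imp_bounded[OF K] by (auto simp: bounded_iff)
    have "norm p \<le> R + c" if i: "infdist p K \<le> c" for p
    proof -
      obtain x where "x \<in> K" "dist p x \<le> c" using near[OF i] by blast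
      then show ?thesis using R norm_triangle_sub[of p x] by (force simp: dist_norm)
    qed
    then show ?thesis by (auto simp: bounded_iff)
  qed
  have K': "compact K'" "compact {p. infdist p K \<le> 3 * \<delta>}"
    unfolding K'_def using cl bd by (auto simp: compact_eq_bounded_closed)
  have K'O: "K' \<subseteq> \<Omega>"
  proof
    fix p assume "p \<in> K'"
    then obtain x where "x \<in> K" "dist p x \<le> 4 * \<delta>" using near unfolding K'_def by blast
    then have "p \<in> ball x r" using r by (simp add: \<delta>_def dist_commute)
    then show "p \<in> \<Omega>" using r \<open>x \<in> K\<close> by blast
  qed
  define g where "g p = max 0 (min 1 (3 - infdist p K / \<delta>))" for p
  have gc: "continuous_on UNIV g" unfolding g_def by (intro continuous_intros) (use d in auto)
  have g0: "g p = 0" if "p \<notin> {p. infdist p K \<le> 3 * \<delta>}" for p using that d by (auto simp: g_def field_simps)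
  obtain \<rho> where rho: "bump3 (\<delta>/3) \<rho>" "\<And>v. 0 \<le> \<rho> v" "integral\<^sup>L lborel \<rho> = 1"
    using mollifier_exists[of "\<delta>/3"] d by auto
  obtain d' where d': "C1on UNIV \<rho> d'" using bump3_C1[OF rho(1)] by blast
  have rm: "\<rho> \<in> borel_measurable borel" using bump3_continuous[OF rho(1)] by (rule borel_measurable_continuous_onI)
  have r1: "integral\<^sup>L lborel (\<lambda>q. \<rho> (p - q)) = 1" for p
    using integral_reflect_translate[OF rm] rho(3) by simp
  have ri: "integrable lborel (\<lambda>q. \<rho> (p - q))" for p
    using r1[of p] not_integrable_integral_eq[of lborel "\<lambda>q. \<rho> (p - q)"] by fastforce
  have gi: "integrable lborel (\<lambda>q. g q * \<rho> (p - q))" for p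
    by (rule conv_integrable[OF gc K'(2) _ bump3_continuous[OF rho(1)]]) (rule g0)
  have inf_lip: "infdist q K \<le> infdist p K + dist p q" for p q
    using infdist_triangle[of q K p] by (simp add: dist_commute)
  show thesis
  proof (rule that[of "conv g \<rho>" "\<lambda>e. conv g (d' e)" K' "{p. infdist p K < \<delta>}"])
    show "C1on UNIV (conv g \<rho>) (\<lambda>e. conv g (d' e))"
      by (rule conv_C1[OF gc K'(2) _ d']) (rule g0)
    show "0 \<le> conv g \<rho> p" for p unfolding conv_def
      by (intro Bochner_Integration.integral_nonneg mult_nonneg_nonneg rho(2)) (simp add: g_def)
    show "conv g \<rho> p \<le> 1" for p
    proof -
      have "conv g \<rho> p \<le> integral\<^sup>L lborel (\<lambda>q. \<rho> (p - q))" unfolding conv_def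
        by (rule integral_mono[OF gi ri]) (rule mult_left_le_one_le, rule rho(2), auto simp: g_def)
      then show ?thesis using r1 by simp
    qed
    show "conv g \<rho> p = 0" if "p \<notin> K'" for p
    proof -
      have "g q * \<rho> (p - q) = 0" for q
      proof (cases "infdist q K \<le> 3 * \<delta>")
        case True
        then have "\<delta> \<le> norm (p - q)" using inf_lip[of p q] inf_lip[of q p] that by (simp add: K'_def dist_norm norm_minus_commute)
        then show ?thesis using bump3_outside[OF rho(1), of "p - q"] by simp
      next
        case False then show ?thesis using g0[of q] by simp
      qed
      then have "(\<lambda>q. g q * \<rho> (p - q)) = (\<lambda>q. 0)" by blast
      then show ?thesis by (simp only: conv_def integral_zero)
    qed
    show "open {p. infdist p K < \<delta>}" by (intro open_Collect_less continuous_intros)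
    show "K \<subseteq> {p. infdist p K < \<delta>}" using d by auto
    show "conv g \<rho> p = 1" if "p \<in> {p. infdist p K < \<delta>}" for p
    proof -
      have "g q * \<rho> (p - q) = \<rho> (p - q)" for q
      proof (cases "norm (p - q) < \<delta>")
        case True
        then have "infdist q K / \<delta> \<le> 2" using inf_lip[of q p] that d by (simp add: dist_norm field_simps)
        then show ?thesis by (simp add: g_def)
      next
        case False then show ?thesis using bump3_outside[OF rho(1), of "p - q"] by simp
      qed
      then have "(\<lambda>q. g q * \<rho> (p - q)) = (\<lambda>q. \<rho> (p - q))" by blast
      then show ?thesis using r1 by (simp only: conv_def)
    qed
  qed (use K' K'O in auto)
qed

section \<open>Foliations by horizontal lines\<close>

text \<open>Rate 0 means nondecreasing, which every strip provides. Rate 1/2 is the slope condition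
  of the theorem expressed through \<open>Z\<close>.\<close>

definition grows :: "real \<Rightarrow> (real \<Rightarrow> real) \<Rightarrow> bool" where
  "grows \<mu> Z \<longleftrightarrow> 0 \<le> \<mu> \<and> continuous_on UNIV Z \<and> (\<forall>v w. v \<le> w \<longrightarrow> \<mu> * (w - v) \<le> Z w - Z v)"

text \<open>If the ruling ends at \<open>(1, y, Z u)\<close> and \<open>u\<close> is the height
  \<open>z - xy/2\<close> of this end, then \<open>u = Z u - y / 2\<close>; this is solved for
  \<open>y\<close>.\<close>

definition ruling_slope :: "(real \<Rightarrow> real) \<Rightarrow> real \<Rightarrow> real" where
  "ruling_slope Z u = 2 * (Z u - u)"

text \<open>A point \<open>p\<close> with \<open>fst p \<noteq> l\<close> lies on a horizontal line through
  \<open>(l, l * ruling_slope Z u, Z u)\<close> iff \<open>RR Z (l * fst p) u = cc l p\<close>.\<close>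

definition RR :: "(real \<Rightarrow> real) \<Rightarrow> real \<Rightarrow> real \<Rightarrow> real" where
  "RR Z k u = (1 - k) * Z u + k * u"

text \<open>The last condition makes the guaranteed growth rate of \<open>RR Z (l * x)\<close>
  positive, so that lines with different parameters do not meet. For rate 0 it leaves the abscissas
  strictly between 0 and \<open>l\<close>; for \<open>l = 1\<close> and rate 1/2 it leaves the whole
  slab.\<close>

definition slab :: "real \<Rightarrow> real \<Rightarrow> hpt set" where
  "slab l \<mu> = {p. \<bar>fst p\<bar> < 1 \<and> 0 < l * (l - fst p) \<and> 0 < (1 - l * fst p) * \<mu> + l * fst p}"

definition cc :: "real \<Rightarrow> hpt \<Rightarrow> real" where
  "cc l p = snd (snd p) - l * fst (snd p) / 2"

text \<open>Through a point \<open>p\<close> of the slab passes exactly one horizontal line that meets the curve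
  \<open>u \<mapsto> (l, l * ruling_slope Z u, Z u)\<close>: \<open>fu\<close> is the parameter of the point of intersection, \<open>fM\<close> the slope of
  the line, and \<open>fy0\<close> the \<open>y\<close>-coordinate of its intersection with \<open>{x = 0}\<close>.\<close>

definition fu :: "real \<Rightarrow> (real \<Rightarrow> real) \<Rightarrow> hpt \<Rightarrow> real" where
  "fu l Z p = (THE u. RR Z (l * fst p) u = cc l p)"

definition fM :: "real \<Rightarrow> (real \<Rightarrow> real) \<Rightarrow> hpt \<Rightarrow> real" where
  "fM l Z p = (l * ruling_slope Z (fu l Z p) - fst (snd p)) / (l - fst p)"

definition fy0 :: "real \<Rightarrow> (real \<Rightarrow> real) \<Rightarrow> hpt \<Rightarrow> real" where
  "fy0 l Z p = l * (ruling_slope Z (fu l Z p) - fM l Z p)"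

lemma open_slab: "open (slab l \<mu>)"
proof -
  have "slab l \<mu> = {p. \<bar>fst p\<bar> < 1} \<inter> {p. 0 < l * (l - fst p)} \<inter> {p. 0 < (1 - l * fst p) * \<mu> + l * fst p}"
    by (auto simp: slab_def)
  then show ?thesis by (auto intro!: open_Int open_Collect_less continuous_intros)
qed

lemma slab_less_1: "\<bar>l\<bar> \<le> 1 \<Longrightarrow> p \<in> slab l \<mu> \<Longrightarrow> l * fst p < 1"
proof -
  assume l: "\<bar>l\<bar> \<le> 1" and p: "p \<in> slab l \<mu>"
  have "l * fst p \<le> \<bar>l\<bar> * \<bar>fst p\<bar>" by (metis abs_ge_self abs_mult)
  also have "\<dots> \<le> 1 * \<bar>fst p\<bar>" using l by (intro mult_right_mono) auto
  finally show ?thesis using p by (simp add: slab_def)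
qed

lemma growsD: "grows \<mu> Z \<Longrightarrow> v \<le> w \<Longrightarrow> \<mu> * (w - v) \<le> Z w - Z v"
  by (simp add: grows_def)

lemma grows_mono: "grows \<mu> Z \<Longrightarrow> v \<le> w \<Longrightarrow> Z v \<le> Z w"
  using growsD[of \<mu> Z v w] by (smt (verit) grows_def mult_nonneg_nonneg)

lemma RR_slope:
  assumes "grows \<mu> Z" "k < 1" "v \<le> w"
  shows "((1 - k) * \<mu> + k) * (w - v) \<le> RR Z k w - RR Z k v"
proof -
  have "(1 - k) * (\<mu> * (w - v)) \<le> (1 - k) * (Z w - Z v)"
    using growsD[OF assms(1,3)] assms(2) by (intro mult_left_mono) auto
  then show ?thesis by (simp add: RR_def algebra_simps)
qed

lemma RR_slope_abs:
  assumes "grows \<mu> Z" "k < 1" "0 < (1 - k) * \<mu> + k"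
  shows "((1 - k) * \<mu> + k) * \<bar>w - v\<bar> \<le> \<bar>RR Z k w - RR Z k v\<bar>"
  using RR_slope[OF assms(1,2), of v w] RR_slope[OF assms(1,2), of w v] assms(3)
  by (cases "v \<le> w") (auto simp: abs_if mult_le_0_iff algebra_simps)

lemma RR_strict:
  assumes "grows \<mu> Z" "k < 1" "0 < (1 - k) * \<mu> + k"
  shows "RR Z k v < RR Z k w \<longleftrightarrow> v < w"
proof -
  have "RR Z k v < RR Z k w" if "v < w" for v w
    using RR_slope[OF assms(1,2), of v w] that mult_pos_pos[OF assms(3), of "w - v"] by simp
  then show ?thesis by (metis less_asym linorder_neqE_linordered_idom)
qed

lemma RR_inj:
  assumes "grows \<mu> Z" "k < 1" "0 < (1 - k) * \<mu> + k"
  shows "RR Z k v = RR Z k w \<longleftrightarrow> v = w"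
  using RR_strict[OF assms, of v w] RR_strict[OF assms, of w v] by (cases v w rule: linorder_cases) auto

lemma RR_surj:
  assumes "grows \<mu> Z" "k < 1" "0 < (1 - k) * \<mu> + k"
  shows "\<exists>u. RR Z k u = c"
proof -
  define m where "m = (1 - k) * \<mu> + k"
  define d where "d = \<bar>c - RR Z k 0\<bar> / m"
  have m: "0 < m" using assms by (simp add: m_def)
  have d: "0 \<le> d" "m * d = \<bar>c - RR Z k 0\<bar>" using m by (auto simp: d_def)
  have "RR Z k (- d) \<le> c" "c \<le> RR Z k d"
    using RR_slope[OF assms(1,2), of "-d" 0] RR_slope[OF assms(1,2), of 0 d] d unfolding m_def[symmetric] by auto
  moreover have "continuous_on {-d..d} (RR Z k)" unfolding RR_def
    using assms(1) by (auto simp: grows_def intro!: continuous_intros intro: continuous_on_subset)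
  ultimately show ?thesis using IVT'[of "RR Z k" "-d" c d] d by auto
qed

section \<open>Existence and continuity of the foliation parameter\<close>

lemma fu_eq:
  assumes "grows \<mu> Z" "\<bar>l\<bar> \<le> 1" "p \<in> slab l \<mu>"
  shows "RR Z (l * fst p) (fu l Z p) = cc l p"
proof -
  have k: "l * fst p < 1" "0 < (1 - l * fst p) * \<mu> + l * fst p"
    using slab_less_1[OF assms(2,3)] assms(3) by (auto simp: slab_def)
  show ?thesis unfolding fu_def
    by (rule theI') (use RR_surj[OF assms(1) k] RR_inj[OF assms(1) k] in metis)
qed

text \<open>Inserting the parameter of \<open>p\<close> into the equation at \<open>q\<close> leaves
  an explicit residual, and the growth rate at \<open>q\<close> bounds the distance between the two
  roots. This needs no derivative of \<open>Z\<close>.\<close>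

lemma fu_lipschitz:
  assumes "grows \<mu> Z" "\<bar>l\<bar> \<le> 1" "p \<in> slab l \<mu>" "q \<in> slab l \<mu>"
  shows "((1 - l * fst q) * \<mu> + l * fst q) * \<bar>fu l Z q - fu l Z p\<bar>
     \<le> \<bar>cc l q - cc l p + l * (fst q - fst p) * (Z (fu l Z p) - fu l Z p)\<bar>"
proof -
  have k: "l * fst q < 1" "0 < (1 - l * fst q) * \<mu> + l * fst q"
    using slab_less_1[OF assms(2,4)] assms(4) by (auto simp: slab_def)
  have "RR Z (l * fst q) (fu l Z q) - RR Z (l * fst q) (fu l Z p)
      = cc l q - cc l p + l * (fst q - fst p) * (Z (fu l Z p) - fu l Z p)"
    using fu_eq[OF assms(1,2,3)] fu_eq[OF assms(1,2,4)] by (simp add: RR_def algebra_simps)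
  then show ?thesis using RR_slope_abs[OF assms(1) k, of "fu l Z q" "fu l Z p"] by simp
qed

lemma fu_continuous:
  assumes "grows \<mu> Z" "\<bar>l\<bar> \<le> 1"
  shows "continuous_on (slab l \<mu>) (fu l Z)"
proof -
  have "(fu l Z \<longlongrightarrow> fu l Z p) (at p)" if p: "p \<in> slab l \<mu>" for p
  proof -
    let ?b = "\<lambda>q. \<bar>cc l q - cc l p + l * (fst q - fst p) * (Z (fu l Z p) - fu l Z p)\<bar> / ((1 - l * fst q) * \<mu> + l * fst q)"
    have m: "0 < (1 - l * fst q) * \<mu> + l * fst q" if "q \<in> slab l \<mu>" for q using that by (simp add: slab_def)
    have "continuous (at p) ?b"
      unfolding cc_def by (intro continuous_intros) (use m[OF p] in auto)
    then have "(?b \<longlongrightarrow> ?b p) (at p)" by (simp only: continuous_at)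
    then have b: "(?b \<longlongrightarrow> 0) (at p)" by simp
    have "((\<lambda>q. fu l Z q - fu l Z p) \<longlongrightarrow> 0) (at p)"
    proof (rule Lim_null_comparison[OF _ b])
      show "\<forall>\<^sub>F q in at p. norm (fu l Z q - fu l Z p) \<le> ?b q"
        using eventually_at_in_open[OF open_slab p]
        by (rule eventually_mono) (use fu_lipschitz[OF assms p] m in \<open>auto simp: pos_le_divide_eq mult.commute\<close>)
    qed
    then show ?thesis by (simp add: Lim_null[symmetric])
  qed
  then show ?thesis by (simp add: continuous_on_eq_continuous_at[OF open_slab] continuous_at)
qed

section \<open>Derivatives of the foliation of a continuously differentiable curve\<close>

definition RRd :: "(real \<Rightarrow> real) \<Rightarrow> real \<Rightarrow> real \<Rightarrow> real" where
  "RRd Z' k u = (1 - k) * Z' u + k"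

text \<open>Implicit differentiation of \<open>RR Z (l * fst p) u = cc l p\<close>; as
  \<open>cc l\<close> is linear, its derivative in direction \<open>e\<close> is
  \<open>cc l e\<close>.\<close>

definition dfu :: "real \<Rightarrow> (real \<Rightarrow> real) \<Rightarrow> (real \<Rightarrow> real) \<Rightarrow> hpt \<Rightarrow> hpt \<Rightarrow> real" where
  "dfu l Z Z' e p = (cc l e + l * fst e * (Z (fu l Z p) - fu l Z p)) / RRd Z' (l * fst p) (fu l Z p)"

definition dfM :: "real \<Rightarrow> (real \<Rightarrow> real) \<Rightarrow> (real \<Rightarrow> real) \<Rightarrow> hpt \<Rightarrow> hpt \<Rightarrow> real" where
  "dfM l Z Z' e p = (2 * l * (Z' (fu l Z p) - 1) * dfu l Z Z' e p - fst (snd e) + fst e * fM l Z p) / (l - fst p)"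

definition dfy0 :: "real \<Rightarrow> (real \<Rightarrow> real) \<Rightarrow> (real \<Rightarrow> real) \<Rightarrow> hpt \<Rightarrow> hpt \<Rightarrow> real" where
  "dfy0 l Z Z' e p = l * (2 * (Z' (fu l Z p) - 1) * dfu l Z Z' e p - dfM l Z Z' e p)"

definition C1grows :: "real \<Rightarrow> (real \<Rightarrow> real) \<Rightarrow> (real \<Rightarrow> real) \<Rightarrow> bool" where
  "C1grows \<mu> Z Z' \<longleftrightarrow> grows \<mu> Z \<and> continuous_on UNIV Z' \<and> (\<forall>u. (Z has_real_derivative Z' u) (at u)) \<and> (\<forall>u. \<mu> \<le> Z' u)"

context
  fixes l \<mu> :: real and Z Z' :: "real \<Rightarrow> real"
  assumes l: "\<bar>l\<bar> \<le> 1" and C1: "C1grows \<mu> Z Z'"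
begin

lemma gr: "grows \<mu> Z" and Z'c: "continuous_on UNIV Z'" and ZD: "(Z has_real_derivative Z' u) (at u)" and Z'ge: "\<mu> \<le> Z' u"
  using C1 by (auto simp: C1grows_def)

lemma RRd_pos:
  assumes "p \<in> slab l \<mu>" shows "0 < RRd Z' (l * fst p) u"
proof -
  have "(1 - l * fst p) * \<mu> \<le> (1 - l * fst p) * Z' u"
    using slab_less_1[OF l assms] Z'ge by (intro mult_left_mono) auto
  then show ?thesis using assms by (simp add: RRd_def slab_def)
qed

lemma slab_ne: "p \<in> slab l \<mu> \<Longrightarrow> l - fst p \<noteq> 0" "p \<in> slab l \<mu> \<Longrightarrow> l \<noteq> 0"
  by (auto simp: slab_def)

lemma fu_deriv:
  assumes p: "p \<in> slab l \<mu>"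
  shows "((\<lambda>t. fu l Z (p + t *\<^sub>R e)) has_real_derivative dfu l Z Z' e p) (at 0)"
proof -
  define u where "u = fu l Z p"
  \<comment> \<open>The Caratheodory quotient \<open>g\<close> turns the implicit equation into an
    exact linear equation for the increment of the parameter. Its values are at least
    \<open>\<mu>\<close>, so the coefficient of this equation stays positive.\<close>
  obtain g where g: "\<And>w. Z w - Z u = g w * (w - u)" "isCont g u" "g u = Z' u"
    using ZD[of u] by (auto simp: CARAT_DERIV)
  have gge: "\<mu> \<le> g w" for w
  proof -
    consider "w = u" | "w < u" | "u < w" by linarith
    then show ?thesis
    proof cases
      case 1 then show ?thesis using g(3) Z'ge by simp
    next
      case 2 then have "\<mu> * (u - w) \<le> g w * (u - w)" using growsD[OF gr, of w u] g(1)[of w] by (simp add: algebra_simps)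
      then show ?thesis using 2 by simp
    next
      case 3 then have "\<mu> * (w - u) \<le> g w * (w - u)" using growsD[OF gr, of u w] g(1)[of w] by simp
      then show ?thesis using 3 by simp
    qed
  qed
  define v where "v t = fu l Z (p + t *\<^sub>R e)" for t
  define k where "k t = l * (fst p + t * fst e)" for t
  define n where "n = cc l e + l * fst e * (Z u - u)"
  have in0: "\<forall>\<^sub>F t in at 0. p + t *\<^sub>R e \<in> slab l \<mu>"
    using eventually_line_in_open[OF open_slab p, of e] unfolding eventually_at_filter
    by (rule eventually_mono) simp
  have main: "(v t - u) * ((1 - k t) * g (v t) + k t) = t * n \<and> 0 < (1 - k t) * g (v t) + k t"
    if q: "p + t *\<^sub>R e \<in> slab l \<mu>" for t
  proof
    have "cc l (p + t *\<^sub>R e) = cc l p + t * cc l e" by (simp add: cc_def field_simps)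
    then have "(1 - k t) * Z (v t) + k t * v t = cc l p + t * cc l e"
      using fu_eq[OF gr l q] by (simp add: v_def k_def RR_def)
    moreover have "(1 - k 0) * Z u + k 0 * u = cc l p"
      using fu_eq[OF gr l p] by (simp add: u_def k_def RR_def)
    moreover have "k t = k 0 + t * (l * fst e)" by (simp add: k_def algebra_simps)
    moreover have "(v t - u) * g (v t) = Z (v t) - Z u" using g(1) by simp
    ultimately have "(1 - k t) * (Z u + (v t - u) * g (v t)) + k t * v t - ((1 - k 0) * Z u + k 0 * u) = t * cc l e"
      and "k t = k 0 + t * (l * fst e)" by (auto simp: algebra_simps)
    then show "(v t - u) * ((1 - k t) * g (v t) + k t) = t * n"
      unfolding n_def by algebra
    have k1: "k t < 1" using slab_less_1[OF l q] by (simp add: k_def)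
    then have "(1 - k t) * \<mu> \<le> (1 - k t) * g (v t)" using gge by (intro mult_left_mono) auto
    then show "0 < (1 - k t) * g (v t) + k t" using q by (simp add: slab_def k_def)
  qed
  have vl: "(v \<longlongrightarrow> u) (at 0)"
  proof -
    have "((\<lambda>t. p + t *\<^sub>R e) \<longlongrightarrow> p + 0 *\<^sub>R e) (at 0)" by (intro tendsto_intros)
    then have "((\<lambda>t. p + t *\<^sub>R e) \<longlongrightarrow> p) (at 0)" by simp
    moreover have "isCont (fu l Z) p" using fu_continuous[OF gr l] p
      by (simp add: continuous_on_eq_continuous_at[OF open_slab])
    ultimately show ?thesis unfolding v_def u_def using isCont_tendsto_compose by blast
  qed
  have "((\<lambda>t. n / ((1 - k t) * g (v t) + k t)) \<longlongrightarrow> n / ((1 - k 0) * g u + k 0)) (at 0)"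
  proof (intro tendsto_intros isCont_tendsto_compose[OF g(2) vl])
    have "(k \<longlongrightarrow> l * (fst p + 0 * fst e)) (at 0)" unfolding k_def[abs_def] by (intro tendsto_intros)
    then show "(k \<longlongrightarrow> k 0) (at 0)" "(k \<longlongrightarrow> k 0) (at 0)" by (simp_all add: k_def)
    show "(1 - k 0) * g u + k 0 \<noteq> 0" using RRd_pos[OF p, of u] g(3) by (simp add: RRd_def k_def)
  qed
  moreover have "\<forall>\<^sub>F t in at 0. n / ((1 - k t) * g (v t) + k t) = (v (0 + t) - v 0) / t"
  proof -
    have "\<forall>\<^sub>F t in at (0::real). t \<noteq> 0" by (simp add: eventually_at_filter)
    with in0 show ?thesis
    proof eventually_elim
      case (elim t)
      have "v 0 = u" by (simp add: v_def u_def)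
      then show ?case using main[OF elim(1)] elim(2) by (simp add: field_simps)
    qed
  qed
  ultimately have "((\<lambda>t. (v (0 + t) - v 0) / t) \<longlongrightarrow> n / ((1 - k 0) * g u + k 0)) (at 0)"
    by (rule Lim_transform_eventually)
  then show ?thesis
    using g(3) unfolding has_field_derivative_iff v_def dfu_def RRd_def n_def k_def u_def by simp
qed

lemma comp_fu_continuous: "continuous_on UNIV h \<Longrightarrow> continuous_on (slab l \<mu>) (\<lambda>p. h (fu l Z p))"
  by (rule continuous_on_compose2[OF _ fu_continuous[OF gr l]]) auto

lemma Z_continuous: "continuous_on UNIV Z" using gr by (simp add: grows_def)

lemma fu_C1: "C1on (slab l \<mu>) (fu l Z) (dfu l Z Z')"
  unfolding C1on_def
proof (intro conjI ballI fu_deriv fu_continuous[OF gr l])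
  fix e :: hpt
  show "continuous_on (slab l \<mu>) (dfu l Z Z' e)"
    unfolding dfu_def RRd_def
    by (intro continuous_intros comp_fu_continuous Z_continuous Z'c fu_continuous[OF gr l] ballI
        less_imp_neq[THEN not_sym] RRd_pos[unfolded RRd_def])
qed auto

lemma ruling_slope_C1: "C1on (slab l \<mu>) (\<lambda>p. ruling_slope Z (fu l Z p)) (\<lambda>e p. 2 * (Z' (fu l Z p) - 1) * dfu l Z Z' e p)"
  unfolding ruling_slope_def
  by (rule C1on_chain_UNIV[OF fu_C1, where f="\<lambda>u. 2 * (Z u - u)" and f'="\<lambda>u. 2 * (Z' u - 1)"])
     (auto intro!: derivative_eq_intros ZD continuous_intros Z'c)

lemma fM_C1: "C1on (slab l \<mu>) (fM l Z) (dfM l Z Z')"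
proof -
  note n = C1on_diff[OF C1on_mult[OF C1on_const[where c=l] ruling_slope_C1] C1on_y]
  note d = C1on_diff[OF C1on_const[where c=l] C1on_x]
  show ?thesis
  proof (rule C1on_cong[OF C1on_divide[OF n d] open_slab])
    fix p e :: hpt assume "p \<in> slab l \<mu>"
    then have D: "l - fst p \<noteq> 0" by (rule slab_ne)
    have "(A - y + x * (N / D)) / D = ((0 * s + A - y) * D - N * (0 - x)) / (D * D)" if "D \<noteq> 0" for A y x N D s :: real
      using that by (simp add: field_simps)
    from this[OF D]
    show "dfM l Z Z' e p = ((0 * ruling_slope Z (fu l Z p) + l * (2 * (Z' (fu l Z p) - 1) * dfu l Z Z' e p) - fst (snd e)) *
        (l - fst p) - (l * ruling_slope Z (fu l Z p) - fst (snd p)) * (0 - fst e)) / ((l - fst p) * (l - fst p))"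
      unfolding dfM_def fM_def by (simp add: mult.assoc mult.left_commute)
  qed (auto simp: fM_def slab_def)
qed

lemma fy0_C1: "C1on (slab l \<mu>) (fy0 l Z) (dfy0 l Z Z')"
  by (rule C1on_cong[OF C1on_mult[OF C1on_const[where c=l] C1on_diff[OF ruling_slope_C1 fM_C1]] open_slab])
     (auto simp: fy0_def dfy0_def)

lemma Z_fu_C1: "C1on (slab l \<mu>) (\<lambda>p. Z (fu l Z p)) (\<lambda>e p. Z' (fu l Z p) * dfu l Z Z' e p)"
  by (rule C1on_chain_UNIV[OF fu_C1 ZD Z'c])

lemma fM_mult: "p \<in> slab l \<mu> \<Longrightarrow> fM l Z p * (l - fst p) = 2 * l * (Z (fu l Z p) - fu l Z p) - fst (snd p)"
  using slab_ne by (simp add: fM_def ruling_slope_def)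

lemma Xd_fu: "Xd (dfu l Z Z') p = (l * (Z (fu l Z p) - fu l Z p) - fst (snd p) / 2) / RRd Z' (l * fst p) (fu l Z p)"
  by (simp add: Xd_def dfu_def cc_def diff_divide_distrib)

lemma Yd_fu: "Yd (dfu l Z Z') p = - ((l - fst p) / 2) / RRd Z' (l * fst p) (fu l Z p)"
  by (simp add: Yd_def dfu_def cc_def diff_divide_distrib)

text \<open>The operator \<open>X + M * Y\<close> differentiates along the horizontal direction of
  slope \<open>M\<close>, which is the direction of the foliation line, and the parameter is
  constant on that line. The same reason applies to the slope and to the intercept at
  \<open>x = 0\<close>.\<close>

lemma V_fu: "p \<in> slab l \<mu> \<Longrightarrow> Xd (dfu l Z Z') p + fM l Z p * Yd (dfu l Z Z') p = 0"
  unfolding Xd_fu Yd_fu using fM_mult[of p] by (simp add: field_simps)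

lemma Xd_fM: "Xd (dfM l Z Z') p = (2 * l * (Z' (fu l Z p) - 1) * Xd (dfu l Z Z') p + fM l Z p) / (l - fst p)"
proof -
  have "(a * d1 - 0 + 1 * M) / D - c * ((a * d3 - 0 + 0 * M) / D) = (a * (d1 - c * d3) + M) / D"
    for a d1 d3 M D c :: real by (cases "D = 0") (simp_all add: field_simps)
  then show ?thesis unfolding Xd_def dfM_def by (simp only: fst_conv snd_conv)
qed

lemma Yd_fM: "Yd (dfM l Z Z') p = (2 * l * (Z' (fu l Z p) - 1) * Yd (dfu l Z Z') p - 1) / (l - fst p)"
proof -
  have "(a * d1 - 1 + 0 * M) / D + c * ((a * d3 - 0 + 0 * M) / D) = (a * (d1 + c * d3) - 1) / D"
    for a d1 d3 M D c :: real by (cases "D = 0") (simp_all add: field_simps)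
  then show ?thesis unfolding Yd_def dfM_def by (simp only: fst_conv snd_conv)
qed

lemma V_fM:
  assumes "p \<in> slab l \<mu>" shows "Xd (dfM l Z Z') p + fM l Z p * Yd (dfM l Z Z') p = 0"
proof -
  have "Xd (dfM l Z Z') p + fM l Z p * Yd (dfM l Z Z') p
     = 2 * l * (Z' (fu l Z p) - 1) * (Xd (dfu l Z Z') p + fM l Z p * Yd (dfu l Z Z') p) / (l - fst p)"
    unfolding Xd_fM Yd_fM by (simp add: add_divide_distrib[symmetric] algebra_simps)
  then show ?thesis using V_fu[OF assms] by simp
qed

lemma Xd_fy0: "Xd (dfy0 l Z Z') p = l * (2 * (Z' (fu l Z p) - 1) * Xd (dfu l Z Z') p - Xd (dfM l Z Z') p)"
  by (simp add: Xd_def dfy0_def field_simps)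

lemma Yd_fy0': "Yd (dfy0 l Z Z') p = l * (2 * (Z' (fu l Z p) - 1) * Yd (dfu l Z Z') p - Yd (dfM l Z Z') p)"
  by (simp add: Yd_def dfy0_def field_simps)

lemma V_fy0:
  assumes "p \<in> slab l \<mu>" shows "Xd (dfy0 l Z Z') p + fM l Z p * Yd (dfy0 l Z Z') p = 0"
proof -
  have "Xd (dfy0 l Z Z') p + fM l Z p * Yd (dfy0 l Z Z') p
     = l * (2 * (Z' (fu l Z p) - 1) * (Xd (dfu l Z Z') p + fM l Z p * Yd (dfu l Z Z') p)
        - (Xd (dfM l Z Z') p + fM l Z p * Yd (dfM l Z Z') p))"
    unfolding Xd_fy0 Yd_fy0' by (simp add: algebra_simps)
  then show ?thesis using V_fu[OF assms] V_fM[OF assms] by simp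
qed

text \<open>The numerator is the growth rate \<open>RRd\<close> with weight
  \<open>x\<^sup>2\<close>, the one of the rulings, and the denominator is that of the foliation
  lines. Both are nonnegative, so the intercept does not decrease in the Y direction.\<close>

lemma Yd_fy0:
  assumes "p \<in> slab l \<mu>"
  shows "Yd (dfy0 l Z Z') p = l / (l - fst p) * (((1 - (fst p)\<^sup>2) * Z' (fu l Z p) + (fst p)\<^sup>2) / RRd Z' (l * fst p) (fu l Z p))"
proof -
  define D where "D = RRd Z' (l * fst p) (fu l Z p)"
  define w where "w = Z' (fu l Z p)"
  define x where "x = fst p"
  have D: "D \<noteq> 0" "D = (1 - l * x) * w + l * x" using RRd_pos[OF assms, of "fu l Z p"] by (auto simp: D_def RRd_def w_def x_def)
  have lx: "l - x \<noteq> 0" using slab_ne(1)[OF assms] by (simp add: x_def)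
  have "Yd (dfy0 l Z Z') p = l / (l - x) * ((D + x * (w - 1) * (l - x)) / D)"
  proof -
    have Yf: "Yd (dfu l Z Z') p = - ((l - x) / 2) / D" by (simp add: Yd_fu D_def x_def)
    show ?thesis unfolding Yd_fy0' Yd_fM Yf w_def[symmetric] x_def[symmetric]
      using D(1) lx by (simp add: field_simps)
  qed
  also have "D + x * (w - 1) * (l - x) = (1 - x\<^sup>2) * w + x\<^sup>2"
    unfolding D(2) by (simp add: power2_eq_square algebra_simps)
  finally show ?thesis by (simp add: D_def w_def x_def)
qed

lemma l_div_pos:
  assumes "p \<in> slab l \<mu>" shows "0 < l / (l - fst p)"
  using assms by (auto simp: slab_def zero_less_mult_iff zero_less_divide_iff)

lemma Yd_fy0_nonneg:
  assumes "p \<in> slab l \<mu>" shows "0 \<le> Yd (dfy0 l Z Z') p"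
proof -
  have "0 \<le> \<mu>" using gr by (simp add: grows_def)
  then have "0 \<le> Z' (fu l Z p)" using Z'ge[of "fu l Z p"] by linarith
  moreover have "(fst p)\<^sup>2 \<le> 1" using assms by (simp add: slab_def abs_square_le_1)
  ultimately show ?thesis
    unfolding Yd_fy0[OF assms]
    by (intro mult_nonneg_nonneg[OF less_imp_le[OF l_div_pos[OF assms]] divide_nonneg_pos[OF _ RRd_pos[OF assms]]]
       add_nonneg_nonneg mult_nonneg_nonneg) simp_all
qed

lemma Yd_l_fu:
  assumes "p \<in> slab l \<mu>" shows "l * Yd (dfu l Z Z') p \<le> 0"
proof -
  have "l * Yd (dfu l Z Z') p = - (l * (l - fst p) / 2 / RRd Z' (l * fst p) (fu l Z p))"
    unfolding Yd_fu by simp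
  also have "\<dots> \<le> 0" using assms RRd_pos[OF assms, of "fu l Z p"]
    by (auto simp: slab_def intro!: divide_nonneg_pos)
  finally show ?thesis .
qed

text \<open>The function differentiated here is the value at \<open>x = 0\<close> of
  \<open>z + l * y / 2\<close> along the line; it describes the second face of the wedge. Between
  \<open>x = 0\<close> and \<open>x = l\<close> the gain from the intercept outweighs the loss from
  the parameter.\<close>

lemma Yd_l_b:
  assumes p: "p \<in> slab l \<mu>" and x: "0 \<le> l * fst p"
  shows "0 \<le> l * (Z' (fu l Z p) * Yd (dfu l Z Z') p + l * Yd (dfy0 l Z Z') p)"
proof -
  define D where "D = RRd Z' (l * fst p) (fu l Z p)"
  define w where "w = Z' (fu l Z p)"
  define x where "x = fst p"
  have D: "0 < D" using RRd_pos[OF p, of "fu l Z p"] by (auto simp: D_def)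
  have lx: "l - x \<noteq> 0" "0 < l * (l - x)" "l \<noteq> 0" using slab_ne[OF p] p by (auto simp: x_def slab_def)
  have "0 \<le> \<mu>" using gr by (simp add: grows_def)
  then have w: "0 \<le> w" using Z'ge[of "fu l Z p"] by (simp add: w_def)
  have l2: "l\<^sup>2 \<le> 1" using l by (simp add: abs_square_le_1)
  \<comment> \<open>As \<open>x\<close> lies between 0 and \<open>l\<close>, one has
    \<open>x\<^sup>2 \<le> l * x\<close>, while \<open>\<bar>l\<bar> \<le> 1\<close> gives
    \<open>l\<^sup>2 * x\<^sup>2 \<le> x\<^sup>2\<close>.\<close>
  have "(l - x)\<^sup>2 / 2 \<le> l\<^sup>2 * (1 - x\<^sup>2)"
  proof -
    have "l\<^sup>2 * x\<^sup>2 \<le> 1 * x\<^sup>2" using l2 by (intro mult_right_mono) auto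
    moreover have "x\<^sup>2 \<le> l * x"
    proof (cases "0 < l")
      case True
      then have "x < l" "0 \<le> x" using lx(2) assms(2) by (auto simp: zero_less_mult_iff x_def zero_le_mult_iff)
      then show ?thesis by (simp add: power2_eq_square mult_right_mono)
    next
      case False
      then have "l < x" "x \<le> 0" using lx(2,3) assms(2) by (auto simp: zero_less_mult_iff x_def zero_le_mult_iff)
      then show ?thesis by (simp add: power2_eq_square mult_right_mono_neg)
    qed
    moreover have "0 \<le> (l - x)\<^sup>2" by simp
    moreover have "(l - x)\<^sup>2 = l\<^sup>2 - 2 * (l * x) + x\<^sup>2" by (simp add: power2_eq_square algebra_simps)
    moreover have "l\<^sup>2 * (1 - x\<^sup>2) = l\<^sup>2 - l\<^sup>2 * x\<^sup>2" by (simp add: algebra_simps)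
    ultimately show ?thesis by linarith
  qed
  then have "0 \<le> w * (l\<^sup>2 * (1 - x\<^sup>2) - (l - x)\<^sup>2 / 2) + l\<^sup>2 * x\<^sup>2" using w by (intro add_nonneg_nonneg mult_nonneg_nonneg) auto
  moreover have "0 < l / (l - x)" using l_div_pos[OF p] by (simp add: x_def)
  ultimately have "0 \<le> l / (l - x) * ((w * (l\<^sup>2 * (1 - x\<^sup>2) - (l - x)\<^sup>2 / 2) + l\<^sup>2 * x\<^sup>2) / D)"
    by (intro mult_nonneg_nonneg divide_nonneg_pos less_imp_le[OF \<open>0 < l / (l - x)\<close>] D)
  also have "\<dots> = l * (w * Yd (dfu l Z Z') p + l * Yd (dfy0 l Z Z') p)"
  proof -
    have Yf: "Yd (dfu l Z Z') p = - ((l - x) / 2) / D" by (simp add: Yd_fu D_def x_def)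
    have Yy: "Yd (dfy0 l Z Z') p = l / (l - x) * (((1 - x\<^sup>2) * w + x\<^sup>2) / D)"
      by (simp add: Yd_fy0[OF p] D_def x_def w_def)
    show ?thesis unfolding Yf Yy
      using D lx by (simp add: field_simps power2_eq_square)
  qed
  finally show ?thesis by (simp add: w_def)
qed

end

section \<open>Approximation by differentiable curves\<close>

lemma smoothing_exists:
  assumes g: "grows \<mu> Z"
  obtains Zs Zs' where "\<And>n. C1grows \<mu> (Zs n) (Zs' n)"
    "\<And>n u. Z u \<le> Zs n u" "\<And>n u. Zs n u \<le> Z (u + 1 / real (Suc n))"
proof -
  have Zc: "isCont Z u" for u using g by (simp add: grows_def continuous_on_eq_continuous_at)
  obtain A where "\<forall>x. ereal x > -\<infinity> \<longrightarrow> ereal x < \<infinity> \<longrightarrow> (A has_vector_derivative Z x) (at x)"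
    using einterval_antiderivative[of "-\<infinity>" \<infinity> Z] Zc by auto
  then have A: "(A has_real_derivative Z x) (at x)" for x
    by (simp add: has_real_derivative_iff_has_vector_derivative)
  define h where "h n = 1 / real (Suc n)" for n
  have h: "0 < h n" for n by (simp add: h_def)
  \<comment> \<open>One-sided averages of \<open>Z\<close> over \<open>[u, u + h n]\<close>.
    Averaging preserves the growth rate, and monotonicity traps the average between the end
    values.\<close>
  define Zs where "Zs n u = (A (u + h n) - A u) / h n" for n u
  define Zs' where "Zs' n u = (Z (u + h n) - Z u) / h n" for n u
  have D: "(Zs n has_real_derivative Zs' n u) (at u)" for n u
  proof -
    have "((\<lambda>u. A (u + h n)) has_real_derivative Z (u + h n)) (at u)"
      using A[of "u + h n"] by (simp add: DERIV_shift)
    then show ?thesis unfolding Zs_def[abs_def] Zs'_def by (intro DERIV_cdivide DERIV_diff A)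
  qed
  have mu: "0 \<le> \<mu>" using g by (simp add: grows_def)
  have ge: "\<mu> \<le> Zs' n u" for n u
    using growsD[OF g, of u "u + h n"] h[of n] by (simp add: Zs'_def pos_le_divide_eq)
  have gr: "grows \<mu> (Zs n)" for n
    unfolding grows_def
  proof (intro conjI allI impI mu)
    show "continuous_on UNIV (Zs n)" by (rule DERIV_continuous_on, rule has_field_derivative_at_within, rule D)
    fix v w :: real assume "v \<le> w"
    have "Zs n v - \<mu> * v \<le> Zs n w - \<mu> * w"
      by (rule DERIV_nonneg_imp_nondecreasing[OF \<open>v \<le> w\<close>, of "\<lambda>u. Zs n u - \<mu> * u"])
         (use D ge in \<open>auto intro!: exI derivative_eq_intros\<close>)
    then show "\<mu> * (w - v) \<le> Zs n w - Zs n v" by (simp add: algebra_simps)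
  qed
  have between: "Z u \<le> Zs n u \<and> Zs n u \<le> Z (u + h n)" for n u
  proof -
    obtain z where z: "u < z" "z < u + h n" "A (u + h n) - A u = (u + h n - u) * Z z"
      using MVT2[of u "u + h n" A Z] h[of n] A by auto
    then have "Zs n u = Z z" using h[of n] by (simp add: Zs_def)
    then show ?thesis using grows_mono[OF g] z by simp
  qed
  have "C1grows \<mu> (Zs n) (Zs' n)" for n
    unfolding C1grows_def
  proof (intro conjI allI gr D ge)
    show "continuous_on UNIV (Zs' n)" unfolding Zs'_def
      using g h[of n] by (auto simp: grows_def intro!: continuous_intros intro: continuous_on_compose2)
  qed
  then show thesis by (rule that[of Zs Zs']) (use between[unfolded h_def] in blast)+
qed

text \<open>The curve is trapped between \<open>Z\<close> and its shift by \<open>h\<close>, so the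
  root of the strictly increasing equation moves down by at most
  \<open>h + \<bar>k\<bar> * h / m\<close>, where \<open>m\<close> is the growth rate, and never
  up.\<close>

lemma fu_smoothing_tendsto:
  assumes g: "grows \<mu> Z" and l: "\<bar>l\<bar> \<le> 1" and p: "p \<in> slab l \<mu>"
    and gn: "\<And>n. grows \<mu> (Zs n)" and b: "\<And>n u. Z u \<le> Zs n u" "\<And>n u. Zs n u \<le> Z (u + 1 / real (Suc n))"
  shows "(\<lambda>n. fu l (Zs n) p) \<longlonglongrightarrow> fu l Z p" "(\<lambda>n. Zs n (fu l (Zs n) p)) \<longlonglongrightarrow> Z (fu l Z p)"
proof -
  define k where "k = l * fst p"
  define m where "m = (1 - k) * \<mu> + k"
  define h where "h n = 1 / real (Suc n)" for n
  have h: "0 < h n" for n by (simp add: h_def)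
  have k: "k < 1" "0 < m" using slab_less_1[OF l p] p by (auto simp: k_def m_def slab_def)
  define u un where "u = fu l Z p" and "un n = fu l (Zs n) p" for n
  have eq: "RR Z k u = cc l p" "RR (Zs n) k (un n) = cc l p" for n
    using fu_eq[OF g l p] fu_eq[OF gn l p] by (auto simp: k_def u_def un_def)
  have up: "un n \<le> u" for n
  proof -
    have "(1 - k) * Z (un n) \<le> (1 - k) * Zs n (un n)" using b(1) k by (intro mult_left_mono) auto
    then have "RR Z k (un n) \<le> RR Z k u" using eq(1) eq(2)[of n] by (simp add: RR_def)
    then show ?thesis using RR_strict[OF g k(1), of u "un n"] k(2) by (simp add: m_def not_less[symmetric])
  qed
  have lo: "u - (h n + \<bar>k\<bar> * h n / m) \<le> un n" for n
  proof (cases "u \<le> un n + h n")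
    case True
    have "0 \<le> \<bar>k\<bar> * h n / m" using h[of n] k by simp
    then show ?thesis using True by linarith
  next
    case False
    have "(1 - k) * Zs n (un n) \<le> (1 - k) * Z (un n + h n)" using b(2)[of n "un n"] k
      unfolding h_def by (intro mult_left_mono) auto
    then have 1: "RR Z k u + k * h n \<le> RR Z k (un n + h n)" using eq(2)[of n] eq(1) by (simp add: RR_def algebra_simps)
    have "m * (u - (un n + h n)) \<le> RR Z k u - RR Z k (un n + h n)"
      using RR_slope[OF g k(1), of "un n + h n" u] False by (simp add: m_def)
    also have "\<dots> \<le> \<bar>k\<bar> * h n" using 1 h[of n] by (smt (verit) mult_minus_left mult_right_mono abs_ge_minus_self)
    finally have "u - (un n + h n) \<le> \<bar>k\<bar> * h n / m" using k by (simp add: pos_le_divide_eq mult.commute)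
    then show ?thesis by linarith
  qed
  have h0: "h \<longlonglongrightarrow> 0" unfolding h_def[abs_def] using LIMSEQ_Suc[OF lim_1_over_n] by simp
  have "(\<lambda>n. u - (h n + \<bar>k\<bar> * h n / m)) \<longlonglongrightarrow> u - (0 + \<bar>k\<bar> * 0 / m)" by (intro tendsto_intros h0) (use k in auto)
  then have "(\<lambda>n. u - (h n + \<bar>k\<bar> * h n / m)) \<longlonglongrightarrow> u" by simp
  then have lim: "un \<longlonglongrightarrow> u"
    by (rule tendsto_sandwich[rotated 2, OF _ tendsto_const]) (use up lo in auto)
  then show "(\<lambda>n. fu l (Zs n) p) \<longlonglongrightarrow> fu l Z p" by (simp add: un_def[abs_def] u_def)
  have Zc: "isCont Z u" using g by (simp add: grows_def continuous_on_eq_continuous_at)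
  have "(\<lambda>n. un n + h n) \<longlonglongrightarrow> u + 0" by (intro tendsto_intros lim h0)
  then have "(\<lambda>n. Z (un n + h n)) \<longlonglongrightarrow> Z u" "(\<lambda>n. Z (un n)) \<longlonglongrightarrow> Z u"
    using isCont_tendsto_compose[OF Zc] lim by auto
  then have "(\<lambda>n. Zs n (un n)) \<longlonglongrightarrow> Z u"
    by (intro tendsto_sandwich[of "\<lambda>n. Z (un n)" "\<lambda>n. Zs n (un n)" sequentially "\<lambda>n. Z (un n + h n)"])
       (use b in \<open>auto simp: h_def\<close>)
  then show "(\<lambda>n. Zs n (fu l (Zs n) p)) \<longlonglongrightarrow> Z (fu l Z p)" by (simp add: un_def[abs_def] u_def)
qed

lemma smoothing_tendsto:
  assumes "grows \<mu> Z" and "\<bar>l\<bar> \<le> 1" and p: "p \<in> slab l \<mu>"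
    and "\<And>n. grows \<mu> (Zs n)" and "\<And>n u. Z u \<le> Zs n u" "\<And>n u. Zs n u \<le> Z (u + 1 / real (Suc n))"
  shows "(\<lambda>n. fM l (Zs n) p) \<longlonglongrightarrow> fM l Z p" "(\<lambda>n. fy0 l (Zs n) p) \<longlonglongrightarrow> fy0 l Z p"
proof -
  note u = fu_smoothing_tendsto[OF assms]
  have s: "(\<lambda>n. ruling_slope (Zs n) (fu l (Zs n) p)) \<longlonglongrightarrow> ruling_slope Z (fu l Z p)"
    unfolding ruling_slope_def by (intro tendsto_intros u)
  have ne: "l - fst p \<noteq> 0" using p by (auto simp: slab_def)
  show M: "(\<lambda>n. fM l (Zs n) p) \<longlonglongrightarrow> fM l Z p"
    unfolding fM_def by (intro tendsto_intros s ne)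
  show "(\<lambda>n. fy0 l (Zs n) p) \<longlonglongrightarrow> fy0 l Z p"
    unfolding fy0_def by (intro tendsto_intros s M)
qed

text \<open>The translates of a bounded piece by \<open>d / (k + 1)\<close> are pairwise disjoint,
  have equal measure and lie in one ball. Arbitrarily many of them fit, so the common measure is
  zero.\<close>

lemma negligible_line_sections:
  fixes d :: "'a::euclidean_space"
  assumes B: "B \<in> sets lebesgue" and inj: "\<And>p t. p \<in> B \<Longrightarrow> p + t *\<^sub>R d \<in> B \<Longrightarrow> t = 0"
  shows "negligible B"
proof -
  have "negligible (B \<inter> cball 0 (real n))" for n
  proof -
    define C where "C = B \<inter> cball 0 (real n)"
    have C: "C \<in> lmeasurable" unfolding C_def
      by (rule fmeasurable_Int_fmeasurable[OF lmeasurable_cball, of B 0 "real n", simplified Int_commute])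
         (use B in auto)
    define T where "T k = (+) ((1 / real (Suc k)) *\<^sub>R d) ` C" for k
    have T: "T k \<in> lmeasurable" "measure lebesgue (T k) = measure lebesgue C" for k
      unfolding T_def using C by (auto intro: measurable_translation measure_translation)
    have disj: "disjoint_family_on T {..<N}" for N
      unfolding disjoint_family_on_def
    proof (intro ballI impI)
      fix j k :: nat assume jk: "j \<noteq> k"
      show "T j \<inter> T k = {}"
      proof (rule ccontr)
        assume "T j \<inter> T k \<noteq> {}"
        then obtain c c' where c: "c \<in> B" "c' \<in> B" "(1 / real (Suc j)) *\<^sub>R d + c = (1 / real (Suc k)) *\<^sub>R d + c'"
          unfolding T_def C_def by auto
        then have "c' = c + (1 / real (Suc j) - 1 / real (Suc k)) *\<^sub>R d"
          by (simp add: algebra_simps)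
        then have "1 / real (Suc j) - 1 / real (Suc k) = 0" using inj c by metis
        then have "1 / real (Suc j) = 1 / real (Suc k)" by (simp only: right_minus_eq)
        then have "real (Suc j) = real (Suc k)" by (simp only: divide_cancel_left) simp
        then show False using jk by simp
      qed
    qed
    define L where "L = cball (0::'a) (real n + norm d)"
    have TL: "T k \<subseteq> L" for k
    proof -
      have "norm ((1 / real (Suc k)) *\<^sub>R d) \<le> norm d" by (simp add: field_simps mult_left_le_one_le)
      then show ?thesis unfolding T_def C_def L_def
        using norm_triangle_mono by (fastforce simp: add.commute)
    qed
    have bound: "real N * measure lebesgue C \<le> measure lebesgue L" for N
    proof -
      have "(\<Union>k<N. T k) \<in> lmeasurable" using T by (intro fmeasurable.finite_UN) auto
      moreover have "measure lebesgue (\<Union>k<N. T k) = (\<Sum>k<N. measure lebesgue (T k))"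
      proof (rule measure_finite_Union[OF _ _ disj])
        show "T ` {..<N} \<subseteq> sets lebesgue" using fmeasurableD[OF T(1)] by blast
        show "emeasure lebesgue (T k) \<noteq> \<infinity>" for k unfolding infinity_ennreal_def by (rule fmeasurableD2[OF T(1)])
      qed simp
      ultimately show ?thesis
        using T(2) measure_mono_fmeasurable[of "\<Union>k<N. T k" L lebesgue] TL
        by (auto simp: L_def fmeasurableD)
    qed
    have "measure lebesgue C = 0"
    proof (rule ccontr)
      assume "measure lebesgue C \<noteq> 0"
      then have pos: "0 < measure lebesgue C" by (simp add: zero_less_measure_iff)
      obtain N where "measure lebesgue L < real N * measure lebesgue C"
        using reals_Archimedean3[OF pos] by blast
      then show False using bound[of N] by simp
    qed
    then show ?thesis using C by (simp add: C_def[symmetric] negligible_iff_measure)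
  qed
  then have "negligible (\<Union>n. B \<inter> cball 0 (real n))" by (intro negligible_countable_Union) auto
  moreover have "(\<Union>n. B \<inter> cball 0 (real n)) = B" using real_arch_simple by (auto simp: mem_cball dist_norm)
  ultimately show ?thesis by simp
qed

text \<open>The lines \<open>{p \<cdot> (0,t,0)}\<close> are not parallel, but the shear \<open>(x,y,w) \<mapsto> (x, y, w + xy/2)\<close>
  straightens them.\<close>

lemma negligible_Y_line_sections:
  fixes A :: "hpt set"
  assumes A: "A \<in> sets borel"
    and inj: "\<And>x y y' w. (x, y, w + x * y / 2) \<in> A \<Longrightarrow> (x, y', w + x * y' / 2) \<in> A \<Longrightarrow> y = y'"
  shows "negligible A"
proof -
  define \<psi> :: "hpt \<Rightarrow> hpt" where "\<psi> p = (fst p, fst (snd p), snd (snd p) + fst p * fst (snd p) / 2)" for p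
  define B where "B = \<psi> -` A"
  have "continuous_on UNIV \<psi>" unfolding \<psi>_def by (intro continuous_intros) auto
  then have "\<psi> \<in> borel_measurable borel" by (rule borel_measurable_continuous_onI)
  then have "B \<in> sets borel" unfolding B_def using measurable_sets[of \<psi> borel borel A] A by simp
  then have "B \<in> sets lebesgue" by (intro sets_completionI_sets) simp
  then have nB: "negligible B"
  proof (rule negligible_line_sections[where d="(0,1,0)"])
    fix p :: hpt and t :: real assume h: "p \<in> B" "p + t *\<^sub>R (0, 1, 0) \<in> B"
    obtain x y w where p: "p = (x,y,w)" by (cases p)
    have "y = y + t" using h inj[of x y w "y + t"] by (auto simp: p B_def \<psi>_def)
    then show "t = 0" by simp
  qed
  have "\<psi> differentiable_on B"
    unfolding differentiable_on_def differentiable_def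
  proof (intro ballI exI)
    fix p
    show "(\<psi> has_derivative (\<lambda>h. (fst h, fst (snd h), snd (snd h) + (fst p * fst (snd h) + fst h * fst (snd p)) / 2)))
      (at p within B)"
      unfolding \<psi>_def by (auto intro!: derivative_eq_intros)
  qed
  then have "negligible (\<psi> ` B)"
    by (rule negligible_differentiable_image_negligible[OF order_refl nB])
  moreover have "A \<subseteq> \<psi> ` B"
  proof
    fix p assume "p \<in> A"
    moreover obtain x y z where p: "p = (x,y,z)" by (cases p)
    moreover have "\<psi> (x, y, z - x * y / 2) = p" by (simp add: \<psi>_def p)
    ultimately show "p \<in> \<psi> ` B" unfolding B_def by (metis image_eqI vimageI)
  qed
  ultimately show ?thesis by (rule negligible_subset)
qed

lemma borel_level_set:
  fixes g :: "hpt \<Rightarrow> real"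
  assumes "open S" "continuous_on S g"
  shows "{p \<in> S. g p = c} \<in> sets borel"
proof -
  obtain T where "closed T" "{p \<in> S. g p = c} = T \<inter> S"
    using continuous_closedin_preimage_constant[OF assms(2), of c] by (auto simp: closedin_closed Int_commute)
  then show ?thesis using assms(1) by simp
qed

section \<open>Graphical strips as families of rulings\<close>

text \<open>Surjectivity says that every point of the z-axis lies on a ruling. Injectivity may fail:
  rulings with different parameters can cross on the z-axis, and then \<open>Z\<close> is constant
  between them.\<close>

definition strip_param :: "(hpt \<Rightarrow> real) \<Rightarrow> (real \<Rightarrow> real) \<Rightarrow> bool" where
  "strip_param f Z \<longleftrightarrow> grows 0 Z \<and> surj Z \<and>
     (\<forall>v x. \<bar>x\<bar> \<le> 1 \<longrightarrow> f (x, 0, RR Z (x\<^sup>2) v) = x * ruling_slope Z v)"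

lemma mem_igraph_Kstrip:
  "(x, y, z) \<in> igraph Kstrip f \<longleftrightarrow> \<bar>x\<bar> \<le> 1 \<and> f (x, 0, z - x * y / 2) = y"
proof
  assume "(x, y, z) \<in> igraph Kstrip f"
  then obtain u where "u \<in> Kstrip" "(x, y, z) = hmul u (0, f u, 0)" unfolding igraph_def by auto
  then show "\<bar>x\<bar> \<le> 1 \<and> f (x, 0, z - x * y / 2) = y"
    by (cases u) (auto simp: Kstrip_def hmul_def)
next
  assume h: "\<bar>x\<bar> \<le> 1 \<and> f (x, 0, z - x * y / 2) = y"
  then have "(x, y, z) = hmul (x, 0, z - x * y / 2) (0, f (x, 0, z - x * y / 2), 0)"
    by (simp add: hmul_def)
  moreover have "(x, 0, z - x * y / 2) \<in> Kstrip" using h by (auto simp: Kstrip_def)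
  ultimately show "(x, y, z) \<in> igraph Kstrip f" unfolding igraph_def by blast
qed

lemma mem_iepigraph_Kstrip:
  "(x, y, z) \<in> iepigraph Kstrip f \<longleftrightarrow> \<bar>x\<bar> \<le> 1 \<and> f (x, 0, z - x * y / 2) < y"
proof
  assume "(x, y, z) \<in> iepigraph Kstrip f"
  then obtain u t where "u \<in> Kstrip" "f u < t" "(x, y, z) = hmul u (0, t, 0)" unfolding iepigraph_def by auto
  then show "\<bar>x\<bar> \<le> 1 \<and> f (x, 0, z - x * y / 2) < y"
    by (cases u) (auto simp: Kstrip_def hmul_def)
next
  assume h: "\<bar>x\<bar> \<le> 1 \<and> f (x, 0, z - x * y / 2) < y"
  then have "(x, y, z) = hmul (x, 0, z - x * y / 2) (0, y, 0)"
    by (simp add: hmul_def)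
  moreover have "(x, 0, z - x * y / 2) \<in> Kstrip" using h by (auto simp: Kstrip_def)
  ultimately show "(x, y, z) \<in> iepigraph Kstrip f" unfolding iepigraph_def using h by blast
qed

lemma igraph_boundary_Kstrip: "(x, y, z) \<in> igraph_boundary Kstrip f \<Longrightarrow> \<bar>x\<bar> = 1"
proof -
  assume "(x, y, z) \<in> igraph_boundary Kstrip f"
  then obtain u where u: "u \<in> Kstrip" "u \<in> closure (V0 - Kstrip)" "(x, y, z) = hmul u (0, f u, 0)"
    unfolding igraph_boundary_def igraph_def V0_boundary_def by auto
  have "closed {p :: hpt. 1 \<le> \<bar>fst p\<bar>}" by (intro closed_Collect_le continuous_intros)
  moreover have "V0 - Kstrip \<subseteq> {p. 1 \<le> \<bar>fst p\<bar>}" by (auto simp: V0_def Kstrip_def)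
  ultimately have "closure (V0 - Kstrip) \<subseteq> {p. 1 \<le> \<bar>fst p\<bar>}" by (intro closure_minimal)
  then have "1 \<le> \<bar>fst u\<bar>" using u(2) by auto
  then show ?thesis using u(1,3) by (cases u) (auto simp: Kstrip_def hmul_def)
qed

text \<open>The abscissas of the ends are 1 or -1 and must be opposite for the segment to reach
  \<open>x = 0\<close>. The point on the z-axis is then the midpoint, so the
  \<open>y\<close>-coordinates are opposite as well and the height is constant.\<close>

lemma ruling_shape:
  assumes "\<bar>fst p\<bar> = 1" "\<bar>fst q\<bar> = 1" "horizontal_vec (hmul (hinv p) q)" "hsegment p q \<inter> zaxis \<noteq> {}"
  shows "\<exists>s z. hsegment p q = {(x, x * s, z) |x. \<bar>x\<bar> \<le> 1}"
proof -
  obtain x1 y1 z1 where p: "p = (x1, y1, z1)" by (cases p)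
  obtain x2 y2 z2 where q: "q = (x2, y2, z2)" by (cases q)
  have h: "z2 - z1 + (y1 * x2 - x1 * y2) / 2 = 0"
    using assms(3) by (simp add: horizontal_vec_def hmul_def hinv_def p q)
  have pt: "hmul p (hscale t (hmul (hinv p) q)) =
      (x1 + t * (x2 - x1), y1 + t * (y2 - y1), z1 + t * (x1 * y2 - y1 * x2) / 2)" for t
  proof -
    have "z1 + t * (- z1 + z2 + (- x1 * y2 - - y1 * x2) / 2) + (x1 * (t * (- y1 + y2)) - y1 * (t * (- x1 + x2))) / 2
      = z1 + t * (z2 - z1 + (y1 * x2 - x1 * y2) / 2) + t * (x1 * y2 - y1 * x2) / 2"
      by (simp add: field_simps)
    then show ?thesis using h by (simp add: hmul_def hinv_def hscale_def p q algebra_simps)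
  qed
  obtain t0 where t0: "0 \<le> t0" "t0 \<le> 1" "x1 + t0 * (x2 - x1) = 0" "y1 + t0 * (y2 - y1) = 0"
    using assms(4) unfolding hsegment_def pt zaxis_def by auto
  have x: "x2 = - x1" "x1 * x1 = 1" using assms(1,2) t0(3) by (auto simp: p q abs_if split: if_splits)
  have "x1 * (1 - 2 * t0) = 0" using t0(3) by (simp add: x(1) algebra_simps)
  moreover have "x1 \<noteq> 0" using x(2) by auto
  ultimately have "t0 = 1/2" by simp
  have xx: "x1 * (x1 * w) = w" for w using x(2) by (simp flip: mult.assoc)
  from \<open>t0 = 1/2\<close> have "y1 + (1/2) * (y2 - y1) = 0" using t0(4) by (simp only:)
  then have y: "y2 = - y1" by (simp add: field_simps)
  have "hsegment p q = {(x, x * (x1 * y1), z1) |x. \<bar>x\<bar> \<le> 1}"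
  proof
    show "hsegment p q \<subseteq> {(x, x * (x1 * y1), z1) |x. \<bar>x\<bar> \<le> 1}"
    proof
      fix r assume "r \<in> hsegment p q"
      then obtain t where t: "0 \<le> t" "t \<le> 1" "r = (x1 + t * (x2 - x1), y1 + t * (y2 - y1), z1 + t * (x1 * y2 - y1 * x2) / 2)"
        unfolding hsegment_def pt by auto
      have "r = ((1 - 2 * t) * x1, (1 - 2 * t) * x1 * (x1 * y1), z1)"
        unfolding t(3) x(1) y using x(2) by (simp add: algebra_simps xx)
      moreover have "\<bar>(1 - 2 * t) * x1\<bar> \<le> 1" using t assms(1) by (simp add: p abs_mult)
      ultimately show "r \<in> {(x, x * (x1 * y1), z1) |x. \<bar>x\<bar> \<le> 1}" by blast
    qed
    show "{(x, x * (x1 * y1), z1) |x. \<bar>x\<bar> \<le> 1} \<subseteq> hsegment p q"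
    proof clarify
      fix r :: real assume r: "\<bar>r\<bar> \<le> 1"
      define t where "t = (1 - r * x1) / 2"
      have "\<bar>r * x1\<bar> \<le> 1" using r assms(1) by (simp add: p abs_mult)
      then have "0 \<le> t" "t \<le> 1" unfolding t_def by auto
      moreover have "(r, r * (x1 * y1), z1) = (x1 + t * (x2 - x1), y1 + t * (y2 - y1), z1 + t * (x1 * y2 - y1 * x2) / 2)"
        unfolding x(1) y t_def using x(2) by (simp add: field_simps xx)
      ultimately show "(r, r * (x1 * y1), z1) \<in> hsegment p q" unfolding hsegment_def pt by blast
    qed
  qed
  then show ?thesis by blast
qed

lemma graphical_strip_param:
  assumes "graphical_strip Kstrip f"
  obtains Z where "strip_param f Z"
proof -
  note strip = assms[unfolded graphical_strip_def]
  have fc: "continuous_on Kstrip f" using strip by (rule conjunct1[OF conjunct2])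
  from strip obtain R where R: "igraph Kstrip f = \<Union>R"
    and rul: "\<And>S. S \<in> R \<Longrightarrow> (\<exists>p q. horizontal_vec (hmul (hinv p) q) \<and> S = hsegment p q \<and>
                      p \<in> igraph_boundary Kstrip f \<and> q \<in> igraph_boundary Kstrip f) \<and> S \<inter> zaxis \<noteq> {}"
    by (elim conjE exE) (rule, assumption, drule (1) bspec)
  have shape: "\<exists>s z. S = {(x, x * s, z) |x. \<bar>x\<bar> \<le> 1}" if SR: "S \<in> R" for S
  proof -
    obtain p q where "horizontal_vec (hmul (hinv p) q)" "S = hsegment p q"
      "p \<in> igraph_boundary Kstrip f" "q \<in> igraph_boundary Kstrip f" "S \<inter> zaxis \<noteq> {}"
      using rul[OF SR] by blast
    then show ?thesis using ruling_shape[of p q] igraph_boundary_Kstrip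
      by (metis prod.collapse)
  qed
  have through: "\<exists>s \<zeta>. (\<forall>x. \<bar>x\<bar> \<le> 1 \<longrightarrow> (x, x * s, \<zeta>) \<in> igraph Kstrip f) \<and> P = (fst P, fst P * s, \<zeta>)"
    if P: "P \<in> igraph Kstrip f" for P
  proof -
    obtain S where "S \<in> R" "P \<in> S" using P R by blast
    then obtain s \<zeta> where "S = {(x, x * s, \<zeta>) |x. \<bar>x\<bar> \<le> 1}" using shape by blast
    moreover from this \<open>P \<in> S\<close> obtain x where "P = (x, x * s, \<zeta>)" by blast
    moreover have "S \<subseteq> igraph Kstrip f" using R \<open>S \<in> R\<close> by blast
    ultimately show ?thesis by (intro exI[of _ s] exI[of _ \<zeta>]) (simp add: subset_iff)
  qed
  \<comment> \<open>The point of the graph over \<open>(1, 0, v)\<close> has height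
    \<open>v + x * y / 2\<close> with \<open>x = 1\<close> and \<open>y = f (1, 0, v)\<close>, and
    this is the constant height of its ruling.\<close>
  define Z where "Z v = v + f (1, 0, v) / 2" for v
  have main: "f (x, 0, RR Z (x\<^sup>2) v) = x * ruling_slope Z v" if "\<bar>x\<bar> \<le> 1" for v x
  proof -
    have "(1, f (1, 0, v), Z v) \<in> igraph Kstrip f" by (simp add: mem_igraph_Kstrip Z_def)
    from through[OF this] obtain s \<zeta> where s: "\<forall>x. \<bar>x\<bar> \<le> 1 \<longrightarrow> (x, x * s, \<zeta>) \<in> igraph Kstrip f"
      "s = f (1, 0, v)" "\<zeta> = Z v" by auto
    have "ruling_slope Z v = s" by (simp add: ruling_slope_def Z_def s)
    have "f (x, 0, Z v - x * (x * s) / 2) = x * s" using s that by (auto simp: mem_igraph_Kstrip)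
    moreover have "Z v - x * (x * s) / 2 = RR Z (x\<^sup>2) v"
      by (simp add: RR_def Z_def s(2) power2_eq_square field_simps)
    ultimately show ?thesis using \<open>ruling_slope Z v = s\<close> by simp
  qed
  have zc: "continuous_on UNIV Z"
  proof -
    have "continuous_on UNIV (\<lambda>v::real. f (1, 0, v))"
      by (rule continuous_on_compose2[OF fc]) (auto simp: Kstrip_def intro!: continuous_intros)
    then show ?thesis unfolding Z_def[abs_def] by (intro continuous_intros) auto
  qed
  have mono: "Z v \<le> Z w" if "v \<le> w" for v w
  proof (rule ccontr)
    assume "\<not> Z v \<le> Z w"
    then have lt: "Z w < Z v" "v < w" using that by (auto simp: not_le order_le_less)
    \<comment> \<open>If the order of the heights were reversed, the two rulings would lie over the
      same point of \<open>V0\<close> at abscissa \<open>sqrt t\<close>. The graph is single-valued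
      there, so their slopes would agree.\<close>
    define t where "t = (Z v - Z w) / ((w - v) + (Z v - Z w))"
    have t: "0 \<le> t" "t \<le> 1" "t \<noteq> 0" using lt by (auto simp: t_def)
    have "t * ((w - v) + (Z v - Z w)) = Z v - Z w" using lt by (simp add: t_def)
    then have "RR Z t v = RR Z t w" by (simp add: RR_def algebra_simps)
    moreover have "(sqrt t)\<^sup>2 = t" "\<bar>sqrt t\<bar> \<le> 1" "sqrt t \<noteq> 0" using t by auto
    ultimately have "sqrt t * ruling_slope Z v = sqrt t * ruling_slope Z w" using main[of "sqrt t" v] main[of "sqrt t" w] by simp
    then have "ruling_slope Z v = ruling_slope Z w" using \<open>sqrt t \<noteq> 0\<close> by simp
    then show False using lt by (simp add: ruling_slope_def)
  qed
  have "surj Z"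
    unfolding surj_def
  proof
    fix \<zeta> :: real
    have "(0, f (0, 0, \<zeta>), \<zeta>) \<in> igraph Kstrip f" by (simp add: mem_igraph_Kstrip)
    from through[OF this] obtain s where "\<forall>x. \<bar>x\<bar> \<le> 1 \<longrightarrow> (x, x * s, \<zeta>) \<in> igraph Kstrip f" by auto
    then have "(1, s, \<zeta>) \<in> igraph Kstrip f" by (metis abs_one mult_1 order_refl)
    then have "Z (\<zeta> - s / 2) = \<zeta>" by (simp add: mem_igraph_Kstrip Z_def)
    then show "\<exists>v. \<zeta> = Z v" by metis
  qed
  moreover have "grows 0 Z" using zc mono by (simp add: grows_def)
  ultimately show thesis using that main unfolding strip_param_def by blast
qed

lemma strip_f: "strip_param f Z \<Longrightarrow> \<bar>x\<bar> \<le> 1 \<Longrightarrow> f (x, 0, RR Z (x\<^sup>2) v) = x * ruling_slope Z v"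
  by (simp add: strip_param_def)

lemma strip_RR_surj:
  assumes "strip_param f Z" "\<bar>x\<bar> \<le> 1"
  shows "\<exists>v. RR Z (x\<^sup>2) v = w"
proof -
  have x2: "x\<^sup>2 \<le> 1" using assms by (simp add: abs_square_le_1)
  consider "x = 0" | "x\<^sup>2 = 1" | "x \<noteq> 0" "x\<^sup>2 < 1" using x2 by linarith
  then show ?thesis
  proof cases
    case 1
    have "\<exists>v. Z v = w" using assms(1) unfolding strip_param_def by (metis surjD)
    then show ?thesis using 1 by (simp add: RR_def)
  next
    case 2
    then show ?thesis by (auto simp: RR_def)
  next
    case 3
    then show ?thesis using RR_surj[of 0 Z "x\<^sup>2" w] assms(1) by (auto simp: strip_param_def)
  qed
qed

lemma igraph_strip:
  assumes "strip_param f Z"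
  shows "igraph Kstrip f = {(x, x * ruling_slope Z v, Z v) |x v. \<bar>x\<bar> \<le> 1}"
proof -
  have eq: "Z v - x * (x * ruling_slope Z v) / 2 = RR Z (x\<^sup>2) v" for x v
    by (simp add: RR_def ruling_slope_def power2_eq_square field_simps)
  have "(x, y, z) \<in> igraph Kstrip f \<longleftrightarrow> (\<exists>v. \<bar>x\<bar> \<le> 1 \<and> y = x * ruling_slope Z v \<and> z = Z v)" for x y z
  proof
    assume h: "(x, y, z) \<in> igraph Kstrip f"
    then have x: "\<bar>x\<bar> \<le> 1" by (simp add: mem_igraph_Kstrip)
    obtain v where v: "RR Z (x\<^sup>2) v = z - x * y / 2" using strip_RR_surj[OF assms x] by blast
    have "y = x * ruling_slope Z v" using h strip_f[OF assms x, of v] v by (simp add: mem_igraph_Kstrip)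
    moreover from this have "z = Z v" using v eq[of v x] by simp
    ultimately show "\<exists>v. \<bar>x\<bar> \<le> 1 \<and> y = x * ruling_slope Z v \<and> z = Z v" using x by blast
  next
    assume "\<exists>v. \<bar>x\<bar> \<le> 1 \<and> y = x * ruling_slope Z v \<and> z = Z v"
    then show "(x, y, z) \<in> igraph Kstrip f" using strip_f[OF assms] eq by (auto simp: mem_igraph_Kstrip)
  qed
  then show ?thesis by auto
qed

section \<open>The epigraph in the coordinates of the foliation\<close>

text \<open>\<open>RR Z (x\<^sup>2) u\<close> is the \<open>V0\<close>-coordinate \<open>z - xy/2\<close> of the point \<open>(x, x * ruling_slope Z u, Z u)\<close> of the strip.\<close>

lemma fol_coords:
  assumes "grows \<mu> Z" "\<bar>l\<bar> \<le> 1" "p \<in> slab l \<mu>"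
  defines "u \<equiv> fu l Z p" and "d \<equiv> fst (snd p) - fst p * ruling_slope Z (fu l Z p)"
  shows "fy0 l Z p = l / (l - fst p) * d"
    and "snd (snd p) - fst p * fst (snd p) / 2 = RR Z ((fst p)\<^sup>2) u + (l - fst p) * d / 2"
proof -
  define x y z where "x = fst p" and "y = fst (snd p)" and "z = snd (snd p)"
  have ne: "l - x \<noteq> 0" using assms(3) by (auto simp: slab_def x_def)
  have "fy0 l Z p = l * (ruling_slope Z u - (l * ruling_slope Z u - y) / (l - x))"
    by (simp add: fy0_def fM_def u_def x_def y_def)
  also have "ruling_slope Z u - (l * ruling_slope Z u - y) / (l - x) = (y - x * ruling_slope Z u) / (l - x)"
    using ne by (simp add: field_simps)
  finally show "fy0 l Z p = l / (l - fst p) * d" by (simp add: d_def x_def y_def u_def)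
  have "z - l * y / 2 = RR Z (l * x) u" using fu_eq[OF assms(1-3)] by (simp add: cc_def x_def y_def z_def u_def)
  then have z: "z = RR Z (l * x) u + l * y / 2" by simp
  have "z - x * y / 2 = RR Z (x\<^sup>2) u + (l - x) * (y - x * ruling_slope Z u) / 2"
    unfolding z by (simp add: RR_def ruling_slope_def power2_eq_square field_simps)
  then show "snd (snd p) - fst p * fst (snd p) / 2 = RR Z ((fst p)\<^sup>2) u + (l - fst p) * d / 2"
    by (simp add: d_def x_def y_def z_def u_def)
qed

lemma slab_square:
  assumes "0 \<le> \<mu>" "p \<in> slab l \<mu>"
  shows "(fst p)\<^sup>2 < 1" "0 < (1 - (fst p)\<^sup>2) * \<mu> + (fst p)\<^sup>2"
proof -
  show lt: "(fst p)\<^sup>2 < 1" using assms(2) by (simp add: slab_def abs_square_less_1)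
  show "0 < (1 - (fst p)\<^sup>2) * \<mu> + (fst p)\<^sup>2"
  proof (cases "fst p = 0")
    case True
    then show ?thesis using assms by (simp add: slab_def)
  next
    case False
    then show ?thesis using assms lt by (intro add_nonneg_pos mult_nonneg_nonneg) auto
  qed
qed

text \<open>Let \<open>u\<close> be the parameter of the foliation line through \<open>p\<close>,
  and \<open>v\<close> that of the ruling over the same point of \<open>V0\<close>. The excess of
  \<open>y\<close> over either one is, up to the factor \<open>(l - x) / 2\<close>, the difference
  of an increasing function at \<open>v\<close> and \<open>u\<close>. So both excesses have the same
  sign, and the first one is a positive multiple of the intercept.\<close>

lemma mem_iepigraph_iff_fy0:
  assumes f: "strip_param f Z" and g: "grows \<mu> Z" and l: "\<bar>l\<bar> \<le> 1" and p: "p \<in> slab l \<mu>"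
  shows "p \<in> iepigraph Kstrip f \<longleftrightarrow> 0 < fy0 l Z p"
proof -
  obtain x y z where pe: "p = (x, y, z)" by (cases p)
  have x1: "\<bar>x\<bar> \<le> 1" using p by (simp add: slab_def pe)
  obtain v where v: "RR Z (x\<^sup>2) v = z - x * y / 2" using strip_RR_surj[OF f x1] by blast
  define u d where "u = fu l Z p" and "d = y - x * ruling_slope Z u"
  have mu: "0 \<le> \<mu>" using g by (simp add: grows_def)
  have k: "l * x < 1" "0 < (1 - l * x) * \<mu> + l * x" using slab_less_1[OF l p] p by (auto simp: slab_def pe)
  have k2: "x\<^sup>2 < 1" "0 < (1 - x\<^sup>2) * \<mu> + x\<^sup>2" using slab_square[OF mu p] by (auto simp: pe)
  have fy: "fy0 l Z p = l / (l - x) * d" and w: "z - x * y / 2 = RR Z (x\<^sup>2) u + (l - x) * d / 2"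
    using fol_coords[OF g l p] by (auto simp: pe u_def d_def)
  have lp: "0 < l / (l - x)" using p by (auto simp: slab_def pe zero_less_mult_iff zero_less_divide_iff)
  \<comment> \<open>The same pair of parameters is compared twice, with the weight
    \<open>x\<^sup>2\<close> of the rulings and the weight \<open>l * x\<close> of the foliation
    lines.\<close>
  have e1: "RR Z (x\<^sup>2) v - RR Z (x\<^sup>2) u = (l - x) * d / 2" using v w by simp
  have e2: "RR Z (l * x) v - RR Z (l * x) u = (l - x) * (y - x * ruling_slope Z v) / 2"
  proof -
    have "(l - x) * (y - x * ruling_slope Z v) / 2 = (l - x) * d / 2 + (l - x) * x * (ruling_slope Z u - ruling_slope Z v) / 2"
      by (simp add: d_def algebra_simps add_divide_distrib diff_divide_distrib)
    moreover have "RR Z (l * x) v - RR Z (l * x) u - (RR Z (x\<^sup>2) v - RR Z (x\<^sup>2) u) = (l - x) * x * (ruling_slope Z u - ruling_slope Z v) / 2"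
      by (simp add: RR_def ruling_slope_def power2_eq_square field_simps)
    ultimately show ?thesis using e1 by linarith
  qed
  have i1: "0 < (l - x) * d \<longleftrightarrow> u < v" using RR_strict[OF g k2, of u v] e1 by auto
  have i2: "0 < (l - x) * (y - x * ruling_slope Z v) \<longleftrightarrow> u < v" using RR_strict[OF g k, of u v] e2 by auto
  have j1: "(l - x) * d < 0 \<longleftrightarrow> v < u" using RR_strict[OF g k2, of v u] e1 by (auto simp: field_simps)
  have j2: "(l - x) * (y - x * ruling_slope Z v) < 0 \<longleftrightarrow> v < u" using RR_strict[OF g k, of v u] e2 by (auto simp: field_simps)
  have lx: "l - x \<noteq> 0" using lp by auto
  have "0 < d \<longleftrightarrow> 0 < y - x * ruling_slope Z v"
  proof (cases "0 < l - x")
    case True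
    then show ?thesis using i1 i2 by (simp add: zero_less_mult_iff)
  next
    case False
    then have "l - x < 0" using lx by simp
    then show ?thesis using j1 j2 by (simp add: mult_less_0_iff)
  qed
  moreover have "f (x, 0, z - x * y / 2) = x * ruling_slope Z v" using strip_f[OF f x1, of v] v by simp
  moreover have "0 < fy0 l Z p \<longleftrightarrow> 0 < d" unfolding fy by (meson lp mult_pos_pos zero_less_mult_pos)
  ultimately show ?thesis using x1 by (simp add: mem_iepigraph_Kstrip pe)
qed

text \<open>On the zero set the height over \<open>V0\<close> determines the parameter by strict
  monotonicity, and the parameter determines \<open>y\<close>. Each Y-line is therefore met at most
  once.\<close>

lemma negligible_fy0_zero:
  assumes g: "grows \<mu> Z" and l: "\<bar>l\<bar> \<le> 1"
  shows "negligible {p \<in> slab l \<mu>. fy0 l Z p = 0}"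
proof (rule negligible_Y_line_sections)
  have mu: "0 \<le> \<mu>" using g by (simp add: grows_def)
  have sgc: "continuous_on (slab l \<mu>) (\<lambda>p. ruling_slope Z (fu l Z p))"
    unfolding ruling_slope_def using g
    by (intro continuous_intros fu_continuous[OF g l] continuous_on_compose2[OF _ fu_continuous[OF g l], of UNIV Z])
       (auto simp: grows_def)
  have "continuous_on (slab l \<mu>) (fy0 l Z)"
    unfolding fy0_def fM_def by (intro continuous_intros sgc) (auto simp: slab_def)
  then show "{p \<in> slab l \<mu>. fy0 l Z p = 0} \<in> sets borel"
    by (rule borel_level_set[OF open_slab])
  fix x y y' w
  assume a: "(x, y, w + x * y / 2) \<in> {p \<in> slab l \<mu>. fy0 l Z p = 0}"
    "(x, y', w + x * y' / 2) \<in> {p \<in> slab l \<mu>. fy0 l Z p = 0}"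
  have *: "y = x * ruling_slope Z (fu l Z (x, y, w + x * y / 2)) \<and> RR Z (x\<^sup>2) (fu l Z (x, y, w + x * y / 2)) = w"
    if "(x, y, w + x * y / 2) \<in> {p \<in> slab l \<mu>. fy0 l Z p = 0}" for y
  proof -
    have s: "(x, y, w + x * y / 2) \<in> slab l \<mu>" using that by auto
    have "l / (l - x) \<noteq> 0" using s by (auto simp: slab_def)
    then show ?thesis using fol_coords[OF g l s] that by auto
  qed
  have k2: "x\<^sup>2 < 1" "0 < (1 - x\<^sup>2) * \<mu> + x\<^sup>2" using slab_square[OF mu, of "(x, y, w + x * y / 2)" l] a by auto
  show "y = y'" using *[OF a(1)] *[OF a(2)] RR_inj[OF g k2] by metis
qed

section \<open>Sufficiency\<close>

lemma koranyi_continuous: "continuous_on UNIV koranyi"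
proof -
  have *: "koranyi = (\<lambda>p. root 4 (((fst p)\<^sup>2 + (fst (snd p))\<^sup>2)\<^sup>2 + (snd (snd p))\<^sup>2))"
    by (auto simp: koranyi_def split: prod.splits)
  moreover have "continuous_on UNIV (\<lambda>p::hpt. root 4 (((fst p)\<^sup>2 + (fst (snd p))\<^sup>2)\<^sup>2 + (snd (snd p))\<^sup>2))"
    by (intro continuous_intros)
  ultimately show ?thesis by metis
qed

lemma hball_0: "hball (0,0,0) r = {q. koranyi q < r}"
  by (auto simp: hball_def hinv_def hmul_def split: prod.splits)

lemma open_hball_0: "open (hball (0,0,0) r)"
  unfolding hball_0 by (intro open_Collect_less koranyi_continuous continuous_intros)

lemma open_Uslab: "open Uslab"
proof -
  have "Uslab = {p. \<bar>fst p\<bar> < 1}" by (auto simp: Uslab_def)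
  moreover have "open {p::hpt. \<bar>fst p\<bar> < 1}" by (intro open_Collect_less continuous_intros)
  ultimately show ?thesis by simp
qed

lemma iepigraph_slab_measurable:
  assumes f: "strip_param f Z" and g: "grows \<mu> Z" and l: "\<bar>l\<bar> \<le> 1"
  shows "iepigraph Kstrip f \<inter> slab l \<mu> \<in> sets lebesgue"
proof -
  have "continuous_on (slab l \<mu>) (fy0 l Z)"
    unfolding fy0_def fM_def ruling_slope_def using g
    by (intro continuous_intros fu_continuous[OF g l] continuous_on_compose2[OF _ fu_continuous[OF g l], of UNIV Z])
       (auto simp: grows_def slab_def)
  then have "open (slab l \<mu> \<inter> fy0 l Z -` {0<..})"
    by (intro continuous_open_preimage open_slab open_greaterThan)
  moreover have "iepigraph Kstrip f \<inter> slab l \<mu> = slab l \<mu> \<inter> fy0 l Z -` {0<..}"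
    using mem_iepigraph_iff_fy0[OF f g l] by auto
  ultimately show ?thesis by (intro sets_completionI_sets) simp
qed

text \<open>The level sets of the intercept at \<open>x = 0\<close> consist of foliation lines and
  the epigraph is its positive set, so steep step functions of the intercept serve as smoothed
  indicators.\<close>

lemma epigraph_calibrated:
  assumes f: "strip_param f Z" and g: "grows \<mu> Z" and l: "\<bar>l\<bar> \<le> 1"
    and K: "compact K" "K \<subseteq> slab l \<mu>"
    and kap: "C1on UNIV \<kappa> d\<kappa>" "\<And>p. p \<notin> K \<Longrightarrow> \<kappa> p = 0" "\<And>p. 0 \<le> \<kappa> p"
    and a: "C1on UNIV a da" and b: "C1on UNIV b db" and ab: "\<And>p. (a p)\<^sup>2 + (b p)\<^sup>2 \<le> 1"
  shows "0 \<le> set_lebesgue_integral lebesgue (iepigraph Kstrip f \<inter> slab l \<mu>) (calib \<kappa> d\<kappa> (fM l Z) a da b db)"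
proof -
  obtain Zs Zs' where Zs: "\<And>n. C1grows \<mu> (Zs n) (Zs' n)"
    "\<And>n u. Z u \<le> Zs n u" "\<And>n u. Zs n u \<le> Z (u + 1 / real (Suc n))"
    using smoothing_exists[OF g] by metis
  have gn: "grows \<mu> (Zs n)" for n using Zs(1) by (simp add: C1grows_def)
  define \<theta> where "\<theta> n p = hstep (real n * fy0 l (Zs n) p)" for n p
  define d\<theta> where "d\<theta> n e p = hstep' (real n * fy0 l (Zs n) p) * (real n * dfy0 l (Zs n) (Zs' n) e p)" for n e p
  have yC: "C1on (slab l \<mu>) (\<lambda>p. real n * fy0 l (Zs n) p) (\<lambda>e p. real n * dfy0 l (Zs n) (Zs' n) e p)" for n
    using C1on_mult[OF C1on_const[where c="real n"] fy0_C1[OF l Zs(1)]] by simp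
  have thC: "C1on (slab l \<mu>) (\<theta> n) (d\<theta> n)" for n
    unfolding \<theta>_def[abs_def] d\<theta>_def[abs_def] by (rule C1on_hstep[OF yC])
  have X: "Xd (d\<theta> n) p = hstep' (real n * fy0 l (Zs n) p) * (real n * Xd (dfy0 l (Zs n) (Zs' n)) p)"
    and Y: "Yd (d\<theta> n) p = hstep' (real n * fy0 l (Zs n) p) * (real n * Yd (dfy0 l (Zs n) (Zs' n)) p)" for n p
    by (simp_all add: d\<theta>_def Xd_def Yd_def algebra_simps)
  show ?thesis
  proof (rule calibrated_limit[OF open_slab K kap a b ab thC fM_C1[OF l Zs(1)] V_fM[OF l Zs(1)]])
    fix n p assume p: "p \<in> slab l \<mu>"
    show "Xd (d\<theta> n) p + fM l (Zs n) p * Yd (d\<theta> n) p = 0"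
    proof -
      have "Xd (d\<theta> n) p + fM l (Zs n) p * Yd (d\<theta> n) p = hstep' (real n * fy0 l (Zs n) p) * real n *
        (Xd (dfy0 l (Zs n) (Zs' n)) p + fM l (Zs n) p * Yd (dfy0 l (Zs n) (Zs' n)) p)"
        unfolding X Y by (simp add: algebra_simps)
      then show ?thesis using V_fy0[OF l Zs(1) p] by simp
    qed
    show "0 \<le> Yd (d\<theta> n) p" unfolding Y
      using Yd_fy0_nonneg[OF l Zs(1) p] hstep'_nonneg by (intro mult_nonneg_nonneg) auto
    show "\<bar>\<theta> n p\<bar> \<le> 1" using hstep_bounds by (simp add: \<theta>_def)
  next
    fix p assume p: "p \<in> slab l \<mu>"
    show "(\<lambda>n. fM l (Zs n) p) \<longlonglongrightarrow> fM l Z p" by (rule smoothing_tendsto[OF g l p gn Zs(2,3)])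
    assume "p \<notin> {p \<in> slab l \<mu>. fy0 l Z p = 0}"
    then have ne: "fy0 l Z p \<noteq> 0" using p by auto
    have "(\<lambda>n. fy0 l (Zs n) p) \<longlonglongrightarrow> fy0 l Z p" by (rule smoothing_tendsto[OF g l p gn Zs(2,3)])
    from hstep_sequence[OF this ne]
    show "(\<lambda>n. \<theta> n p) \<longlonglongrightarrow> indicator (iepigraph Kstrip f \<inter> slab l \<mu>) p"
      using mem_iepigraph_iff_fy0[OF f g l p] p by (auto simp: \<theta>_def indicator_def)
  next
    show "negligible {p \<in> slab l \<mu>. fy0 l Z p = 0}" by (rule negligible_fy0_zero[OF g l])
  qed (assumption | rule iepigraph_slab_measurable[OF f g l])+
qed

text \<open>The rate \<open>(1 - x) / 2 + x = (1 + x) / 2\<close> is positive exactly for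
  \<open>x > -1\<close>: with rate 1/2 the lines through \<open>x = 1\<close> reach the opposite
  wall without crossing.\<close>

lemma slab_1_half: "slab 1 (1/2) = Uslab"
  by (auto simp: slab_def Uslab_def field_simps)

text \<open>With a cutoff \<open>\<eta>\<close> equal to 1 near the support of \<open>(a, b)\<close>
  and near the difference of the two sets, let \<open>h\<close> be the divergence of
  \<open>\<eta>\<close> times the calibrating field. The integral of the divergence of
  \<open>(a, b)\<close> over the epigraph is at most that of \<open>h\<close>. The latter is the
  same for \<open>F\<close>, because \<open>h\<close> vanishes where the sets differ, and it bounds
  the perimeter of \<open>F\<close> from below.\<close>

lemma strip_minimizer:
  assumes f: "strip_param f Z" and g: "grows (1/2) Z"
  shows "perimeter_minimizer (iepigraph Kstrip f) Uslab"
  unfolding perimeter_minimizer_def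
proof (intro allI impI ballI)
  fix r :: real and F :: "hpt set" assume r: "0 < r" and F: "F \<in> sets lebesgue"
  define E where "E = iepigraph Kstrip f"
  define \<Omega> where "\<Omega> = hball (0,0,0) r \<inter> Uslab"
  define D where "D = closure ((iepigraph Kstrip f - F) \<union> (F - iepigraph Kstrip f))"
  assume "compact (closure (iepigraph Kstrip f - F \<union> (F - iepigraph Kstrip f))) \<and>
    closure (iepigraph Kstrip f - F \<union> (F - iepigraph Kstrip f)) \<subseteq> hball (0, 0, 0) r \<inter> Uslab"
  then have D: "compact D" "D \<subseteq> \<Omega>" by (auto simp: D_def \<Omega>_def)
  have O: "open \<Omega>" unfolding \<Omega>_def by (intro open_Int open_hball_0 open_Uslab)
  have l: "\<bar>1::real\<bar> \<le> 1" by simp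
  note S = open_slab[of 1 "1/2", unfolded slab_1_half]
  obtain Zs Zs' where Zs: "\<And>n. C1grows (1/2) (Zs n) (Zs' n)"
    "\<And>n u. Z u \<le> Zs n u" "\<And>n u. Zs n u \<le> Z (u + 1 / real (Suc n))"
    using smoothing_exists[OF g] by metis
  have gn: "grows (1/2) (Zs n)" for n using Zs(1) by (simp add: C1grows_def)
  have "Per E \<Omega> \<le> Per F \<Omega>"
    unfolding Per_def[of E]
  proof (rule SUP_least, clarify)
    fix a b assume ab: "a \<in> Cinf_c \<Omega>" "b \<in> Cinf_c \<Omega>" "\<forall>p. (a p)\<^sup>2 + (b p)\<^sup>2 \<le> 1"
    define L where "L = closure {p. a p \<noteq> 0} \<union> closure {p. b p \<noteq> 0}"
    have L: "compact L" "L \<subseteq> \<Omega>" using ab by (auto simp: L_def Cinf_c_def)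
    have az: "a p = 0" "b p = 0" if "p \<notin> L" for p
      using that closure_subset[of "{p. a p \<noteq> 0}"] closure_subset[of "{p. b p \<noteq> 0}"] by (auto simp: L_def)
    have aC: "C1on UNIV a (\<lambda>e. pderiv3 e a)" and bC: "C1on UNIV b (\<lambda>e. pderiv3 e b)"
      using ab by (auto simp: Cinf_c_def intro: smooth3_imp_C1on)
    let ?da = "\<lambda>e. pderiv3 e a" and ?db = "\<lambda>e. pderiv3 e b"
    obtain \<eta> d\<eta> K V where eta: "C1on UNIV \<eta> d\<eta>" "\<And>p. 0 \<le> \<eta> p" "\<And>p. \<eta> p \<le> (1::real)" "compact K" "K \<subseteq> \<Omega>"
      "\<And>p. p \<notin> K \<Longrightarrow> \<eta> p = 0" "open V" "D \<union> L \<subseteq> V" "\<And>p. p \<in> V \<Longrightarrow> \<eta> p = 1"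
      using C1_cutoff[of "D \<union> L" \<Omega>] D L O by (metis Un_least compact_Un)
    have KU: "K \<subseteq> slab 1 (1/2)" using eta(5) by (auto simp: slab_1_half \<Omega>_def)
    let ?M = "fM 1 Z"
    let ?z = "\<lambda>p. 0 :: real" and ?dz = "\<lambda>e p. 0 :: real"
    define h where "h = calib \<eta> d\<eta> ?M ?z ?dz ?z ?dz"
    have dV: "Xd d\<eta> p = 0" "Yd d\<eta> p = 0" if "p \<in> V" for p
    proof -
      have "C1on V \<eta> (\<lambda>e p. 0)" by (rule C1on_cong[OF C1on_const[where c=1] eta(7)]) (use eta(9) in auto)
      then have "d\<eta> e p = 0" if "e \<in> Basis" for e
        using C1on_unique[OF C1on_subset[OF eta(1) subset_UNIV] _ \<open>p \<in> V\<close> that] by blast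
      then show "Xd d\<eta> p = 0" "Yd d\<eta> p = 0" by (auto simp: Xd_def Yd_def Basis_hpt)
    qed
    have LD: "Xd ?da p = 0" "Yd ?db p = 0" if "p \<notin> L" for p
      using C1on_cutoff_deriv_zero(1)[OF aC L(1) _ that] C1on_cutoff_deriv_zero(2)[OF bC L(1) _ that] az by blast+
    have hV: "h p = 0" if "p \<in> V" for p using dV[OF that] by (simp add: h_def calib_def Xd_def Yd_def)
    have hK: "h p = 0" if "p \<notin> K" for p
      unfolding h_def by (rule calib_zero[OF eta(1,4) _ that]) (rule eta(6))
    \<comment> \<open>On \<open>L\<close> the cutoff is locally constant with value 1, and off
      \<open>L\<close> the field \<open>(a, b)\<close> and its derivatives vanish, so no mixed terms
      remain.\<close>
    have eq: "calib \<eta> d\<eta> ?M a ?da b ?db p = h p - (Xd ?da p + Yd ?db p)" for p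
    proof (cases "p \<in> L")
      case True
      then have "p \<in> V" using eta(8) by auto
      then show ?thesis using hV dV eta(9) by (simp add: calib_def)
    next
      case False
      then show ?thesis using az LD by (simp add: h_def calib_def) (simp add: Xd_def Yd_def)
    qed
    have EU: "E \<inter> Uslab \<in> sets lebesgue"
      using iepigraph_slab_measurable[OF f g l] by (simp add: E_def slab_1_half)
    have Mc: "continuous_on (slab 1 (1/2)) ?M"
    proof -
      have "continuous_on (slab 1 (1/2)) (\<lambda>p. ruling_slope Z (fu 1 Z p))"
        unfolding ruling_slope_def using g
        by (intro continuous_intros fu_continuous[OF g l] continuous_on_compose2[OF _ fu_continuous[OF g l], of UNIV Z])
           (auto simp: grows_def)
      then show ?thesis unfolding fM_def by (intro continuous_intros) (auto simp: slab_def)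
    qed
    have hc: "continuous_on UNIV h" unfolding h_def
      by (rule calib_continuous[OF open_slab eta(4) KU eta(1) _ Mc C1on_const C1on_const]) (rule eta(6))
    have dc: "continuous_on UNIV (\<lambda>p. Xd ?da p + Yd ?db p)"
      by (intro continuous_intros C1on_continuous_Xd[OF aC] C1on_continuous_Yd[OF bC])
    have hi: "set_integrable lebesgue (E \<inter> Uslab) h"
      by (rule set_integrable_compact_support[OF hc eta(4) _ EU]) (rule hK)
    have di: "set_integrable lebesgue (E \<inter> Uslab) (\<lambda>p. Xd ?da p + Yd ?db p)"
      by (rule set_integrable_compact_support[OF dc L(1) _ EU]) (simp add: LD)
    have "0 \<le> set_lebesgue_integral lebesgue (E \<inter> Uslab) (calib \<eta> d\<eta> ?M a ?da b ?db)"
      using epigraph_calibrated[OF f g l eta(4) KU eta(1) eta(6) eta(2) aC bC] ab(3)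
      by (simp add: E_def slab_1_half)
    also have "\<dots> = set_lebesgue_integral lebesgue (E \<inter> Uslab) h - set_lebesgue_integral lebesgue (E \<inter> Uslab) (\<lambda>p. Xd ?da p + Yd ?db p)"
      unfolding eq by (rule set_integral_diff(2)[OF hi di])
    finally have le: "set_lebesgue_integral lebesgue (E \<inter> Uslab) (\<lambda>p. Xd ?da p + Yd ?db p) \<le> set_lebesgue_integral lebesgue (E \<inter> Uslab) h"
      by simp
    have A: "set_lebesgue_integral lebesgue E (\<lambda>p. Xfield a p + Yfield b p) = set_lebesgue_integral lebesgue (E \<inter> Uslab) (\<lambda>p. Xd ?da p + Yd ?db p)"
      unfolding set_lebesgue_integral_def
    proof (rule Bochner_Integration.integral_cong[OF refl])
      fix p
      show "indicat_real E p *\<^sub>R (Xfield a p + Yfield b p) = indicat_real (E \<inter> Uslab) p *\<^sub>R (Xd ?da p + Yd ?db p)"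
        using LD[of p] L(2) unfolding Xfield_eq_Xd[OF aC] Yfield_eq_Yd[OF bC]
        by (cases "p \<in> L") (auto simp: indicator_def \<Omega>_def)
    qed
    have B: "set_lebesgue_integral lebesgue (E \<inter> Uslab) h = set_lebesgue_integral lebesgue F h"
      unfolding set_lebesgue_integral_def
    proof (rule Bochner_Integration.integral_cong[OF refl])
      fix p
      show "indicat_real (E \<inter> Uslab) p *\<^sub>R h p = indicat_real F p *\<^sub>R h p"
      proof (cases "p \<in> K \<and> p \<notin> V")
        case True
        then have "p \<in> Uslab" using eta(5) by (auto simp: \<Omega>_def)
        moreover have "(E - F) \<union> (F - E) \<subseteq> D" unfolding D_def E_def by (rule closure_subset)
        then have "p \<notin> (E - F) \<union> (F - E)" using True eta(8) by blast
        ultimately show ?thesis by (auto simp: indicator_def)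
      next
        case False
        then show ?thesis using hK[of p] hV[of p] by auto
      qed
    qed
    have C: "ereal (set_lebesgue_integral lebesgue F h) \<le> Per F \<Omega>"
    proof -
      have "ereal (set_lebesgue_integral lebesgue F (\<lambda>p. Xd ?dz p + Yd ?dz p + calib \<eta> d\<eta> ?M ?z ?dz ?z ?dz p)) \<le> Per F \<Omega>"
      proof (rule Per_ge_limit[OF open_slab eta(4) KU O eta(5) eta(1) eta(6) eta(2,3) C1on_const C1on_const _ compact_empty])
        show "C1on (slab 1 (1/2)) (fM 1 (Zs n)) (dfM 1 (Zs n) (Zs' n))" for n by (rule fM_C1[OF l Zs(1)])
        show "Xd (dfM 1 (Zs n) (Zs' n)) p + fM 1 (Zs n) p * Yd (dfM 1 (Zs n) (Zs' n)) p = 0" if "p \<in> slab 1 (1/2)" for n p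
          by (rule V_fM[OF l Zs(1) that])
        show "(\<lambda>n. fM 1 (Zs n) p) \<longlonglongrightarrow> fM 1 Z p" if "p \<in> slab 1 (1/2)" for p
          by (rule smoothing_tendsto[OF g l that gn Zs(2,3)])
      qed (use F in auto)
      then show ?thesis by (simp add: h_def Xd_def Yd_def)
    qed
    have "ereal (set_lebesgue_integral lebesgue (E \<inter> Uslab) (\<lambda>p. Xd ?da p + Yd ?db p)) \<le> ereal (set_lebesgue_integral lebesgue F h)"
      using le unfolding B by simp
    from order_trans[OF this C]
    show "ereal (set_lebesgue_integral lebesgue E (\<lambda>p. Xfield (fst (a, b)) p + Yfield (snd (a, b)) p)) \<le> Per F \<Omega>"
      unfolding fst_conv snd_conv A .
  qed
  then show "Per (iepigraph Kstrip f) (hball (0, 0, 0) r \<inter> Uslab) \<le> Per F (hball (0, 0, 0) r \<inter> Uslab)"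
    by (simp add: E_def \<Omega>_def)
qed

section \<open>Competitors\<close>

text \<open>Smoothed indicators of sets that are made of foliation lines and are closed upwards in
  the Y direction: these are the sets to which the calibration inequality applies.\<close>

definition cal :: "hpt set \<Rightarrow> (hpt \<Rightarrow> real) \<Rightarrow> (hpt \<Rightarrow> real) \<Rightarrow> (hpt \<Rightarrow> hpt \<Rightarrow> real) \<Rightarrow> bool" where
  "cal S M \<theta> d\<theta> \<longleftrightarrow> C1on S \<theta> d\<theta> \<and>
     (\<forall>p\<in>S. Xd d\<theta> p + M p * Yd d\<theta> p = 0 \<and> 0 \<le> Yd d\<theta> p \<and> 0 \<le> \<theta> p \<and> \<theta> p \<le> 1)"

lemma cal_mult:
  assumes "cal S M a da" "cal S M b db"
  shows "\<exists>d. cal S M (\<lambda>p. a p * b p) d"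
proof (intro exI[of _ "\<lambda>e p. da e p * b p + a p * db e p"])
  have X: "Xd (\<lambda>e p. da e p * b p + a p * db e p) p = Xd da p * b p + a p * Xd db p"
    and Y: "Yd (\<lambda>e p. da e p * b p + a p * db e p) p = Yd da p * b p + a p * Yd db p" for p
    by (rule Xd_simps Yd_simps)+
  have "Xd da p * b p + a p * Xd db p + M p * (Yd da p * b p + a p * Yd db p) = 0" if "p \<in> S" for p
  proof -
    have "Xd da p * b p + a p * Xd db p + M p * (Yd da p * b p + a p * Yd db p)
      = (Xd da p + M p * Yd da p) * b p + a p * (Xd db p + M p * Yd db p)" by (simp add: algebra_simps)
    then show ?thesis using assms that by (simp add: cal_def)
  qed
  then show "cal S M (\<lambda>p. a p * b p) (\<lambda>e p. da e p * b p + a p * db e p)"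
    using assms C1on_mult[of S a da b db] unfolding cal_def X Y by (auto intro: mult_le_one)
qed

text \<open>In terms of indicators a product is an intersection, and the product of the complements
  gives the union. Neither destroys constancy along the lines or monotonicity in the Y direction, so
  calibrated sets can be combined.\<close>

lemma cal_union:
  assumes "cal S M a da" "cal S M b db"
  shows "\<exists>d. cal S M (\<lambda>p. 1 - (1 - a p) * (1 - b p)) d"
proof (intro exI[of _ "\<lambda>e p. da e p * (1 - b p) + (1 - a p) * db e p"])
  have X: "Xd (\<lambda>e p. da e p * (1 - b p) + (1 - a p) * db e p) p = Xd da p * (1 - b p) + (1 - a p) * Xd db p"
    and Y: "Yd (\<lambda>e p. da e p * (1 - b p) + (1 - a p) * db e p) p = Yd da p * (1 - b p) + (1 - a p) * Yd db p" for p
    using Xd_simps(3)[of da "\<lambda>p. 1 - b p" "\<lambda>p. 1 - a p" db p] Yd_simps(3)[of da "\<lambda>p. 1 - b p" "\<lambda>p. 1 - a p" db p] by auto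
  have V: "Xd da p * (1 - b p) + (1 - a p) * Xd db p + M p * (Yd da p * (1 - b p) + (1 - a p) * Yd db p) = 0" if "p \<in> S" for p
  proof -
    have "Xd da p * (1 - b p) + (1 - a p) * Xd db p + M p * (Yd da p * (1 - b p) + (1 - a p) * Yd db p)
      = (Xd da p + M p * Yd da p) * (1 - b p) + (1 - a p) * (Xd db p + M p * Yd db p)" by (simp add: algebra_simps)
    then show ?thesis using assms that by (simp add: cal_def)
  qed
  have ca: "C1on S a da" "C1on S b db" using assms by (auto simp: cal_def)
  have one: "C1on S (\<lambda>p. 1::real) (\<lambda>e p. 0)" by (rule C1on_const)
  have "C1on S (\<lambda>p. 1 - (1 - a p) * (1 - b p))
      (\<lambda>e p. 0 - ((0 - da e p) * (1 - b p) + (1 - a p) * (0 - db e p)))"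
    by (intro C1on_diff C1on_mult one ca)
  moreover have "(\<lambda>e p. 0 - ((0 - da e p) * (1 - b p) + (1 - a p) * (0 - db e p)))
      = (\<lambda>e p. da e p * (1 - b p) + (1 - a p) * db e p)" by (intro ext) (simp add: algebra_simps)
  ultimately have C: "C1on S (\<lambda>p. 1 - (1 - a p) * (1 - b p)) (\<lambda>e p. da e p * (1 - b p) + (1 - a p) * db e p)" by simp
  have "0 \<le> 1 - (1 - a p) * (1 - b p) \<and> 1 - (1 - a p) * (1 - b p) \<le> 1 \<and>
      0 \<le> Yd da p * (1 - b p) + (1 - a p) * Yd db p" if "p \<in> S" for p
    using assms that by (auto simp: cal_def intro!: mult_le_one mult_nonneg_nonneg add_nonneg_nonneg)
  then show "cal S M (\<lambda>p. 1 - (1 - a p) * (1 - b p)) (\<lambda>e p. da e p * (1 - b p) + (1 - a p) * db e p)"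
    using C V unfolding cal_def X Y by auto
qed

lemma cal_hstep:
  assumes g: "C1on S g dg" and V: "\<And>p. p \<in> S \<Longrightarrow> Xd dg p + M p * Yd dg p = 0"
    and Y: "\<And>p. p \<in> S \<Longrightarrow> 0 \<le> Yd dg p" and c: "0 \<le> c"
  shows "\<exists>d. cal S M (\<lambda>p. hstep (c * g p)) d"
proof (intro exI[of _ "\<lambda>e p. hstep' (c * g p) * (c * dg e p)"])
  have C: "C1on S (\<lambda>p. c * g p) (\<lambda>e p. c * dg e p)"
    using C1on_mult[OF C1on_const[where c=c] g] by simp
  have X': "Xd (\<lambda>e p. hstep' (c * g p) * (c * dg e p)) p = hstep' (c * g p) * (c * Xd dg p)"
    and Y': "Yd (\<lambda>e p. hstep' (c * g p) * (c * dg e p)) p = hstep' (c * g p) * (c * Yd dg p)" for p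
    by (simp_all add: Xd_def Yd_def algebra_simps)
  have "hstep' (c * g p) * (c * Xd dg p) + M p * (hstep' (c * g p) * (c * Yd dg p)) = 0" if "p \<in> S" for p
  proof -
    have "hstep' (c * g p) * (c * Xd dg p) + M p * (hstep' (c * g p) * (c * Yd dg p))
      = hstep' (c * g p) * c * (Xd dg p + M p * Yd dg p)" by (simp add: algebra_simps)
    then show ?thesis using V that by simp
  qed
  then show "cal S M (\<lambda>p. hstep (c * g p)) (\<lambda>e p. hstep' (c * g p) * (c * dg e p))"
    unfolding cal_def X' Y' using C1on_hstep[OF C] hstep_bounds hstep'_nonneg Y c by auto
qed

lemma calibrated_limit_cal:
  assumes S: "open S" "compact K" "K \<subseteq> S"
    and kap: "C1on UNIV \<kappa> d\<kappa>" "\<And>p. p \<notin> K \<Longrightarrow> \<kappa> p = 0" "\<And>p. 0 \<le> \<kappa> p"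
    and a: "C1on UNIV a da" and b: "C1on UNIV b db" and ab: "\<And>p. (a p)\<^sup>2 + (b p)\<^sup>2 \<le> 1"
    and th: "\<And>n. \<exists>d. cal S (Ms n) (\<theta> n) d" and Ms: "\<And>n. C1on S (Ms n) (dM n)"
    and VM: "\<And>n p. p \<in> S \<Longrightarrow> Xd (dM n) p + Ms n p * Yd (dM n) p = 0"
    and Mlim: "\<And>p. p \<in> S \<Longrightarrow> (\<lambda>n. Ms n p) \<longlonglongrightarrow> M p"
    and F: "F \<in> sets lebesgue" and N: "negligible N"
    and thlim: "\<And>p. p \<in> S \<Longrightarrow> p \<notin> N \<Longrightarrow> (\<lambda>n. \<theta> n p) \<longlonglongrightarrow> indicator F p"
  shows "0 \<le> set_lebesgue_integral lebesgue F (calib \<kappa> d\<kappa> M a da b db)"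
proof -
  obtain d\<theta> where d: "\<And>n. cal S (Ms n) (\<theta> n) (d\<theta> n)" using th by metis
  show ?thesis
    by (rule calibrated_limit[where \<theta>=\<theta> and d\<theta>=d\<theta>, OF S kap a b ab _ Ms VM _ _ _ Mlim F N thlim])
       (use d in \<open>auto simp: cal_def\<close>)
qed

text \<open>If the line meets \<open>x = 0\<close> at \<open>(0, y, z)\<close>, then
  \<open>Z u = z - l * y / 2\<close>, so this is \<open>z + l * y / 2\<close>. It plays for
  \<open>l\<close> the part that \<open>Z u\<close> plays for \<open>- l\<close>.\<close>

definition fb :: "real \<Rightarrow> (real \<Rightarrow> real) \<Rightarrow> hpt \<Rightarrow> real" where
  "fb l Z p = Z (fu l Z p) + l * fy0 l Z p"

text \<open>The part between \<open>{x = 0}\<close> and \<open>{x = l}\<close> of the lines of the foliation through the points of a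
  triangle in \<open>{x = 0}\<close> with a side on the \<open>z\<close>-axis.\<close>

definition ruling_wedge :: "real \<Rightarrow> (real \<Rightarrow> real) \<Rightarrow> real \<Rightarrow> real \<Rightarrow> hpt set" where
  "ruling_wedge l Z uA B = {p \<in> slab l 0. 0 < fy0 l Z p \<and> 0 \<le> l * (fu l Z p - uA) \<and> 0 \<le> l * (B - fb l Z p)}"

lemma slab_0: "p \<in> slab l 0 \<longleftrightarrow> \<bar>fst p\<bar> < 1 \<and> 0 < l * (l - fst p) \<and> 0 < l * fst p"
  by (simp add: slab_def)

lemma fol_continuous:
  assumes g: "grows \<mu> Z" and l: "\<bar>l\<bar> \<le> 1"
  shows "continuous_on (slab l \<mu>) (\<lambda>p. Z (fu l Z p))" "continuous_on (slab l \<mu>) (fM l Z)"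
    "continuous_on (slab l \<mu>) (fy0 l Z)" "continuous_on (slab l \<mu>) (fb l Z)"
proof -
  show Zf: "continuous_on (slab l \<mu>) (\<lambda>p. Z (fu l Z p))"
    by (rule continuous_on_compose2[OF _ fu_continuous[OF g l], of UNIV Z]) (use g in \<open>auto simp: grows_def\<close>)
  have s: "continuous_on (slab l \<mu>) (\<lambda>p. ruling_slope Z (fu l Z p))"
    unfolding ruling_slope_def by (intro continuous_intros Zf fu_continuous[OF g l])
  show M: "continuous_on (slab l \<mu>) (fM l Z)"
    unfolding fM_def by (intro continuous_intros s) (auto simp: slab_def)
  show y: "continuous_on (slab l \<mu>) (fy0 l Z)"
    unfolding fy0_def by (intro continuous_intros s M)
  show "continuous_on (slab l \<mu>) (fb l Z)"
    unfolding fb_def by (intro continuous_intros Zf y)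
qed

lemma negligible_fu_level:
  assumes g: "grows \<mu> Z" and l: "\<bar>l\<bar> \<le> 1"
  shows "negligible {p \<in> slab l \<mu>. fu l Z p = c}"
proof (rule negligible_Y_line_sections)
  show "{p \<in> slab l \<mu>. fu l Z p = c} \<in> sets borel"
    by (rule borel_level_set[OF open_slab fu_continuous[OF g l]])
  fix x y y' w
  assume a: "(x, y, w + x * y / 2) \<in> {p \<in> slab l \<mu>. fu l Z p = c}"
    "(x, y', w + x * y' / 2) \<in> {p \<in> slab l \<mu>. fu l Z p = c}"
  have "RR Z (l * x) c = w + (x - l) * y / 2" if "(x, y, w + x * y / 2) \<in> {p \<in> slab l \<mu>. fu l Z p = c}" for y
    using fu_eq[OF g l, of "(x, y, w + x * y / 2)"] that by (auto simp: cc_def algebra_simps diff_divide_distrib)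
  from this[OF a(1)] this[OF a(2)] have "(x - l) * y = (x - l) * y'" by linarith
  moreover have "x - l \<noteq> 0" using a(1) by (auto simp: slab_def)
  ultimately show "y = y'" by (metis mult_left_cancel)
qed

lemma half_square_le:
  assumes "\<bar>l\<bar> \<le> (1::real)" "0 < l * (l - x)" "0 < l * x"
  shows "(l - x)\<^sup>2 / 2 \<le> l\<^sup>2 * (1 - x\<^sup>2)"
proof -
  have "l\<^sup>2 \<le> 1" using assms by (simp add: abs_square_le_1)
  then have "l\<^sup>2 * x\<^sup>2 \<le> 1 * x\<^sup>2" by (intro mult_right_mono) auto
  moreover have "x\<^sup>2 \<le> l * x"
  proof (cases "0 < l")
    case True
    then show ?thesis using assms by (simp add: zero_less_mult_iff power2_eq_square mult_right_mono)
  next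
    case False
    then show ?thesis using assms by (simp add: zero_less_mult_iff power2_eq_square mult_right_mono_neg)
  qed
  moreover have "0 \<le> (l - x)\<^sup>2" by simp
  moreover have "(l - x)\<^sup>2 = l\<^sup>2 - 2 * (l * x) + x\<^sup>2" by (simp add: power2_eq_square algebra_simps)
  moreover have "l\<^sup>2 * (1 - x\<^sup>2) = l\<^sup>2 - l\<^sup>2 * x\<^sup>2" by (simp add: algebra_simps)
  ultimately show ?thesis by linarith
qed

lemma fy0_eq_imp:
  assumes g: "grows \<mu> Z" and l: "\<bar>l\<bar> \<le> 1" and p: "(x, y, z) \<in> slab l \<mu>"
  shows "y = x * ruling_slope Z (fu l Z (x, y, z)) + (l - x) / l * fy0 l Z (x, y, z)"
    and "l * (z - x * y / 2) = l * RR Z (x\<^sup>2) (fu l Z (x, y, z)) + (l - x)\<^sup>2 / 2 * fy0 l Z (x, y, z)"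
proof -
  have ne: "l - x \<noteq> 0" "l \<noteq> 0" using p by (auto simp: slab_def)
  define d where "d = y - x * ruling_slope Z (fu l Z (x, y, z))"
  have f: "fy0 l Z (x, y, z) = l / (l - x) * d" and w: "z - x * y / 2 = RR Z (x\<^sup>2) (fu l Z (x, y, z)) + (l - x) * d / 2"
    using fol_coords[OF g l p] by (auto simp: d_def)
  have d: "(l - x) / l * fy0 l Z (x, y, z) = d" unfolding f using ne by simp
  then show "y = x * ruling_slope Z (fu l Z (x, y, z)) + (l - x) / l * fy0 l Z (x, y, z)" by (simp add: d_def)
  have "(l - x)\<^sup>2 / 2 * fy0 l Z (x, y, z) = l * ((l - x) * d / 2)"
  proof -
    have "t\<^sup>2 / 2 * (l / t * d) = l * (t * d / 2)" if "t \<noteq> 0" for t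
      using that by (simp add: power2_eq_square)
    from this[OF ne(1)] show ?thesis unfolding f .
  qed
  then show "l * (z - x * y / 2) = l * RR Z (x\<^sup>2) (fu l Z (x, y, z)) + (l - x)\<^sup>2 / 2 * fy0 l Z (x, y, z)"
    unfolding w by (simp add: algebra_simps)
qed

text \<open>On a Y-line inside the level set, a larger intercept forces a smaller
  \<open>l * Z u\<close>, hence a smaller \<open>l * u\<close>. The equation for the height forces
  \<open>l * u\<close> not to decrease, because its coefficient \<open>C\<close> is nonnegative. So
  the intercept, then the parameter, then \<open>y\<close> are determined.\<close>

lemma negligible_fb_level:
  assumes g: "grows 0 Z" and l: "\<bar>l\<bar> \<le> 1"
  shows "negligible {p \<in> slab l 0. fb l Z p = c}"
proof (rule negligible_Y_line_sections)
  show "{p \<in> slab l 0. fb l Z p = c} \<in> sets borel"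
    by (rule borel_level_set[OF open_slab fol_continuous(4)[OF g l]])
  fix x y y' w
  assume a: "(x, y, w + x * y / 2) \<in> {p \<in> slab l 0. fb l Z p = c}"
    "(x, y', w + x * y' / 2) \<in> {p \<in> slab l 0. fb l Z p = c}"
  define u v where "u y = fu l Z (x, y, w + x * y / 2)" and "v y = fy0 l Z (x, y, w + x * y / 2)" for y
  have s: "0 < l * (l - x)" "0 < l * x" "l \<noteq> 0" using a by (auto simp: slab_0)
  define C where "C = l\<^sup>2 * (1 - x\<^sup>2) - (l - x)\<^sup>2 / 2"
  have C: "0 \<le> C" using half_square_le[OF l s(1,2)] by (simp add: C_def)
  have h: "y = x * ruling_slope Z (u y) + (l - x) / l * v y \<and> Z (u y) + l * v y = c \<and> l * w = l * (1 - x\<^sup>2) * c + x\<^sup>2 * (l * u y) - C * v y"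
    if "(x, y, w + x * y / 2) \<in> {p \<in> slab l 0. fb l Z p = c}" for y
  proof -
    have p: "(x, y, w + x * y / 2) \<in> slab l 0" and fbe: "Z (u y) + l * v y = c" using that by (auto simp: fb_def u_def v_def)
    have "l * w = l * RR Z (x\<^sup>2) (u y) + (l - x)\<^sup>2 / 2 * v y"
      using fy0_eq_imp(2)[OF g l p] by (simp add: u_def v_def)
    moreover have "Z (u y) = c - l * v y" using fbe by simp
    ultimately have "l * w = l * (1 - x\<^sup>2) * c + x\<^sup>2 * (l * u y) - C * v y"
      by (simp add: RR_def C_def power2_eq_square algebra_simps)
    then show ?thesis using fy0_eq_imp(1)[OF g l p] fbe by (simp add: u_def v_def)
  qed
  have key: "\<not> v y < v y'" if "(x, y, w + x * y / 2) \<in> {p \<in> slab l 0. fb l Z p = c}"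
    "(x, y', w + x * y' / 2) \<in> {p \<in> slab l 0. fb l Z p = c}" for y y'
  proof
    assume lt: "v y < v y'"
    have "Z (u y') - Z (u y) = l * (v y - v y')" using h[OF that(1)] h[OF that(2)] by (simp add: algebra_simps)
    then have "l * (Z (u y') - Z (u y)) = l\<^sup>2 * (v y - v y')" by (simp add: power2_eq_square)
    also have "\<dots> < 0" using lt s by (simp add: mult_pos_neg)
    finally have neg: "l * (Z (u y') - Z (u y)) < 0" .
    have "l * (u y' - u y) < 0"
    proof (cases "0 < l")
      case True
      then have "Z (u y') < Z (u y)" using neg by (simp add: mult_less_0_iff)
      then have "u y' < u y" using grows_mono[OF g, of "u y" "u y'"] by fastforce
      then show ?thesis using True by (simp add: mult_pos_neg)
    next
      case False
      then have "Z (u y) < Z (u y')" using neg by (simp add: mult_less_0_iff)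
      then have "u y < u y'" using grows_mono[OF g, of "u y'" "u y"] by fastforce
      then show ?thesis using False s by (simp add: mult_neg_pos)
    qed
    moreover have "0 < x\<^sup>2" using s by auto
    ultimately have "x\<^sup>2 * (l * (u y' - u y)) < 0" by (simp add: mult_pos_neg)
    moreover have "0 \<le> C * (v y' - v y)" using C lt by simp
    moreover have "x\<^sup>2 * (l * (u y' - u y)) = C * (v y' - v y)"
      using h[OF that(1)] h[OF that(2)] by (simp add: algebra_simps)
    ultimately show False by linarith
  qed
  have ve: "v y = v y'" using key[OF a(1,2)] key[OF a(2,1)] by linarith
  moreover have "x \<noteq> 0" using s by auto
  ultimately have "u y = u y'" using h[OF a(1)] h[OF a(2)] s by auto
  then show "y = y'" using h[OF a(1)] h[OF a(2)] ve by metis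
qed

lemma borel_sub_ge:
  fixes g :: "hpt \<Rightarrow> real"
  assumes "open S" "continuous_on S g"
  shows "{p \<in> S. 0 < g p} \<in> sets borel" "{p \<in> S. 0 \<le> g p} \<in> sets borel"
proof -
  have 1: "open (S \<inter> h -` {0<..})" if "continuous_on S h" for h :: "hpt \<Rightarrow> real"
    using that assms(1) by (intro continuous_open_preimage) auto
  have "{p \<in> S. 0 < g p} = S \<inter> g -` {0<..}" by auto
  then show "{p \<in> S. 0 < g p} \<in> sets borel" using 1[OF assms(2)] by simp
  have "{p \<in> S. 0 \<le> g p} = S - (S \<inter> (\<lambda>p. - g p) -` {0<..})" by auto
  moreover have "continuous_on S (\<lambda>p. - g p)" by (intro continuous_intros assms(2))
  ultimately show "{p \<in> S. 0 \<le> g p} \<in> sets borel" using 1 assms(1) by (simp add: sets.Diff)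
qed

lemma ruling_wedge_borel:
  assumes g: "grows 0 Z" and l: "\<bar>l\<bar> \<le> 1"
  shows "ruling_wedge l Z uA B \<in> sets borel"
proof -
  have "ruling_wedge l Z uA B = {p \<in> slab l 0. 0 < fy0 l Z p} \<inter> {p \<in> slab l 0. 0 \<le> l * (fu l Z p - uA)}
      \<inter> {p \<in> slab l 0. 0 \<le> l * (B - fb l Z p)}" by (auto simp: ruling_wedge_def)
  moreover have "{p \<in> slab l 0. 0 < fy0 l Z p} \<in> sets borel" "{p \<in> slab l 0. 0 \<le> l * (fu l Z p - uA)} \<in> sets borel"
      "{p \<in> slab l 0. 0 \<le> l * (B - fb l Z p)} \<in> sets borel"
    by (intro borel_sub_ge open_slab continuous_intros fol_continuous[OF g l] fu_continuous[OF g l])+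
  ultimately show ?thesis by simp
qed

text \<open>What remains of the epigraph is the intersection of \<open>fy0 > 0\<close> with the
  union of \<open>l * (uA - u) > 0\<close> and \<open>l * (fb - B) > 0\<close>. All three functions
  are constant along the lines and nondecreasing in the Y direction, so the same field calibrates
  the set after the cut.\<close>

lemma cut_calibrated:
  assumes f: "strip_param f Z" and l: "\<bar>l\<bar> \<le> 1"
    and K: "compact K" "K \<subseteq> slab l 0"
    and kap: "C1on UNIV \<kappa> d\<kappa>" "\<And>p. p \<notin> K \<Longrightarrow> \<kappa> p = 0" "\<And>p. 0 \<le> \<kappa> p"
    and a: "C1on UNIV a da" and b: "C1on UNIV b db" and ab: "\<And>p. (a p)\<^sup>2 + (b p)\<^sup>2 \<le> 1"
  shows "0 \<le> set_lebesgue_integral lebesgue (iepigraph Kstrip f \<inter> slab l 0 - ruling_wedge l Z uA B) (calib \<kappa> d\<kappa> (fM l Z) a da b db)"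
proof -
  have g: "grows 0 Z" using f by (simp add: strip_param_def)
  obtain Zs Zs' where Zs: "\<And>n. C1grows 0 (Zs n) (Zs' n)"
    "\<And>n u. Z u \<le> Zs n u" "\<And>n u. Zs n u \<le> Z (u + 1 / real (Suc n))"
    using smoothing_exists[OF g] by metis
  have gn: "grows 0 (Zs n)" for n using Zs(1) by (simp add: C1grows_def)
  let ?S = "slab l 0"
  define A1 A2 A3 where "A1 n p = hstep (real n * fy0 l (Zs n) p)"
    and "A2 n p = hstep (real n * (l * (uA - fu l (Zs n) p)))"
    and "A3 n p = hstep (real n * (l * (fb l (Zs n) p - B)))" for n p
  \<comment> \<open>Smoothed form of an intersection of one set with the union of two
    others.\<close>
  define \<theta> where "\<theta> n p = A1 n p * (1 - (1 - A2 n p) * (1 - A3 n p))" for n p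
  have c1: "\<exists>d. cal ?S (fM l (Zs n)) (A1 n) d" for n
    unfolding A1_def[abs_def]
    by (rule cal_hstep[OF fy0_C1[OF l Zs(1)] V_fy0[OF l Zs(1)] Yd_fy0_nonneg[OF l Zs(1)]]) auto
  have c2: "\<exists>d. cal ?S (fM l (Zs n)) (A2 n) d" for n
  proof -
    have C: "C1on ?S (\<lambda>p. l * (uA - fu l (Zs n) p)) (\<lambda>e p. 0 * (uA - fu l (Zs n) p) + l * (0 - dfu l (Zs n) (Zs' n) e p))"
      by (intro C1on_mult C1on_diff C1on_const fu_C1[OF l Zs(1)])
    have X: "Xd (\<lambda>e p. 0 * (uA - fu l (Zs n) p) + l * (0 - dfu l (Zs n) (Zs' n) e p)) p = - l * Xd (dfu l (Zs n) (Zs' n)) p"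
      and Y: "Yd (\<lambda>e p. 0 * (uA - fu l (Zs n) p) + l * (0 - dfu l (Zs n) (Zs' n) e p)) p = - l * Yd (dfu l (Zs n) (Zs' n)) p" for p
      by (simp_all add: Xd_def Yd_def algebra_simps)
    show ?thesis unfolding A2_def[abs_def]
    proof (rule cal_hstep[OF C], unfold X Y)
      fix p assume p: "p \<in> ?S"
      have "- l * Xd (dfu l (Zs n) (Zs' n)) p + fM l (Zs n) p * (- l * Yd (dfu l (Zs n) (Zs' n)) p)
        = - l * (Xd (dfu l (Zs n) (Zs' n)) p + fM l (Zs n) p * Yd (dfu l (Zs n) (Zs' n)) p)" by (simp add: algebra_simps)
      then show "- l * Xd (dfu l (Zs n) (Zs' n)) p + fM l (Zs n) p * (- l * Yd (dfu l (Zs n) (Zs' n)) p) = 0"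
        using V_fu[OF l Zs(1) p] by simp
      show "0 \<le> - l * Yd (dfu l (Zs n) (Zs' n)) p" using Yd_l_fu[OF l Zs(1) p, of n] by simp
    qed simp
  qed
  have c3: "\<exists>d. cal ?S (fM l (Zs n)) (A3 n) d" for n
  proof -
    let ?d = "\<lambda>e p. 0 * (fb l (Zs n) p - B) + l * ((Zs' n (fu l (Zs n) p) * dfu l (Zs n) (Zs' n) e p
        + (0 * fy0 l (Zs n) p + l * dfy0 l (Zs n) (Zs' n) e p)) - 0)"
    have C: "C1on ?S (\<lambda>p. l * (fb l (Zs n) p - B)) ?d"
      unfolding fb_def by (intro C1on_mult C1on_diff C1on_add C1on_const Z_fu_C1[OF l Zs(1)] fy0_C1[OF l Zs(1)])
    have X: "Xd ?d p = l * (Zs' n (fu l (Zs n) p) * Xd (dfu l (Zs n) (Zs' n)) p + l * Xd (dfy0 l (Zs n) (Zs' n)) p)"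
      and Y: "Yd ?d p = l * (Zs' n (fu l (Zs n) p) * Yd (dfu l (Zs n) (Zs' n)) p + l * Yd (dfy0 l (Zs n) (Zs' n)) p)" for p
      by (simp_all add: Xd_def Yd_def field_simps)
    show ?thesis unfolding A3_def[abs_def]
    proof (rule cal_hstep[OF C], unfold X Y)
      fix p assume p: "p \<in> ?S"
      have "l * (Zs' n (fu l (Zs n) p) * Xd (dfu l (Zs n) (Zs' n)) p + l * Xd (dfy0 l (Zs n) (Zs' n)) p)
          + fM l (Zs n) p * (l * (Zs' n (fu l (Zs n) p) * Yd (dfu l (Zs n) (Zs' n)) p + l * Yd (dfy0 l (Zs n) (Zs' n)) p))
        = l * (Zs' n (fu l (Zs n) p) * (Xd (dfu l (Zs n) (Zs' n)) p + fM l (Zs n) p * Yd (dfu l (Zs n) (Zs' n)) p)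
          + l * (Xd (dfy0 l (Zs n) (Zs' n)) p + fM l (Zs n) p * Yd (dfy0 l (Zs n) (Zs' n)) p))" by (simp add: algebra_simps)
      then show "l * (Zs' n (fu l (Zs n) p) * Xd (dfu l (Zs n) (Zs' n)) p + l * Xd (dfy0 l (Zs n) (Zs' n)) p)
          + fM l (Zs n) p * (l * (Zs' n (fu l (Zs n) p) * Yd (dfu l (Zs n) (Zs' n)) p + l * Yd (dfy0 l (Zs n) (Zs' n)) p)) = 0"
        using V_fu[OF l Zs(1) p] V_fy0[OF l Zs(1) p] by simp
      show "0 \<le> l * (Zs' n (fu l (Zs n) p) * Yd (dfu l (Zs n) (Zs' n)) p + l * Yd (dfy0 l (Zs n) (Zs' n)) p)"
        using p by (intro Yd_l_b[OF l Zs(1) p]) (simp add: slab_0)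
    qed simp
  qed
  have thc: "\<exists>d. cal ?S (fM l (Zs n)) (\<theta> n) d" for n
  proof -
    obtain d1 d2 d3 where d: "cal ?S (fM l (Zs n)) (A1 n) d1" "cal ?S (fM l (Zs n)) (A2 n) d2" "cal ?S (fM l (Zs n)) (A3 n) d3"
      using c1[of n] c2[of n] c3[of n] by blast
    obtain d4 where "cal ?S (fM l (Zs n)) (\<lambda>p. 1 - (1 - A2 n p) * (1 - A3 n p)) d4" using cal_union[OF d(2,3)] by blast
    from cal_mult[OF d(1) this] show ?thesis unfolding \<theta>_def[abs_def] .
  qed
  define N where "N = {p \<in> ?S. fy0 l Z p = 0} \<union> {p \<in> ?S. fu l Z p = uA} \<union> {p \<in> ?S. fb l Z p = B}"
  have N: "negligible N" unfolding N_def
    by (intro negligible_Un negligible_fy0_zero[OF g l] negligible_fu_level[OF g l] negligible_fb_level[OF g l])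
  show ?thesis
  proof (rule calibrated_limit_cal[OF open_slab K kap a b ab thc fM_C1[OF l Zs(1)] V_fM[OF l Zs(1)] _ _ N])
    show "iepigraph Kstrip f \<inter> ?S - ruling_wedge l Z uA B \<in> sets lebesgue"
      by (intro sets.Diff iepigraph_slab_measurable[OF f g l] sets_completionI_sets) (simp add: ruling_wedge_borel[OF g l])
    fix p assume p: "p \<in> ?S"
    note lims = smoothing_tendsto[OF g l p gn Zs(2,3)] fu_smoothing_tendsto[OF g l p gn Zs(2,3)]
    show "(\<lambda>n. fM l (Zs n) p) \<longlonglongrightarrow> fM l Z p" by (rule lims)
    assume "p \<notin> N"
    then have ne: "fy0 l Z p \<noteq> 0" "fu l Z p \<noteq> uA" "fb l Z p \<noteq> B" using p by (auto simp: N_def)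
    have l0: "l \<noteq> 0" using p by (auto simp: slab_0)
    have bl: "(\<lambda>n. fb l (Zs n) p) \<longlonglongrightarrow> fb l Z p" unfolding fb_def by (intro tendsto_intros lims)
    have 1: "(\<lambda>n. A1 n p) \<longlonglongrightarrow> (if 0 < fy0 l Z p then 1 else 0)"
      unfolding A1_def by (rule hstep_sequence[OF lims(2) ne(1)])
    have 2: "(\<lambda>n. A2 n p) \<longlonglongrightarrow> (if 0 < l * (uA - fu l Z p) then 1 else 0)"
      unfolding A2_def by (rule hstep_sequence) (use ne l0 in \<open>auto intro!: tendsto_intros lims\<close>)
    have 3: "(\<lambda>n. A3 n p) \<longlonglongrightarrow> (if 0 < l * (fb l Z p - B) then 1 else 0)"
      unfolding A3_def by (rule hstep_sequence) (use ne l0 in \<open>auto intro!: tendsto_intros bl\<close>)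
    have "(\<lambda>n. \<theta> n p) \<longlonglongrightarrow> (if 0 < fy0 l Z p then 1 else 0) * (1 - (1 - (if 0 < l * (uA - fu l Z p) then 1 else 0))
        * (1 - (if 0 < l * (fb l Z p - B) then 1 else 0)))"
      unfolding \<theta>_def by (intro tendsto_intros 1 2 3)
    moreover have "(if 0 < fy0 l Z p then 1 else 0) * (1 - (1 - (if 0 < l * (uA - fu l Z p) then 1 else 0))
        * (1 - (if 0 < l * (fb l Z p - B) then 1 else 0))) = indicat_real (iepigraph Kstrip f \<inter> ?S - ruling_wedge l Z uA B) p"
    proof -
      have "0 < l * (uA - fu l Z p) \<longleftrightarrow> \<not> 0 \<le> l * (fu l Z p - uA)" "0 < l * (fb l Z p - B) \<longleftrightarrow> \<not> 0 \<le> l * (B - fb l Z p)"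
        by (auto simp: algebra_simps)
      then show ?thesis using mem_iepigraph_iff_fy0[OF f g l p] p by (auto simp: indicator_def ruling_wedge_def)
    qed
    ultimately show "(\<lambda>n. \<theta> n p) \<longlonglongrightarrow> indicat_real (iepigraph Kstrip f \<inter> ?S - ruling_wedge l Z uA B) p" by simp
  qed assumption+
qed

text \<open>Since \<open>Z\<close> is surjective, \<open>B\<close> is attained, which traps the
  parameter between \<open>uA\<close> and a preimage of \<open>B\<close>; the two level conditions
  bound the intercept. Boundedness makes the competitor admissible and dominates the flux
  integrals.\<close>

lemma ruling_wedge_bounds:
  assumes f: "strip_param f Z" and l: "\<bar>l\<bar> \<le> 1" "l \<noteq> 0" and A: "Z uA = A"
  obtains R Y where "\<And>p. p \<in> ruling_wedge l Z uA B \<Longrightarrow> \<bar>fst p\<bar> \<le> \<bar>l\<bar> \<and> \<bar>fst (snd p)\<bar> \<le> R \<and> \<bar>snd (snd p)\<bar> \<le> R \<and> fy0 l Z p \<le> Y"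
proof -
  have g: "grows 0 Z" using f by (simp add: strip_param_def)
  obtain v where v: "Z v = B" using f unfolding strip_param_def by (metis surjD)
  define Y where "Y = \<bar>(B - A) / l\<bar>"
  define U where "U = \<bar>uA\<bar> + \<bar>v\<bar>"
  define H where "H = \<bar>A\<bar> + \<bar>B\<bar>"
  define R where "R = 2 * (H + U) + 2 * Y + 2 * (H + U)"
  have "\<bar>fst p\<bar> \<le> \<bar>l\<bar> \<and> \<bar>fst (snd p)\<bar> \<le> R \<and> \<bar>snd (snd p)\<bar> \<le> R \<and> fy0 l Z p \<le> Y"
    if p: "p \<in> ruling_wedge l Z uA B" for p
  proof -
    obtain x y z where pe: "p = (x, y, z)" by (cases p)
    define u w where "u = fu l Z p" and "w = fy0 l Z p"
    have s: "(x, y, z) \<in> slab l 0" and h: "0 < w" "0 \<le> l * (u - uA)" "0 \<le> l * (B - (Z u + l * w))"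
      using p by (auto simp: ruling_wedge_def pe u_def w_def fb_def)
    have sx: "\<bar>x\<bar> < 1" "0 < l * (l - x)" "0 < l * x" using s by (auto simp: slab_0)
    have Zlin: "0 \<le> l * (Z u - A)"
    proof (cases "0 < l")
      case True
      then have "uA \<le> u" using h(2) by (simp add: zero_le_mult_iff)
      then show ?thesis using grows_mono[OF g, of uA u] A True by simp
    next
      case False
      then have "u \<le> uA" using h(2) l by (auto simp: zero_le_mult_iff)
      then show ?thesis using grows_mono[OF g, of u uA] A False by (simp add: mult_nonpos_nonpos)
    qed
    have "0 < l\<^sup>2 * w" using h(1) l by simp
    then have "0 < l * (l * w)" by (simp add: power2_eq_square mult.assoc)
    then have lB: "0 < l * (B - Z u)" "l * (l * w) \<le> l * (B - A)" using h(3) Zlin by (auto simp: algebra_simps)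
    have wY: "w \<le> Y"
    proof -
      have "l * (l * w) / (l * l) \<le> l * (B - A) / (l * l)" using lB l by (intro divide_right_mono) auto
      then have "w \<le> (B - A) / l" using l by simp
      also have "\<dots> \<le> \<bar>(B - A) / l\<bar>" by (rule abs_ge_self)
      finally show ?thesis by (simp only: Y_def)
    qed
    have uv: "\<bar>u\<bar> \<le> U \<and> \<bar>Z u\<bar> \<le> H"
    proof (cases "0 < l")
      case True
      then have "uA \<le> u" "Z u < B" "A \<le> Z u" using h(2) lB(1) Zlin by (auto simp: zero_le_mult_iff zero_less_mult_iff)
      moreover then have "u \<le> v" using grows_mono[OF g, of v u] v by force
      ultimately show ?thesis by (auto simp: U_def H_def)
    next
      case False
      then have "u \<le> uA" "B < Z u" "Z u \<le> A" using h(2) lB(1) Zlin l by (auto simp: zero_le_mult_iff zero_less_mult_iff)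
      moreover then have "v \<le> u" using grows_mono[OF g, of u v] v by force
      ultimately show ?thesis by (auto simp: U_def H_def)
    qed
    have lx: "0 < (l - x) / l" "(l - x) / l \<le> 1"
    proof -
      show "0 < (l - x) / l" using sx by (auto simp: zero_less_mult_iff zero_less_divide_iff)
      have "0 < x / l" using sx by (auto simp: zero_less_mult_iff zero_less_divide_iff)
      then show "(l - x) / l \<le> 1" using l by (simp add: diff_divide_distrib)
    qed
    have "\<bar>x\<bar> \<le> \<bar>l\<bar>" using sx by (auto simp: zero_less_mult_iff)
    moreover have ybd: "\<bar>y\<bar> \<le> 2 * (H + U) + Y"
    proof -
      have e: "y = x * ruling_slope Z u + (l - x) / l * w" using fy0_eq_imp(1)[OF g l(1) s] by (simp add: u_def w_def pe)
      have 1: "\<bar>x * ruling_slope Z u\<bar> \<le> 1 * (2 * (H + U))" unfolding abs_mult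
        using sx uv by (intro mult_mono) (auto simp: ruling_slope_def)
      have 2: "\<bar>(l - x) / l * w\<bar> \<le> 1 * Y" unfolding abs_mult
        using lx h(1) wY by (intro mult_mono) auto
      have "\<bar>x * ruling_slope Z u + (l - x) / l * w\<bar> \<le> 1 * (2 * (H + U)) + 1 * Y"
        by (rule order_trans[OF abs_triangle_ineq add_mono[OF 1 2]])
      then show ?thesis by (simp only: e[symmetric] mult_1)
    qed
    moreover have "\<bar>z\<bar> \<le> R"
    proof -
      have e: "z = RR Z (l * x) u + l * y / 2" using fu_eq[OF g l(1) s] by (simp add: cc_def u_def pe)
      have "l * x < 1" using slab_less_1[OF l(1) s] by simp
      then have "\<bar>(1 - l * x) * Z u\<bar> \<le> 1 * H" "\<bar>l * x * u\<bar> \<le> 1 * U" unfolding abs_mult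
        using sx uv by (intro mult_mono; auto simp: abs_mult[symmetric])+
      then have 1: "\<bar>RR Z (l * x) u\<bar> \<le> H + U" unfolding RR_def by linarith
      have 2: "\<bar>l * y / 2\<bar> \<le> \<bar>y\<bar>"
        using mult_right_mono[OF l(1), of "\<bar>y\<bar>"] by (simp add: abs_mult)
      have 3: "\<bar>z\<bar> \<le> (H + U) + \<bar>y\<bar>" unfolding e by (rule order_trans[OF abs_triangle_ineq add_mono[OF 1 2]])
      have 4: "0 \<le> H" "0 \<le> U" "0 \<le> Y" by (auto simp: H_def U_def Y_def)
      show ?thesis using 3 4 ybd unfolding R_def by argo
    qed
    moreover have "0 \<le> H" "0 \<le> U" "0 \<le> Y" by (auto simp: H_def U_def Y_def)
    ultimately show ?thesis using wY unfolding R_def pe w_def by auto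
  qed
  then show thesis using that by blast
qed

section \<open>The flux through the plane \<open>x = 0\<close>\<close>

text \<open>This is the slope of a ruling at height \<open>t\<close>, the candidate for the function
  of the theorem. Where \<open>Z\<close> is constant, \<open>inv Z\<close> makes an arbitrary
  choice, which affects only countably many heights.\<close>

definition slope_at :: "(real \<Rightarrow> real) \<Rightarrow> real \<Rightarrow> real" where
  "slope_at Z t = ruling_slope Z (inv Z t)"

text \<open>In the coordinates \<open>(y, z)\<close> of \<open>{x = 0}\<close>; for
  \<open>l > 0\<close> and \<open>A < B\<close> the vertices are \<open>(0, A)\<close>,
  \<open>(0, B)\<close> and \<open>((B - A) / l, (A + B) / 2)\<close>. Exchanging \<open>l\<close>,
  \<open>A\<close>, \<open>B\<close> for \<open>- l\<close>, \<open>B\<close>, \<open>A\<close>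
  gives the same triangle.\<close>

definition flux_triangle :: "real \<Rightarrow> real \<Rightarrow> real \<Rightarrow> (real \<times> real) set" where
  "flux_triangle l A B = {q. 0 < fst q \<and> 0 < l * (snd q - l * fst q / 2 - A) \<and> 0 < l * (B - (snd q + l * fst q / 2))}"

text \<open>At \<open>x = 0\<close> the line through \<open>(0, y, z)\<close> starts from the ruling
  of height \<open>z - l * y / 2\<close> and has the slope of that ruling minus
  \<open>y / l\<close>. Only the first component of the calibrating field crosses
  \<open>{x = 0}\<close>.\<close>

definition wall_flux :: "real \<Rightarrow> (real \<Rightarrow> real) \<Rightarrow> real \<times> real \<Rightarrow> real" where
  "wall_flux l Z q = fx (slope_at Z (snd q - l * fst q / 2) - fst q / l)"

lemma inv_mono:
  fixes Z :: "real \<Rightarrow> real"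
  assumes "mono Z" "surj Z" shows "mono (inv Z)"
proof
  fix s t :: real assume "s \<le> t"
  show "inv Z s \<le> inv Z t"
  proof (rule ccontr)
    assume "\<not> inv Z s \<le> inv Z t"
    then have "Z (inv Z t) \<le> Z (inv Z s)" using assms(1) by (simp add: mono_def)
    then have "t \<le> s" by (simp add: surj_f_inv_f[OF assms(2)])
    then show False using \<open>s \<le> t\<close> \<open>\<not> inv Z s \<le> inv Z t\<close> by simp
  qed
qed

lemma strip_mono: "strip_param f Z \<Longrightarrow> mono Z"
  using grows_mono by (auto simp: strip_param_def mono_def)

lemma strip_surj: "strip_param f Z \<Longrightarrow> surj Z"
  by (simp add: strip_param_def)

lemma slope_at_measurable:
  assumes "strip_param f Z" shows "slope_at Z \<in> borel_measurable borel"
proof -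
  have "inv Z \<in> borel_measurable borel"
    by (rule borel_measurable_mono[OF inv_mono[OF strip_mono[OF assms] strip_surj[OF assms]]])
  moreover have "slope_at Z = (\<lambda>t. 2 * (t - inv Z t))"
    by (auto simp: slope_at_def ruling_slope_def surj_f_inv_f[OF strip_surj[OF assms]])
  ultimately show ?thesis by simp
qed

lemma wall_flux_measurable:
  assumes "strip_param f Z" shows "wall_flux l Z \<in> borel_measurable borel"
proof -
  have "(\<lambda>q::real \<times> real. snd q - l * fst q / 2) \<in> borel_measurable borel"
    by (intro borel_measurable_continuous_onI continuous_intros) auto
  then have "(\<lambda>q::real \<times> real. slope_at Z (snd q - l * fst q / 2)) \<in> borel_measurable borel"
    using slope_at_measurable[OF assms] by (rule measurable_compose)
  moreover have "(\<lambda>q::real \<times> real. fst q / l) \<in> borel_measurable borel"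
    by (intro borel_measurable_continuous_onI) (auto simp: divide_inverse intro!: continuous_intros)
  ultimately have "(\<lambda>q. slope_at Z (snd q - l * fst q / 2) - fst q / l) \<in> borel_measurable borel" by (rule borel_measurable_diff)
  then show ?thesis unfolding wall_flux_def[abs_def]
    using borel_measurable_continuous_onI[OF fx_continuous] by (rule measurable_compose)
qed

lemma flux_triangle_open: "open (flux_triangle l A B)"
proof -
  have "flux_triangle l A B = {q. 0 < fst q} \<inter> {q. 0 < l * (snd q - l * fst q / 2 - A)} \<inter> {q. 0 < l * (B - (snd q + l * fst q / 2))}"
    by (auto simp: flux_triangle_def)
  then show ?thesis by (simp only:) (intro open_Int open_Collect_less continuous_intros; simp)
qed

lemma slab_scaled:
  assumes "\<bar>l\<bar> \<le> 1" "l \<noteq> 0" "0 < s" "s < 1"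
  shows "(l * s, q) \<in> slab l 0"
proof -
  have "\<bar>l * s\<bar> < 1"
  proof -
    have "\<bar>l\<bar> * s \<le> 1 * s" using assms by (intro mult_right_mono) auto
    then have "\<bar>l * s\<bar> \<le> s" using assms(3) by (simp only: abs_mult abs_of_pos mult_1)
    then show ?thesis using assms(4) by linarith
  qed
  moreover have "0 < l * (l - l * s)" "0 < l * (l * s)"
  proof -
    have l2: "0 < l\<^sup>2" using assms by simp
    have "l * (l - l * s) = l\<^sup>2 * (1 - s)" "l * (l * s) = l\<^sup>2 * s" by (auto simp: power2_eq_square algebra_simps)
    moreover have "0 < l\<^sup>2 * (1 - s)" "0 < l\<^sup>2 * s" using l2 assms by (auto intro: mult_pos_pos)
    ultimately show "0 < l * (l - l * s)" "0 < l * (l * s)" by (simp_all only:)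
  qed
  ultimately show ?thesis unfolding slab_0 fst_conv by blast
qed

lemma countable_lines_negligible:
  assumes "countable C"
  shows "negligible {q :: real \<times> real. snd q + k * fst q \<in> C}"
proof -
  have "negligible {q :: real \<times> real. snd q + k * fst q = c}" for c
  proof -
    have "negligible {q :: real \<times> real. (k, 1) \<bullet> q = c}" by (rule negligible_hyperplane) (simp add: zero_prod_def)
    moreover have "{q :: real \<times> real. (k, 1) \<bullet> q = c} = {q. snd q + k * fst q = c}"
      by (auto simp: inner_prod_def)
    ultimately show ?thesis by simp
  qed
  then have "negligible (\<Union>c\<in>C. {q :: real \<times> real. snd q + k * fst q = c})"
    using assms by (intro negligible_countable_Union) auto
  moreover have "(\<Union>c\<in>C. {q :: real \<times> real. snd q + k * fst q = c}) = {q. snd q + k * fst q \<in> C}" by auto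
  ultimately show ?thesis by simp
qed

lemma AE_lborel_negligible:
  fixes N :: "'a::euclidean_space set"
  assumes "negligible N" "\<And>q. q \<notin> N \<Longrightarrow> P q"
  shows "AE q in lborel. P q"
proof -
  have "AE q in lebesgue. P q"
    by (rule AE_I'[of N]) (use assms in \<open>auto simp: negligible_iff_null_sets\<close>)
  then show ?thesis by (simp add: AE_completion_iff)
qed

lemma fu_tendsto_at_0:
  assumes f: "strip_param f Z" and l: "\<bar>l\<bar> \<le> 1" "l \<noteq> 0"
    and s: "\<And>n. 0 < s n" "\<And>n. s n < (1::real)" "s \<longlonglongrightarrow> 0"
    and c: "z - l * y / 2 \<notin> Z ` \<rat>"
  shows "(\<lambda>n. fu l Z (l * s n, y, z)) \<longlonglongrightarrow> inv Z (z - l * y / 2)"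
proof -
  have g: "grows 0 Z" using f by (simp add: strip_param_def)
  define w where "w = z - l * y / 2"
  define u where "u = inv Z w"
  have Zu: "Z u = w" by (simp add: u_def surj_f_inv_f[OF strip_surj[OF f]])
  have strict: "Z v < w" if vu: "v < u" for v
  proof (rule ccontr)
    assume "\<not> Z v < w"
    obtain r where r: "r \<in> \<rat>" "v < r" "r < u" using Rats_dense_in_real[OF vu] by blast
    then have "Z v \<le> Z r" "Z r \<le> Z u" using grows_mono[OF g] by auto
    then have "Z r = w" using Zu \<open>\<not> Z v < w\<close> by simp
    then show False using c imageI[OF r(1), of Z] by (simp add: w_def)
  qed
  have strict': "w < Z v" if vu: "u < v" for v
  proof (rule ccontr)
    assume "\<not> w < Z v"
    obtain r where r: "r \<in> \<rat>" "u < r" "r < v" using Rats_dense_in_real[OF vu] by blast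
    then have "Z u \<le> Z r" "Z r \<le> Z v" using grows_mono[OF g] by auto
    then have "Z r = w" using Zu \<open>\<not> w < Z v\<close> by simp
    then show False using c imageI[OF r(1), of Z] by (simp add: w_def)
  qed
  define k where "k n = l * (l * s n)" for n
  have k0: "k \<longlonglongrightarrow> 0" unfolding k_def by (rule tendsto_eq_intros s(3) | simp)+
  have RRl: "(\<lambda>n. RR Z (k n) v) \<longlonglongrightarrow> Z v" for v
    unfolding RR_def by (rule tendsto_eq_intros k0 | simp)+
  have sl: "(l * s n, y, z) \<in> slab l 0" for n by (rule slab_scaled[OF l s(1,2)])
  have kn: "k n < 1" "0 < (1 - k n) * 0 + k n" for n
    using slab_less_1[OF l(1) sl[of n]] sl[of n] by (auto simp: k_def slab_0)
  have eq: "RR Z (k n) (fu l Z (l * s n, y, z)) = w" for n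
    using fu_eq[OF g l(1) sl[of n]] by (simp add: k_def cc_def w_def)
  have "(\<lambda>n. fu l Z (l * s n, y, z)) \<longlonglongrightarrow> u"
  proof (rule order_tendstoI)
    fix v assume "v < u"
    then have "\<forall>\<^sub>F n in sequentially. RR Z (k n) v < w" using order_tendstoD(2)[OF RRl strict] by blast
    then show "\<forall>\<^sub>F n in sequentially. v < fu l Z (l * s n, y, z)"
      by (rule eventually_mono) (metis RR_strict[OF g kn] eq)
  next
    fix v assume "u < v"
    then have "\<forall>\<^sub>F n in sequentially. w < RR Z (k n) v" using order_tendstoD(1)[OF RRl strict'] by blast
    then show "\<forall>\<^sub>F n in sequentially. fu l Z (l * s n, y, z) < v"
      by (rule eventually_mono) (metis RR_strict[OF g kn] eq)
  qed
  then show ?thesis by (simp add: u_def w_def)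
qed

section \<open>A cutoff in the abscissa\<close>

definition kcut :: "real \<Rightarrow> real \<Rightarrow> real" where
  "kcut \<epsilon> s = hstep (s / \<epsilon> - 1) * hstep ((1 - s) / \<epsilon> - 1)"

definition kcut' :: "real \<Rightarrow> real \<Rightarrow> real" where
  "kcut' \<epsilon> s = hstep' (s / \<epsilon> - 1) / \<epsilon> - hstep' ((1 - s) / \<epsilon> - 1) / \<epsilon>"

text \<open>For \<open>\<epsilon> \<le> 1 / 4\<close> the ramps on
  \<open>[\<epsilon>, 2 * \<epsilon>]\<close> and
  \<open>[1 - 2 * \<epsilon>, 1 - \<epsilon>]\<close> do not overlap. So wherever one factor varies
  the other one equals 1, and the product rule reduces to a difference.\<close>

lemma kcut_derivative:
  assumes "0 < \<epsilon>" "\<epsilon> \<le> 1 / 4"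
  shows "(kcut \<epsilon> has_real_derivative kcut' \<epsilon> s) (at s)"
proof -
  let ?u = "s / \<epsilon> - 1" and ?v = "(1 - s) / \<epsilon> - 1"
  have sum: "2 \<le> ?u + ?v"
  proof -
    have "?u + ?v = 1 / \<epsilon> - 2" using assms by (simp add: field_simps)
    moreover have "4 \<le> 1 / \<epsilon>" using assms by (simp add: field_simps)
    ultimately show ?thesis by linarith
  qed
  have 1: "hstep' ?u * hstep ?v = hstep' ?u" using sum hstep'_0[of ?u] hstep_1[of ?v] by (cases "1 \<le> ?u") auto
  have 2: "hstep ?u * hstep' ?v = hstep' ?v" using sum hstep'_0[of ?v] hstep_1[of ?u] by (cases "1 \<le> ?v") auto
  have d1: "((\<lambda>s. hstep (s / \<epsilon> - 1)) has_real_derivative hstep' ?u * (1 / \<epsilon>)) (at s)"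
    by (rule DERIV_chain2[OF hstep_derivative]) (use assms in \<open>auto intro!: derivative_eq_intros\<close>)
  have d2: "((\<lambda>s. hstep ((1 - s) / \<epsilon> - 1)) has_real_derivative hstep' ?v * (- 1 / \<epsilon>)) (at s)"
    by (rule DERIV_chain2[OF hstep_derivative]) (use assms in \<open>auto intro!: derivative_eq_intros\<close>)
  have "(kcut \<epsilon> has_real_derivative hstep' ?u * (1 / \<epsilon>) * hstep ?v + hstep' ?v * (- 1 / \<epsilon>) * hstep ?u) (at s)"
    unfolding kcut_def[abs_def] by (rule DERIV_mult[OF d1 d2])
  moreover have "hstep' ?u * (1 / \<epsilon>) * hstep ?v + hstep' ?v * (- 1 / \<epsilon>) * hstep ?u
      = (hstep' ?u * hstep ?v) / \<epsilon> - (hstep ?u * hstep' ?v) / \<epsilon>" by (simp add: algebra_simps)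
  ultimately show ?thesis unfolding 1 2 kcut'_def by simp
qed

lemma hstep'_integral: "integral\<^sup>L lborel hstep' = 1"
proof -
  have "(\<integral>x. hstep' x * indicator {0..1} x \<partial>lborel) = hstep 1 - hstep 0"
    by (rule integral_FTC_Icc_real)
       (use hstep_derivative hstep'_continuous in \<open>auto simp: continuous_on_eq_continuous_at\<close>)
  moreover have "(\<lambda>x. hstep' x * indicator {0..1} x) = hstep'"
  proof
    fix x show "hstep' x * indicator {0..1} x = hstep' x" using hstep'_0[of x] by (cases "x \<in> {0..1}") auto
  qed
  ultimately show ?thesis by (simp add: hstep_0 hstep_1)
qed

text \<open>The two ramps contribute approximate identities of mass 1 at \<open>s = 0\<close> and of
  mass -1 at \<open>s = 1\<close>; rescaling each of them to the unit interval permits dominated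
  convergence.\<close>

lemma kcut'_integral_limit:
  assumes H: "H \<in> borel_measurable borel" "\<And>s. \<bar>H s\<bar> \<le> C"
    and l0: "\<And>s. (\<And>n. 0 < s n) \<Longrightarrow> (\<And>n. s n < 1) \<Longrightarrow> s \<longlonglongrightarrow> 0 \<Longrightarrow> (\<lambda>n. H (s n)) \<longlonglongrightarrow> h"
    and l1: "\<And>s. (\<And>n. 0 < s n) \<Longrightarrow> (\<And>n. s n < 1) \<Longrightarrow> s \<longlonglongrightarrow> 1 \<Longrightarrow> (\<lambda>n. H (s n)) \<longlonglongrightarrow> 0"
    and e: "\<And>n. 0 < \<epsilon> n" "\<And>n. \<epsilon> n \<le> 1 / 4" "\<epsilon> \<longlonglongrightarrow> 0"
  shows "(\<lambda>n. \<integral>s. kcut' (\<epsilon> n) s * H s \<partial>lborel) \<longlonglongrightarrow> h"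
proof -
  have hm: "hstep' \<in> borel_measurable borel" by (rule borel_measurable_continuous_onI[OF hstep'_continuous])
  have C0: "0 \<le> C" using H(2)[of 0] by simp
  have bnd: "\<bar>hstep' t * H s\<bar> \<le> 2 * C * indicator {0..1} t" for s t
  proof (cases "t \<in> {0..1}")
    case True
    have "\<bar>hstep' t\<bar> * \<bar>H s\<bar> \<le> 2 * C" using hstep'_nonneg[of t] hstep'_le[of t] H(2)[of s] by (intro mult_mono) auto
    then show ?thesis using True by (simp add: abs_mult)
  qed (auto simp: hstep'_0)
  have wi: "integrable lborel (\<lambda>t::real. 2 * C * indicat_real {0..1} t)"
    by (intro integrable_mult_right integrable_real_indicator) auto
  have ae: "integral\<^sup>L lborel (\<lambda>s. hstep' (s / \<epsilon> n - 1) / \<epsilon> n * H s) = (\<integral>t. hstep' t * H (\<epsilon> n + \<epsilon> n * t) \<partial>lborel)"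
    "integral\<^sup>L lborel (\<lambda>s. hstep' ((1 - s) / \<epsilon> n - 1) / \<epsilon> n * H s) = (\<integral>t. hstep' t * H (1 - \<epsilon> n + - \<epsilon> n * t) \<partial>lborel)"
    and ie: "integrable lborel (\<lambda>s. hstep' (s / \<epsilon> n - 1) / \<epsilon> n * H s)"
    "integrable lborel (\<lambda>s. hstep' ((1 - s) / \<epsilon> n - 1) / \<epsilon> n * H s)" for n
  proof -
    have e0: "\<epsilon> n \<noteq> 0" "0 < \<epsilon> n" using e(1)[of n] by auto
    have i: "integrable lborel (\<lambda>t. hstep' t * H (g t))" if "g \<in> borel_measurable borel" for g
      by (rule Bochner_Integration.integrable_bound[OF wi])
         (use bnd C0 hm measurable_compose[OF that H(1)] in \<open>auto simp: abs_mult\<close>)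
    have A: "hstep' ((\<epsilon> n + \<epsilon> n * t) / \<epsilon> n - 1) / \<epsilon> n * H (\<epsilon> n + \<epsilon> n * t) = (1 / \<epsilon> n) * (hstep' t * H (\<epsilon> n + \<epsilon> n * t))" for t
      using e0 by (simp add: add_divide_distrib)
    have B: "hstep' ((1 - (1 - \<epsilon> n + - \<epsilon> n * t)) / \<epsilon> n - 1) / \<epsilon> n * H (1 - \<epsilon> n + - \<epsilon> n * t)
        = (1 / \<epsilon> n) * (hstep' t * H (1 - \<epsilon> n + - \<epsilon> n * t))" for t
      using e0 by (simp add: add_divide_distrib)
    show "integral\<^sup>L lborel (\<lambda>s. hstep' (s / \<epsilon> n - 1) / \<epsilon> n * H s) = (\<integral>t. hstep' t * H (\<epsilon> n + \<epsilon> n * t) \<partial>lborel)"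
      using lborel_integral_real_affine[OF e0(1), of "\<lambda>s. hstep' (s / \<epsilon> n - 1) / \<epsilon> n * H s" "\<epsilon> n"] e0
      unfolding A by simp
    have m: "- \<epsilon> n \<noteq> 0" using e0 by simp
    show "integral\<^sup>L lborel (\<lambda>s. hstep' ((1 - s) / \<epsilon> n - 1) / \<epsilon> n * H s) = (\<integral>t. hstep' t * H (1 - \<epsilon> n + - \<epsilon> n * t) \<partial>lborel)"
      using lborel_integral_real_affine[OF m, of "\<lambda>s. hstep' ((1 - s) / \<epsilon> n - 1) / \<epsilon> n * H s" "1 - \<epsilon> n"] e0
      unfolding B by simp
    show "integrable lborel (\<lambda>s. hstep' (s / \<epsilon> n - 1) / \<epsilon> n * H s)"
      by (subst lborel_integrable_real_affine_iff[OF e0(1), of _ "\<epsilon> n", symmetric], unfold A)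
         (intro integrable_mult_right i; measurable)
    show "integrable lborel (\<lambda>s. hstep' ((1 - s) / \<epsilon> n - 1) / \<epsilon> n * H s)"
      by (subst lborel_integrable_real_affine_iff[OF m, of _ "1 - \<epsilon> n", symmetric], unfold B)
         (intro integrable_mult_right i; measurable)
  qed
  have lim: "(\<lambda>n. \<integral>t. hstep' t * H (g n t) \<partial>lborel) \<longlonglongrightarrow> (\<integral>t. hstep' t * c \<partial>lborel)"
    if "\<And>t. 0 < t \<Longrightarrow> t < 1 \<Longrightarrow> (\<lambda>n. H (g n t)) \<longlonglongrightarrow> c" and gm: "\<And>n. g n \<in> borel_measurable borel" for g c
  proof (rule integral_dominated_convergence[OF _ _ wi])
    show "AE t in lborel. (\<lambda>n. hstep' t * H (g n t)) \<longlonglongrightarrow> hstep' t * c"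
    proof (intro AE_I2)
      fix t
      show "(\<lambda>n. hstep' t * H (g n t)) \<longlonglongrightarrow> hstep' t * c"
      proof (cases "0 < t \<and> t < 1")
        case True
        then show ?thesis by (intro tendsto_mult tendsto_const that(1)) auto
      next
        case False
        then show ?thesis using hstep'_0[of t] by auto
      qed
    qed
    show "AE t in lborel. norm (hstep' t * H (g n t)) \<le> 2 * C * indicator {0..1} t" for n
      using bnd by (intro AE_I2) simp
    show "(\<lambda>t. hstep' t * H (g n t)) \<in> borel_measurable lborel" for n
      using hm measurable_compose[OF gm H(1)] by simp
  qed (use hm in simp)
  have L0: "(\<lambda>n. \<integral>t. hstep' t * H (\<epsilon> n + \<epsilon> n * t) \<partial>lborel) \<longlonglongrightarrow> (\<integral>t. hstep' t * h \<partial>lborel)"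
  proof (rule lim)
    fix t :: real assume t: "0 < t" "t < 1"
    show "(\<lambda>n. H (\<epsilon> n + \<epsilon> n * t)) \<longlonglongrightarrow> h"
    proof (rule l0)
      show "0 < \<epsilon> n + \<epsilon> n * t" for n using e(1)[of n] t by (simp add: add_pos_pos)
      show "\<epsilon> n + \<epsilon> n * t < 1" for n
      proof -
        have "\<epsilon> n * t \<le> \<epsilon> n" using e(1)[of n] t by (simp add: mult_le_cancel_left2)
        then show ?thesis using e(2)[of n] by linarith
      qed
      have "(\<lambda>n. \<epsilon> n + \<epsilon> n * t) \<longlonglongrightarrow> 0 + 0 * t" by (intro tendsto_intros e(3))
      then show "(\<lambda>n. \<epsilon> n + \<epsilon> n * t) \<longlonglongrightarrow> 0" by simp
    qed
  qed measurable
  have L1: "(\<lambda>n. \<integral>t. hstep' t * H (1 - \<epsilon> n + - \<epsilon> n * t) \<partial>lborel) \<longlonglongrightarrow> (\<integral>t. hstep' t * 0 \<partial>lborel)"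
  proof (rule lim)
    fix t :: real assume t: "0 < t" "t < 1"
    show "(\<lambda>n. H (1 - \<epsilon> n + - \<epsilon> n * t)) \<longlonglongrightarrow> 0"
    proof (rule l1)
      show "1 - \<epsilon> n + - \<epsilon> n * t < 1" for n using e(1)[of n] mult_pos_pos[OF e(1)[of n] t(1)] by simp
      show "0 < 1 - \<epsilon> n + - \<epsilon> n * t" for n
      proof -
        have "\<epsilon> n * t \<le> \<epsilon> n" using e(1)[of n] t by (simp add: mult_le_cancel_left2)
        then show ?thesis using e(2)[of n] by linarith
      qed
      have "(\<lambda>n. 1 - \<epsilon> n + - \<epsilon> n * t) \<longlonglongrightarrow> 1 - 0 + - 0 * t" by (intro tendsto_intros e(3))
      then show "(\<lambda>n. 1 - \<epsilon> n + - \<epsilon> n * t) \<longlonglongrightarrow> 1" by simp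
    qed
  qed measurable
  have "(\<integral>s. kcut' (\<epsilon> n) s * H s \<partial>lborel) = (\<integral>t. hstep' t * H (\<epsilon> n + \<epsilon> n * t) \<partial>lborel) - (\<integral>t. hstep' t * H (1 - \<epsilon> n + - \<epsilon> n * t) \<partial>lborel)" for n
    unfolding ae[symmetric] kcut'_def using ie by (simp add: left_diff_distrib)
  moreover have "(\<lambda>n. (\<integral>t. hstep' t * H (\<epsilon> n + \<epsilon> n * t) \<partial>lborel) - (\<integral>t. hstep' t * H (1 - \<epsilon> n + - \<epsilon> n * t) \<partial>lborel)) \<longlonglongrightarrow> h - 0"
    using tendsto_diff[OF L0 L1] hstep'_integral by simp
  ultimately show ?thesis by simp
qed

section \<open>Flux through the sections of a wedge\<close>

context
  fixes f :: "hpt \<Rightarrow> real" and Z :: "real \<Rightarrow> real" and l uA B :: real and a :: "hpt \<Rightarrow> real"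
  assumes f: "strip_param f Z" and l: "\<bar>l\<bar> \<le> 1" "l \<noteq> 0"
    and ac: "continuous_on UNIV a" and a1: "\<And>p. \<bar>a p\<bar> \<le> 1"
begin

abbreviation "DS \<equiv> ruling_wedge l Z uA B"

definition flux_density :: "hpt \<Rightarrow> real" where
  "flux_density p = indicator DS p * (fx (fM l Z p) - a p)"

definition section_flux :: "real \<Rightarrow> real" where
  "section_flux x = integral\<^sup>L lborel (\<lambda>q. flux_density (x, q))"

lemma Z_grows: "grows 0 Z" using f by (simp add: strip_param_def)

lemma flux_density_measurable: "flux_density \<in> borel_measurable borel"
proof -
  have sub: "DS \<subseteq> slab l 0" by (auto simp: ruling_wedge_def)
  have "continuous_on DS (\<lambda>p. fx (fM l Z p) - a p)"
    by (intro continuous_intros continuous_on_compose2[OF fx_continuous continuous_on_subset[OF fol_continuous(2)[OF Z_grows l(1)] sub]]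
        continuous_on_subset[OF ac]) auto
  then have "(\<lambda>p. indicator DS p *\<^sub>R (fx (fM l Z p) - a p)) \<in> borel_measurable borel"
    by (rule borel_measurable_continuous_on_indicator[OF ruling_wedge_borel[OF Z_grows l(1)]])
  then show ?thesis by (simp add: flux_density_def[abs_def])
qed

lemma flux_density_abs: "\<bar>flux_density p\<bar> \<le> 2 * indicator DS p"
  using fx_abs_le[of "fM l Z p"] a1[of p] by (auto simp: flux_density_def indicator_def)

lemma section_measurable: "(\<lambda>q. flux_density (x, q)) \<in> borel_measurable borel"
proof -
  have "(\<lambda>q::real \<times> real. (x, q)) \<in> borel_measurable borel"
    by (intro borel_measurable_continuous_onI continuous_intros)
  then show ?thesis using flux_density_measurable by (rule measurable_compose)
qed

lemma section_flux_measurable: "section_flux \<in> borel_measurable borel"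
proof -
  have "flux_density \<in> borel_measurable (lborel \<Otimes>\<^sub>M lborel)"
    using flux_density_measurable by (simp add: lborel_prod)
  then have "case_prod (\<lambda>x q. flux_density (x, q)) \<in> borel_measurable (lborel \<Otimes>\<^sub>M lborel)" by simp
  then have "(\<lambda>x. \<integral>q. flux_density (x, q) \<partial>lborel) \<in> borel_measurable lborel"
    by (rule lborel.borel_measurable_lebesgue_integral)
  then show ?thesis by (simp add: section_flux_def[abs_def])
qed

lemma DS_box: obtains R where "0 \<le> R"
  "\<And>p. p \<in> DS \<Longrightarrow> \<bar>fst p\<bar> \<le> \<bar>l\<bar> \<and> snd p \<in> cbox (-R, -R) (R, R)"
proof -
  obtain R Y where "\<And>p. p \<in> DS \<Longrightarrow> \<bar>fst p\<bar> \<le> \<bar>l\<bar> \<and> \<bar>fst (snd p)\<bar> \<le> R \<and> \<bar>snd (snd p)\<bar> \<le> R \<and> fy0 l Z p \<le> Y"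
    using ruling_wedge_bounds[OF f l refl] by metis
  then show thesis by (intro that[of "\<bar>R\<bar>"]) (auto simp: cbox_Pair_eq abs_le_iff, force+)
qed

lemma section_flux_bounded: obtains C where "0 \<le> C" "\<And>x. \<bar>section_flux x\<bar> \<le> C"
proof -
  obtain R where R: "\<And>p. p \<in> DS \<Longrightarrow> \<bar>fst p\<bar> \<le> \<bar>l\<bar> \<and> snd p \<in> cbox (-R, -R) (R, R)" using DS_box by metis
  let ?Q = "cbox (-R, -R) (R, R) :: (real \<times> real) set"
  have i: "integrable lborel (\<lambda>q. 2 * indicat_real ?Q q)"
    by (intro integrable_mult_right integrable_real_indicator) (use emeasure_bounded_finite[of ?Q] in auto)
  have "\<bar>section_flux x\<bar> \<le> integral\<^sup>L lborel (\<lambda>q. 2 * indicat_real ?Q q)" for x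
  proof -
    have b: "norm (flux_density (x, q)) \<le> 2 * indicat_real ?Q q" for q
      using flux_density_abs[of "(x, q)"] R[of "(x, q)"] by (cases "(x, q) \<in> DS") auto
    have "integrable lborel (\<lambda>q. flux_density (x, q))"
      by (rule Bochner_Integration.integrable_bound[OF i]) (use section_measurable b in auto)
    then have "norm (section_flux x) \<le> integral\<^sup>L lborel (\<lambda>q. norm (flux_density (x, q)))"
      unfolding section_flux_def by (intro integral_norm_bound)
    also have "\<dots> \<le> integral\<^sup>L lborel (\<lambda>q. 2 * indicat_real ?Q q)"
      by (rule integral_mono[OF integrable_norm i b]) fact
    finally show ?thesis by simp
  qed
  then show thesis using that[of "integral\<^sup>L lborel (\<lambda>q. 2 * indicat_real ?Q q)"] abs_ge_zero order_trans by metis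
qed

lemma section_flux_limit:
  assumes s: "\<And>n. 0 < s n" "\<And>n. s n < 1"
    and lim: "negligible N" "\<And>q. q \<notin> N \<Longrightarrow> (\<lambda>n. flux_density (l * s n, q)) \<longlonglongrightarrow> h q" and h: "h \<in> borel_measurable borel"
  shows "(\<lambda>n. section_flux (l * s n)) \<longlonglongrightarrow> integral\<^sup>L lborel h"
proof -
  obtain R where R: "\<And>p. p \<in> DS \<Longrightarrow> \<bar>fst p\<bar> \<le> \<bar>l\<bar> \<and> snd p \<in> cbox (-R, -R) (R, R)" using DS_box by metis
  let ?Q = "cbox (-R, -R) (R, R) :: (real \<times> real) set"
  show ?thesis unfolding section_flux_def
  proof (rule integral_dominated_convergence[where w="\<lambda>q. 2 * indicat_real ?Q q"])
    show "integrable lborel (\<lambda>q. 2 * indicat_real ?Q q)"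
      by (intro integrable_mult_right integrable_real_indicator) (use emeasure_bounded_finite[of ?Q] in auto)
    show "AE q in lborel. (\<lambda>n. flux_density (l * s n, q)) \<longlonglongrightarrow> h q"
      by (rule AE_lborel_negligible[OF lim])
    show "AE q in lborel. norm (flux_density (l * s n, q)) \<le> 2 * indicat_real ?Q q" for n
    proof (intro AE_I2)
      fix q
      show "norm (flux_density (l * s n, q)) \<le> 2 * indicat_real ?Q q"
        using flux_density_abs[of "(l * s n, q)"] R[of "(l * s n, q)"] by (cases "(l * s n, q) \<in> DS") auto
    qed
  qed (use h section_measurable in auto)
qed

text \<open>As \<open>x\<close> tends to 0, the parameter, slope and intercept of the line through a
  fixed \<open>(y, z)\<close> converge, and the section of the wedge converges to the triangle away
  from a null set.\<close>

lemma section_flux_at_0: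
  assumes s: "\<And>n. 0 < s n" "\<And>n. s n < 1" "s \<longlonglongrightarrow> 0"
  shows "(\<lambda>n. section_flux (l * s n)) \<longlonglongrightarrow> integral\<^sup>L lborel (\<lambda>q. indicator (flux_triangle l (Z uA) B) q * (wall_flux l Z q - a (0, q)))"
proof -
  define A where "A = Z uA"
  \<comment> \<open>The excluded set consists of the lines carrying the three sides of the triangle
    and of the countably many lines on which the limit parameter may be ambiguous.\<close>
  define N where "N = {q :: real \<times> real. fst q = 0} \<union> {q. snd q + (- l / 2) * fst q \<in> Z ` \<rat> \<union> {A}} \<union> {q. snd q + (l / 2) * fst q \<in> {B}}"
  have "negligible {q :: real \<times> real. fst q = 0}"
  proof -
    have "negligible {q :: real \<times> real. (1, 0) \<bullet> q = 0}" by (rule negligible_hyperplane) (simp add: zero_prod_def)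
    then show ?thesis by (simp add: inner_prod_def)
  qed
  then have N: "negligible N" unfolding N_def
    by (intro negligible_Un countable_lines_negligible) (auto simp: countable_rat)
  have "(\<lambda>n. flux_density (l * s n, q)) \<longlonglongrightarrow> indicator (flux_triangle l A B) q * (wall_flux l Z q - a (0, q))" if "q \<notin> N" for q
  proof -
    obtain y z where q: "q = (y, z)" by (cases q)
    define w where "w = z - l * y / 2"
    define u where "u = inv Z w"
    have ne: "y \<noteq> 0" "w \<notin> Z ` \<rat>" "w \<noteq> A" "z + l * y / 2 \<noteq> B" using that by (auto simp: N_def q w_def)
    have Zu: "Z u = w" by (simp add: u_def surj_f_inv_f[OF strip_surj[OF f]])
    have ul: "(\<lambda>n. fu l Z (l * s n, y, z)) \<longlonglongrightarrow> u"
      unfolding u_def w_def by (rule fu_tendsto_at_0[OF f l s]) (use ne in \<open>simp add: w_def\<close>)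
    have Zc: "isCont Z u" using Z_grows by (simp add: grows_def continuous_on_eq_continuous_at)
    have Zul: "(\<lambda>n. Z (fu l Z (l * s n, y, z))) \<longlonglongrightarrow> w" using isCont_tendsto_compose[OF Zc ul] Zu by simp
    have sgl: "(\<lambda>n. ruling_slope Z (fu l Z (l * s n, y, z))) \<longlonglongrightarrow> ruling_slope Z u"
      unfolding ruling_slope_def Zu by (intro tendsto_intros Zul ul)
    have Ml: "(\<lambda>n. fM l Z (l * s n, y, z)) \<longlonglongrightarrow> (l * ruling_slope Z u - y) / (l - l * 0)"
      unfolding fM_def fst_conv snd_conv by (intro tendsto_intros sgl s(3)) (use l in simp)
    then have Ml: "(\<lambda>n. fM l Z (l * s n, y, z)) \<longlonglongrightarrow> ruling_slope Z u - y / l"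
      using l by (simp add: diff_divide_distrib)
    have yl: "(\<lambda>n. fy0 l Z (l * s n, y, z)) \<longlonglongrightarrow> l * (ruling_slope Z u - (ruling_slope Z u - y / l))"
      unfolding fy0_def by (intro tendsto_intros sgl Ml)
    then have yl: "(\<lambda>n. fy0 l Z (l * s n, y, z)) \<longlonglongrightarrow> y" using l by simp
    have bl: "(\<lambda>n. fb l Z (l * s n, y, z)) \<longlonglongrightarrow> z + l * y / 2"
    proof -
      have "(\<lambda>n. fb l Z (l * s n, y, z)) \<longlonglongrightarrow> w + l * y" unfolding fb_def by (intro tendsto_intros Zul yl)
      then show ?thesis by (simp add: w_def add.commute)
    qed
    have uA: "0 < l * (u - uA) \<longleftrightarrow> 0 < l * (w - A)" "l * (u - uA) < 0 \<longleftrightarrow> l * (w - A) < 0"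
    proof -
      have "u < uA \<longleftrightarrow> w < A" "uA < u \<longleftrightarrow> A < w"
        using grows_mono[OF Z_grows, of u uA] grows_mono[OF Z_grows, of uA u] Zu ne(3) unfolding A_def by fastforce+
      then show "0 < l * (u - uA) \<longleftrightarrow> 0 < l * (w - A)" "l * (u - uA) < 0 \<longleftrightarrow> l * (w - A) < 0"
        by (auto simp: zero_less_mult_iff mult_less_0_iff)
    qed
    have sl: "(l * s n, y, z) \<in> slab l 0" for n by (rule slab_scaled[OF l s(1,2)])
    have dl: "(\<lambda>n. l * (fu l Z (l * s n, y, z) - uA)) \<longlonglongrightarrow> l * (u - uA)"
      "(\<lambda>n. l * (B - fb l Z (l * s n, y, z))) \<longlonglongrightarrow> l * (B - (z + l * y / 2))"
      by (intro tendsto_intros ul bl)+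
    have "\<forall>\<^sub>F n in sequentially. indicat_real DS (l * s n, y, z) = indicator (flux_triangle l A B) q"
    proof (cases "q \<in> flux_triangle l A B")
      case True
      then have pos: "0 < y" "0 < l * (u - uA)" "0 < l * (B - (z + l * y / 2))"
        using uA by (auto simp: flux_triangle_def q w_def)
      have "\<forall>\<^sub>F n in sequentially. 0 < fy0 l Z (l * s n, y, z) \<and> 0 < l * (fu l Z (l * s n, y, z) - uA)
          \<and> 0 < l * (B - fb l Z (l * s n, y, z))"
        by (intro eventually_conj order_tendstoD(1)[OF yl pos(1)] order_tendstoD(1)[OF dl(1) pos(2)] order_tendstoD(1)[OF dl(2) pos(3)])
      then show ?thesis by (rule eventually_mono) (use sl True in \<open>auto simp: ruling_wedge_def indicator_def less_imp_le\<close>)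
    next
      case False
      then have "y < 0 \<or> l * (u - uA) < 0 \<or> l * (B - (z + l * y / 2)) < 0"
        using uA ne l by (auto simp: flux_triangle_def q w_def not_less order_le_less)
      then have "\<forall>\<^sub>F n in sequentially. fy0 l Z (l * s n, y, z) < 0 \<or> l * (fu l Z (l * s n, y, z) - uA) < 0
          \<or> l * (B - fb l Z (l * s n, y, z)) < 0"
        using order_tendstoD(2)[OF yl, of 0] order_tendstoD(2)[OF dl(1), of 0] order_tendstoD(2)[OF dl(2), of 0]
        by (auto elim: eventually_mono)
      then show ?thesis by (rule eventually_mono) (use False in \<open>auto simp: ruling_wedge_def indicator_def\<close>)
    qed
    then have il: "(\<lambda>n. indicat_real DS (l * s n, y, z)) \<longlonglongrightarrow> indicator (flux_triangle l A B) q" by (rule tendsto_eventually)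
    have "isCont fx (ruling_slope Z u - y / l)" using fx_continuous by (simp add: continuous_on_eq_continuous_at)
    from isCont_tendsto_compose[OF this Ml]
    have fxl: "(\<lambda>n. fx (fM l Z (l * s n, y, z))) \<longlonglongrightarrow> wall_flux l Z q"
      by (simp add: wall_flux_def q slope_at_def u_def w_def)
    have "(\<lambda>n. (l * s n, y, z)) \<longlonglongrightarrow> (l * 0, y, z)" by (intro tendsto_intros s(3))
    moreover have "isCont a (0, y, z)" using ac by (simp add: continuous_on_eq_continuous_at)
    ultimately have al: "(\<lambda>n. a (l * s n, y, z)) \<longlonglongrightarrow> a (0, q)" using isCont_tendsto_compose[of "(0,y,z)" a] by (simp add: q)
    show ?thesis unfolding flux_density_def q using il fxl al unfolding q by (intro tendsto_intros)
  qed
  moreover have "(\<lambda>q. indicator (flux_triangle l A B) q * (wall_flux l Z q - a (0, q))) \<in> borel_measurable borel"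
  proof -
    have "(\<lambda>q. a (0, q)) \<in> borel_measurable borel"
      by (intro borel_measurable_continuous_onI continuous_on_compose2[OF ac]) (auto intro: continuous_intros)
    then show ?thesis using wall_flux_measurable[OF f, of l] flux_triangle_open[of l A B] by simp
  qed
  ultimately show ?thesis unfolding A_def[symmetric] by (intro section_flux_limit[OF s(1,2) N])
qed

text \<open>At \<open>x = l\<close> all lines end on the curve
  \<open>u \<mapsto> (l * ruling_slope Z u, Z u)\<close> in the coordinates \<open>(y, z)\<close>.
  The sections of the wedge shrink to this null set, so the outer end contributes no flux.\<close>

lemma section_flux_at_1:
  assumes s: "\<And>n. 0 < s n" "\<And>n. s n < 1" "s \<longlonglongrightarrow> 1"
  shows "(\<lambda>n. section_flux (l * s n)) \<longlonglongrightarrow> 0"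
proof -
  obtain R Y where RY: "\<And>p. p \<in> DS \<Longrightarrow> \<bar>fst p\<bar> \<le> \<bar>l\<bar> \<and> \<bar>fst (snd p)\<bar> \<le> R \<and> \<bar>snd (snd p)\<bar> \<le> R \<and> fy0 l Z p \<le> Y"
    using ruling_wedge_bounds[OF f l refl] by metis
  \<comment> \<open>The curve with \<open>u\<close> eliminated: \<open>y = 2 * l * (Z u - u)\<close>
    and \<open>z = Z u\<close> give \<open>u = z - y / (2 * l)\<close>. The translation in the next
    argument leaves this \<open>u\<close> unchanged while \<open>z\<close> moves.\<close>
  define N where "N = {q :: real \<times> real. snd q = Z (snd q - fst q / (2 * l))}"
  have Zc: "continuous_on UNIV Z" using Z_grows by (simp add: grows_def)
  have "continuous_on UNIV (\<lambda>q::real \<times> real. snd q - fst q / (2 * l))"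
    using l by (intro continuous_intros) auto
  then have "continuous_on UNIV (\<lambda>q::real \<times> real. Z (snd q - fst q / (2 * l)))"
    by (rule continuous_on_compose2[OF Zc]) auto
  then have "closed N" unfolding N_def
    by (intro closed_Collect_eq continuous_on_snd continuous_on_id)
  then have "N \<in> sets lebesgue" by (intro sets_completionI_sets) auto
  then have N: "negligible N"
  proof (rule negligible_line_sections[where d="(1, 1 / (2 * l))"])
    fix p :: "real \<times> real" and t assume p: "p \<in> N" "p + t *\<^sub>R (1, 1 / (2 * l)) \<in> N"
    have eq: "snd p + t / (2 * l) - (fst p + t) / (2 * l) = snd p - fst p / (2 * l)" using l by (simp add: field_simps)
    have "snd p + t / (2 * l) = Z (snd p + t / (2 * l) - (fst p + t) / (2 * l))" "snd p = Z (snd p - fst p / (2 * l))"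
      using p by (auto simp: N_def)
    then have "snd p + t / (2 * l) = snd p" unfolding eq by (rule trans[OF _ sym])
    then show "t = 0" using l by simp
  qed
  have "(\<lambda>n. flux_density (l * s n, q)) \<longlonglongrightarrow> 0" if "q \<notin> N" for q
  proof -
    obtain y z where q: "q = (y, z)" by (cases q)
    define v where "v = z - y / (2 * l)"
    define \<eta> where "\<eta> = \<bar>z - Z v\<bar>"
    have eta: "0 < \<eta>" using that by (simp add: N_def q \<eta>_def v_def)
    have "isCont Z v" using Z_grows by (simp add: grows_def continuous_on_eq_continuous_at)
    then obtain \<delta> where d: "0 < \<delta>" "\<And>u. \<bar>u - v\<bar> < \<delta> \<Longrightarrow> \<bar>Z u - Z v\<bar> < \<eta> / 2"
      using eta unfolding continuous_at_eps_delta dist_real_def by (metis half_gt_zero)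
    define r where "r n = \<bar>l - l * s n\<bar> * \<bar>Y\<bar> / 2" for n
    define r' where "r' n = \<bar>y\<bar> * \<bar>1 / (2 * (l * s n)) - 1 / (2 * l)\<bar> + r n * \<bar>1 / (l * (l * s n))\<bar>" for n
    have "r \<longlonglongrightarrow> \<bar>l - l * 1\<bar> * \<bar>Y\<bar> / 2" unfolding r_def by (intro tendsto_intros s(3)) simp
    then have r0: "r \<longlonglongrightarrow> 0" by simp
    have "r' \<longlonglongrightarrow> \<bar>y\<bar> * \<bar>1 / (2 * (l * 1)) - 1 / (2 * l)\<bar> + 0 * \<bar>1 / (l * (l * 1))\<bar>"
      unfolding r'_def by (intro tendsto_intros s(3) r0) (use l in auto)
    then have r'0: "r' \<longlonglongrightarrow> 0" by simp
    \<comment> \<open>The intercept is at most \<open>Y\<close> in the wedge, so the distance of the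
      point from the ruling with the same parameter is of order \<open>l - x\<close>.\<close>
    have inD: "\<bar>z - Z (fu l Z (l * s n, y, z))\<bar> \<le> r n \<and> \<bar>fu l Z (l * s n, y, z) - v\<bar> \<le> r' n"
      if D: "(l * s n, y, z) \<in> DS" for n
    proof -
      define x u w where "x = l * s n" and "u = fu l Z (x, y, z)" and "w = fy0 l Z (x, y, z)"
      define e where "e = (l - x) * w / 2"
      have sl: "(x, y, z) \<in> slab l 0" using D by (simp add: ruling_wedge_def x_def)
      have w: "0 < w" "w \<le> Y" using D RY[OF D] by (auto simp: ruling_wedge_def w_def x_def)
      have x0: "x \<noteq> 0" "l * x < 1" "0 < l * x" using sl slab_less_1[OF l(1) sl] by (auto simp: slab_0)
      have c: "z - l * y / 2 = (1 - l * x) * Z u + l * x * u" using fu_eq[OF Z_grows l(1) sl] by (simp add: cc_def RR_def u_def)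
      have "l * y = l * (x * ruling_slope Z u) + (l - x) * w"
        using fy0_eq_imp(1)[OF Z_grows l(1) sl] l by (simp add: u_def[symmetric] w_def[symmetric] field_simps)
      then have zZ: "z - Z u = e" using c by (simp add: ruling_slope_def e_def algebra_simps)
      have er: "\<bar>e\<bar> \<le> r n"
      proof -
        have "\<bar>l - x\<bar> * \<bar>w\<bar> \<le> \<bar>l - x\<bar> * \<bar>Y\<bar>" using w by (intro mult_left_mono) auto
        then show ?thesis by (simp add: e_def r_def x_def abs_mult)
      qed
      have "l * x * u = l * x * z - l * y / 2 + (1 - l * x) * e"
        using c zZ by (simp add: algebra_simps)
      then have "u = (l * x * z - l * y / 2 + (1 - l * x) * e) / (l * x)"
        using x0 l by (simp add: nonzero_eq_divide_eq mult.commute)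
      also have "\<dots> = z - y / (2 * x) + (1 - l * x) * e / (l * x)"
        using x0 l by (simp add: add_divide_distrib diff_divide_distrib)
      finally have u: "u - v = y * (1 / (2 * l) - 1 / (2 * x)) + (1 - l * x) * e * (1 / (l * x))"
        by (simp add: v_def right_diff_distrib)
      have "\<bar>y * (1 / (2 * l) - 1 / (2 * x))\<bar> \<le> \<bar>y\<bar> * \<bar>1 / (2 * x) - 1 / (2 * l)\<bar>"
        by (simp add: abs_mult abs_minus_commute)
      moreover have "\<bar>(1 - l * x) * e * (1 / (l * x))\<bar> \<le> r n * \<bar>1 / (l * x)\<bar>"
      proof -
        have "\<bar>1 - l * x\<bar> * \<bar>e\<bar> \<le> 1 * r n" using x0 er by (intro mult_mono) auto
        then have "\<bar>(1 - l * x) * e\<bar> * \<bar>1 / (l * x)\<bar> \<le> r n * \<bar>1 / (l * x)\<bar>"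
          unfolding abs_mult[of "1 - l * x"] by (intro mult_right_mono) auto
        then show ?thesis by (simp only: abs_mult)
      qed
      ultimately have "\<bar>u - v\<bar> \<le> \<bar>y\<bar> * \<bar>1 / (2 * x) - 1 / (2 * l)\<bar> + r n * \<bar>1 / (l * x)\<bar>"
        unfolding u by (meson abs_triangle_ineq add_mono order_trans)
      then show ?thesis using zZ er by (simp add: r'_def x_def u_def mult.assoc)
    qed
    have "\<forall>\<^sub>F n in sequentially. r n < \<eta> / 2 \<and> r' n < \<delta>"
      by (intro eventually_conj order_tendstoD(2)[OF r0] order_tendstoD(2)[OF r'0]) (use eta d in auto)
    then have "\<forall>\<^sub>F n in sequentially. flux_density (l * s n, q) = 0"
    proof (rule eventually_mono)
      fix n assume n: "r n < \<eta> / 2 \<and> r' n < \<delta>"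
      have "(l * s n, y, z) \<notin> DS"
      proof
        assume "(l * s n, y, z) \<in> DS"
        from inD[OF this] n have "\<bar>z - Z (fu l Z (l * s n, y, z))\<bar> < \<eta> / 2" "\<bar>fu l Z (l * s n, y, z) - v\<bar> < \<delta>" by auto
        then have "\<bar>z - Z (fu l Z (l * s n, y, z))\<bar> + \<bar>Z (fu l Z (l * s n, y, z)) - Z v\<bar> < \<eta> / 2 + \<eta> / 2"
          by (intro add_strict_mono d(2))
        moreover have "\<eta> \<le> \<bar>z - Z (fu l Z (l * s n, y, z))\<bar> + \<bar>Z (fu l Z (l * s n, y, z)) - Z v\<bar>"
          unfolding \<eta>_def by (rule abs_triangle_ineq[of "z - Z (fu l Z (l * s n, y, z))" "Z (fu l Z (l * s n, y, z)) - Z v", simplified])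
        ultimately show False by simp
      qed
      then show "flux_density (l * s n, q) = 0" by (simp add: flux_density_def q)
    qed
    then show ?thesis by (rule tendsto_eventually)
  qed
  then have "(\<lambda>n. section_flux (l * s n)) \<longlonglongrightarrow> integral\<^sup>L lborel (\<lambda>q::real \<times> real. 0)"
    by (intro section_flux_limit[OF s(1,2) N]) auto
  then show ?thesis by simp
qed

text \<open>Fubini and the substitution \<open>x = l * s\<close> turn the volume integral into an
  average of section fluxes. The Jacobian \<open>\<bar>l\<bar>\<close> against the factor
  \<open>1 / l\<close> leaves the sign of \<open>l\<close>, which orients the flux.\<close>

lemma flux_limit:
  assumes e: "\<And>n. 0 < \<epsilon> n" "\<And>n. \<epsilon> n \<le> 1 / 4" "\<epsilon> \<longlonglongrightarrow> 0"
  shows "(\<lambda>n. set_lebesgue_integral lebesgue DS (\<lambda>p. kcut' (\<epsilon> n) (fst p / l) / l * (fx (fM l Z p) - a p)))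
    \<longlonglongrightarrow> sgn l * integral\<^sup>L lborel (\<lambda>q. indicator (flux_triangle l (Z uA) B) q * (wall_flux l Z q - a (0, q)))"
proof -
  obtain C where C: "\<And>x. \<bar>section_flux x\<bar> \<le> C" using section_flux_bounded by metis
  let ?h = "integral\<^sup>L lborel (\<lambda>q. indicator (flux_triangle l (Z uA) B) q * (wall_flux l Z q - a (0, q)))"
  have lim: "(\<lambda>n. \<integral>s. kcut' (\<epsilon> n) s * section_flux (l * s) \<partial>lborel) \<longlonglongrightarrow> ?h"
  proof (rule kcut'_integral_limit[OF _ _ _ _ e])
    have "(\<lambda>s. l * s) \<in> borel_measurable borel" by measurable
    then show "(\<lambda>s. section_flux (l * s)) \<in> borel_measurable borel" using section_flux_measurable by (rule measurable_compose)
    show "\<bar>section_flux (l * s)\<bar> \<le> C" for s by (rule C)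
  qed (rule section_flux_at_0 section_flux_at_1; assumption)+
  have eq: "set_lebesgue_integral lebesgue DS (\<lambda>p. kcut' (\<epsilon> n) (fst p / l) / l * (fx (fM l Z p) - a p))
      = sgn l * (\<integral>s. kcut' (\<epsilon> n) s * section_flux (l * s) \<partial>lborel)" for n
  proof -
    obtain R where R: "0 \<le> R" "\<And>p. p \<in> DS \<Longrightarrow> \<bar>fst p\<bar> \<le> \<bar>l\<bar> \<and> snd p \<in> cbox (-R, -R) (R, R)" using DS_box by metis
    let ?g = "\<lambda>p. kcut' (\<epsilon> n) (fst p / l) / l * flux_density p"
    have km: "continuous_on UNIV (kcut' (\<epsilon> n))"
      unfolding kcut'_def using e(1)[of n]
      by (intro continuous_intros continuous_on_compose2[OF hstep'_continuous]) auto
    have kb: "\<bar>kcut' (\<epsilon> n) s / l\<bar> \<le> 2 / \<epsilon> n / \<bar>l\<bar>" for s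
    proof -
      have "\<bar>hstep' (s / \<epsilon> n - 1) / \<epsilon> n - hstep' ((1 - s) / \<epsilon> n - 1) / \<epsilon> n\<bar> \<le> 2 / \<epsilon> n"
      proof -
        have "0 \<le> hstep' u / \<epsilon> n \<and> hstep' u / \<epsilon> n \<le> 2 / \<epsilon> n" for u
          using hstep'_nonneg[of u] hstep'_le[of u] e(1)[of n] by (auto simp: divide_right_mono)
        from this[of "s / \<epsilon> n - 1"] this[of "(1 - s) / \<epsilon> n - 1"] show ?thesis by linarith
      qed
      then show ?thesis unfolding abs_divide kcut'_def by (intro divide_right_mono) auto
    qed
    have gm: "?g \<in> borel_measurable borel"
    proof (intro borel_measurable_times flux_density_measurable borel_measurable_continuous_onI)
      show "continuous_on UNIV (\<lambda>p::hpt. kcut' (\<epsilon> n) (fst p / l) / l)"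
        using l by (intro continuous_intros continuous_on_compose2[OF km]) auto
    qed
    have gi: "integrable lborel ?g"
    proof -
      let ?K = "cbox (-1, -R, -R) (1, R, R) :: hpt set"
      have i: "integrable lborel (\<lambda>p. 2 / \<epsilon> n / \<bar>l\<bar> * 2 * indicat_real ?K p)"
        by (intro integrable_mult_right integrable_real_indicator) (use emeasure_bounded_finite[of ?K] in auto)
      show ?thesis
      proof (rule Bochner_Integration.integrable_bound[OF i])
        show "AE p in lborel. norm (?g p) \<le> norm (2 / \<epsilon> n / \<bar>l\<bar> * 2 * indicat_real ?K p)"
        proof (intro AE_I2)
          fix p
          have nn: "0 \<le> 2 / \<epsilon> n / \<bar>l\<bar>" using e(1)[of n] by simp
          show "norm (?g p) \<le> norm (2 / \<epsilon> n / \<bar>l\<bar> * 2 * indicat_real ?K p)"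
          proof (cases "p \<in> DS")
            case True
            have "p \<in> ?K" using R(2)[OF True] l(1) by (cases p) (auto simp: cbox_Pair_eq)
            have "\<bar>flux_density p\<bar> \<le> 2" using flux_density_abs[of p] True by simp
            then have "\<bar>kcut' (\<epsilon> n) (fst p / l) / l\<bar> * \<bar>flux_density p\<bar> \<le> 2 / \<epsilon> n / \<bar>l\<bar> * 2"
              using kb nn by (intro mult_mono) auto
            moreover have "norm (2 / \<epsilon> n / \<bar>l\<bar> * 2 * indicat_real ?K p) = 2 / \<epsilon> n / \<bar>l\<bar> * 2"
              using nn \<open>p \<in> ?K\<close> e(1)[of n] by simp
            ultimately show ?thesis by (simp only: real_norm_def abs_mult)
          next
            case False
            then show ?thesis by (simp add: flux_density_def)
          qed
        qed
      qed (use gm in simp)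
    qed
    have "set_lebesgue_integral lebesgue DS (\<lambda>p. kcut' (\<epsilon> n) (fst p / l) / l * (fx (fM l Z p) - a p)) = integral\<^sup>L lebesgue ?g"
      unfolding set_lebesgue_integral_def flux_density_def by (simp add: mult.left_commute)
    also have "\<dots> = integral\<^sup>L lborel ?g" by (rule integral_completion) (use gm in simp)
    also have "\<dots> = (\<integral>x. (\<integral>q. ?g (x, q) \<partial>lborel) \<partial>lborel)"
      by (rule lborel_pair.integral_fst'[of ?g, unfolded lborel_prod, OF gi, symmetric])
    also have "\<dots> = (\<integral>x. kcut' (\<epsilon> n) (x / l) / l * section_flux x \<partial>lborel)"
      unfolding section_flux_def fst_conv by simp
    also have "\<dots> = \<bar>l\<bar> * (\<integral>s. kcut' (\<epsilon> n) ((0 + l * s) / l) / l * section_flux (0 + l * s) \<partial>lborel)"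
      using lborel_integral_real_affine[OF l(2), of "\<lambda>x. kcut' (\<epsilon> n) (x / l) / l * section_flux x" 0] by simp
    also have "\<dots> = \<bar>l\<bar> * (\<integral>s. (1 / l) * (kcut' (\<epsilon> n) s * section_flux (l * s)) \<partial>lborel)" using l(2) by simp
    also have "\<dots> = sgn l * (\<integral>s. kcut' (\<epsilon> n) s * section_flux (l * s) \<partial>lborel)"
      using l(2) by (simp only: integral_mult_right_zero) (simp add: sgn_if)
    finally show ?thesis .
  qed
  show ?thesis unfolding eq by (intro tendsto_intros lim)
qed

end

section \<open>Necessity\<close>

abbreviation SI :: "hpt set \<Rightarrow> (hpt \<Rightarrow> real) \<Rightarrow> real" where
  "SI A g \<equiv> set_lebesgue_integral lebesgue A g"

lemma SI_split:
  assumes "integrable lebesgue g" "A \<in> sets lebesgue" "B \<in> sets lebesgue" "B \<subseteq> A"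
  shows "SI A g = SI B g + SI (A - B) g"
proof -
  have i: "set_integrable lebesgue C g" if "C \<in> sets lebesgue" for C
    unfolding set_integrable_def using integrable_mult_indicator[OF that assms(1)] .
  have "SI (B \<union> (A - B)) g = SI B g + SI (A - B) g"
    by (rule set_integral_Un) (use assms in \<open>auto intro!: i\<close>)
  moreover have "B \<union> (A - B) = A" using assms by auto
  ultimately show ?thesis by simp
qed

lemma SI_cong:
  assumes "\<And>p. indicat_real A p * g p = indicat_real B p * h p"
  shows "SI A g = SI B h"
  unfolding set_lebesgue_integral_def real_scaleR_def assms ..

lemma SI_mono:
  assumes "integrable lebesgue g" "integrable lebesgue h" "A \<in> sets lebesgue" "\<And>p. p \<in> A \<Longrightarrow> g p \<le> h p"
  shows "SI A g \<le> SI A h"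
  unfolding set_lebesgue_integral_def
proof (rule integral_mono)
  show "indicat_real A p *\<^sub>R g p \<le> indicat_real A p *\<^sub>R h p" for p
    using assms(4)[of p] by (cases "p \<in> A") auto
qed (rule integrable_mult_indicator[OF assms(3)], rule assms)+

lemma integrable_lebesgue_compact:
  fixes g :: "'a::euclidean_space \<Rightarrow> real"
  assumes "continuous_on UNIV g" "compact K" "\<And>p. p \<notin> K \<Longrightarrow> g p = 0"
  shows "integrable lebesgue g"
  using integrable_compact_support[OF assms] integrable_completion by blast

text \<open>The first factor localises to a compact set; the second keeps the support away from
  \<open>x = 0\<close>, where the fields of the two sides do not match, and from
  \<open>x = l\<close>, where the foliation is singular.\<close>

definition lcut :: "(hpt \<Rightarrow> real) \<Rightarrow> real \<Rightarrow> real \<Rightarrow> hpt \<Rightarrow> real" where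
  "lcut \<eta> l \<epsilon> p = \<eta> p * kcut \<epsilon> (fst p / l)"

definition dlcut :: "(hpt \<Rightarrow> real) \<Rightarrow> (hpt \<Rightarrow> hpt \<Rightarrow> real) \<Rightarrow> real \<Rightarrow> real \<Rightarrow> hpt \<Rightarrow> hpt \<Rightarrow> real" where
  "dlcut \<eta> d\<eta> l \<epsilon> e p = d\<eta> e p * kcut \<epsilon> (fst p / l) + \<eta> p * (kcut' \<epsilon> (fst p / l) * (fst e / l))"

definition lsupp :: "hpt set \<Rightarrow> real \<Rightarrow> real \<Rightarrow> hpt set" where
  "lsupp K l \<epsilon> = K \<inter> {p. \<epsilon> \<le> fst p / l \<and> fst p / l \<le> 1 - \<epsilon>}"

lemma kcut_bounds: "0 \<le> kcut \<epsilon> s" "kcut \<epsilon> s \<le> 1"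
  unfolding kcut_def using hstep_bounds[of "s / \<epsilon> - 1"] hstep_bounds[of "(1 - s) / \<epsilon> - 1"] by (auto intro: mult_le_one)

lemma kcut_0: "0 < \<epsilon> \<Longrightarrow> s < \<epsilon> \<or> 1 - \<epsilon> < s \<Longrightarrow> kcut \<epsilon> s = 0"
  using hstep_0[of "s / \<epsilon> - 1"] hstep_0[of "(1 - s) / \<epsilon> - 1"] by (auto simp: kcut_def field_simps)

context
  fixes l \<epsilon> :: real and \<eta> :: "hpt \<Rightarrow> real" and d\<eta> and K
  assumes l: "\<bar>l\<bar> \<le> 1" "l \<noteq> 0" and e: "0 < \<epsilon>" "\<epsilon> \<le> 1 / 4"
    and eta: "C1on UNIV \<eta> d\<eta>" "\<And>p. 0 \<le> \<eta> p" "\<And>p. \<eta> p \<le> 1" "compact K" "\<forall>p. p \<notin> K \<longrightarrow> \<eta> p = 0"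
begin

lemma kcut'_cont: "continuous_on UNIV (kcut' \<epsilon>)"
proof -
  have "continuous_on UNIV (\<lambda>s. hstep' (s / \<epsilon> - 1))" "continuous_on UNIV (\<lambda>s. hstep' ((1 - s) / \<epsilon> - 1))"
    by (rule continuous_on_compose2[OF hstep'_continuous]; use e in \<open>auto intro!: continuous_intros\<close>)+
  then show ?thesis unfolding kcut'_def[abs_def] using e by (intro continuous_on_diff continuous_on_divide continuous_on_const) auto
qed

lemma lcut_C1: "C1on UNIV (lcut \<eta> l \<epsilon>) (dlcut \<eta> d\<eta> l \<epsilon>)"
proof -
  have "C1on UNIV (\<lambda>p::hpt. fst p / l) (\<lambda>e p. fst e / l)"
    using C1on_mult[OF C1on_const[where c="1/l"] C1on_x] by simp
  from C1on_mult[OF eta(1) C1on_chain_UNIV[OF this kcut_derivative[OF e] kcut'_cont]]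
  show ?thesis unfolding lcut_def dlcut_def .
qed

lemma lcut_bounds: "0 \<le> lcut \<eta> l \<epsilon> p" "lcut \<eta> l \<epsilon> p \<le> 1"
  unfolding lcut_def using eta(2,3)[of p] kcut_bounds[of \<epsilon> "fst p / l"] by (auto intro: mult_le_one)

lemma lsupp_compact: "compact (lsupp K l \<epsilon>)"
  unfolding lsupp_def using l
  by (intro compact_Int_closed eta(4)) (auto intro!: closed_Collect_conj closed_Collect_le continuous_intros)

lemma lsupp_slab: "lsupp K l \<epsilon> \<subseteq> slab l 0"
proof
  fix p assume p: "p \<in> lsupp K l \<epsilon>"
  then have "0 < fst p / l" "fst p / l < 1" using e by (auto simp: lsupp_def)
  from slab_scaled[OF l this, of "snd p"] show "p \<in> slab l 0" using l by simp
qed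

lemma lcut_0: "p \<notin> lsupp K l \<epsilon> \<Longrightarrow> lcut \<eta> l \<epsilon> p = 0"
  using spec[OF eta(5), of p] kcut_0[OF e(1), of "fst p / l"] by (auto simp: lcut_def lsupp_def not_le)

lemma Xd_lcut: "Xd (dlcut \<eta> d\<eta> l \<epsilon>) p = Xd d\<eta> p * kcut \<epsilon> (fst p / l) + \<eta> p * (kcut' \<epsilon> (fst p / l) / l)"
  by (simp add: Xd_def dlcut_def algebra_simps)

lemma Yd_lcut: "Yd (dlcut \<eta> d\<eta> l \<epsilon>) p = Yd d\<eta> p * kcut \<epsilon> (fst p / l)"
  by (simp add: Yd_def dlcut_def algebra_simps)

end

lemma kcut_tendsto:
  assumes "\<And>n. 0 < \<epsilon> n" "\<epsilon> \<longlonglongrightarrow> 0" "0 < s" "s < 1"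
  shows "(\<lambda>n. kcut (\<epsilon> n) s) \<longlonglongrightarrow> 1"
proof -
  have "\<forall>\<^sub>F n in sequentially. \<epsilon> n < s / 2 \<and> \<epsilon> n < (1 - s) / 2"
    by (intro eventually_conj order_tendstoD(2)[OF assms(2)]) (use assms in auto)
  then have "\<forall>\<^sub>F n in sequentially. kcut (\<epsilon> n) s = 1"
  proof (rule eventually_mono)
    fix n assume "\<epsilon> n < s / 2 \<and> \<epsilon> n < (1 - s) / 2"
    then have "1 \<le> s / \<epsilon> n - 1" "1 \<le> (1 - s) / \<epsilon> n - 1" using assms(1)[of n] by (auto simp: field_simps)
    then show "kcut (\<epsilon> n) s = 1" by (simp add: kcut_def hstep_1)
  qed
  then show ?thesis by (rule tendsto_eventually)
qed

lemma slab_0_ratio: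
  assumes "p \<in> slab l 0" shows "0 < fst p / l" "fst p / l < 1"
proof -
  have h: "0 < l * (l - fst p)" "0 < l * fst p" using assms by (auto simp: slab_0)
  then have l: "l \<noteq> 0" by auto
  show "0 < fst p / l" using h by (auto simp: zero_less_mult_iff zero_less_divide_iff)
  have "0 < (l - fst p) / l" using h by (auto simp: zero_less_mult_iff zero_less_divide_iff)
  then show "fst p / l < 1" using l by (simp add: diff_divide_distrib)
qed

lemma SI_kcut_limit:
  assumes g: "integrable lebesgue g" and A: "A \<in> sets lebesgue" "A \<subseteq> slab l 0"
    and e: "\<And>n. 0 < \<epsilon> n" "\<And>n. \<epsilon> n \<le> 1/4" "\<epsilon> \<longlonglongrightarrow> 0"
  shows "(\<lambda>n. SI A (\<lambda>p. kcut (\<epsilon> n) (fst p / l) * g p)) \<longlonglongrightarrow> SI A g"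
  unfolding set_lebesgue_integral_def
proof (rule integral_dominated_convergence[where w="\<lambda>p. norm (g p)"])
  have gm: "g \<in> borel_measurable lebesgue" using g by simp
  show "(\<lambda>p. indicat_real A p *\<^sub>R g p) \<in> borel_measurable lebesgue" using A gm by measurable
  show "(\<lambda>p. indicat_real A p *\<^sub>R (kcut (\<epsilon> n) (fst p / l) * g p)) \<in> borel_measurable lebesgue" for n
  proof -
    have "continuous_on UNIV (\<lambda>p::hpt. kcut (\<epsilon> n) (fst p / l))"
    proof (rule continuous_on_compose2[of UNIV "kcut (\<epsilon> n)"])
      show "continuous_on UNIV (kcut (\<epsilon> n))"
        by (rule DERIV_continuous_on, rule has_field_derivative_at_within, rule kcut_derivative[OF e(1,2)])
      show "continuous_on UNIV (\<lambda>p::hpt. fst p / l)"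
        by (cases "l = 0") (auto intro!: continuous_intros)
    qed auto
    then have "(\<lambda>p::hpt. kcut (\<epsilon> n) (fst p / l)) \<in> borel_measurable lebesgue"
      by (intro measurable_completion) (simp add: borel_measurable_continuous_onI)
    then show ?thesis using A gm by measurable
  qed
  show "integrable lebesgue (\<lambda>p. norm (g p))" using g by (rule integrable_norm)
  show "AE p in lebesgue. (\<lambda>n. indicat_real A p *\<^sub>R (kcut (\<epsilon> n) (fst p / l) * g p)) \<longlonglongrightarrow> indicat_real A p *\<^sub>R g p"
  proof (intro AE_I2)
    fix p
    show "(\<lambda>n. indicat_real A p *\<^sub>R (kcut (\<epsilon> n) (fst p / l) * g p)) \<longlonglongrightarrow> indicat_real A p *\<^sub>R g p"
    proof (cases "p \<in> A")
      case True
      then have "0 < fst p / l" "fst p / l < 1" using A slab_0_ratio by blast+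
      then have "(\<lambda>n. kcut (\<epsilon> n) (fst p / l)) \<longlonglongrightarrow> 1" by (rule kcut_tendsto[OF e(1,3)])
      then have "(\<lambda>n. indicat_real A p *\<^sub>R (kcut (\<epsilon> n) (fst p / l) * g p)) \<longlonglongrightarrow> indicat_real A p *\<^sub>R (1 * g p)"
        by (intro tendsto_intros)
      then show ?thesis by simp
    qed simp
  qed
  show "AE p in lebesgue. norm (indicat_real A p *\<^sub>R (kcut (\<epsilon> n) (fst p / l) * g p)) \<le> norm (g p)" for n
  proof (intro AE_I2)
    fix p
    have "\<bar>kcut (\<epsilon> n) (fst p / l)\<bar> * \<bar>g p\<bar> \<le> 1 * \<bar>g p\<bar>" using kcut_bounds by (intro mult_right_mono) auto
    then show "norm (indicat_real A p *\<^sub>R (kcut (\<epsilon> n) (fst p / l) * g p)) \<le> norm (g p)"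
      by (simp add: abs_mult indicator_def)
  qed
qed

text \<open>The offset 4 makes every term at most 1/4, as the disjointness of the two ramps
  requires.\<close>

definition eps :: "nat \<Rightarrow> real" where "eps n = 1 / real (n + 4)"

lemma eps_props: "0 < eps n" "eps n \<le> 1/4" "eps \<longlonglongrightarrow> 0"
proof -
  show "0 < eps n" "eps n \<le> 1/4" by (auto simp: eps_def field_simps)
  show "eps \<longlonglongrightarrow> 0" unfolding eps_def[abs_def] using LIMSEQ_ignore_initial_segment[OF lim_1_over_n, of 4] by simp
qed

lemma negligible_fst_eq: "negligible {p :: hpt. fst p = c}"
proof -
  have "negligible {p :: hpt. (1, 0, 0) \<bullet> p = c}" by (rule negligible_hyperplane) (simp add: zero_prod_def)
  then show ?thesis by (simp add: inner_prod_def)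
qed

section \<open>Measurability and finite perimeter of the epigraph\<close>

lemma iepigraph_measurable:
  assumes f: "strip_param f Z" shows "iepigraph Kstrip f \<in> sets lebesgue"
proof -
  let ?E = "iepigraph Kstrip f"
  have g: "grows 0 Z" using f by (simp add: strip_param_def)
  have N: "negligible ({p :: hpt. fst p = 0} \<union> {p. fst p = 1} \<union> {p. fst p = -1})"
    by (intro negligible_Un negligible_fst_eq)
  have "negligible (?E \<inter> ({p. fst p = 0} \<union> {p. fst p = 1} \<union> {p. fst p = -1}))"
    by (rule negligible_subset[OF N]) auto
  then have 3: "?E \<inter> ({p. fst p = 0} \<union> {p. fst p = 1} \<union> {p. fst p = -1}) \<in> sets lebesgue" by (rule negligible_imp_sets)
  have 1: "?E \<inter> slab 1 0 \<in> sets lebesgue" "?E \<inter> slab (-1) 0 \<in> sets lebesgue"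
    by (rule iepigraph_slab_measurable[OF f g], simp)+
  have "?E = ?E \<inter> slab 1 0 \<union> ?E \<inter> slab (-1) 0 \<union> ?E \<inter> ({p. fst p = 0} \<union> {p. fst p = 1} \<union> {p. fst p = -1})"
  proof -
    have "p \<in> slab 1 0 \<union> slab (-1) 0 \<union> ({p. fst p = 0} \<union> {p. fst p = 1} \<union> {p. fst p = -1})" if "p \<in> ?E" for p
    proof -
      obtain x y z where p: "p = (x, y, z)" by (cases p)
      have "\<bar>x\<bar> \<le> 1" using that by (simp add: p mem_iepigraph_Kstrip)
      then show ?thesis by (auto simp: p slab_0)
    qed
    then show ?thesis by blast
  qed
  then show ?thesis using 1 3 by (metis sets.Un)
qed

lemma iepigraph_halves:
  assumes f: "strip_param f Z" and g: "integrable lebesgue g" and gz: "\<And>p. p \<notin> Uslab \<Longrightarrow> g p = 0"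
  shows "SI (iepigraph Kstrip f) g = SI (iepigraph Kstrip f \<inter> slab 1 0) g + SI (iepigraph Kstrip f \<inter> slab (-1) 0) g"
proof -
  let ?E = "iepigraph Kstrip f"
  have gr: "grows 0 Z" using f by (simp add: strip_param_def)
  have m: "?E \<inter> slab 1 0 \<in> sets lebesgue" "?E \<inter> slab (-1) 0 \<in> sets lebesgue"
    by (rule iepigraph_slab_measurable[OF f gr], simp)+
  have "SI ?E g = SI (?E \<inter> slab 1 0 \<union> ?E \<inter> slab (-1) 0) g"
    unfolding set_lebesgue_integral_def
  proof (rule integral_cong_AE)
    have gm: "g \<in> borel_measurable lebesgue" using g by simp
    show "(\<lambda>p. indicat_real ?E p *\<^sub>R g p) \<in> borel_measurable lebesgue"
      using gm iepigraph_measurable[OF f] by measurable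
    have "?E \<inter> slab 1 0 \<union> ?E \<inter> slab (-1) 0 \<in> sets lebesgue" using m by blast
    then show "(\<lambda>p. indicat_real (?E \<inter> slab 1 0 \<union> ?E \<inter> slab (-1) 0) p *\<^sub>R g p) \<in> borel_measurable lebesgue"
      using gm by measurable
    show "AE p in lebesgue. indicat_real ?E p *\<^sub>R g p = indicat_real (?E \<inter> slab 1 0 \<union> ?E \<inter> slab (-1) 0) p *\<^sub>R g p"
    proof (rule AE_I'[of "{p. fst p = 0}"])
      show "{p :: hpt. fst p = 0} \<in> null_sets lebesgue" using negligible_fst_eq[of 0] by (simp add: negligible_iff_null_sets)
      show "{p \<in> space lebesgue. \<not> (indicat_real ?E p *\<^sub>R g p = indicat_real (?E \<inter> slab 1 0 \<union> ?E \<inter> slab (-1) 0) p *\<^sub>R g p)} \<subseteq> {p. fst p = 0}"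
      proof clarify
        fix x y z assume ne: "indicat_real ?E (x, y, z) *\<^sub>R g (x, y, z) \<noteq> indicat_real (?E \<inter> slab 1 0 \<union> ?E \<inter> slab (-1) 0) (x, y, z) *\<^sub>R g (x, y, z)"
        show "fst (x, y, z) = 0"
        proof (rule ccontr)
          assume x: "fst (x, y, z) \<noteq> 0"
          have "g (x, y, z) \<noteq> 0" using ne by auto
          then have "(x, y, z) \<in> Uslab" using gz by blast
          then have "(x, y, z) \<in> slab 1 0 \<union> slab (-1) 0" using x by (auto simp: Uslab_def slab_0)
          then show False using ne by (auto simp: indicator_def)
        qed
      qed
    qed
  qed
  also have "\<dots> = SI (?E \<inter> slab 1 0) g + SI (?E \<inter> slab (-1) 0) g"
  proof (rule set_integral_Un)
    show "?E \<inter> slab 1 0 \<inter> (?E \<inter> slab (-1) 0) = {}" by (auto simp: slab_0)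
    show "set_integrable lebesgue (?E \<inter> slab 1 0) g" "set_integrable lebesgue (?E \<inter> slab (-1) 0) g"
      unfolding set_integrable_def using integrable_mult_indicator[OF m(1) g] integrable_mult_indicator[OF m(2) g] by auto
  qed
  finally show ?thesis .
qed

lemma hball_bounded: obtains R where "0 < R" "hball (0,0,0) r \<subseteq> cbox (-R, -R, -R) (R, R, R)"
proof -
  define R where "R = 1 + \<bar>r\<bar> + r\<^sup>2"
  have "\<bar>x\<bar> \<le> R \<and> \<bar>y\<bar> \<le> R \<and> \<bar>z\<bar> \<le> R" if "(x, y, z) \<in> hball (0,0,0) r" for x y z
  proof -
    have k: "root 4 ((x\<^sup>2 + y\<^sup>2)\<^sup>2 + z\<^sup>2) < r" using that unfolding hball_0 by (simp add: koranyi_def)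
    have n: "0 \<le> (x\<^sup>2 + y\<^sup>2)\<^sup>2 + z\<^sup>2" by simp
    then have "0 \<le> root 4 ((x\<^sup>2 + y\<^sup>2)\<^sup>2 + z\<^sup>2)" by simp
    then have r: "0 < r" using k by linarith
    have "(x\<^sup>2 + y\<^sup>2)\<^sup>2 + z\<^sup>2 = root 4 ((x\<^sup>2 + y\<^sup>2)\<^sup>2 + z\<^sup>2) ^ 4" using n by simp
    also have "\<dots> \<le> r ^ 4" using k n by (intro power_mono) auto
    also have "r ^ 4 = (r\<^sup>2)\<^sup>2" by simp
    finally have N: "(x\<^sup>2 + y\<^sup>2)\<^sup>2 + z\<^sup>2 \<le> (r\<^sup>2)\<^sup>2" .
    then have "(x\<^sup>2 + y\<^sup>2)\<^sup>2 \<le> (r\<^sup>2)\<^sup>2" "z\<^sup>2 \<le> (r\<^sup>2)\<^sup>2"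
      using zero_le_power2[of z] zero_le_power2[of "x\<^sup>2 + y\<^sup>2"] by linarith+
    then have "x\<^sup>2 + y\<^sup>2 \<le> r\<^sup>2" "\<bar>z\<bar> \<le> r\<^sup>2"
      using power2_le_imp_le[of "x\<^sup>2 + y\<^sup>2" "r\<^sup>2"] abs_le_square_iff[of z "r\<^sup>2"] by auto
    then have "x\<^sup>2 \<le> r\<^sup>2" "y\<^sup>2 \<le> r\<^sup>2" "\<bar>z\<bar> \<le> r\<^sup>2"
      using zero_le_power2[of x] zero_le_power2[of y] by linarith+
    then have "\<bar>x\<bar> \<le> \<bar>r\<bar>" "\<bar>y\<bar> \<le> \<bar>r\<bar>" by (auto simp: abs_le_square_iff)
    then show ?thesis using \<open>\<bar>z\<bar> \<le> r\<^sup>2\<close> zero_le_power2[of r] unfolding R_def by auto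
  qed
  then have "hball (0,0,0) r \<subseteq> cbox (-R, -R, -R) (R, R, R)" by (auto simp: cbox_Pair_eq abs_le_iff, force+)
  moreover have "0 < R" unfolding R_def using zero_le_power2[of r] by linarith
  ultimately show thesis using that by blast
qed

lemma measure_box:
  assumes "x1 \<le> x2" "0 \<le> R"
  shows "measure lborel (cbox (x1, -R, -R) (x2, R, R) :: hpt set) = (x2 - x1) * (2 * R) * (2 * R)"
proof -
  have "measure lborel (cbox (x1, -R, -R) (x2, R, R) :: hpt set) = (\<Prod>i\<in>Basis. (x2, R, R) \<bullet> i - (x1, -R, -R) \<bullet> i)"
    by (rule content_cbox) (use assms in \<open>auto simp: Basis_hpt\<close>)
  also have "\<dots> = (x2 - x1) * (2 * R) * (2 * R)" by (simp add: Basis_hpt)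
  finally show ?thesis .
qed

text \<open>Finiteness is needed to subtract the flux gain from the perimeter. Each half of the
  epigraph is calibrated by its own foliation, from \<open>x = 1\<close> or \<open>x = -1\<close>.
  The price is the derivative of the cutoff, and its ramps have height of order
  \<open>1 / \<epsilon>\<close> on boxes of width \<open>\<epsilon>\<close>, a bounded
  contribution.\<close>

lemma Per_epigraph_finite:
  assumes f: "strip_param f Z"
  obtains C where "Per (iepigraph Kstrip f) (hball (0,0,0) r \<inter> Uslab) \<le> ereal C"
proof -
  let ?E = "iepigraph Kstrip f"
  have gr: "grows 0 Z" using f by (simp add: strip_param_def)
  obtain R0 where R0: "0 < R0" "hball (0,0,0) r \<subseteq> cbox (-R0, -R0, -R0) (R0, R0, R0)" using hball_bounded by metis
  obtain \<eta> d\<eta> K V where eta: "C1on UNIV \<eta> d\<eta>" "\<And>p. 0 \<le> \<eta> p" "\<And>p. \<eta> p \<le> (1::real)" "compact K"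
    "\<And>p. p \<notin> K \<Longrightarrow> \<eta> p = 0" "cbox (-R0, -R0, -R0) (R0, R0, R0) \<subseteq> V" "\<And>p. p \<in> V \<Longrightarrow> \<eta> p = 1"
    using C1_cutoff[OF compact_cbox open_UNIV subset_UNIV, of "(-R0, -R0, -R0)" "(R0, R0, R0)"] by metis
  obtain RR where RR: "K \<subseteq> cbox (-RR) RR" using bounded_subset_cbox_symmetric[OF compact_imp_bounded[OF eta(4)]] by metis
  define R where "R = \<bar>fst RR\<bar> + \<bar>fst (snd RR)\<bar> + \<bar>snd (snd RR)\<bar>"
  have KR: "\<bar>fst p\<bar> \<le> R \<and> \<bar>fst (snd p)\<bar> \<le> R \<and> \<bar>snd (snd p)\<bar> \<le> R" if "p \<in> K" for p
  proof -
    obtain x y z where p: "p = (x, y, z)" by (cases p)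
    obtain a b c where r: "RR = (a, b, c)" by (cases RR)
    have "(x, y, z) \<in> cbox (-a, -b, -c) (a, b, c)" using RR that by (auto simp: p r)
    then show ?thesis unfolding R_def p r by (auto simp: cbox_Pair_eq)
  qed
  define G where "G p = 2 * \<bar>Xd d\<eta> p\<bar> + 2 * \<bar>Yd d\<eta> p\<bar>" for p
  have Gz: "G p = 0" if "p \<notin> K" for p
    using C1on_cutoff_deriv_zero[OF eta(1,4) _ that] eta(5) by (simp add: G_def)
  have Gi: "integrable lebesgue G"
    by (rule integrable_lebesgue_compact[OF _ eta(4)])
       (use Gz in \<open>auto simp: G_def intro!: continuous_intros C1on_continuous_Xd[OF eta(1)] C1on_continuous_Yd[OF eta(1)]\<close>)
  \<comment> \<open>Two boxes of volume \<open>\<epsilon> * (2 * R)\<^sup>2\<close> with density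
    \<open>4 / \<epsilon>\<close> contribute \<open>32 * R\<^sup>2\<close>. In the density one
    factor 2 bounds \<open>hstep'\<close> and the other bounds the difference of two unit
    fields.\<close>
  define C0 where "C0 = integral\<^sup>L lebesgue G + 32 * R\<^sup>2"
  have half: "SI (?E \<inter> slab l 0) (\<lambda>p. Xd da p + Yd db p) \<le> C0"
    if l: "l = 1 \<or> l = -1" and a: "C1on UNIV a da" and b: "C1on UNIV b db" and ab: "\<And>p. (a p)\<^sup>2 + (b p)\<^sup>2 \<le> 1"
      and L: "compact L" "L \<subseteq> V" "\<And>p. p \<notin> L \<Longrightarrow> a p = 0" "\<And>p. p \<notin> L \<Longrightarrow> b p = 0" for l a da b db L
  proof -
    have l': "\<bar>l\<bar> \<le> 1" "l \<noteq> 0" "\<bar>l\<bar> = 1" using l by auto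
    let ?A = "?E \<inter> slab l 0"
    have Am: "?A \<in> sets lebesgue" by (rule iepigraph_slab_measurable[OF f gr l'(1)])
    define g where "g p = Xd da p + Yd db p" for p
    have gz: "g p = 0" if "p \<notin> L" for p
      using C1on_cutoff_deriv_zero(1)[OF a L(1) _ that] C1on_cutoff_deriv_zero(2)[OF b L(1) _ that] L(3,4) by (simp add: g_def)
    have gi: "integrable lebesgue g"
      by (rule integrable_lebesgue_compact[OF _ L(1)])
         (use gz in \<open>auto simp: g_def intro!: continuous_intros C1on_continuous_Xd[OF a] C1on_continuous_Yd[OF b]\<close>)
    have bound: "SI ?A (\<lambda>p. kcut (eps n) (fst p / l) * g p) \<le> C0" for n
    proof -
      define \<kappa> d\<kappa> where "\<kappa> = lcut \<eta> l (eps n)" and "d\<kappa> = dlcut \<eta> d\<eta> l (eps n)"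
      have eta5: "\<forall>p. p \<notin> K \<longrightarrow> \<eta> p = 0" using eta(5) by blast
      note c = lcut_C1[OF l'(1,2) eps_props(1,2) eta(1-4) eta5] lsupp_compact[OF l'(1,2) eps_props(1,2) eta(1-4) eta5]
        lsupp_slab[OF l'(1,2) eps_props(1,2) eta(1-4) eta5] lcut_0[OF l'(1,2) eps_props(1,2) eta(1-4) eta5] lcut_bounds[OF l'(1,2) eps_props(1,2) eta(1-4) eta5]
      let ?S = "lsupp K l (eps n)"
      let ?w = "calib \<kappa> d\<kappa> (fM l Z) a da b db"
      have wz: "?w p = 0" if "p \<notin> ?S" for p
        unfolding \<kappa>_def d\<kappa>_def by (rule calib_zero[OF c(1,2) _ that]) (rule c(4))
      have wc: "continuous_on UNIV ?w"
        unfolding \<kappa>_def d\<kappa>_def by (rule calib_continuous[OF open_slab c(2,3,1) _ fol_continuous(2)[OF gr l'(1)] a b]) (rule c(4))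
      have wi: "integrable lebesgue ?w" by (rule integrable_lebesgue_compact[OF wc c(2)]) (rule wz)
      have pos: "0 \<le> SI ?A ?w"
        unfolding \<kappa>_def d\<kappa>_def
        by (rule epigraph_calibrated[OF f gr l'(1) c(2,3,1) _ c(5) a b ab]) (rule c(4))
      \<comment> \<open>These boxes contain the parts of \<open>K\<close> where the cutoff in the
        abscissa varies; for \<open>l = -1\<close> they are reflected.\<close>
      define B1 B2 where "B1 = (if l = 1 then cbox (eps n, -R, -R) (2 * eps n, R, R) else cbox (- 2 * eps n, -R, -R) (- eps n, R, R) :: hpt set)"
        and "B2 = (if l = 1 then cbox (1 - 2 * eps n, -R, -R) (1 - eps n, R, R) else cbox (- 1 + eps n, -R, -R) (- 1 + 2 * eps n, R, R) :: hpt set)"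
      define h where "h p = G p + 4 / eps n * (indicat_real B1 p + indicat_real B2 p)" for p
      have R0': "0 \<le> R" by (simp add: R_def)
      have Bl: "B1 \<in> lmeasurable" "B2 \<in> lmeasurable" by (auto simp: B1_def B2_def)
      have Bm: "measure lebesgue B1 = eps n * (2 * R) * (2 * R)" "measure lebesgue B2 = eps n * (2 * R) * (2 * R)"
        using eps_props(1,2)[of n] R0' unfolding B1_def B2_def
        by (auto simp: measure_box[OF _ R0'] simp del: cbox_Pair_eq)
      have Ii: "integrable lebesgue (indicat_real B1)" "integrable lebesgue (indicat_real B2)"
        using Bl by (auto simp: fmeasurable_def intro!: integrable_real_indicator)
      have hi: "integrable lebesgue h" unfolding h_def using Gi Ii by auto
      have "integral\<^sup>L lebesgue h = integral\<^sup>L lebesgue G + 4 / eps n * (measure lebesgue B1 + measure lebesgue B2)"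
        unfolding h_def using Gi Ii Bl by (simp add: fmeasurableD)
      also have "\<dots> = C0" unfolding Bm C0_def using eps_props(1)[of n] by (simp add: power2_eq_square)
      finally have hI: "integral\<^sup>L lebesgue h = C0" .
      have h0: "0 \<le> h p" for p using eps_props(1)[of n] by (auto simp: h_def G_def intro!: add_nonneg_nonneg)
      have key: "?w p \<le> h p - kcut (eps n) (fst p / l) * g p" for p
      proof -
        define s where "s = fst p / l"
        have ab1: "\<bar>a p\<bar> \<le> 1" "\<bar>b p\<bar> \<le> 1" using abs_le_1_of_sum_squares[OF ab[of p]] by auto
        have d2: "\<bar>fx (fM l Z p) - a p\<bar> \<le> 2" "\<bar>fy (fM l Z p) - b p\<bar> \<le> 2"
          using ab1 fx_abs_le[of "fM l Z p"] fy_abs_le[of "fM l Z p"] by auto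
        have kg: "\<kappa> p * g p = kcut (eps n) s * g p"
        proof (cases "p \<in> L")
          case True
          then have "\<eta> p = 1" using L(2) eta(7) by blast
          then show ?thesis by (simp add: \<kappa>_def lcut_def s_def)
        next
          case False
          then show ?thesis using gz by simp
        qed
        have X: "Xd d\<kappa> p = Xd d\<eta> p * kcut (eps n) s + \<eta> p * (kcut' (eps n) s / l)"
          and Y: "Yd d\<kappa> p = Yd d\<eta> p * kcut (eps n) s"
          unfolding d\<kappa>_def s_def by (rule Xd_lcut[OF l'(1,2) eps_props(1,2) eta(1-4) eta5] Yd_lcut[OF l'(1,2) eps_props(1,2) eta(1-4) eta5])+
        have k1: "\<bar>kcut (eps n) s\<bar> \<le> 1" using kcut_bounds by simp
        have Xb: "\<bar>Xd d\<kappa> p\<bar> \<le> \<bar>Xd d\<eta> p\<bar> + \<bar>\<eta> p * (kcut' (eps n) s / l)\<bar>"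
        proof -
          have "\<bar>Xd d\<eta> p * kcut (eps n) s\<bar> \<le> \<bar>Xd d\<eta> p\<bar> * 1" unfolding abs_mult using k1 by (intro mult_left_mono) auto
          then have "\<bar>Xd d\<eta> p * kcut (eps n) s\<bar> \<le> \<bar>Xd d\<eta> p\<bar>" by (simp only: mult_1_right)
          then show ?thesis unfolding X by (rule order_trans[OF abs_triangle_ineq add_right_mono])
        qed
        have Yb: "\<bar>Yd d\<kappa> p\<bar> \<le> \<bar>Yd d\<eta> p\<bar>"
        proof -
          have "\<bar>Yd d\<eta> p * kcut (eps n) s\<bar> \<le> \<bar>Yd d\<eta> p\<bar> * 1" unfolding abs_mult using k1 by (intro mult_left_mono) auto
          then show ?thesis unfolding Y by simp
        qed
        have ramp: "\<bar>\<eta> p * (kcut' (eps n) s / l)\<bar> \<le> 2 / eps n * (indicat_real B1 p + indicat_real B2 p)"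
        proof (cases "p \<in> K")
          case True
          have e0: "0 < eps n" by (rule eps_props)
          have sx: "s = l * fst p" using l by (auto simp: s_def)
          have h1: "hstep' (s / eps n - 1) / eps n \<le> 2 / eps n * indicat_real B1 p"
          proof (cases "eps n \<le> s \<and> s \<le> 2 * eps n")
            case True
            then have "p \<in> B1" using KR[OF \<open>p \<in> K\<close>] l sx by (cases p) (auto simp: B1_def cbox_Pair_eq)
            then show ?thesis using hstep'_le e0 by (simp add: divide_right_mono)
          next
            case False
            then have "hstep' (s / eps n - 1) = 0" using e0 by (intro hstep'_0) (auto simp: field_simps)
            then show ?thesis using e0 by simp
          qed
          have h2: "hstep' ((1 - s) / eps n - 1) / eps n \<le> 2 / eps n * indicat_real B2 p"
          proof (cases "eps n \<le> 1 - s \<and> 1 - s \<le> 2 * eps n")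
            case True
            then have "p \<in> B2" using KR[OF \<open>p \<in> K\<close>] l sx by (cases p) (auto simp: B2_def cbox_Pair_eq)
            then show ?thesis using hstep'_le e0 by (simp add: divide_right_mono)
          next
            case False
            then have "hstep' ((1 - s) / eps n - 1) = 0" using e0 by (intro hstep'_0) (auto simp: field_simps)
            then show ?thesis using e0 by simp
          qed
          have nn: "0 \<le> hstep' u / eps n" for u using hstep'_nonneg e0 by simp
          have "\<bar>kcut' (eps n) s\<bar> \<le> hstep' (s / eps n - 1) / eps n + hstep' ((1 - s) / eps n - 1) / eps n"
            unfolding kcut'_def using nn[of "s / eps n - 1"] nn[of "(1 - s) / eps n - 1"] by linarith
          also have "\<dots> \<le> 2 / eps n * (indicat_real B1 p + indicat_real B2 p)"
            using h1 h2 by (simp add: distrib_left)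
          finally have k: "\<bar>kcut' (eps n) s\<bar> \<le> 2 / eps n * (indicat_real B1 p + indicat_real B2 p)" .
          have "\<bar>\<eta> p * (kcut' (eps n) s / l)\<bar> = \<eta> p * \<bar>kcut' (eps n) s\<bar>" using eta(2)[of p] l'(3) by (simp add: abs_mult)
          also have "\<dots> \<le> 1 * \<bar>kcut' (eps n) s\<bar>" using eta(3) by (intro mult_right_mono) auto
          finally show ?thesis using k by simp
        next
          case False
          then show ?thesis using eta(5) eps_props(1)[of n] by simp
        qed
        have t1: "Xd d\<kappa> p * (fx (fM l Z p) - a p) \<le> 2 * \<bar>Xd d\<kappa> p\<bar>"
          using mult_mono[OF order_refl d2(1), of "\<bar>Xd d\<kappa> p\<bar>"] by (simp add: abs_mult[symmetric]) 
        have t2: "Yd d\<kappa> p * (fy (fM l Z p) - b p) \<le> 2 * \<bar>Yd d\<kappa> p\<bar>"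
          using mult_mono[OF order_refl d2(2), of "\<bar>Yd d\<kappa> p\<bar>"] by (simp add: abs_mult[symmetric])
        have "?w p = Xd d\<kappa> p * (fx (fM l Z p) - a p) + Yd d\<kappa> p * (fy (fM l Z p) - b p) - kcut (eps n) s * g p"
          unfolding calib_def kg[symmetric] by (simp only: g_def)
        also have "\<dots> \<le> 2 * \<bar>Xd d\<kappa> p\<bar> + 2 * \<bar>Yd d\<kappa> p\<bar> - kcut (eps n) s * g p" using t1 t2 by linarith
        also have "\<dots> \<le> h p - kcut (eps n) s * g p"
        proof -
          have "2 * (2 / eps n * (indicat_real B1 p + indicat_real B2 p)) = 4 / eps n * (indicat_real B1 p + indicat_real B2 p)" by simp
          then show ?thesis using Xb Yb ramp unfolding h_def G_def by linarith
        qed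
        finally show ?thesis by (simp add: s_def)
      qed
      have kgc: "integrable lebesgue (\<lambda>p. kcut (eps n) (fst p / l) * g p)"
      proof -
        have "continuous_on UNIV (kcut (eps n))"
          by (rule DERIV_continuous_on, rule has_field_derivative_at_within, rule kcut_derivative[OF eps_props(1,2)])
        then have "continuous_on UNIV (\<lambda>p::hpt. kcut (eps n) (fst p / l))"
          by (rule continuous_on_compose2) (use l' in \<open>auto intro!: continuous_intros\<close>)
        moreover have "continuous_on UNIV g" unfolding g_def
          by (intro continuous_intros C1on_continuous_Xd[OF a] C1on_continuous_Yd[OF b])
        ultimately have "continuous_on UNIV (\<lambda>p. kcut (eps n) (fst p / l) * g p)" by (intro continuous_intros)
        then show ?thesis by (rule integrable_lebesgue_compact[OF _ L(1)]) (simp add: gz)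
      qed
      have "SI ?A ?w \<le> SI ?A (\<lambda>p. h p - kcut (eps n) (fst p / l) * g p)"
        by (rule SI_mono[OF wi Bochner_Integration.integrable_diff[OF hi kgc] Am key])
      also have "\<dots> = SI ?A h - SI ?A (\<lambda>p. kcut (eps n) (fst p / l) * g p)"
        by (rule set_integral_diff(2))
           (unfold set_integrable_def, rule integrable_mult_indicator[OF Am hi], rule integrable_mult_indicator[OF Am kgc])
      also have "SI ?A h \<le> integral\<^sup>L lebesgue h"
        unfolding set_lebesgue_integral_def
      proof (rule integral_mono[OF integrable_mult_indicator[OF Am hi] hi])
        show "indicat_real ?A p *\<^sub>R h p \<le> h p" for p using h0[of p] by (simp add: indicator_def)
      qed
      finally show ?thesis using pos hI by simp
    qed
    have "(\<lambda>n. SI ?A (\<lambda>p. kcut (eps n) (fst p / l) * g p)) \<longlonglongrightarrow> SI ?A g"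
      by (rule SI_kcut_limit[OF gi Am _ eps_props]) auto
    then have "SI ?A g \<le> C0" using bound by (intro LIMSEQ_le_const2) auto
    then show ?thesis unfolding g_def[abs_def] .
  qed
  have "Per ?E (hball (0,0,0) r \<inter> Uslab) \<le> ereal (2 * C0)"
    unfolding Per_def
  proof (rule SUP_least, clarify)
    fix a b assume ab: "a \<in> Cinf_c (hball (0,0,0) r \<inter> Uslab)" "b \<in> Cinf_c (hball (0,0,0) r \<inter> Uslab)" "\<forall>p. (a p)\<^sup>2 + (b p)\<^sup>2 \<le> 1"
    define L where "L = closure {p. a p \<noteq> 0} \<union> closure {p. b p \<noteq> 0}"
    have L: "compact L" "L \<subseteq> hball (0,0,0) r \<inter> Uslab" using ab by (auto simp: L_def Cinf_c_def)
    have LV: "L \<subseteq> V" using L(2) R0(2) eta(6) by blast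
    have az: "a p = 0" "b p = 0" if "p \<notin> L" for p
      using that closure_subset[of "{p. a p \<noteq> 0}"] closure_subset[of "{p. b p \<noteq> 0}"] by (auto simp: L_def)
    have aC: "C1on UNIV a (\<lambda>e. pderiv3 e a)" and bC: "C1on UNIV b (\<lambda>e. pderiv3 e b)"
      using ab by (auto simp: Cinf_c_def intro: smooth3_imp_C1on)
    let ?g = "\<lambda>p. Xd (\<lambda>e. pderiv3 e a) p + Yd (\<lambda>e. pderiv3 e b) p"
    have gz: "?g p = 0" if "p \<notin> L" for p
      using C1on_cutoff_deriv_zero(1)[OF aC L(1) _ that] C1on_cutoff_deriv_zero(2)[OF bC L(1) _ that] az by simp
    have gi: "integrable lebesgue ?g"
      by (rule integrable_lebesgue_compact[OF _ L(1)])
         (use gz in \<open>auto intro!: continuous_intros C1on_continuous_Xd[OF aC] C1on_continuous_Yd[OF bC]\<close>)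
    have "SI ?E ?g = SI (?E \<inter> slab 1 0) ?g + SI (?E \<inter> slab (-1) 0) ?g"
      by (rule iepigraph_halves[OF f gi]) (use gz L(2) in blast)
    also have "\<dots> \<le> C0 + C0"
      by (rule add_mono; rule half[OF _ aC bC _ L(1) LV]) (use ab(3) az in auto)
    finally show "ereal (set_lebesgue_integral lebesgue ?E (\<lambda>p. Xfield (fst (a, b)) p + Yfield (snd (a, b)) p)) \<le> ereal (2 * C0)"
      unfolding fst_conv snd_conv Xfield_eq_Xd[OF aC] Yfield_eq_Yd[OF bC] by simp
  qed
  then show thesis by (rule that)
qed

lemma flux_triangle_swap: "flux_triangle (- l) B A = flux_triangle l A B"
proof -
  have "0 < - l * (z + l * y / 2 - B) \<longleftrightarrow> 0 < l * (B - (z + l * y / 2))"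
    "0 < - l * (A - (z - l * y / 2)) \<longleftrightarrow> 0 < l * (z - l * y / 2 - A)" for y z by (simp_all add: algebra_simps)
  then show ?thesis by (auto simp: flux_triangle_def)
qed

lemma flux_triangle_bounded:
  assumes "0 < l" shows "bounded (flux_triangle l A B)"
proof -
  have "flux_triangle l A B \<subseteq> cbox (0, A) ((B - A) / l, B)"
  proof
    fix q assume q: "q \<in> flux_triangle l A B"
    obtain y z where qe: "q = (y, z)" by (cases q)
    have h: "0 < y" "0 < z - l * y / 2 - A" "0 < B - (z + l * y / 2)" using q assms by (auto simp: flux_triangle_def qe zero_less_mult_iff)
    have "0 < l * y" using h assms by simp
    then have "A \<le> z" "z \<le> B" "l * y \<le> B - A" using h by linarith+
    then show "q \<in> cbox (0, A) ((B - A) / l, B)" using h assms by (auto simp: qe cbox_Pair_eq pos_le_divide_eq mult.commute)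
  qed
  then show ?thesis by (rule bounded_subset[OF bounded_cbox])
qed

lemma flux_triangle_integrable:
  fixes C :: real and h :: "real \<times> real \<Rightarrow> real"
  assumes "0 < l" "h \<in> borel_measurable borel" "\<And>q. \<bar>h q\<bar> \<le> C"
  shows "integrable lborel (\<lambda>q. indicator (flux_triangle l A B) q * h q)"
proof -
  have i: "integrable lborel (\<lambda>q. C * indicat_real (flux_triangle l A B) q)"
    by (intro integrable_mult_right integrable_real_indicator)
       (use flux_triangle_open[of l A B] emeasure_bounded_finite[OF flux_triangle_bounded[OF assms(1)]] in auto)
  show ?thesis
  proof (rule Bochner_Integration.integrable_bound[OF i])
    show "(\<lambda>q. indicator (flux_triangle l A B) q * h q) \<in> borel_measurable lborel"
      using assms(2) flux_triangle_open[of l A B] by simp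
    show "AE q in lborel. norm (indicator (flux_triangle l A B) q * h q) \<le> norm (C * indicat_real (flux_triangle l A B) q)"
      using assms(3) by (intro AE_I2) (auto simp: indicator_def intro: order_trans[OF _ abs_ge_self])
  qed
qed

lemma wall_flux_bounded: "\<bar>wall_flux l Z q\<bar> \<le> 1"
  by (simp add: wall_flux_def fx_abs_le)

text \<open>The integral is the flux gained when the two wedges over the triangle are removed. For
  every admissible \<open>(a, b)\<close>, interpolation with the calibrating fields bounds the
  perimeter of the epigraph below by the divergence integral over the competitor plus this gain. If
  the gain were positive, the competitor would have a strictly smaller perimeter.\<close>

lemma necessity_flux:
  assumes f: "strip_param f Z" and pm: "perimeter_minimizer (iepigraph Kstrip f) Uslab"
    and la: "0 < l" "l < 1" and AB: "A < B"
  shows "(\<integral>q. indicator (flux_triangle l A B) q * (wall_flux l Z q - wall_flux (- l) Z q) \<partial>lborel) \<le> 0"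
proof (rule ccontr)
  define \<Delta> where "\<Delta> = (\<integral>q. indicator (flux_triangle l A B) q * (wall_flux l Z q - wall_flux (- l) Z q) \<partial>lborel)"
  assume "\<not> (\<integral>q. indicator (flux_triangle l A B) q * (wall_flux l Z q - wall_flux (- l) Z q) \<partial>lborel) \<le> 0"
  then have Dpos: "0 < \<Delta>" by (simp add: \<Delta>_def)
  let ?E = "iepigraph Kstrip f"
  have gr: "grows 0 Z" using f by (simp add: strip_param_def)
  have l1: "\<bar>l\<bar> \<le> 1" "l \<noteq> 0" and l2: "\<bar>- l\<bar> \<le> 1" "- l \<noteq> 0" using la by auto
  obtain uA uB where u: "Z uA = A" "Z uB = B" using f unfolding strip_param_def by (metis surjD)
  define D1 D2 where "D1 = ruling_wedge l Z uA B" and "D2 = ruling_wedge (- l) Z uB A"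
  have Db: "D1 \<in> sets borel" "D2 \<in> sets borel"
    unfolding D1_def D2_def by (rule ruling_wedge_borel[OF gr l1(1)], rule ruling_wedge_borel[OF gr l2(1)])
  have Dm: "D1 \<in> sets lebesgue" "D2 \<in> sets lebesgue" using Db by (auto intro!: sets_completionI_sets)
  have Ds: "D1 \<subseteq> slab l 0" "D2 \<subseteq> slab (- l) 0" by (auto simp: D1_def D2_def ruling_wedge_def)
  have Sd: "slab l 0 \<inter> slab (- l) 0 = {}" by (auto simp: slab_0)
  have DE: "D1 \<subseteq> ?E" "D2 \<subseteq> ?E"
    using mem_iepigraph_iff_fy0[OF f gr l1(1)] mem_iepigraph_iff_fy0[OF f gr l2(1)] by (auto simp: D1_def D2_def ruling_wedge_def)
  obtain R1 where R1: "\<And>p. p \<in> D1 \<Longrightarrow> \<bar>fst p\<bar> \<le> l \<and> \<bar>fst (snd p)\<bar> \<le> R1 \<and> \<bar>snd (snd p)\<bar> \<le> R1"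
    using ruling_wedge_bounds[OF f l1 u(1), of B] la unfolding D1_def by (metis abs_of_pos)
  obtain R2 where R2: "\<And>p. p \<in> D2 \<Longrightarrow> \<bar>fst p\<bar> \<le> l \<and> \<bar>fst (snd p)\<bar> \<le> R2 \<and> \<bar>snd (snd p)\<bar> \<le> R2"
    using ruling_wedge_bounds[OF f l2 u(2), of A] la unfolding D2_def by (metis abs_minus_cancel abs_of_pos)
  define R where "R = max R1 R2"
  define K0 where "K0 = cbox (- l, - R, - R) (l, R, R)"
  have DK: "D1 \<union> D2 \<subseteq> K0"
  proof
    fix p assume p: "p \<in> D1 \<union> D2"
    have "\<bar>fst p\<bar> \<le> l \<and> \<bar>fst (snd p)\<bar> \<le> R \<and> \<bar>snd (snd p)\<bar> \<le> R"
      using R1[of p] R2[of p] p by (auto simp: R_def)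
    then show "p \<in> K0" by (cases p) (auto simp: K0_def cbox_Pair_eq abs_le_iff)
  qed
  have K0c: "compact K0" by (simp add: K0_def del: cbox_Pair_eq)
  have K0U: "K0 \<subseteq> Uslab" using la by (auto simp: K0_def Uslab_def cbox_Pair_eq)
  have "compact (koranyi ` K0)" using K0c koranyi_continuous by (meson compact_continuous_image continuous_on_subset top_greatest)
  then obtain r0 where r0: "\<And>p. p \<in> K0 \<Longrightarrow> \<bar>koranyi p\<bar> \<le> r0" unfolding compact_eq_bounded_closed bounded_real by blast
  define r where "r = \<bar>r0\<bar> + 1"
  have r: "0 < r" "K0 \<subseteq> hball (0,0,0) r" using r0 unfolding hball_0 by (auto simp: r_def) (smt (verit) r0)+
  define \<Omega> where "\<Omega> = hball (0,0,0) r \<inter> Uslab"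
  have O: "open \<Omega>" unfolding \<Omega>_def by (intro open_Int open_hball_0 open_Uslab)
  have K0O: "K0 \<subseteq> \<Omega>" using r K0U by (simp add: \<Omega>_def)
  define F where "F = ?E - (D1 \<union> D2)"
  have Em: "?E \<in> sets lebesgue" by (rule iepigraph_measurable[OF f])
  have Fm: "F \<in> sets lebesgue" unfolding F_def using Em Dm by auto
  have EF: "(?E - F) \<union> (F - ?E) = D1 \<union> D2" using DE by (auto simp: F_def)
  have clK: "closure (D1 \<union> D2) \<subseteq> K0" by (rule closure_minimal[OF DK compact_imp_closed[OF K0c]])
  then have clc: "compact (closure (D1 \<union> D2))" using K0c by (meson closed_closure compact_Int_closed inf.absorb2 inf_commute compact_eq_bounded_closed bounded_subset)
  have min: "Per ?E \<Omega> \<le> Per F \<Omega>"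
    using pm r(1) Fm clc clK K0O unfolding perimeter_minimizer_def \<Omega>_def EF[symmetric] by blast
  obtain \<eta> d\<eta> K V where eta: "C1on UNIV \<eta> d\<eta>" "\<And>p. 0 \<le> \<eta> p" "\<And>p. \<eta> p \<le> (1::real)" "compact K" "K \<subseteq> \<Omega>"
    "\<And>p. p \<notin> K \<Longrightarrow> \<eta> p = 0" "open V" "K0 \<subseteq> V" "\<And>p. p \<in> V \<Longrightarrow> \<eta> p = 1"
    using C1_cutoff[OF K0c O K0O] by metis
  have eta5: "\<forall>p. p \<notin> K \<longrightarrow> \<eta> p = 0" using eta(6) by blast
  have dV: "Xd d\<eta> p = 0" "Yd d\<eta> p = 0" if "p \<in> V" for p
  proof -
    have "C1on V \<eta> (\<lambda>e p. 0)" by (rule C1on_cong[OF C1on_const[where c=1] eta(7)]) (use eta(9) in auto)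
    then have "d\<eta> e p = 0" if "e \<in> Basis" for e
      using C1on_unique[OF C1on_subset[OF eta(1) subset_UNIV] _ \<open>p \<in> V\<close> that] by blast
    then show "Xd d\<eta> p = 0" "Yd d\<eta> p = 0" by (auto simp: Xd_def Yd_def Basis_hpt)
  qed
  obtain Zs Zs' where Zs: "\<And>n. C1grows 0 (Zs n) (Zs' n)"
    "\<And>n u. Z u \<le> Zs n u" "\<And>n u. Zs n u \<le> Z (u + 1 / real (Suc n))"
    using smoothing_exists[OF gr] by metis
  have gn: "grows 0 (Zs n)" for n using Zs(1) by (simp add: C1grows_def)
  let ?S = "slab l 0 \<union> slab (- l) 0"
  \<comment> \<open>The half slabs are disjoint open sets, so the foliations of the two sides form
    one continuously differentiable slope function on their union, although they disagree at
    \<open>x = 0\<close>.\<close>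
  define Ms where "Ms n p = (if 0 < fst p then fM l (Zs n) p else fM (- l) (Zs n) p)" for n p
  define dM where "dM n e p = (if 0 < fst p then dfM l (Zs n) (Zs' n) e p else dfM (- l) (Zs n) (Zs' n) e p)" for n e p
  define M where "M p = (if 0 < fst p then fM l Z p else fM (- l) Z p)" for p
  have sg1: "0 < fst p" if "p \<in> slab l 0" for p using that la by (auto simp: slab_0 zero_less_mult_iff)
  have sg2: "\<not> 0 < fst p" if "p \<in> slab (- l) 0" for p
  proof -
    have "0 < - l * fst p" using that by (simp add: slab_0)
    then have "l * fst p < 0" by simp
    then show ?thesis using la by (simp add: mult_less_0_iff)
  qed
  have MC: "C1on ?S (Ms n) (dM n)" for n
    by (rule C1on_Un[OF C1on_cong[OF fM_C1[OF l1(1) Zs(1)] open_slab] C1on_cong[OF fM_C1[OF l2(1) Zs(1)] open_slab] open_slab open_slab])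
       (auto simp: Ms_def dM_def dest: sg1 sg2)
  have VM: "Xd (dM n) p + Ms n p * Yd (dM n) p = 0" if "p \<in> ?S" for n p
  proof (cases "p \<in> slab l 0")
    case True
    then show ?thesis using V_fM[OF l1(1) Zs(1) True, of n] sg1[OF True] by (simp add: Xd_def Yd_def dM_def Ms_def)
  next
    case False
    then have p: "p \<in> slab (- l) 0" using that by blast
    then show ?thesis using V_fM[OF l2(1) Zs(1) p, of n] sg2[OF p] by (simp add: Xd_def Yd_def dM_def Ms_def)
  qed
  have Ml: "(\<lambda>n. Ms n p) \<longlonglongrightarrow> M p" if "p \<in> ?S" for p
  proof (cases "p \<in> slab l 0")
    case True
    then show ?thesis using smoothing_tendsto(1)[OF gr l1(1) True gn Zs(2,3)] sg1[OF True] by (simp add: Ms_def M_def)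
  next
    case False
    then have p: "p \<in> slab (- l) 0" using that by blast
    then show ?thesis using smoothing_tendsto(1)[OF gr l2(1) p gn Zs(2,3)] sg2[OF p] by (simp add: Ms_def M_def)
  qed
  \<comment> \<open>The inequality is proved for one test field at a time; the supremum over
    \<open>(a, b)\<close> is taken only at the end.\<close>
  have main: "SI F (\<lambda>p. Xd da p + Yd db p) + \<Delta> \<le> c"
    if c: "Per ?E \<Omega> \<le> ereal c" and a: "C1on UNIV a da" and b: "C1on UNIV b db" and ab: "\<And>p. (a p)\<^sup>2 + (b p)\<^sup>2 \<le> 1"
      and L: "compact L" "L \<subseteq> \<Omega>" "\<And>p. p \<notin> L \<Longrightarrow> a p = 0" "\<And>p. p \<notin> L \<Longrightarrow> b p = 0" for c a da b db L
  proof -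
    define g where "g p = Xd da p + Yd db p" for p
    have gz: "g p = 0" if "p \<notin> L" for p
      using C1on_cutoff_deriv_zero(1)[OF a L(1) _ that] C1on_cutoff_deriv_zero(2)[OF b L(1) _ that] L(3,4) by (simp add: g_def)
    have gi: "integrable lebesgue g"
      by (rule integrable_lebesgue_compact[OF _ L(1)])
         (use gz in \<open>auto simp: g_def intro!: continuous_intros C1on_continuous_Xd[OF a] C1on_continuous_Yd[OF b]\<close>)
    have a1: "\<bar>a p\<bar> \<le> 1" for p using abs_le_1_of_sum_squares[OF ab[of p]] by simp
    note ac = C1on_continuous[OF a]
    define q1 q2 where "q1 n p = kcut' (eps n) (fst p / l) / l * (fx (fM l Z p) - a p)"
      and "q2 n p = kcut' (eps n) (fst p / - l) / - l * (fx (fM (- l) Z p) - a p)" for n p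
    define k1 k2 where "k1 n p = kcut (eps n) (fst p / l) * g p"
      and "k2 n p = kcut (eps n) (fst p / - l) * g p" for n p
    \<comment> \<open>Over the cut sets the calibrated integrals are nonnegative and are dropped.
      Over the wedges \<open>\<eta> = 1\<close>, so only the ramps in the abscissa
      (\<open>q1\<close>, \<open>q2\<close>) and the divergence terms (\<open>k1\<close>,
      \<open>k2\<close>) remain.\<close>
    have step: "SI ?E g + (SI D1 (q1 n) - SI D1 (k1 n)) + (SI D2 (q2 n) - SI D2 (k2 n)) \<le> c" for n
    proof -
      note e12 = eps_props(1)[of n] eps_props(2)[of n]
      note c1 = lcut_C1[OF l1 e12 eta(1-4) eta5] lsupp_compact[OF l1 e12 eta(1-4) eta5]
        lsupp_slab[OF l1 e12 eta(1-4) eta5] lcut_0[OF l1 e12 eta(1-4) eta5] lcut_bounds[OF l1 e12 eta(1-4) eta5]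
      note c2 = lcut_C1[OF l2 e12 eta(1-4) eta5] lsupp_compact[OF l2 e12 eta(1-4) eta5]
        lsupp_slab[OF l2 e12 eta(1-4) eta5] lcut_0[OF l2 e12 eta(1-4) eta5] lcut_bounds[OF l2 e12 eta(1-4) eta5]
      define \<kappa>1 d\<kappa>1 \<kappa>2 d\<kappa>2 where "\<kappa>1 = lcut \<eta> l (eps n)" and "d\<kappa>1 = dlcut \<eta> d\<eta> l (eps n)"
        and "\<kappa>2 = lcut \<eta> (- l) (eps n)" and "d\<kappa>2 = dlcut \<eta> d\<eta> (- l) (eps n)"
      define S1 S2 where "S1 = lsupp K l (eps n)" and "S2 = lsupp K (- l) (eps n)"
      note c1 = c1[folded \<kappa>1_def d\<kappa>1_def S1_def] and c2 = c2[folded \<kappa>2_def d\<kappa>2_def S2_def]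
      let ?w1 = "calib \<kappa>1 d\<kappa>1 (fM l Z) a da b db" and ?w2 = "calib \<kappa>2 d\<kappa>2 (fM (- l) Z) a da b db"
      have z1: "?w1 p = 0" if "p \<notin> S1" for p by (rule calib_zero[OF c1(1,2) _ that]) (rule c1(4))
      have z2: "?w2 p = 0" if "p \<notin> S2" for p by (rule calib_zero[OF c2(1,2) _ that]) (rule c2(4))
      have w1c: "continuous_on UNIV ?w1"
        by (rule calib_continuous[OF open_slab c1(2,3,1) _ fol_continuous(2)[OF gr l1(1)] a b]) (rule c1(4))
      have w2c: "continuous_on UNIV ?w2"
        by (rule calib_continuous[OF open_slab c2(2,3,1) _ fol_continuous(2)[OF gr l2(1)] a b]) (rule c2(4))
      have w1i: "integrable lebesgue ?w1" by (rule integrable_lebesgue_compact[OF w1c c1(2)]) (rule z1)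
      have w2i: "integrable lebesgue ?w2" by (rule integrable_lebesgue_compact[OF w2c c2(2)]) (rule z2)
      have pos1: "0 \<le> SI (?E \<inter> slab l 0 - D1) ?w1"
        unfolding D1_def by (rule cut_calibrated[OF f l1(1) c1(2,3,1) _ c1(5) a b ab]) (rule c1(4))
      have pos2: "0 \<le> SI (?E \<inter> slab (- l) 0 - D2) ?w2"
        unfolding D2_def by (rule cut_calibrated[OF f l2(1) c2(2,3,1) _ c2(5) a b ab]) (rule c2(4))
      have E1: "SI ?E ?w1 = SI D1 ?w1 + SI (?E \<inter> slab l 0 - D1) ?w1"
      proof -
        have "SI ?E ?w1 = SI (?E \<inter> slab l 0) ?w1"
          by (rule SI_cong) (use z1 c1(3) in \<open>force simp: indicator_def\<close>)
        also have "\<dots> = SI D1 ?w1 + SI (?E \<inter> slab l 0 - D1) ?w1"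
          by (rule SI_split[OF w1i iepigraph_slab_measurable[OF f gr l1(1)] Dm(1)]) (use DE Ds in blast)
        finally show ?thesis .
      qed
      have E2: "SI ?E ?w2 = SI D2 ?w2 + SI (?E \<inter> slab (- l) 0 - D2) ?w2"
      proof -
        have "SI ?E ?w2 = SI (?E \<inter> slab (- l) 0) ?w2"
          by (rule SI_cong) (use z2 c2(3) in \<open>force simp: indicator_def\<close>)
        also have "\<dots> = SI D2 ?w2 + SI (?E \<inter> slab (- l) 0 - D2) ?w2"
          by (rule SI_split[OF w2i iepigraph_slab_measurable[OF f gr l2(1)] Dm(2)]) (use DE Ds in blast)
        finally show ?thesis .
      qed
      have on1: "?w1 p = q1 n p - k1 n p" if "p \<in> D1" for p
      proof -
        have pV: "p \<in> V" using that DK eta(8) by blast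
        have "Xd d\<kappa>1 p = kcut' (eps n) (fst p / l) / l" "Yd d\<kappa>1 p = 0" "\<kappa>1 p = kcut (eps n) (fst p / l)"
          unfolding d\<kappa>1_def Xd_lcut[OF l1 e12 eta(1-4) eta5] Yd_lcut[OF l1 e12 eta(1-4) eta5]
          using dV[OF pV] eta(9)[OF pV] by (simp_all add: \<kappa>1_def lcut_def)
        then show ?thesis by (simp add: calib_def q1_def k1_def g_def)
      qed
      have on2: "?w2 p = q2 n p - k2 n p" if "p \<in> D2" for p
      proof -
        have pV: "p \<in> V" using that DK eta(8) by blast
        have "Xd d\<kappa>2 p = kcut' (eps n) (fst p / - l) / - l" "Yd d\<kappa>2 p = 0" "\<kappa>2 p = kcut (eps n) (fst p / - l)"
          unfolding d\<kappa>2_def Xd_lcut[OF l2 e12 eta(1-4) eta5] Yd_lcut[OF l2 e12 eta(1-4) eta5]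
          using dV[OF pV] eta(9)[OF pV] by (simp_all add: \<kappa>2_def lcut_def)
        then show ?thesis by (simp add: calib_def q2_def k2_def g_def)
      qed
      have kc: "continuous_on UNIV (\<lambda>p::hpt. kcut (eps n) (fst p / m))" for m
      proof (rule continuous_on_compose2[of UNIV "kcut (eps n)"])
        show "continuous_on UNIV (kcut (eps n))"
          by (rule DERIV_continuous_on, rule has_field_derivative_at_within, rule kcut_derivative[OF eps_props(1,2)])
        show "continuous_on UNIV (\<lambda>p::hpt. fst p / m)" by (cases "m = 0") (auto intro!: continuous_intros)
      qed auto
      have gc: "continuous_on UNIV g" unfolding g_def
        by (intro continuous_intros C1on_continuous_Xd[OF a] C1on_continuous_Yd[OF b])
      have k1i: "integrable lebesgue (k1 n)" unfolding k1_def
        by (rule integrable_lebesgue_compact[OF continuous_on_mult[OF kc gc] L(1)]) (simp add: gz)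
      have k2i: "integrable lebesgue (k2 n)" unfolding k2_def
        by (rule integrable_lebesgue_compact[OF continuous_on_mult[OF kc gc] L(1)]) (simp add: gz)
      have si: "set_integrable lebesgue C h" if "integrable lebesgue h" "C \<in> sets lebesgue" for C :: "hpt set" and h :: "hpt \<Rightarrow> real"
        unfolding set_integrable_def using integrable_mult_indicator[OF that(2,1)] .
      have D1e: "SI D1 ?w1 = SI D1 (q1 n) - SI D1 (k1 n)"
      proof -
        have "SI D1 (q1 n) = SI D1 (\<lambda>p. ?w1 p + k1 n p)"
          by (rule SI_cong) (use on1 in \<open>auto simp: indicator_def\<close>)
        also have "\<dots> = SI D1 ?w1 + SI D1 (k1 n)"
          by (rule set_integral_add(2)) (rule si[OF w1i Dm(1)], rule si[OF k1i Dm(1)])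
        finally show ?thesis by simp
      qed
      have D2e: "SI D2 ?w2 = SI D2 (q2 n) - SI D2 (k2 n)"
      proof -
        have "SI D2 (q2 n) = SI D2 (\<lambda>p. ?w2 p + k2 n p)"
          by (rule SI_cong) (use on2 in \<open>auto simp: indicator_def\<close>)
        also have "\<dots> = SI D2 ?w2 + SI D2 (k2 n)"
          by (rule set_integral_add(2)) (rule si[OF w2i Dm(2)], rule si[OF k2i Dm(2)])
        finally show ?thesis by simp
      qed
      let ?w = "calib (\<lambda>p. \<kappa>1 p + \<kappa>2 p) (\<lambda>e p. d\<kappa>1 e p + d\<kappa>2 e p) M a da b db"
      have disj: "p \<notin> S1 \<or> p \<notin> S2" for p using c1(3) c2(3) Sd by blast
      have we: "?w p = ?w1 p + ?w2 p" for p
      proof -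
        have d1: "Xd d\<kappa>1 p = 0 \<and> Yd d\<kappa>1 p = 0 \<and> \<kappa>1 p = 0" if "p \<notin> S1" for p
          using C1on_cutoff_deriv_zero[OF c1(1,2) _ that] c1(4) that by blast
        have d2: "Xd d\<kappa>2 p = 0 \<and> Yd d\<kappa>2 p = 0 \<and> \<kappa>2 p = 0" if "p \<notin> S2" for p
          using C1on_cutoff_deriv_zero[OF c2(1,2) _ that] c2(4) that by blast
        consider "p \<in> S1" "p \<notin> S2" | "p \<in> S2" "p \<notin> S1" | "p \<notin> S1" "p \<notin> S2" using disj by blast
        then show ?thesis
        proof cases
          case 1
          then have "M p = fM l Z p" using sg1[OF subsetD[OF c1(3)]] by (simp add: M_def)
          then show ?thesis using d2[OF 1(2)] by (simp add: calib_def Xd_simps Yd_simps)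
        next
          case 2
          then have "M p = fM (- l) Z p" using sg2[OF subsetD[OF c2(3)]] by (simp add: M_def)
          then show ?thesis using d1[OF 2(2)] by (simp add: calib_def Xd_simps Yd_simps)
        next
          case 3
          then show ?thesis using d1 d2 by (simp add: calib_def Xd_simps Yd_simps)
        qed
      qed
      have "ereal (SI ?E (\<lambda>p. Xd da p + Yd db p + ?w p)) \<le> Per ?E \<Omega>"
      proof (rule Per_ge_limit[OF open_Un[OF open_slab open_slab] compact_Un[OF c1(2) c2(2)] _ O _ C1on_add[OF c1(1) c2(1)] _ _ _ a b ab L(1,2) _ _ MC VM Ml Em])
        show "S1 \<union> S2 \<subseteq> ?S" using c1(3) c2(3) by blast
        show "S1 \<union> S2 \<subseteq> \<Omega>" using eta(5) by (auto simp: S1_def S2_def lsupp_def)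
        show "\<kappa>1 p + \<kappa>2 p = 0" if "p \<notin> S1 \<union> S2" for p using that c1(4)[of p] c2(4)[of p] by simp
        show "0 \<le> \<kappa>1 p + \<kappa>2 p" for p using c1(5)[of p] c2(5)[of p] by simp
        show "\<kappa>1 p + \<kappa>2 p \<le> 1" for p
          using disj[of p] c1(4)[of p] c2(4)[of p] c1(6)[of p] c2(6)[of p] by auto
      qed (use L in auto)
      also have "SI ?E (\<lambda>p. Xd da p + Yd db p + ?w p) = SI ?E (\<lambda>p. g p + (?w1 p + ?w2 p))"
        unfolding we g_def ..
      also have "\<dots> = SI ?E g + SI ?E (\<lambda>p. ?w1 p + ?w2 p)"
        by (rule set_integral_add(2)) (intro si gi Em Bochner_Integration.integrable_add w1i w2i)+
      also have "SI ?E (\<lambda>p. ?w1 p + ?w2 p) = SI ?E ?w1 + SI ?E ?w2"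
        by (rule set_integral_add(2)) (intro si Em w1i w2i)+
      finally have "ereal (SI ?E g + (SI ?E ?w1 + SI ?E ?w2)) \<le> ereal c" using c by (rule order_trans)
      then show ?thesis using pos1 pos2 E1 E2 D1e D2e by simp
    qed
    let ?T = "flux_triangle l A B"
    have TTi: "integrable lborel (\<lambda>q. indicator ?T q * (wall_flux m Z q - a (0, q)))" for m
    proof (rule flux_triangle_integrable[OF la(1)])
      have "(\<lambda>q. a (0, q)) \<in> borel_measurable borel"
        by (intro borel_measurable_continuous_onI continuous_on_compose2[OF ac]) (auto intro: continuous_intros)
      then show "(\<lambda>q. wall_flux m Z q - a (0, q)) \<in> borel_measurable borel" using wall_flux_measurable[OF f] by simp
      show "\<bar>wall_flux m Z q - a (0, q)\<bar> \<le> 2" for q using wall_flux_bounded[of m Z q] a1[of "(0, q)"] by linarith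
    qed
    \<comment> \<open>The ramps concentrate on \<open>{x = 0}\<close>. The two sides carry opposite
      orientations, so the contributions of \<open>a\<close> cancel and the jump of the calibrating
      flux is left.\<close>
    have Lq1: "(\<lambda>n. SI D1 (q1 n)) \<longlonglongrightarrow> sgn l * (\<integral>q. indicator ?T q * (wall_flux l Z q - a (0, q)) \<partial>lborel)"
      using flux_limit[OF f l1 ac a1 eps_props, of uA B] unfolding D1_def q1_def u by simp
    have Lq2: "(\<lambda>n. SI D2 (q2 n)) \<longlonglongrightarrow> sgn (- l) * (\<integral>q. indicator ?T q * (wall_flux (- l) Z q - a (0, q)) \<partial>lborel)"
      using flux_limit[OF f l2 ac a1 eps_props, of uB A] unfolding D2_def q2_def u flux_triangle_swap by simp
    have Lk1: "(\<lambda>n. SI D1 (k1 n)) \<longlonglongrightarrow> SI D1 g" unfolding k1_def by (rule SI_kcut_limit[OF gi Dm(1) Ds(1) eps_props])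
    have Lk2: "(\<lambda>n. SI D2 (k2 n)) \<longlonglongrightarrow> SI D2 g" unfolding k2_def by (rule SI_kcut_limit[OF gi Dm(2) Ds(2) eps_props])
    have "(\<lambda>n. SI ?E g + (SI D1 (q1 n) - SI D1 (k1 n)) + (SI D2 (q2 n) - SI D2 (k2 n))) \<longlonglongrightarrow>
      SI ?E g + (sgn l * (\<integral>q. indicator ?T q * (wall_flux l Z q - a (0, q)) \<partial>lborel) - SI D1 g)
        + (sgn (- l) * (\<integral>q. indicator ?T q * (wall_flux (- l) Z q - a (0, q)) \<partial>lborel) - SI D2 g)"
      by (intro tendsto_intros Lq1 Lq2 Lk1 Lk2)
    then have "SI ?E g + (sgn l * (\<integral>q. indicator ?T q * (wall_flux l Z q - a (0, q)) \<partial>lborel) - SI D1 g)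
        + (sgn (- l) * (\<integral>q. indicator ?T q * (wall_flux (- l) Z q - a (0, q)) \<partial>lborel) - SI D2 g) \<le> c"
      using step by (intro LIMSEQ_le_const2) auto
    moreover have "sgn l * (\<integral>q. indicator ?T q * (wall_flux l Z q - a (0, q)) \<partial>lborel)
        + sgn (- l) * (\<integral>q. indicator ?T q * (wall_flux (- l) Z q - a (0, q)) \<partial>lborel) = \<Delta>"
    proof -
      have "(\<integral>q. indicator ?T q * (wall_flux l Z q - a (0, q)) \<partial>lborel) - (\<integral>q. indicator ?T q * (wall_flux (- l) Z q - a (0, q)) \<partial>lborel)
        = (\<integral>q. indicator ?T q * (wall_flux l Z q - a (0, q)) - indicator ?T q * (wall_flux (- l) Z q - a (0, q)) \<partial>lborel)"
        using TTi by simp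
      also have "\<dots> = \<Delta>" unfolding \<Delta>_def by (rule Bochner_Integration.integral_cong) (auto simp: algebra_simps)
      finally show ?thesis using la by simp
    qed
    moreover have "SI ?E g = SI D1 g + SI D2 g + SI F g"
    proof -
      have "SI ?E g = SI D1 g + SI (?E - D1) g" by (rule SI_split[OF gi Em Dm(1) DE(1)])
      also have "SI (?E - D1) g = SI D2 g + SI (?E - D1 - D2) g"
        by (rule SI_split[OF gi _ Dm(2)]) (use Em Dm DE Ds Sd in auto)
      also have "?E - D1 - D2 = F" by (auto simp: F_def)
      finally show ?thesis by simp
    qed
    ultimately have "SI F g + \<Delta> \<le> c" by linarith
    then show ?thesis unfolding g_def[abs_def] .
  qed
  obtain C where C: "Per ?E \<Omega> \<le> ereal C" using Per_epigraph_finite[OF f, of r] unfolding \<Omega>_def by metis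
  have "0 \<le> Per ?E \<Omega>"
  proof -
    have "ereal (SI ?E (\<lambda>p. Xd (\<lambda>e p. 0) p + Yd (\<lambda>e p. 0) p)) \<le> Per ?E \<Omega>"
      by (rule Per_ge_integral_C1[OF Em O C1on_const[where c=0] C1on_const[where c=0] compact_empty]) auto
    then show ?thesis by (simp add: Xd_def Yd_def zero_ereal_def set_lebesgue_integral_def)
  qed
  then obtain c where c: "Per ?E \<Omega> = ereal c" using C by (cases "Per ?E \<Omega>") auto
  have "Per F \<Omega> \<le> ereal (c - \<Delta>)"
    unfolding Per_def
  proof (rule SUP_least, clarify)
    fix a b assume ab: "a \<in> Cinf_c \<Omega>" "b \<in> Cinf_c \<Omega>" "\<forall>p. (a p)\<^sup>2 + (b p)\<^sup>2 \<le> 1"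
    define L where "L = closure {p. a p \<noteq> 0} \<union> closure {p. b p \<noteq> 0}"
    have L: "compact L" "L \<subseteq> \<Omega>" using ab by (auto simp: L_def Cinf_c_def)
    have az: "a p = 0" "b p = 0" if "p \<notin> L" for p
      using that closure_subset[of "{p. a p \<noteq> 0}"] closure_subset[of "{p. b p \<noteq> 0}"] by (auto simp: L_def)
    have aC: "C1on UNIV a (\<lambda>e. pderiv3 e a)" and bC: "C1on UNIV b (\<lambda>e. pderiv3 e b)"
      using ab by (auto simp: Cinf_c_def intro: smooth3_imp_C1on)
    have "SI F (\<lambda>p. Xd (\<lambda>e. pderiv3 e a) p + Yd (\<lambda>e. pderiv3 e b) p) + \<Delta> \<le> c"
      by (rule main[OF _ aC bC _ L]) (use c ab(3) az in auto)
    then show "ereal (set_lebesgue_integral lebesgue F (\<lambda>p. Xfield (fst (a, b)) p + Yfield (snd (a, b)) p)) \<le> ereal (c - \<Delta>)"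
      unfolding fst_conv snd_conv Xfield_eq_Xd[OF aC] Yfield_eq_Yd[OF bC] by simp
  qed
  from order_trans[OF min this] c Dpos show False by simp
qed

section \<open>From the flux inequality to the slope condition\<close>

lemma antiderivative_exists:
  fixes g :: "real \<Rightarrow> real"
  assumes "continuous_on UNIV g"
  obtains G where "\<And>x. (G has_real_derivative g x) (at x)"
proof -
  have "isCont g u" for u using assms by (simp add: continuous_on_eq_continuous_at)
  then obtain G where "\<forall>x. ereal x > -\<infinity> \<longrightarrow> ereal x < \<infinity> \<longrightarrow> (G has_vector_derivative g x) (at x)"
    using einterval_antiderivative[of "-\<infinity>" \<infinity> g] by auto
  then have "(G has_real_derivative g x) (at x)" for x by (simp add: has_real_derivative_iff_has_vector_derivative)
  then show thesis by (rule that)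
qed

lemma fx_strict_mono: "m < n \<Longrightarrow> fx m < fx n"
  by (rule DERIV_pos_imp_increasing) (use fx_derivative fx'_pos in blast)+

lemma fx'_le_1: "fx' m \<le> 1"
proof -
  have "1 \<le> sqrt (1 + m\<^sup>2)" by simp
  then have "1 * 1 \<le> (1 + m\<^sup>2) * sqrt (1 + m\<^sup>2)" by (intro mult_mono) auto
  then show ?thesis by (simp add: fx'_def divide_le_eq_1)
qed

lemma fx_mvt: "\<exists>\<xi>. min m n \<le> \<xi> \<and> \<xi> \<le> max m n \<and> fx m - fx n = fx' \<xi> * (m - n)"
proof (cases m n rule: linorder_cases)
  case less
  then obtain \<xi> where "m < \<xi>" "\<xi> < n" "fx n - fx m = (n - m) * fx' \<xi>" using MVT2[OF less, of fx fx'] fx_derivative by blast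
  then show ?thesis using less by (intro exI[of _ \<xi>]) (auto simp: algebra_simps)
next
  case greater
  then obtain \<xi> where "n < \<xi>" "\<xi> < m" "fx m - fx n = (m - n) * fx' \<xi>" using MVT2[OF greater, of fx fx'] fx_derivative by blast
  then show ?thesis using greater by (intro exI[of _ \<xi>]) (auto simp: algebra_simps)
qed auto

lemma fx_diff_ge:
  assumes "n - m \<le> d" "0 \<le> d" shows "- d \<le> fx m - fx n"
proof -
  obtain \<xi> where x: "fx m - fx n = fx' \<xi> * (m - n)" using fx_mvt by blast
  show ?thesis
  proof (cases "n \<le> m")
    case True
    then have "0 \<le> fx' \<xi> * (m - n)" using fx'_pos[of \<xi>] by simp
    then show ?thesis using x assms by simp
  next
    case False
    then have "fx' \<xi> * (n - m) \<le> 1 * (n - m)" using fx'_le_1 by (intro mult_right_mono) auto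
    then show ?thesis using x assms by (simp add: algebra_simps)
  qed
qed

lemma measure_box2:
  assumes "a \<le> c" "b \<le> d"
  shows "measure lborel (cbox (a, b) (c, d) :: (real \<times> real) set) = (c - a) * (d - b)"
proof -
  have B: "(Basis :: (real \<times> real) set) = {(1, 0), (0, 1)}" by (auto simp: Basis_prod_def)
  have "measure lborel (cbox (a, b) (c, d) :: (real \<times> real) set) = (\<Prod>i\<in>Basis. (c, d) \<bullet> i - (a, b) \<bullet> i)"
    by (rule content_cbox) (use assms in \<open>auto simp: B\<close>)
  also have "\<dots> = (c - a) * (d - b)" by (simp add: B)
  finally show ?thesis .
qed

lemma integrable_box: "integrable lborel (indicat_real (cbox a b :: (real \<times> real) set))"
  by (intro integrable_real_indicator) (use emeasure_bounded_finite[of "cbox a b"] in auto)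

text \<open>If \<open>\<theta> x + \<kappa> x\<close> is not nondecreasing in \<open>x\<close>, then for some \<open>s\<close> the antiderivative of
  \<open>\<theta> x + \<kappa> x - s\<close> has an interior maximum. It exceeds its boundary values on an interval around the
  maximum, so the trapezoidal rule underestimates its integral there.\<close>

lemma trapezoid_gain:
  fixes \<theta> TA PB :: "real \<Rightarrow> real"
  assumes T: "\<And>x. (TA has_real_derivative \<theta> x) (at x)" and P: "\<And>x. (PB has_real_derivative TA x) (at x)"
    and pq: "p < q" "\<theta> q - \<theta> p < - \<kappa> * (q - p)"
  obtains \<alpha> \<beta> where "p \<le> \<alpha>" "\<alpha> < \<beta>" "\<beta> \<le> q" "\<kappa> * (\<beta> - \<alpha>) ^ 3 / 6 \<le> 2 * (PB \<beta> - PB \<alpha>) - (\<beta> - \<alpha>) * (TA \<alpha> + TA \<beta>)"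
proof -
  \<comment> \<open>The mean of the two end values makes the derivative of \<open>g\<close> positive
    at \<open>p\<close> and negative at \<open>q\<close>, which rules out a maximum at either
    end.\<close>
  define s where "s = ((\<theta> p + \<kappa> * p) + (\<theta> q + \<kappa> * q)) / 2"
  have s: "\<theta> q + \<kappa> * q < s" "s < \<theta> p + \<kappa> * p" using pq by (auto simp: s_def algebra_simps)
  define g where "g t = TA t + \<kappa> * t\<^sup>2 / 2 - s * t" for t
  have gd: "(g has_real_derivative \<theta> t + \<kappa> * t - s) (at t)" for t
    unfolding g_def[abs_def] by (auto intro!: derivative_eq_intros T)
  have gc: "continuous_on A g" for A
    by (rule DERIV_continuous_on[OF has_field_derivative_at_within[OF gd]])
  obtain t where t: "t \<in> {p..q}" "\<And>u. u \<in> {p..q} \<Longrightarrow> g u \<le> g t"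
    using continuous_attains_sup[OF compact_Icc _ gc, of p q] pq(1) by auto
  have gp: "g p < g t"
  proof -
    have "0 < \<theta> p + \<kappa> * p - s" using s by simp
    from DERIV_pos_inc_right[OF gd this] obtain d where d: "0 < d" "\<And>h. 0 < h \<Longrightarrow> h < d \<Longrightarrow> g p < g (p + h)" by blast
    define h where "h = min (d / 2) (q - p)"
    have "0 < h" "h < d" "p + h \<in> {p..q}" using d pq by (auto simp: h_def)
    then show ?thesis using d(2)[of h] t(2)[of "p + h"] by linarith
  qed
  have gq: "g q < g t"
  proof -
    have "\<theta> q + \<kappa> * q - s < 0" using s by simp
    from DERIV_neg_dec_left[OF gd this] obtain d where d: "0 < d" "\<And>h. 0 < h \<Longrightarrow> h < d \<Longrightarrow> g q < g (q - h)" by blast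
    define h where "h = min (d / 2) (q - p)"
    have "0 < h" "h < d" "q - h \<in> {p..q}" using d pq by (auto simp: h_def)
    then show ?thesis using d(2)[of h] t(2)[of "q - h"] by linarith
  qed
  \<comment> \<open>At the higher of the two end values, the last point before and the first point
    after the maximum at which \<open>g\<close> is at most \<open>m\<close> delimit the
    interval.\<close>
  define m where "m = max (g p) (g q)"
  have m: "m < g t" using gp gq by (simp add: m_def)
  have cl: "closed {u. g u \<le> m}" using gc[of UNIV] by (intro closed_Collect_le continuous_on_const)
  obtain \<alpha> where a: "\<alpha> \<in> {p..t}" "g \<alpha> \<le> m" "\<And>u. u \<in> {p..t} \<Longrightarrow> g u \<le> m \<Longrightarrow> u \<le> \<alpha>"
  proof -
    have "compact ({p..t} \<inter> {u. g u \<le> m})" "{p..t} \<inter> {u. g u \<le> m} \<noteq> {}"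
      using cl t(1) by (auto simp: m_def intro!: compact_Int_closed exI[of _ p])
    from compact_attains_sup[OF this] show thesis using that by blast
  qed
  obtain \<beta> where b: "\<beta> \<in> {t..q}" "g \<beta> \<le> m" "\<And>u. u \<in> {t..q} \<Longrightarrow> g u \<le> m \<Longrightarrow> \<beta> \<le> u"
  proof -
    have "compact ({t..q} \<inter> {u. g u \<le> m})" "{t..q} \<inter> {u. g u \<le> m} \<noteq> {}"
      using cl t(1) by (auto simp: m_def intro!: compact_Int_closed exI[of _ q])
    from compact_attains_inf[OF this] show thesis using that by blast
  qed
  have "\<alpha> \<noteq> t" "\<beta> \<noteq> t" using a(2) b(2) m by auto
  then have ab: "\<alpha> < t" "t < \<beta>" using a(1) b(1) by auto
  have inside: "m < g u" if "\<alpha> < u" "u < \<beta>" for u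
  proof (rule ccontr)
    assume "\<not> m < g u"
    then show False using that a(1) b(1) a(3)[of u] b(3)[of u] by (cases "u \<le> t") auto
  qed
  \<comment> \<open>An antiderivative of \<open>g\<close>. The trapezoidal rule is exact for the
    linear term, and its defect on \<open>\<kappa> * t\<^sup>2 / 2\<close> is the source of
    \<open>\<kappa> * (\<beta> - \<alpha>) ^ 3 / 6\<close>.\<close>
  define Q where "Q u = PB u + \<kappa> * u ^ 3 / 6 - s * u\<^sup>2 / 2" for u
  have Qd: "(Q has_real_derivative g u) (at u)" for u
    unfolding Q_def[abs_def] g_def by (auto intro!: derivative_eq_intros P simp: power2_eq_square)
  obtain \<xi> where xi: "\<alpha> < \<xi>" "\<xi> < \<beta>" "Q \<beta> - Q \<alpha> = (\<beta> - \<alpha>) * g \<xi>"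
    using MVT2[of \<alpha> \<beta> Q g] Qd ab by force
  have "(\<beta> - \<alpha>) * m \<le> (\<beta> - \<alpha>) * g \<xi>" using inside[OF xi(1,2)] ab by (intro mult_left_mono) auto
  moreover have "(\<beta> - \<alpha>) * (g \<alpha> + g \<beta>) \<le> (\<beta> - \<alpha>) * (m + m)" using a(2) b(2) ab by (intro mult_left_mono) auto
  ultimately have "0 \<le> 2 * (Q \<beta> - Q \<alpha>) - (\<beta> - \<alpha>) * (g \<alpha> + g \<beta>)" using xi(3) by (simp add: algebra_simps)
  moreover have "2 * (Q \<beta> - Q \<alpha>) - (\<beta> - \<alpha>) * (g \<alpha> + g \<beta>)
      = 2 * (PB \<beta> - PB \<alpha>) - (\<beta> - \<alpha>) * (TA \<alpha> + TA \<beta>) - \<kappa> * (\<beta> - \<alpha>) ^ 3 / 6"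
    unfolding Q_def g_def by (simp add: field_simps power2_eq_square power3_eq_cube)
  ultimately show thesis using that[of \<alpha> \<beta>] a(1) b(1) ab by simp
qed

text \<open>Integrating over \<open>z\<close> and then over \<open>y\<close> uses up two
  antiderivatives. The result is twice the amount by which the trapezoidal rule underestimates the
  integral of \<open>TA\<close> over \<open>[A, B]\<close>, divided by \<open>l\<close>; this links
  the triangle to \<open>trapezoid_gain\<close>.\<close>

lemma flux_triangle_integral_diff:
  fixes \<theta> TA PB :: "real \<Rightarrow> real"
  assumes T: "\<And>x. (TA has_real_derivative \<theta> x) (at x)" and P: "\<And>x. (PB has_real_derivative TA x) (at x)"
    and \<theta>c: "continuous_on UNIV \<theta>" and l: "0 < l" and AB: "A < B"
  shows "integrable lborel (\<lambda>q. indicator (flux_triangle l A B) q * (\<theta> (snd q - l * fst q / 2) - \<theta> (snd q + l * fst q / 2)))"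
    and "(\<integral>q. indicator (flux_triangle l A B) q * (\<theta> (snd q - l * fst q / 2) - \<theta> (snd q + l * fst q / 2)) \<partial>lborel)
      = (2 * (PB B - PB A) - (B - A) * (TA A + TA B)) / l"
proof -
  let ?g = "\<lambda>q. indicator (flux_triangle l A B) q * (\<theta> (snd q - l * fst q / 2) - \<theta> (snd q + l * fst q / 2))"
  let ?X = "cbox (0, A) ((B - A) / l, B) :: (real \<times> real) set"
  define h where "h q = \<theta> (snd q - l * fst q / 2) - \<theta> (snd q + l * fst q / 2)" for q :: "real \<times> real"
  have hc: "continuous_on UNIV h" unfolding h_def
    by (intro continuous_intros continuous_on_compose2[OF \<theta>c]) auto
  have TX: "flux_triangle l A B \<subseteq> ?X"
  proof
    fix q assume q: "q \<in> flux_triangle l A B"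
    obtain y z where qe: "q = (y, z)" by (cases q)
    have b: "0 < y" "0 < z - l * y / 2 - A" "0 < B - (z + l * y / 2)" using q l by (auto simp: flux_triangle_def qe zero_less_mult_iff)
    have "0 < l * y" using b l by simp
    then have "A \<le> z" "z \<le> B" "l * y \<le> B - A" using b by linarith+
    then show "q \<in> ?X" using b l by (auto simp: qe cbox_Pair_eq pos_le_divide_eq mult.commute)
  qed
  have "compact (h ` ?X)" using hc by (meson compact_cbox compact_continuous_image continuous_on_subset top_greatest)
  then obtain C where C: "\<And>q. q \<in> ?X \<Longrightarrow> \<bar>h q\<bar> \<le> C" unfolding compact_eq_bounded_closed bounded_real by blast
  show gi: "integrable lborel ?g"
  proof (rule Bochner_Integration.integrable_bound[OF integrable_mult_right[OF integrable_box[of "(0, A)" "((B - A) / l, B)"], of C]])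
    show "?g \<in> borel_measurable lborel"
      using borel_measurable_continuous_onI[OF hc] flux_triangle_open[of l A B] by (simp add: h_def[abs_def])
    show "AE q in lborel. norm (?g q) \<le> norm (C * indicat_real ?X q)"
    proof (intro AE_I2)
      fix q
      show "norm (?g q) \<le> norm (C * indicat_real ?X q)"
      proof (cases "q \<in> flux_triangle l A B")
        case True
        then have "q \<in> ?X" using TX by blast
        then show ?thesis using C[of q] True by (simp add: h_def)
      qed simp
    qed
  qed
  \<comment> \<open>The integral over the slice of the triangle at \<open>y\<close>; the shifts by
    \<open>l * y / 2\<close> combine with the ends of the slice to the arguments \<open>A\<close>,
    \<open>B\<close>, \<open>A + l * y\<close> and \<open>B - l * y\<close>.\<close>
  define H where "H y = TA (B - l * y) - TA B - TA A + TA (A + l * y)" for y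
  have inner: "(\<integral>z. ?g (y, z) \<partial>lborel) = H y * indicator {0..(B - A) / l} y" if y: "y \<noteq> 0" "y \<noteq> (B - A) / l" for y
  proof (cases "0 < y \<and> y < (B - A) / l")
    case True
    then have ly: "0 < l * y" "l * y < B - A" using l by (auto simp: pos_less_divide_eq mult.commute)
    define x1 x2 where "x1 = A + l * y / 2" and "x2 = B - l * y / 2"
    have x12: "x1 \<le> x2" using ly by (simp add: x1_def x2_def)
    define k where "k z = \<theta> (z - l * y / 2) - \<theta> (z + l * y / 2)" for z
    have kd: "((\<lambda>z. TA (z - l * y / 2) - TA (z + l * y / 2)) has_real_derivative k z) (at z)" for z
    proof -
      have "((\<lambda>z. TA (z + c)) has_real_derivative \<theta> (z + c)) (at z)" for c
        using T[of "z + c"] by (simp add: DERIV_shift)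
      from DERIV_diff[OF this[of "- (l * y / 2)"] this[of "l * y / 2"]] show ?thesis by (simp add: k_def)
    qed
    have kc: "continuous_on UNIV k" unfolding k_def[abs_def]
      by (intro continuous_intros continuous_on_compose2[OF \<theta>c]) auto
    have "(\<integral>z. ?g (y, z) \<partial>lborel) = (\<integral>z. k z * indicator {x1..x2} z \<partial>lborel)"
    proof (rule integral_cong_AE)
      have "AE z in lborel. z \<noteq> x1" "AE z in lborel. z \<noteq> x2" by (rule AE_lborel_singleton)+
      then show "AE z in lborel. ?g (y, z) = k z * indicator {x1..x2} z"
      proof eventually_elim
        case (elim z)
        have "(y, z) \<in> flux_triangle l A B \<longleftrightarrow> z \<in> {x1..x2}" using elim True l
          by (auto simp: flux_triangle_def zero_less_mult_iff x1_def x2_def)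
        then show ?case by (simp add: k_def indicator_def)
      qed
      show "(\<lambda>z. ?g (y, z)) \<in> borel_measurable lborel"
      proof -
        have "(\<lambda>z::real. (y, z)) \<in> borel_measurable borel" by (intro borel_measurable_continuous_onI continuous_intros)
        moreover have "?g \<in> borel_measurable borel" using gi by simp
        ultimately have "(\<lambda>z. ?g (y, z)) \<in> borel_measurable borel" by (rule measurable_compose)
        then show ?thesis by simp
      qed
      show "(\<lambda>z. k z * indicator {x1..x2} z) \<in> borel_measurable lborel"
        using borel_measurable_continuous_onI[OF kc] by simp
    qed
    also have "\<dots> = (TA (x2 - l * y / 2) - TA (x2 + l * y / 2)) - (TA (x1 - l * y / 2) - TA (x1 + l * y / 2))"
      by (rule integral_FTC_Icc_real[OF x12 kd]) (use kc in \<open>auto simp: continuous_on_eq_continuous_at\<close>)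
    also have "\<dots> = H y"
    proof -
      have "x2 - l * y / 2 = B - l * y" "x2 + l * y / 2 = B" "x1 - l * y / 2 = A" "x1 + l * y / 2 = A + l * y"
        by (auto simp: x1_def x2_def)
      then have e: "(TA (x2 - l * y / 2) - TA (x2 + l * y / 2)) - (TA (x1 - l * y / 2) - TA (x1 + l * y / 2))
          = (TA (B - l * y) - TA B) - (TA A - TA (A + l * y))" by (simp only:)
      show ?thesis unfolding e by (simp add: H_def)
    qed
    finally show ?thesis using True by simp
  next
    case False
    have "(y, z) \<notin> flux_triangle l A B" for z
    proof
      assume "(y, z) \<in> flux_triangle l A B"
      then have b: "0 < y" "0 < z - l * y / 2 - A" "0 < B - (z + l * y / 2)" using l by (auto simp: flux_triangle_def zero_less_mult_iff)
      then have "l * y < B - A" by linarith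
      then show False using b False l by (auto simp: pos_less_divide_eq mult.commute)
    qed
    then have "(\<lambda>z. ?g (y, z)) = (\<lambda>z. 0)" by auto
    moreover have "y \<notin> {0..(B - A) / l}" using False y by auto
    ultimately show ?thesis by (simp only: integral_zero) simp
  qed
  have Hc: "continuous_on UNIV H"
  proof -
    have "continuous_on UNIV TA" by (rule DERIV_continuous_on, rule has_field_derivative_at_within, rule T)
    then have c: "continuous_on UNIV (\<lambda>y. TA (u y))" if "continuous_on UNIV u" for u :: "real \<Rightarrow> real"
      using that by (rule continuous_on_compose2) auto
    show ?thesis unfolding H_def[abs_def]
      by (intro continuous_on_add continuous_on_diff c continuous_on_mult continuous_on_const continuous_on_id)
  qed
  define W where "W y = - PB (B - l * y) / l - y * (TA B + TA A) + PB (A + l * y) / l" for y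
  have Wd: "(W has_real_derivative H y) (at y)" for y
  proof -
    have 1: "((\<lambda>y. PB (B - l * y)) has_real_derivative TA (B - l * y) * (- l)) (at y)"
      by (rule DERIV_chain2[OF P]) (auto intro!: derivative_eq_intros)
    have 2: "((\<lambda>y. PB (A + l * y)) has_real_derivative TA (A + l * y) * l) (at y)"
      by (rule DERIV_chain2[OF P]) (auto intro!: derivative_eq_intros)
    show ?thesis unfolding W_def[abs_def] H_def
      by (rule derivative_eq_intros 1 2 refl | use l in \<open>simp add: field_simps\<close>)+
  qed
  have "(\<integral>q. ?g q \<partial>lborel) = (\<integral>y. (\<integral>z. ?g (y, z) \<partial>lborel) \<partial>lborel)"
    by (rule lborel_pair.integral_fst'[of ?g, unfolded lborel_prod, OF gi, symmetric])
  also have "\<dots> = (\<integral>y. H y * indicator {0..(B - A) / l} y \<partial>lborel)"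
  proof (rule integral_cong_AE)
    have "AE y in lborel. y \<noteq> 0" "AE y in lborel. y \<noteq> (B - A) / l" by (rule AE_lborel_singleton)+
    then show "AE y in lborel. (\<integral>z. ?g (y, z) \<partial>lborel) = H y * indicator {0..(B - A) / l} y"
      by eventually_elim (rule inner)
    have "case_prod (\<lambda>y z. ?g (y, z)) \<in> borel_measurable (lborel \<Otimes>\<^sub>M lborel)"
      using borel_measurable_integrable[OF gi] by (simp add: lborel_prod split_beta')
    then show "(\<lambda>y. \<integral>z. ?g (y, z) \<partial>lborel) \<in> borel_measurable lborel"
      by (rule lborel.borel_measurable_lebesgue_integral)
    show "(\<lambda>y. H y * indicator {0..(B - A) / l} y) \<in> borel_measurable lborel"
      using borel_measurable_continuous_onI[OF Hc] by simp
  qed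
  also have "\<dots> = W ((B - A) / l) - W 0"
    by (rule integral_FTC_Icc_real[OF _ Wd]) (use l AB Hc in \<open>auto simp: continuous_on_eq_continuous_at\<close>)
  also have "\<dots> = (2 * (PB B - PB A) - (B - A) * (TA A + TA B)) / l"
    using l by (simp add: W_def field_simps)
  finally show "(\<integral>q. ?g q \<partial>lborel) = (2 * (PB B - PB A) - (B - A) * (TA A + TA B)) / l" .
qed

section \<open>The slope bound for fixed l\<close>

context
  fixes f :: "hpt \<Rightarrow> real" and Z :: "real \<Rightarrow> real" and l :: real
  assumes f: "strip_param f Z" and l: "0 < l"
    and flux: "\<And>A B. A < B \<Longrightarrow> (\<integral>q. indicator (flux_triangle l A B) q * (wall_flux l Z q - wall_flux (- l) Z q) \<partial>lborel) \<le> 0"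
begin

lemma Z_grows_0: "grows 0 Z" using f by (simp add: strip_param_def)

lemma ZinvZ: "Z (inv Z t) = t" by (rule surj_f_inv_f[OF strip_surj[OF f]])

lemma slope_at_eq: "slope_at Z t = 2 * (t - inv Z t)" by (simp add: slope_at_def ruling_slope_def ZinvZ)

text \<open>One half of the slope condition is automatic: \<open>inv Z\<close> is nondecreasing and
  enters with a negative sign.\<close>

lemma slope_at_upper: "s \<le> t \<Longrightarrow> slope_at Z t - slope_at Z s \<le> 2 * (t - s)"
  using monoD[OF inv_mono[OF strip_mono[OF f] strip_surj[OF f]], of s t] by (simp add: slope_at_eq)

lemma wall_flux_diff: "wall_flux l Z q - wall_flux (- l) Z q =
    fx (slope_at Z (snd q - l * fst q / 2) - fst q / l) - fx (slope_at Z (snd q + l * fst q / 2) + fst q / l)"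
  by (simp add: wall_flux_def)

lemma flux_integrable: "integrable lborel (\<lambda>q. indicator (flux_triangle l A B) q * (wall_flux l Z q - wall_flux (- l) Z q))"
proof (rule flux_triangle_integrable[OF l])
  show "(\<lambda>q. wall_flux l Z q - wall_flux (- l) Z q) \<in> borel_measurable borel"
    using wall_flux_measurable[OF f] by simp
  show "\<bar>wall_flux l Z q - wall_flux (- l) Z q\<bar> \<le> 2" for q
    using wall_flux_bounded[of l Z q] wall_flux_bounded[of "- l" Z q] by linarith
qed

lemma flux_triangle_mem:
  assumes "q \<in> flux_triangle l A B"
  shows "0 < fst q" "A < snd q - l * fst q / 2" "snd q + l * fst q / 2 < B" "l * fst q < B - A"
    "q \<in> cbox (0, A) ((B - A) / l, B)"
proof -
  obtain y z where qe: "q = (y, z)" by (cases q)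
  have b: "0 < y" "0 < z - l * y / 2 - A" "0 < B - (z + l * y / 2)" using assms l by (auto simp: flux_triangle_def qe zero_less_mult_iff)
  have ly: "0 < l * y" using b l by simp
  then have "A \<le> z" "z \<le> B" "l * y \<le> B - A" using b by linarith+
  then show "q \<in> cbox (0, A) ((B - A) / l, B)" using b l by (auto simp: qe cbox_Pair_eq pos_le_divide_eq mult.commute)
  show "0 < fst q" "A < snd q - l * fst q / 2" "snd q + l * fst q / 2 < B" "l * fst q < B - A"
    using b unfolding qe fst_conv snd_conv by linarith+
qed

text \<open>With \<open>a = z - l * y / 2\<close> and \<open>b = z + l * y / 2\<close>, the shift
  \<open>y / l\<close> of the slopes is \<open>cl * (b - a)\<close>. The two opposite shifts add up
  to \<open>2 * cl\<close> per unit of \<open>b - a\<close>, which is the origin of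
  \<open>- 2 / l\<^sup>2\<close>.\<close>

definition cl :: real where "cl = 1 / l\<^sup>2"

lemma cl_props: "0 < cl" "y / l = cl * (l * y)"
  using l by (auto simp: cl_def power2_eq_square)

text \<open>The upper slope bound limits by how much the second argument of \<open>fx\<close> can
  exceed the first, and \<open>fx\<close> is increasing and 1-Lipschitz. So the negative part of the
  integrand is of the order of the size of the triangle.\<close>

lemma flux_lower:
  assumes "q \<in> flux_triangle l A B"
  shows "- ((2 + 2 * cl) * (B - A)) \<le> wall_flux l Z q - wall_flux (- l) Z q"
proof -
  define a b d where "a = snd q - l * fst q / 2" and "b = snd q + l * fst q / 2" and "d = l * fst q"
  note t = flux_triangle_mem[OF assms]
  have d: "0 < d" "d < B - A" "b - a = d" using t l by (auto simp: d_def a_def b_def)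
  have "slope_at Z b - slope_at Z a \<le> 2 * d" using slope_at_upper[of a b] d by simp
  then have "(slope_at Z b + cl * d) - (slope_at Z a - cl * d) \<le> (2 + 2 * cl) * d" by (simp add: algebra_simps)
  also have "\<dots> \<le> (2 + 2 * cl) * (B - A)" using d cl_props(1) by (intro mult_left_mono) auto
  finally have "- ((2 + 2 * cl) * (B - A)) \<le> fx (slope_at Z a - cl * d) - fx (slope_at Z b + cl * d)"
    by (rule fx_diff_ge) (use d cl_props(1) in \<open>auto intro!: mult_nonneg_nonneg\<close>)
  then show ?thesis unfolding wall_flux_diff cl_props(2) by (simp add: a_def b_def d_def)
qed

text \<open>If \<open>Z\<close> were constant on \<open>[v, w]\<close>, the slope would drop by
  \<open>2 * (w - v)\<close> across the height \<open>t0\<close>. On small triangles around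
  \<open>t0\<close> a fixed fraction of the area sees a definite positive flux jump, while the loss
  elsewhere has one more power of the size.\<close>

lemma no_flats: assumes "v < w" shows "Z v < Z w"
proof (rule ccontr)
  assume "\<not> Z v < Z w"
  then have eq: "Z w = Z v" using grows_mono[OF Z_grows_0, of v w] assms by simp
  define t0 where "t0 = Z v"
  have lo: "2 * (t - v) < slope_at Z t" if "t < t0" for t
  proof -
    have "inv Z t < v"
    proof (rule ccontr)
      assume "\<not> inv Z t < v"
      then have "Z v \<le> Z (inv Z t)" using grows_mono[OF Z_grows_0] by simp
      then show False using that by (simp add: ZinvZ t0_def)
    qed
    then show ?thesis by (simp add: slope_at_eq)
  qed
  have hi: "slope_at Z t < 2 * (t - w)" if "t0 < t" for t
  proof -
    have "w < inv Z t"
    proof (rule ccontr)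
      assume "\<not> w < inv Z t"
      then have "Z (inv Z t) \<le> Z w" using grows_mono[OF Z_grows_0] by simp
      then show False using that by (simp add: ZinvZ t0_def eq)
    qed
    then show ?thesis by (simp add: slope_at_eq)
  qed
  \<comment> \<open>The one-sided bounds of the slope at \<open>t0\<close> are \<open>s1\<close>
    from below and \<open>s1 - 2 * J\<close> from above; a margin \<open>J / 2\<close> on each side
    absorbs the distance from \<open>t0\<close> and the shifts by \<open>cl\<close>.\<close>
  define J s1 L \<kappa> where "J = w - v" and "s1 = 2 * (t0 - v)" and "L = 2 + 2 * cl"
    and "\<kappa> = fx (s1 - J / 2) - fx (s1 - 3 * J / 2)"
  have J: "0 < J" using assms by (simp add: J_def)
  have \<kappa>: "0 < \<kappa>" using fx_strict_mono[of "s1 - 3 * J / 2" "s1 - J / 2"] J by (simp add: \<kappa>_def)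
  have L: "0 < L" using cl_props(1) by (simp add: L_def)
  \<comment> \<open>The first bound secures the margin \<open>J / 2\<close>; the second makes the
    loss \<open>8 * (L * e)\<close> smaller than the gain \<open>3 * \<kappa> / 8\<close> in the
    final comparison.\<close>
  define e where "e = min (J / (2 * L)) (\<kappa> / (32 * L))"
  have e: "0 < e" "L * e \<le> J / 2" "32 * (L * e) \<le> \<kappa>"
    using J \<kappa> L by (auto simp: e_def min_def field_simps)
  define A B where "A = t0 - e" and "B = t0 + e"
  \<comment> \<open>A box inside the triangle whose points have
    \<open>z - l * y / 2 < t0 < z + l * y / 2\<close>: there \<open>l * y / 2\<close> lies between
    \<open>5 * e / 16\<close> and \<open>11 * e / 16\<close>, and \<open>z\<close> deviates from
    \<open>t0\<close> by at most \<open>e / 4\<close>.\<close>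
  define Q where "Q = cbox (5 * e / (8 * l), t0 - e / 4) (11 * e / (8 * l), t0 + e / 4)"
  define X where "X = cbox (0, A) ((B - A) / l, B)"
  have AB: "A < B" using e by (simp add: A_def B_def)
  have Qab: "t0 - e < z - l * y / 2 \<and> z - l * y / 2 < t0 \<and> t0 < z + l * y / 2 \<and> z + l * y / 2 < t0 + e \<and> 0 < y \<and> l * y < 2 * e"
    if "(y, z) \<in> Q" for y z
  proof -
    have h: "5 * e / (8 * l) \<le> y" "y \<le> 11 * e / (8 * l)" "t0 - e / 4 \<le> z" "z \<le> t0 + e / 4"
      using that by (auto simp: Q_def cbox_Pair_eq)
    then have "5 * e / 8 \<le> l * y" "l * y \<le> 11 * e / 8" using l by (auto simp: field_simps)
    moreover have "0 < 5 * e / (8 * l)" using e l by simp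
    ultimately show ?thesis using h e by auto
  qed
  have QT: "Q \<subseteq> flux_triangle l A B"
  proof
    fix q assume "q \<in> Q"
    then show "q \<in> flux_triangle l A B" using Qab[of "fst q" "snd q"] l by (auto simp: flux_triangle_def A_def B_def zero_less_mult_iff)
  qed
  have good: "\<kappa> \<le> wall_flux l Z q - wall_flux (- l) Z q" if "q \<in> Q" for q
  proof -
    define a b d where "a = snd q - l * fst q / 2" and "b = snd q + l * fst q / 2" and "d = l * fst q"
    have h: "t0 - e < a" "a < t0" "t0 < b" "b < t0 + e" "0 < d" "d < 2 * e"
      using Qab[of "fst q" "snd q"] that l by (auto simp: a_def b_def d_def)
    have "cl * d \<le> cl * (2 * e)" using h cl_props(1) by (intro mult_left_mono) auto
    moreover have "L * e = 2 * e + cl * (2 * e)" by (simp add: L_def algebra_simps)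
    ultimately have cd: "2 * e + cl * d \<le> J / 2" using e(2) by linarith
    have "s1 - J / 2 \<le> slope_at Z a - cl * d" using lo[OF h(2)] h(1) cd unfolding s1_def by argo
    moreover have "slope_at Z b + cl * d \<le> s1 - 3 * J / 2"
    proof -
      have "2 * (b - w) = 2 * (b - t0) + s1 - 2 * J" by (simp add: s1_def J_def)
      then show ?thesis using hi[OF h(3)] h(4) cd by argo
    qed
    ultimately have "fx (s1 - J / 2) \<le> fx (slope_at Z a - cl * d)" "fx (slope_at Z b + cl * d) \<le> fx (s1 - 3 * J / 2)"
      using fx_strict_mono by (metis less_eq_real_def)+
    then show ?thesis unfolding wall_flux_diff cl_props(2) \<kappa>_def by (simp add: a_def b_def d_def)
  qed
  have pw: "\<kappa> * indicat_real Q q - (L * (B - A)) * indicat_real X q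
      \<le> indicator (flux_triangle l A B) q * (wall_flux l Z q - wall_flux (- l) Z q)" for q
  proof (cases "q \<in> flux_triangle l A B")
    case True
    then have "q \<in> X" using flux_triangle_mem(5)[OF True] by (simp add: X_def)
    have "0 \<le> L * (B - A)" using L AB by simp
    then show ?thesis using True \<open>q \<in> X\<close> good[of q] flux_lower[OF True] by (cases "q \<in> Q") (auto simp: L_def)
  next
    case False
    then have "q \<notin> Q" using QT by blast
    moreover have "0 \<le> L * (B - A)" using L AB by simp
    ultimately show ?thesis using False by (simp add: indicator_def)
  qed
  have mQ: "measure lborel Q = (3 * e / (4 * l)) * (e / 2)" unfolding Q_def
    by (subst measure_box2) (use e l in \<open>auto simp: field_simps\<close>)
  have mX: "measure lborel X = (2 * e / l) * (2 * e)" unfolding X_def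
    by (subst measure_box2) (use e l in \<open>auto simp: A_def B_def\<close>)
  have i: "integrable lborel (indicat_real Q)" "integrable lborel (indicat_real X)"
    unfolding Q_def X_def by (rule integrable_box)+
  have "(\<integral>q. \<kappa> * indicat_real Q q - (L * (B - A)) * indicat_real X q \<partial>lborel)
      \<le> (\<integral>q. indicator (flux_triangle l A B) q * (wall_flux l Z q - wall_flux (- l) Z q) \<partial>lborel)"
    by (rule integral_mono[OF _ flux_integrable pw]) (use i in auto)
  also have "\<dots> \<le> 0" by (rule flux[OF AB])
  also have "(\<integral>q. \<kappa> * indicat_real Q q - (L * (B - A)) * indicat_real X q \<partial>lborel)
      = \<kappa> * measure lborel Q - L * (B - A) * measure lborel X"
    using i by (simp add: Q_def X_def del: cbox_Pair_eq)
  also have "\<dots> = e\<^sup>2 / l * (3 * \<kappa> / 8 - 8 * (L * e))"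
    unfolding mQ mX A_def B_def using l by (simp add: field_simps power2_eq_square)
  finally have "e\<^sup>2 / l * (3 * \<kappa> / 8 - 8 * (L * e)) \<le> 0" .
  moreover have "0 < 3 * \<kappa> / 8 - 8 * (L * e)" using e(3) \<kappa> by linarith
  moreover have "0 < e\<^sup>2 / l" using e l by simp
  ultimately show False by (meson mult_pos_pos not_le)
qed

lemma slope_at_continuous: "continuous_on UNIV (slope_at Z)"
proof -
  have inj: "inj Z"
    by (rule linorder_injI) (use no_flats in \<open>metis less_irrefl\<close>)
  have "continuous_on UNIV (inv Z)"
  proof (rule continuous_onI_mono)
    show "open (range (inv Z))" using inj_imp_surj_inv[OF inj] by simp
    show "inv Z x \<le> inv Z y" if "x \<le> y" for x y
      using monoD[OF inv_mono[OF strip_mono[OF f] strip_surj[OF f]] that] .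
  qed
  then have "continuous_on UNIV (\<lambda>t. 2 * (t - inv Z t))" by (intro continuous_intros)
  moreover have "slope_at Z = (\<lambda>t. 2 * (t - inv Z t))" by (rule ext) (rule slope_at_eq)
  ultimately show ?thesis by simp
qed

text \<open>Near \<open>t0\<close> the slope is continuous, so \<open>fx\<close> can be replaced by
  its linearisation with coefficient \<open>\<mu>\<close>. The integrand becomes
  \<open>\<mu>\<close> times the decrease of \<open>\<theta> t = slope_at Z t + 2 * cl * t\<close>
  from \<open>a\<close> to \<open>b\<close>. A violation of the claim would give, by
  \<open>trapezoid_gain\<close>, an interval with too large a flux.\<close>

lemma slope_at_lower_local:
  assumes \<kappa>: "0 < \<kappa>"
  obtains \<delta> where "0 < \<delta>" "\<And>p q. p \<le> t0 \<Longrightarrow> t0 \<le> q \<Longrightarrow> q - p < \<delta> \<Longrightarrow>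
    - \<kappa> * (q - p) \<le> (slope_at Z q + 2 * cl * q) - (slope_at Z p + 2 * cl * p)"
proof -
  define \<mu> L where "\<mu> = fx' (slope_at Z t0)" and "L = 2 + 2 * cl"
  have \<mu>: "0 < \<mu>" using fx'_pos by (simp add: \<mu>_def)
  have L: "0 < L" using cl_props(1) by (simp add: L_def)
  \<comment> \<open>Gain and error both scale like \<open>(B - A) ^ 3 / l\<close>, with coefficients
    at least \<open>\<mu> * \<kappa> / 12\<close> and at most \<open>2 * L * \<omega>\<close>. The
    second entry of the minimum makes the error at most half of the gain.\<close>
  define \<omega> where "\<omega> = min (\<mu> / 2) (\<mu> * \<kappa> / (48 * L))"
  have \<omega>: "0 < \<omega>" "\<omega> \<le> \<mu> / 2" "48 * (L * \<omega>) \<le> \<mu> * \<kappa>"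
    using \<mu> \<kappa> L by (auto simp: \<omega>_def min_def field_simps)
  have "isCont fx' (slope_at Z t0)" using fx'_continuous by (simp add: continuous_on_eq_continuous_at)
  then obtain \<tau> where tau: "0 < \<tau>" "\<And>\<xi>. \<bar>\<xi> - slope_at Z t0\<bar> < \<tau> \<Longrightarrow> \<bar>fx' \<xi> - \<mu>\<bar> < \<omega>"
    using \<omega>(1) unfolding continuous_at_eps_delta dist_real_def \<mu>_def by blast
  have "isCont (slope_at Z) t0" using slope_at_continuous by (simp add: continuous_on_eq_continuous_at)
  then obtain \<delta>0 where d0: "0 < \<delta>0" "\<And>t. \<bar>t - t0\<bar> < \<delta>0 \<Longrightarrow> \<bar>slope_at Z t - slope_at Z t0\<bar> < \<tau> / 2"
    using tau(1) unfolding continuous_at_eps_delta dist_real_def by (metis half_gt_zero)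
  \<comment> \<open>Half of \<open>\<tau>\<close> is reserved for the oscillation of the slope and
    half for the shifts by \<open>cl * d\<close>.\<close>
  define \<delta> where "\<delta> = min \<delta>0 (\<tau> / (2 * cl))"
  have \<delta>: "0 < \<delta>" "\<delta> \<le> \<delta>0" "cl * \<delta> \<le> \<tau> / 2" using d0 tau cl_props(1) by (auto simp: \<delta>_def min_def field_simps)
  define \<theta> where "\<theta> t = slope_at Z t + 2 * cl * t" for t
  have \<theta>c: "continuous_on UNIV \<theta>" unfolding \<theta>_def[abs_def] by (intro continuous_intros slope_at_continuous)
  obtain TA where T: "\<And>x. (TA has_real_derivative \<theta> x) (at x)" using antiderivative_exists[OF \<theta>c] by metis
  have "continuous_on UNIV TA" by (rule DERIV_continuous_on, rule has_field_derivative_at_within, rule T)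
  then obtain PB where P: "\<And>x. (PB has_real_derivative TA x) (at x)" using antiderivative_exists by metis
  have "- \<kappa> * (q - p) \<le> \<theta> q - \<theta> p" if pq: "p \<le> t0" "t0 \<le> q" "q - p < \<delta>" for p q
  proof (rule ccontr)
    assume "\<not> - \<kappa> * (q - p) \<le> \<theta> q - \<theta> p"
    then have lt: "\<theta> q - \<theta> p < - \<kappa> * (q - p)" by simp
    have "p \<noteq> q" using lt by auto
    then have "p < q" using pq by simp
    then obtain A B where AB: "p \<le> A" "A < B" "B \<le> q" "\<kappa> * (B - A) ^ 3 / 6 \<le> 2 * (PB B - PB A) - (B - A) * (TA A + TA B)"
      using trapezoid_gain[OF T P _ lt] by metis
    define X where "X = cbox (0, A) ((B - A) / l, B)"
    let ?h = "\<lambda>q. indicator (flux_triangle l A B) q * (\<theta> (snd q - l * fst q / 2) - \<theta> (snd q + l * fst q / 2))"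
    have pw: "(\<mu> - \<omega>) * ?h q - 2 * \<omega> * L * (B - A) * indicat_real X q
      \<le> indicator (flux_triangle l A B) q * (wall_flux l Z q - wall_flux (- l) Z q)" for q
    proof (cases "q \<in> flux_triangle l A B")
      case True
      define a b d where "a = snd q - l * fst q / 2" and "b = snd q + l * fst q / 2" and "d = l * fst q"
      note t = flux_triangle_mem[OF True]
      have d: "0 < d" "d < B - A" "b - a = d" "A < a" "b < B" using t l by (auto simp: d_def a_def b_def)
      have near: "\<bar>a - t0\<bar> < \<delta>0" "\<bar>b - t0\<bar> < \<delta>0" using d AB pq \<delta> by auto
      have cd: "0 \<le> cl * d" "cl * d < \<tau> / 2"
      proof -
        show "0 \<le> cl * d" using d cl_props(1) by simp
        have "cl * d < cl * \<delta>" using d AB pq cl_props(1) by (intro mult_strict_left_mono) auto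
        then show "cl * d < \<tau> / 2" using \<delta>(3) by linarith
      qed
      obtain \<xi> where xi: "min (slope_at Z a - cl * d) (slope_at Z b + cl * d) \<le> \<xi>" "\<xi> \<le> max (slope_at Z a - cl * d) (slope_at Z b + cl * d)"
        "fx (slope_at Z a - cl * d) - fx (slope_at Z b + cl * d) = fx' \<xi> * ((slope_at Z a - cl * d) - (slope_at Z b + cl * d))"
        using fx_mvt by blast
      have "\<bar>\<xi> - slope_at Z t0\<bar> < \<tau>"
        using xi(1,2) d0(2)[OF near(1)] d0(2)[OF near(2)] cd by (auto simp: abs_if min_def max_def split: if_splits)
      then have fx: "\<mu> - \<omega> < fx' \<xi>" "fx' \<xi> < \<mu> + \<omega>" using tau(2)[of \<xi>] by (auto simp: abs_if split: if_splits)
      have be: "b = a + d" using d(3) by simp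
      have D: "(slope_at Z a - cl * d) - (slope_at Z b + cl * d) = \<theta> a - \<theta> b"
        by (simp add: \<theta>_def be algebra_simps)
      have up: "\<theta> b - \<theta> a \<le> L * d"
      proof -
        have "slope_at Z b - slope_at Z a \<le> 2 * d" using slope_at_upper[of a b] d by simp
        then show ?thesis by (simp add: \<theta>_def L_def be algebra_simps)
      qed
      \<comment> \<open>Only an increase of \<open>\<theta>\<close> needs a correction, and it is at
        most \<open>L * d\<close> by the upper slope bound; for a decrease the lower bound of
        \<open>fx' \<xi>\<close> suffices.\<close>
      have "(\<mu> - \<omega>) * (\<theta> a - \<theta> b) - 2 * \<omega> * (L * d) \<le> fx' \<xi> * (\<theta> a - \<theta> b)"
      proof (cases "\<theta> b \<le> \<theta> a")
        case True
        then have "(\<mu> - \<omega>) * (\<theta> a - \<theta> b) \<le> fx' \<xi> * (\<theta> a - \<theta> b)" using fx by (intro mult_right_mono) auto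
        moreover have "0 \<le> 2 * \<omega> * (L * d)" using \<omega> L d by simp
        ultimately show ?thesis by linarith
      next
        case False
        then have "fx' \<xi> * (\<theta> b - \<theta> a) \<le> (\<mu> + \<omega>) * (\<theta> b - \<theta> a)" using fx by (intro mult_right_mono) auto
        moreover have "2 * \<omega> * (\<theta> b - \<theta> a) \<le> 2 * \<omega> * (L * d)" using up \<omega> by (intro mult_left_mono) auto
        ultimately show ?thesis by (simp add: algebra_simps)
      qed
      moreover have "2 * \<omega> * (L * d) \<le> 2 * \<omega> * (L * (B - A))" using \<omega> L d by (intro mult_left_mono) auto
      ultimately have "(\<mu> - \<omega>) * (\<theta> a - \<theta> b) - 2 * \<omega> * (L * (B - A)) \<le> wall_flux l Z q - wall_flux (- l) Z q"
        unfolding wall_flux_diff cl_props(2) using xi(3) D by (simp add: a_def b_def d_def)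
      then show ?thesis using True t(5) by (simp add: a_def b_def X_def mult.assoc)
    next
      case False
      have "0 \<le> 2 * \<omega> * L * (B - A)" using \<omega> L AB by simp
      then show ?thesis using False by (simp add: indicator_def)
    qed
    note hI = flux_triangle_integral_diff[OF T P \<theta>c l AB(2)]
    have i: "integrable lborel (indicat_real X)" unfolding X_def by (rule integrable_box)
    have mX: "measure lborel X = ((B - A) / l) * (B - A)" unfolding X_def
      by (subst measure_box2) (use AB l in auto)
    have "(\<integral>q. (\<mu> - \<omega>) * ?h q - 2 * \<omega> * L * (B - A) * indicat_real X q \<partial>lborel)
      \<le> (\<integral>q. indicator (flux_triangle l A B) q * (wall_flux l Z q - wall_flux (- l) Z q) \<partial>lborel)"
      by (rule integral_mono[OF _ flux_integrable pw]) (intro Bochner_Integration.integrable_diff integrable_mult_right hI(1) i)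
    also have "\<dots> \<le> 0" by (rule flux[OF AB(2)])
    also have "(\<integral>q. (\<mu> - \<omega>) * ?h q - 2 * \<omega> * L * (B - A) * indicat_real X q \<partial>lborel)
      = (\<mu> - \<omega>) * ((2 * (PB B - PB A) - (B - A) * (TA A + TA B)) / l) - 2 * \<omega> * L * (B - A) * measure lborel X"
      using hI i by (subst Bochner_Integration.integral_diff) (auto simp: X_def simp del: cbox_Pair_eq)
    finally have "(\<mu> - \<omega>) * ((2 * (PB B - PB A) - (B - A) * (TA A + TA B)) / l) \<le> 2 * \<omega> * L * (B - A) * (((B - A) / l) * (B - A))"
      unfolding mX by simp
    moreover have "(\<mu> - \<omega>) * (\<kappa> * (B - A) ^ 3 / 6 / l) \<le> (\<mu> - \<omega>) * ((2 * (PB B - PB A) - (B - A) * (TA A + TA B)) / l)"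
      using AB(4) l \<omega> \<mu> by (intro mult_left_mono divide_right_mono) auto
    moreover have "\<mu> / 2 * (\<kappa> * (B - A) ^ 3 / 6 / l) \<le> (\<mu> - \<omega>) * (\<kappa> * (B - A) ^ 3 / 6 / l)"
      using \<omega> \<kappa> AB l by (intro mult_right_mono) auto
    ultimately have "\<mu> / 2 * (\<kappa> * (B - A) ^ 3 / 6 / l) \<le> 2 * \<omega> * L * (B - A) * (((B - A) / l) * (B - A))" by linarith
    moreover have "\<mu> / 2 * (\<kappa> * x ^ 3 / 6 / l) = x ^ 3 / l * (\<mu> * \<kappa> / 12)"
      "2 * \<omega> * L * x * ((x / l) * x) = x ^ 3 / l * (2 * (L * \<omega>))" for x
      by (simp_all add: power3_eq_cube algebra_simps)
    ultimately have "(B - A) ^ 3 / l * (\<mu> * \<kappa> / 12) \<le> (B - A) ^ 3 / l * (2 * (L * \<omega>))" by (simp only:)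
    moreover have "0 < (B - A) ^ 3 / l" using AB l by simp
    ultimately have "\<mu> * \<kappa> / 12 \<le> 2 * (L * \<omega>)" by (meson mult_le_cancel_left_pos)
    then show False using \<omega>(3) mult_pos_pos[OF \<mu> \<kappa>] by linarith
  qed
  then show thesis using that[OF \<delta>(1)] by (simp add: \<theta>_def)
qed

text \<open>The inequality with error \<open>\<kappa>\<close> is additive over adjacent intervals
  and holds on short intervals around each point, so bisection extends it to every interval; then
  \<open>\<kappa>\<close> tends to 0.\<close>

lemma slope_at_lower:
  assumes "s \<le> t" shows "- (2 * cl) * (t - s) \<le> slope_at Z t - slope_at Z s"
proof -
  define \<theta> where "\<theta> t = slope_at Z t + 2 * cl * t" for t
  have "- \<kappa> * (t - s) \<le> \<theta> t - \<theta> s" if \<kappa>: "0 < \<kappa>" for \<kappa>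
  proof (rule Bolzano[OF assms, of "\<lambda>s t. - \<kappa> * (t - s) \<le> \<theta> t - \<theta> s"])
    fix a b c assume "- \<kappa> * (b - a) \<le> \<theta> b - \<theta> a" "- \<kappa> * (c - b) \<le> \<theta> c - \<theta> b"
    then show "- \<kappa> * (c - a) \<le> \<theta> c - \<theta> a" by (simp add: algebra_simps)
  next
    fix x
    obtain \<delta> where "0 < \<delta>" "\<And>p q. p \<le> x \<Longrightarrow> x \<le> q \<Longrightarrow> q - p < \<delta> \<Longrightarrow> - \<kappa> * (q - p) \<le> \<theta> q - \<theta> p"
      using slope_at_lower_local[OF \<kappa>, of x] unfolding \<theta>_def by metis
    then show "\<exists>d>0. \<forall>a b. a \<le> x \<and> x \<le> b \<and> b - a < d \<longrightarrow> - \<kappa> * (b - a) \<le> \<theta> b - \<theta> a" by blast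
  qed
  then have "0 \<le> (\<theta> t - \<theta> s) + \<kappa> * (t - s)" if "0 < \<kappa>" for \<kappa> using that by (simp add: algebra_simps)
  then have "0 \<le> \<theta> t - \<theta> s"
  proof (cases "s = t")
    case False
    then have ts: "0 < t - s" using assms by simp
    show ?thesis
    proof (rule field_le_epsilon)
      fix e :: real assume "0 < e"
      then show "0 \<le> \<theta> t - \<theta> s + e"
        using \<open>\<And>\<kappa>. 0 < \<kappa> \<Longrightarrow> 0 \<le> \<theta> t - \<theta> s + \<kappa> * (t - s)\<close>[of "e / (t - s)"] ts by simp
    qed
  qed simp
  then show ?thesis by (simp add: \<theta>_def algebra_simps)
qed

lemma Z_growth: "v \<le> w \<Longrightarrow> w - v \<le> (1 + cl) * (Z w - Z v)"
proof -
  assume vw: "v \<le> w"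
  have inj: "inj Z"
    by (rule linorder_injI) (use no_flats in \<open>metis less_irrefl\<close>)
  have "- (2 * cl) * (Z w - Z v) \<le> slope_at Z (Z w) - slope_at Z (Z v)"
    by (rule slope_at_lower[OF grows_mono[OF Z_grows_0 vw]])
  then show ?thesis by (simp add: slope_at_eq inv_f_f[OF inj] algebra_simps)
qed

end

text \<open>For every \<open>l < 1\<close> the growth rate is at least
  \<open>1 / (1 + 1 / l\<^sup>2)\<close>, and this tends to 1/2 as \<open>l\<close> tends to
  1.\<close>

lemma strip_grows_half:
  assumes f: "strip_param f Z" and m: "perimeter_minimizer (iepigraph Kstrip f) Uslab"
  shows "grows (1/2) Z"
proof -
  have "w - v \<le> 2 * (Z w - Z v)" if vw: "v \<le> w" for v w
  proof (rule LIMSEQ_le_const)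
    define l where "l n = 1 - 1 / real (n + 2)" for n
    have "w - v \<le> (1 + 1 / (l n)\<^sup>2) * (Z w - Z v)" for n
    proof -
      have l: "0 < l n" "l n < 1" by (auto simp: l_def field_simps)
      show ?thesis
        using Z_growth[OF f l(1) necessity_flux[OF f m l] vw] by (simp add: cl_def[OF f l(1) necessity_flux[OF f m l]])
    qed
    then show "\<exists>N. \<forall>n\<ge>N. w - v \<le> (1 + 1 / (l n)\<^sup>2) * (Z w - Z v)" by blast
    have "(\<lambda>n. 1 + 1 / (l n)\<^sup>2) \<longlonglongrightarrow> 1 + 1 / (1 - 0)\<^sup>2" unfolding l_def
      by (intro tendsto_intros LIMSEQ_ignore_initial_segment lim_1_over_n) auto
    then show "(\<lambda>n. (1 + 1 / (l n)\<^sup>2) * (Z w - Z v)) \<longlonglongrightarrow> 2 * (Z w - Z v)"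
      by (intro tendsto_mult tendsto_const) simp
  qed
  then show ?thesis using f by (auto simp: strip_param_def grows_def field_simps)
qed

lemma ruling_eq: "closed_segment (-1, - s, z) (1, s, z) = {(x, x * s, z) |x. \<bar>x\<bar> \<le> 1}" for s z :: real
proof -
  have "(1 - u) *\<^sub>R (-1, - s, z) + u *\<^sub>R (1, s, z) = (2 * u - 1, (2 * u - 1) * s, z)" for u
    by (simp add: algebra_simps)
  then have "closed_segment (-1, - s, z) (1, s, z) = (\<lambda>u. (2 * u - 1, (2 * u - 1) * s, z)) ` {0..1}"
    by (simp add: closed_segment_image_interval)
  also have "\<dots> = {(x, x * s, z) |x. \<bar>x\<bar> \<le> 1}"
  proof (intro equalityI subsetI)
    fix p assume "p \<in> {(x, x * s, z) |x. \<bar>x\<bar> \<le> 1}"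
    then obtain x where "p = (x, x * s, z)" "\<bar>x\<bar> \<le> 1" by blast
    then show "p \<in> (\<lambda>u. (2 * u - 1, (2 * u - 1) * s, z)) ` {0..1}"
      by (intro image_eqI[of _ _ "(x + 1) / 2"]) (auto simp: field_simps)
  qed auto
  finally show ?thesis .
qed

theorem theorem1p1:
  fixes f :: "hpt \<Rightarrow> real"
  assumes "graphical_strip Kstrip f"
  shows "area_minimizing_strip Kstrip f Uslab \<longleftrightarrow>
    (\<exists>\<sigma> :: real \<Rightarrow> real.
       (\<forall>s t. s < t \<longrightarrow> -2 \<le> (\<sigma> t - \<sigma> s) / (t - s) \<and> (\<sigma> t - \<sigma> s) / (t - s) < 2) \<and>
       igraph Kstrip f = (\<Union>z. closed_segment (-1, - \<sigma> z, z) (1, \<sigma> z, z)))"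
proof -
  obtain Z where Z: "strip_param f Z" using graphical_strip_param[OF assms] .
  have gr: "grows 0 Z" and sj: "surj Z" using Z by (auto simp: strip_param_def)
  show ?thesis
  proof
    assume "area_minimizing_strip Kstrip f Uslab"
    then have g: "grows (1/2) Z" using strip_grows_half[OF Z] by (simp add: area_minimizing_strip_def)
    have lt: "Z v < Z w" if "v < w" for v w using growsD[OF g, of v w] that by simp
    have inj: "inj Z" by (rule linorder_injI) (use lt in \<open>metis less_irrefl\<close>)
    define \<sigma> where "\<sigma> t = ruling_slope Z (inv Z t)" for t
    have ZZ: "Z (inv Z t) = t" for t using sj by (rule surj_f_inv_f)
    have "-2 \<le> (\<sigma> t - \<sigma> s) / (t - s) \<and> (\<sigma> t - \<sigma> s) / (t - s) < 2" if "s < t" for s t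
    proof -
      have "inv Z s < inv Z t"
        using that grows_mono[OF gr, of "inv Z t" "inv Z s"] by (force simp: ZZ simp flip: not_le)
      \<comment> \<open>The increment of \<open>\<sigma>\<close> is \<open>2 * (t - s)\<close> minus
        twice the increment of \<open>inv Z\<close>. That increment is positive, which gives the
        strict upper bound, and at most \<open>2 * (t - s)\<close>, which gives the lower
        one.\<close>
      then show ?thesis using growsD[OF g, of "inv Z s" "inv Z t"] that
        by (simp add: \<sigma>_def ruling_slope_def ZZ field_simps)
    qed
    moreover have "igraph Kstrip f = (\<Union>z. closed_segment (-1, - \<sigma> z, z) (1, \<sigma> z, z))"
    proof -
      have "(x, x * ruling_slope Z v, Z v) \<in> {(x, x * \<sigma> (Z v), Z v) |x. \<bar>x\<bar> \<le> 1}" if "\<bar>x\<bar> \<le> 1" for x v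
        using that by (auto simp: \<sigma>_def inv_f_f[OF inj])
      moreover have "(x, x * \<sigma> z, z) = (x, x * ruling_slope Z (inv Z z), Z (inv Z z))" for x z
        by (simp add: \<sigma>_def ZZ)
      ultimately show ?thesis unfolding igraph_strip[OF Z] ruling_eq by blast
    qed
    ultimately show "\<exists>\<sigma>. (\<forall>s t. s < t \<longrightarrow> -2 \<le> (\<sigma> t - \<sigma> s) / (t - s) \<and> (\<sigma> t - \<sigma> s) / (t - s) < 2) \<and>
       igraph Kstrip f = (\<Union>z. closed_segment (-1, - \<sigma> z, z) (1, \<sigma> z, z))" by blast
  next
    assume "\<exists>\<sigma>. (\<forall>s t. s < t \<longrightarrow> -2 \<le> (\<sigma> t - \<sigma> s) / (t - s) \<and> (\<sigma> t - \<sigma> s) / (t - s) < 2) \<and>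
       igraph Kstrip f = (\<Union>z. closed_segment (-1, - \<sigma> z, z) (1, \<sigma> z, z))"
    then obtain \<sigma> where sl: "\<And>s t. s < t \<Longrightarrow> -2 \<le> (\<sigma> t - \<sigma> s) / (t - s)"
      and ig: "igraph Kstrip f = (\<Union>z. {(x, x * \<sigma> z, z) |x. \<bar>x\<bar> \<le> 1})"
      unfolding ruling_eq by blast
    have ruling_slope: "ruling_slope Z v = \<sigma> (Z v)" for v
    proof -
      have "(1, 1 * ruling_slope Z v, Z v) \<in> igraph Kstrip f" unfolding igraph_strip[OF Z] by force
      then show ?thesis unfolding ig by auto
    qed
    have "1/2 * (w - v) \<le> Z w - Z v" if vw: "v \<le> w" for v w
    proof (cases "Z v = Z w")
      \<comment> \<open>Rulings at equal height have the same \<open>\<sigma>\<close>, hence the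
        same slope, and then \<open>v = w\<close>: a slope that is a function of the height excludes
        intervals of constancy.\<close>
      case True
      then have "ruling_slope Z v = ruling_slope Z w" using ruling_slope by simp
      then show ?thesis using True by (simp add: ruling_slope_def)
    next
      case False
      then have "Z v < Z w" using grows_mono[OF gr vw] by simp
      then show ?thesis using sl[of "Z v" "Z w"] by (simp add: ruling_slope[symmetric] ruling_slope_def field_simps)
    qed
    then have "grows (1/2) Z" using gr by (simp add: grows_def)
    then show "area_minimizing_strip Kstrip f Uslab"
      using strip_minimizer[OF Z] by (simp add: area_minimizing_strip_def)
  qed
qed

end
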